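(* Let $n\ge 1$. Let $H=H(x,\xi)$ be a symbol in $C^\infty(\mathbb R^{n+1}\times\mathbb R^{n+1})$, invariant under the transformations $(x,\xi)\mapsto(tx,t^{-1}\xi)$, $t\ne0$; assume that it is bounded and remains so after it has been applied any operator in the algebra generated by the differential operators $x_j\frac{\partial}{\partial x_k}$ or $\xi_j\frac{\partial}{\partial\xi_k}$. Let $\mathrm{Op}_0(H):\mathcal F\mathcal S_{\mathrm{flat}}(\mathbb R^{n+1})\to L^2(\mathbb R^{n+1})$ be the pseudodifferential operator with standard symbol $H$. For every function $v\in\mathcal S(\mathbb R^{n+1})$ and every $(\lambda,\varepsilon)\in\mathbb R\times\{0,1\}$, one has $$(\mathrm{Op}_0(H)\,v)_{i\lambda,\varepsilon}=\mathrm{Op}_0(H)\,v_{i\lambda,\varepsilon}.$$ For any given pair $(\lambda,\varepsilon)$, the operator $A_{i\lambda,\varepsilon}$ on functions of $n$ variables characterized by the property $$(\mathrm{Op}_0(H)\,v)^{\flat}_{i\lambda,\varepsilon}=A_{i\lambda,\varepsilon}\,v^{\flat}_{i\lambda,\varepsilon}$$ can be identified with the operator $\mathrm{Op}_{i\lambda,\varepsilon}(f)$ if one defines the function $f$ on $\mathcal X_n^\bullet$ in terms of $(H,\lambda,\varepsilon)$ by $$f((x,\xi)^\bullet)=(-1)^\varepsilon\,C_{-i\lambda,\varepsilon}^{-1}\int_{-\infty}^\infty H\big((x,t\xi)^\bullet\big)\,e^{2i\pi t}\,|t|_\varepsilon^{\frac{n-1}2+i\lambda}\,dt .$$ In a similar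 way, the operator $B_{i\lambda,\varepsilon}$ characterized by the equation $(\mathrm{Op}_1(H)\,v)^\flat_{i\lambda,\varepsilon}=B_{i\lambda,\varepsilon}\,v^\flat_{i\lambda,\varepsilon}$ can be written as $B_{i\lambda,\varepsilon}=\mathrm{Op}^\vee_{i\lambda,\varepsilon}(h)$ with $$h((x,\xi)^\bullet)=C_{i\lambda,\varepsilon}^{-1}\int_{-\infty}^\infty H\big((tx,\xi)^\bullet\big)\,e^{-2i\pi t}\,|t|_\varepsilon^{\frac{n-1}2-i\lambda}\,dt .$$
   Context: $|t|_\varepsilon^\alpha=|t|^\alpha(\mathrm{sign}\,t)^\varepsilon$. The Fourier transformation is $(\mathcal Fv)(x)=\int_{\mathbb R^{n+1}}v(y)e^{-2i\pi\langle x,y\rangle}dy$. $\mathcal S_{\mathrm{flat}}(\mathbb R^{n+1})$ is the space of Schwartz functions all of whose derivatives are, near $0$, bounded by a constant times any power of $|x|$. Standard and antistandard calculi on $\mathbb R^{n+1}$: $(\mathrm{Op}_0(H)v)(x)=\int H(x,\xi)e^{2i\pi\langle x,\xi\rangle}(\mathcal Fv)(\xi)\,d\xi$ and $(\mathcal F\,\mathrm{Op}_1(H)v)(\xi)=\int H(x,\xi)e^{-2i\pi\langle x,\xi\rangle}v(x)\,dx$. Under the hypotheses on $H$, $\mathrm{Op}_0(H)$ maps $\mathcal F\mathcal S_{\mathrm{flat}}(\mathbb R^{n+1})$ into $L^2(\mathbb R^{n+1})$ and $\mathrm{Op}_1(H)$ maps $\mathcal S_{\mathrm{flat}}(\mathbb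 R^{n+1})$ into $L^2(\mathbb R^{n+1})$. Homogeneous components: for $v$ on $\mathbb R^{n+1}$, $v_{i\lambda,\varepsilon}(x)=\frac1{4\pi}\int_{-\infty}^\infty|t|_\varepsilon^{\frac{n-1}2+i\lambda}v(tx)\,dt$, homogeneous of degree $-\frac{n+1}2-i\lambda$ and parity $\varepsilon$, so that $v=\sum_{\varepsilon}\int_{-\infty}^\infty v_{i\lambda,\varepsilon}\,d\lambda$; and $v^\flat_{i\lambda,\varepsilon}(s)=v_{i\lambda,\varepsilon}(s,1)$ for $s\in\mathbb R^n$. Intertwining operator: $\theta_{i\lambda,\varepsilon}$ is the unitary operator on $L^2(\mathbb R^n)$ defined by $\theta_{i\lambda,\varepsilon}v^\flat_{i\lambda,\varepsilon}=(\mathcal Fv)^\flat_{-i\lambda,\varepsilon}$; formally $(\theta_{i\lambda,\varepsilon}u)(\sigma)=C_{i\lambda,\varepsilon}\int_{\mathbb R^n}|1+\langle s,\sigma\rangle|_\varepsilon^{-\frac{n+1}2+i\lambda}u(s)\,ds$ with $$C_{i\lambda,\varepsilon}=(-i)^\varepsilon\pi^{-\frac n2+i\lambda}\frac{\Gamma(\frac{1+n}4-\frac{i\lambda}2+\frac\varepsilon2)}{\Gamma(\frac{1-n}4+\frac{i\lambda}2+\frac\varepsilon2)}.$$ Phase space: $\Omega^\bullet$ is the quotient of $\{(x,\xi)\in\mathbb R^{n+1}\times\mathbb R^{n+1}:\langle x,\xi\rangle\ne0\}$ by the equivalence $(x,\xi)\sim(tx,t^{-1}\xi)$, $t\neq 0$;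 $(x,\xi)^\bullet$ is the class of $(x,\xi)$; the invariant function $H$ is also regarded as a function on $\Omega^\bullet$. $\mathcal X_n^\bullet\subset\Omega^\bullet$ is the set of classes with $\langle x,\xi\rangle=1$. Writing $x=(x_*,x_{n+1})$, $\xi=(\xi_*,\xi_{n+1})$, functions on $\mathcal X_n^\bullet$ are expressed in the (almost everywhere defined) coordinates $s=x_*/x_{n+1}$, $\sigma=\xi_*/\xi_{n+1}$. Calculi on functions on $\mathbb R^n$: $$(\mathrm{Op}_{i\lambda,\varepsilon}(f)u)(s)=(-1)^\varepsilon C_{-i\lambda,\varepsilon}\int_{\mathbb R^n}f(s,\sigma)|1+\langle s,\sigma\rangle|_\varepsilon^{-\frac{n+1}2-i\lambda}(\theta_{i\lambda,\varepsilon}u)(\sigma)\,d\sigma,$$ $$(\theta_{i\lambda,\varepsilon}\mathrm{Op}^\vee_{i\lambda,\varepsilon}(h)u)(\sigma)=C_{i\lambda,\varepsilon}\int_{\mathbb R^n}h(s,\sigma)|1+\langle s,\sigma\rangle|_\varepsilon^{-\frac{n+1}2+i\lambda}u(s)\,ds.$$ The integrals in $t$ defining $f$ and $h$ are not absolutely convergent in general and are understood as Fourier integrals (e.g. inserting a factor $e^{-\alpha|t|}$ and letting $\alpha\to0^+$).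
   Formalization: Where C vanishes (e.g. n=1, λ=0, ε=0), so that C^{-1} is undefined, C is replaced by 1 in f, h and the operators; Op(f), Op^∨(h), whose kernels are not locally integrable, are limits of the operators with damped symbols, equal to the literal integrals where the kernel is integrable against them. *)

theory Defs
  imports "HOL-Analysis.Analysis"
begin

section \<open>Function spaces and the Fourier transformation\<close>

text \<open>Iterated partial derivative along the listed directions, the last one being applied first.\<close>

definition iter_deriv :: "'a::euclidean_space list \<Rightarrow> ('a \<Rightarrow> complex) \<Rightarrow> 'a \<Rightarrow> complex" where
  "iter_deriv bs f = foldr (\<lambda>b g x. frechet_derivative g (at x) b) bs f"

text \<open>Class \<open>C\<^sup>\<infinity>\<close>: every iterated partial derivative is differentiable, hence also continuous.\<close>

definition smooth :: "('a::euclidean_space \<Rightarrow> complex) \<Rightarrow> bool" where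
  "smooth f \<longleftrightarrow> (\<forall>bs\<in>lists Basis. \<forall>x. iter_deriv bs f differentiable (at x))"

definition schwartz :: "('a::euclidean_space \<Rightarrow> complex) set" where
  "schwartz = {f. smooth f \<and>
     (\<forall>bs\<in>lists Basis. \<forall>N::nat. \<exists>c. \<forall>x. (1 + norm x) ^ N * norm (iter_deriv bs f x) \<le> c)}"

definition schwartz_flat :: "('a::euclidean_space \<Rightarrow> complex) set" where
  "schwartz_flat = {f \<in> schwartz.
     \<forall>bs\<in>lists Basis. \<forall>N::nat. \<exists>c. \<exists>\<delta>>0. \<forall>x. norm x < \<delta> \<longrightarrow>
       norm (iter_deriv bs f x) \<le> c * norm x ^ N}"

definition fourier :: "('a::euclidean_space \<Rightarrow> complex) \<Rightarrow> 'a \<Rightarrow> complex" where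
  "fourier v x = (LINT y|lborel. cis (- 2 * pi * (x \<bullet> y)) * v y)"

definition inv_fourier :: "('a::euclidean_space \<Rightarrow> complex) \<Rightarrow> 'a \<Rightarrow> complex" where
  "inv_fourier v x = (LINT y|lborel. cis (2 * pi * (x \<bullet> y)) * v y)"

text \<open>The function \<open>g\<close> is the Fourier transform, in the sense of tempered distributions, of the
  function \<open>w\<close>; this determines \<open>g\<close> almost everywhere.\<close>

definition distr_fourier :: "('a::euclidean_space \<Rightarrow> complex) \<Rightarrow> ('a \<Rightarrow> complex) \<Rightarrow> bool" where
  "distr_fourier w g \<longleftrightarrow> w \<in> borel_measurable borel \<and> g \<in> borel_measurable borel \<and>
     (\<forall>\<phi>\<in>schwartz. integrable lborel (\<lambda>x. w x * fourier \<phi> x) \<and>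
        integrable lborel (\<lambda>\<xi>. g \<xi> * \<phi> \<xi>) \<and>
        (LINT x|lborel. w x * fourier \<phi> x) = (LINT \<xi>|lborel. g \<xi> * \<phi> \<xi>))"

definition square_integrable :: "('a::euclidean_space \<Rightarrow> complex) \<Rightarrow> bool" where
  "square_integrable u \<longleftrightarrow> u \<in> borel_measurable borel \<and> integrable lborel (\<lambda>s. (norm (u s))\<^sup>2)"

definition L2_tendsto :: "(nat \<Rightarrow> 'a::euclidean_space \<Rightarrow> complex) \<Rightarrow> ('a \<Rightarrow> complex) \<Rightarrow> bool" where
  "L2_tendsto w u \<longleftrightarrow> (\<forall>k. square_integrable (w k)) \<and> square_integrable u \<and>
     (\<lambda>k. LINT s|lborel. (norm (w k s - u s))\<^sup>2) \<longlonglongrightarrow> 0"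


section \<open>Symbols and the standard and antistandard calculi\<close>

definition dilation_invariant :: "('a::euclidean_space \<Rightarrow> 'a \<Rightarrow> complex) \<Rightarrow> bool" where
  "dilation_invariant H \<longleftrightarrow> (\<forall>t x \<xi>. t \<noteq> 0 \<longrightarrow> H (t *\<^sub>R x) (inverse t *\<^sub>R \<xi>) = H x \<xi>)"

text \<open>The algebra of differential operators generated by the \<open>x\<^sub>j \<partial>/\<partial>x\<^sub>k\<close> and \<open>\<xi>\<^sub>j \<partial>/\<partial>\<xi>\<^sub>k\<close>.\<close>

inductive_set symbol_ops ::
  "(('a::euclidean_space \<Rightarrow> 'a \<Rightarrow> complex) \<Rightarrow> ('a \<Rightarrow> 'a \<Rightarrow> complex)) set" where
  gen_x: "j \<in> Basis \<Longrightarrow> k \<in> Basis \<Longrightarrow>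
    (\<lambda>G x \<xi>. of_real (x \<bullet> j) * frechet_derivative (\<lambda>y. G y \<xi>) (at x) k) \<in> symbol_ops"
| gen_xi: "j \<in> Basis \<Longrightarrow> k \<in> Basis \<Longrightarrow>
    (\<lambda>G x \<xi>. of_real (\<xi> \<bullet> j) * frechet_derivative (\<lambda>\<eta>. G x \<eta>) (at \<xi>) k) \<in> symbol_ops"
| one: "(\<lambda>G. G) \<in> symbol_ops"
| add: "P \<in> symbol_ops \<Longrightarrow> Q \<in> symbol_ops \<Longrightarrow> (\<lambda>G x \<xi>. P G x \<xi> + Q G x \<xi>) \<in> symbol_ops"
| scale: "P \<in> symbol_ops \<Longrightarrow> (\<lambda>G x \<xi>. c * P G x \<xi>) \<in> symbol_ops"
| comp: "P \<in> symbol_ops \<Longrightarrow> Q \<in> symbol_ops \<Longrightarrow> (\<lambda>G. P (Q G)) \<in> symbol_ops"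

definition Op0 :: "('a::euclidean_space \<Rightarrow> 'a \<Rightarrow> complex) \<Rightarrow> ('a \<Rightarrow> complex) \<Rightarrow> 'a \<Rightarrow> complex" where
  "Op0 H v x = (LINT \<xi>|lborel. H x \<xi> * cis (2 * pi * (x \<bullet> \<xi>)) * fourier v \<xi>)"

text \<open>For \<open>v\<close> in \<open>schwartz_flat\<close> and the symbols of interest the inner integral is a Schwartz
  function of \<open>\<xi>\<close>, so that \<open>inv_fourier\<close> really inverts \<open>fourier\<close> on it.\<close>

definition Op1 :: "('a::euclidean_space \<Rightarrow> 'a \<Rightarrow> complex) \<Rightarrow> ('a \<Rightarrow> complex) \<Rightarrow> 'a \<Rightarrow> complex" where
  "Op1 H v = inv_fourier (\<lambda>\<xi>. LINT x|lborel. H x \<xi> * cis (- 2 * pi * (x \<bullet> \<xi>)) * v x)"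

text \<open>Regularization of Fourier integrals. The factor is itself invariant under
  \<open>(x, \<xi>) \<mapsto> (t x, t\<^sup>-\<^sup>1 \<xi>)\<close>; replacing \<open>H\<close> by \<open>damp \<alpha> H\<close> inserts the factor
  \<open>exp (- \<alpha> \<bar>x\<bar> \<bar>\<xi>\<bar> \<bar>t\<bar>)\<close> under an integral of \<open>H (x, t \<xi>)\<close> or \<open>H (t x, \<xi>)\<close> over \<open>t\<close>.\<close>

definition damp :: "real \<Rightarrow> ('a::euclidean_space \<Rightarrow> 'a \<Rightarrow> complex) \<Rightarrow> 'a \<Rightarrow> 'a \<Rightarrow> complex" where
  "damp \<alpha> H x \<xi> = of_real (exp (- \<alpha> * (norm x * norm \<xi>))) * H x \<xi>"

text \<open>\<open>Op\<^sub>0(H) w = u\<close> on the complement of \<open>0\<close>, for \<open>w\<close> a function such as a homogeneous one, the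
  Fourier transform of which is a function, but not a summable one: the integral defining
  \<open>Op\<^sub>0(H) w\<close> is then a Fourier integral.\<close>

definition has_Op0 ::
  "('a::euclidean_space \<Rightarrow> 'a \<Rightarrow> complex) \<Rightarrow> ('a \<Rightarrow> complex) \<Rightarrow> ('a \<Rightarrow> complex) \<Rightarrow> bool" where
  "has_Op0 H w u \<longleftrightarrow> (\<exists>g. distr_fourier w g \<and> (\<forall>x. x \<noteq> 0 \<longrightarrow>
     (\<forall>\<alpha>>0. integrable lborel (\<lambda>\<xi>. damp \<alpha> H x \<xi> * cis (2 * pi * (x \<bullet> \<xi>)) * g \<xi>)) \<and>
     ((\<lambda>\<alpha>. LINT \<xi>|lborel. damp \<alpha> H x \<xi> * cis (2 * pi * (x \<bullet> \<xi>)) * g \<xi>) \<longlongrightarrow> u x) (at_right 0)))"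


section \<open>Homogeneous components\<close>

text \<open>With \<open>n = CARD('n)\<close>, the space \<open>\<real>\<^sup>n\<^sup>+\<^sup>1\<close> is \<open>\<real>\<^sup>n \<times> \<real>\<close>, with points
  \<open>x = (x\<^sub>*, x\<^sub>n\<^sub>+\<^sub>1)\<close>.\<close>

type_synonym 'n space = "(real ^ 'n) \<times> real"

definition spow :: "nat \<Rightarrow> complex \<Rightarrow> real \<Rightarrow> complex" where
  "spow \<epsilon> a t = complex_of_real \<bar>t\<bar> powr a * of_real (sgn t) ^ \<epsilon>"

definition hom_comp ::
  "real \<Rightarrow> nat \<Rightarrow> ('n::finite space \<Rightarrow> complex) \<Rightarrow> 'n space \<Rightarrow> complex" where
  "hom_comp lam \<epsilon> v x = of_real (1 / (4 * pi)) *
     (LINT t|lborel. spow \<epsilon> ((of_nat CARD('n) - 1) / 2 + \<i> * of_real lam) t * v (t *\<^sub>R x))"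

definition flat ::
  "real \<Rightarrow> nat \<Rightarrow> ('n::finite space \<Rightarrow> complex) \<Rightarrow> real ^ 'n \<Rightarrow> complex" where
  "flat lam \<epsilon> v s = hom_comp lam \<epsilon> v (s, 1)"

text \<open>\<open>A\<close> is the operator on functions of \<open>n\<close> variables induced by \<open>T\<close>, acting on the
  functions in \<open>V\<close>; it is determined on the set \<open>flat lam \<epsilon> ` V\<close>.\<close>

definition component_op ::
  "real \<Rightarrow> nat \<Rightarrow> ('n::finite space \<Rightarrow> complex) set \<Rightarrow>
   (('n space \<Rightarrow> complex) \<Rightarrow> 'n space \<Rightarrow> complex) \<Rightarrow>
   ((real ^ 'n \<Rightarrow> complex) \<Rightarrow> real ^ 'n \<Rightarrow> complex) \<Rightarrow> bool" where
  "component_op lam \<epsilon> V T A \<longleftrightarrow> (\<forall>v\<in>V. flat lam \<epsilon> (T v) = A (flat lam \<epsilon> v))"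

text \<open>The unitary operator on \<open>L\<^sup>2(\<real>\<^sup>n)\<close> extending \<open>flat lam \<epsilon> v \<mapsto> flat (-lam) \<epsilon> (\<F> v)\<close>,
  \<open>v\<close> in the Schwartz space: its graph is the closure in \<open>L\<^sup>2 \<times> L\<^sup>2\<close> of the graph of this
  densely defined isometry. The value is determined almost everywhere.\<close>

definition theta_graph ::
  "real \<Rightarrow> nat \<Rightarrow> (real ^ 'n::finite \<Rightarrow> complex) \<Rightarrow> (real ^ 'n \<Rightarrow> complex) \<Rightarrow> bool" where
  "theta_graph lam \<epsilon> u w \<longleftrightarrow> (\<exists>v. (\<forall>k. v k \<in> schwartz) \<and>
     L2_tendsto (\<lambda>k. flat lam \<epsilon> (v k)) u \<and> L2_tendsto (\<lambda>k. flat (- lam) \<epsilon> (fourier (v k))) w)"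

definition theta ::
  "real \<Rightarrow> nat \<Rightarrow> (real ^ 'n::finite \<Rightarrow> complex) \<Rightarrow> real ^ 'n \<Rightarrow> complex" where
  "theta lam \<epsilon> u = (SOME w. theta_graph lam \<epsilon> u w)"

text \<open>\<open>rGamma\<close> is the entire function \<open>1/\<Gamma>\<close>.\<close>

definition C_const :: "nat \<Rightarrow> real \<Rightarrow> nat \<Rightarrow> complex" where
  "C_const n lam \<epsilon> = (- \<i>) ^ \<epsilon> * of_real pi powr (- of_nat n / 2 + \<i> * of_real lam) *
     Gamma ((1 + of_nat n) / 4 - \<i> * of_real lam / 2 + of_nat \<epsilon> / 2) *
     rGamma ((1 - of_nat n) / 4 + \<i> * of_real lam / 2 + of_nat \<epsilon> / 2)"

text \<open>\<open>C_const n lam \<epsilon>\<close> vanishes exactly if \<open>lam = 0\<close> and \<open>(n - 1)/2 - \<epsilon>\<close> is a nonnegative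
  even integer. For these pairs the constant and its inverse, which occur as a product in the
  operators built from the symbols \<open>f\<close> and \<open>h\<close>, make sense only after they have cancelled
  out: the constant is then replaced by \<open>1\<close>.\<close>

definition C_norm :: "nat \<Rightarrow> real \<Rightarrow> nat \<Rightarrow> complex" where
  "C_norm n lam \<epsilon> = (if C_const n lam \<epsilon> = 0 then 1 else C_const n lam \<epsilon>)"


section \<open>The phase space and the calculi on functions on \<open>\<real>\<^sup>n\<close>\<close>

definition bullet :: "'a::real_vector \<Rightarrow> 'a \<Rightarrow> ('a \<times> 'a) set" where
  "bullet x \<xi> = {(t *\<^sub>R x, inverse t *\<^sub>R \<xi>) | t::real. t \<noteq> 0}"

definition X_bullet :: "('a::euclidean_space \<times> 'a) set set" where
  "X_bullet = {bullet x \<xi> | x \<xi>. x \<bullet> \<xi> = 1}"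

text \<open>An invariant function of \<open>(x, \<xi>)\<close>, regarded as a function of the class of \<open>(x, \<xi>)\<close>.\<close>

definition on_classes :: "('a \<Rightarrow> 'a \<Rightarrow> complex) \<Rightarrow> ('a \<times> 'a) set \<Rightarrow> complex" where
  "on_classes G c = (THE z. \<forall>(x, \<xi>)\<in>c. G x \<xi> = z)"

lemma on_classes_bullet:
  assumes "dilation_invariant G"
  shows "on_classes G (bullet x \<xi>) = G x \<xi>"
proof -
  have self: "(x, \<xi>) \<in> bullet x \<xi>"
    unfolding bullet_def by (rule CollectI, rule exI[of _ 1]) simp
  have const: "\<forall>(y, \<eta>)\<in>bullet x \<xi>. G y \<eta> = G x \<xi>"
    using assms unfolding bullet_def dilation_invariant_def by blast
  show ?thesis
    unfolding on_classes_def
  proof (rule the_equality)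
    show "\<forall>(y, \<eta>)\<in>bullet x \<xi>. G y \<eta> = G x \<xi>"
      by (rule const)
    show "z = G x \<xi>" if "\<forall>(y, \<eta>)\<in>bullet x \<xi>. G y \<eta> = z" for z
      using bspec[OF that self] by simp
  qed
qed

lemma dilation_invariant_damp:
  assumes "dilation_invariant H"
  shows "dilation_invariant (damp \<alpha> H)"
  unfolding dilation_invariant_def
proof (intro allI impI)
  fix t :: real and x \<xi> :: 'a
  assume t: "t \<noteq> 0"
  then have "norm (t *\<^sub>R x) * norm (inverse t *\<^sub>R \<xi>) = norm x * norm \<xi>"
    by simp
  moreover have "H (t *\<^sub>R x) (inverse t *\<^sub>R \<xi>) = H x \<xi>"
    using assms t unfolding dilation_invariant_def by blast
  ultimately show "damp \<alpha> H (t *\<^sub>R x) (inverse t *\<^sub>R \<xi>) = damp \<alpha> H x \<xi>"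
    unfolding damp_def by (simp only:)
qed

text \<open>A function on \<open>X_bullet\<close> in the coordinates \<open>s = x\<^sub>* / x\<^sub>n\<^sub>+\<^sub>1\<close>,
  \<open>\<sigma> = \<xi>\<^sub>* / \<xi>\<^sub>n\<^sub>+\<^sub>1\<close>, where \<open>1 + \<langle>s, \<sigma>\<rangle> \<noteq> 0\<close>.\<close>

definition coord ::
  "(('n::finite space \<times> 'n space) set \<Rightarrow> complex) \<Rightarrow> real ^ 'n \<Rightarrow> real ^ 'n \<Rightarrow> complex" where
  "coord F s \<sigma> = F (bullet (s, 1) (inverse (1 + s \<bullet> \<sigma>) *\<^sub>R (\<sigma>, 1)))"

definition f_symbol ::
  "real \<Rightarrow> nat \<Rightarrow> ('n::finite space \<Rightarrow> 'n space \<Rightarrow> complex) \<Rightarrow>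
   ('n space \<times> 'n space) set \<Rightarrow> complex" where
  "f_symbol lam \<epsilon> H = on_classes (\<lambda>x \<xi>.
     (- 1) ^ \<epsilon> * inverse (C_norm CARD('n) (- lam) \<epsilon>) *
     (LINT t|lborel. on_classes H (bullet x (t *\<^sub>R \<xi>)) * cis (2 * pi * t) *
        spow \<epsilon> ((of_nat CARD('n) - 1) / 2 + \<i> * of_real lam) t))"

definition h_symbol ::
  "real \<Rightarrow> nat \<Rightarrow> ('n::finite space \<Rightarrow> 'n space \<Rightarrow> complex) \<Rightarrow>
   ('n space \<times> 'n space) set \<Rightarrow> complex" where
  "h_symbol lam \<epsilon> H = on_classes (\<lambda>x \<xi>.
     inverse (C_norm CARD('n) lam \<epsilon>) *
     (LINT t|lborel. on_classes H (bullet (t *\<^sub>R x) \<xi>) * cis (- 2 * pi * t) *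
        spow \<epsilon> ((of_nat CARD('n) - 1) / 2 - \<i> * of_real lam) t))"

definition Op_integrand ::
  "real \<Rightarrow> nat \<Rightarrow> (('n::finite space \<times> 'n space) set \<Rightarrow> complex) \<Rightarrow>
   (real ^ 'n \<Rightarrow> complex) \<Rightarrow> real ^ 'n \<Rightarrow> real ^ 'n \<Rightarrow> complex" where
  "Op_integrand lam \<epsilon> f u s \<sigma> = coord f s \<sigma> *
     spow \<epsilon> (- (of_nat CARD('n) + 1) / 2 - \<i> * of_real lam) (1 + s \<bullet> \<sigma>) * theta lam \<epsilon> u \<sigma>"

definition Op ::
  "real \<Rightarrow> nat \<Rightarrow> (('n::finite space \<times> 'n space) set \<Rightarrow> complex) \<Rightarrow>
   (real ^ 'n \<Rightarrow> complex) \<Rightarrow> real ^ 'n \<Rightarrow> complex" where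
  "Op lam \<epsilon> f u s = (- 1) ^ \<epsilon> * C_norm CARD('n) (- lam) \<epsilon> *
     (LINT \<sigma>|lborel. Op_integrand lam \<epsilon> f u s \<sigma>)"

definition theta_Op_vee_integrand ::
  "real \<Rightarrow> nat \<Rightarrow> (('n::finite space \<times> 'n space) set \<Rightarrow> complex) \<Rightarrow>
   (real ^ 'n \<Rightarrow> complex) \<Rightarrow> real ^ 'n \<Rightarrow> real ^ 'n \<Rightarrow> complex" where
  "theta_Op_vee_integrand lam \<epsilon> h u \<sigma> s = coord h s \<sigma> *
     spow \<epsilon> (- (of_nat CARD('n) + 1) / 2 + \<i> * of_real lam) (1 + s \<bullet> \<sigma>) * u s"

definition theta_Op_vee ::
  "real \<Rightarrow> nat \<Rightarrow> (('n::finite space \<times> 'n space) set \<Rightarrow> complex) \<Rightarrow>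
   (real ^ 'n \<Rightarrow> complex) \<Rightarrow> real ^ 'n \<Rightarrow> complex" where
  "theta_Op_vee lam \<epsilon> h u \<sigma> = C_norm CARD('n) lam \<epsilon> *
     (LINT s|lborel. theta_Op_vee_integrand lam \<epsilon> h u \<sigma> s)"

text \<open>A symbol \<open>f\<close> given by a Fourier integral is the pointwise limit, as \<open>\<alpha> \<rightarrow> 0+\<close>, of the
  symbols \<open>\<Phi> \<alpha>\<close> given by the regularized integrals. Since the exponent of
  \<open>\<bar>1 + \<langle>s, \<sigma>\<rangle>\<bar>\<close> has real part \<open>- (n + 1)/2 \<le> - 1\<close>, the integral which defines the
  operator with symbol \<open>f\<close> does not converge absolutely either, and is part of the same
  Fourier integral: the limit has to be taken outside of it. (With the factor
  \<open>exp (- \<alpha> \<bar>t\<bar>)\<close>, not involving \<open>\<bar>x\<bar> \<bar>\<xi>\<bar>\<close>, the singularity at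
  \<open>1 + \<langle>s, \<sigma>\<rangle> = 0\<close> would survive the regularization.)\<close>

definition fourier_symbol ::
  "(real \<Rightarrow> ('a::euclidean_space \<times> 'a) set \<Rightarrow> complex) \<Rightarrow>
   (('a \<times> 'a) set \<Rightarrow> complex) \<Rightarrow> bool" where
  "fourier_symbol \<Phi> f \<longleftrightarrow> (\<forall>c\<in>X_bullet. ((\<lambda>\<alpha>. \<Phi> \<alpha> c) \<longlongrightarrow> f c) (at_right 0))"

text \<open>\<open>w\<close> is the image of \<open>u\<close> under the operator with symbol \<open>f\<close>, the latter being the limit of
  the \<open>\<Phi> \<alpha>\<close>. The integral with the symbol \<open>f\<close> itself is required to give the same result
  wherever the singularity does no harm, so that it converges absolutely for bounded \<open>f\<close>.\<close>

definition has_Op ::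
  "real \<Rightarrow> nat \<Rightarrow> (real \<Rightarrow> ('n::finite space \<times> 'n space) set \<Rightarrow> complex) \<Rightarrow>
   (('n space \<times> 'n space) set \<Rightarrow> complex) \<Rightarrow>
   (real ^ 'n \<Rightarrow> complex) \<Rightarrow> (real ^ 'n \<Rightarrow> complex) \<Rightarrow> bool" where
  "has_Op lam \<epsilon> \<Phi> f u w \<longleftrightarrow> (\<forall>s.
     (\<forall>\<alpha>>0. integrable lborel (\<lambda>\<sigma>. Op_integrand lam \<epsilon> (\<Phi> \<alpha>) u s \<sigma>)) \<and>
     ((\<lambda>\<alpha>. Op lam \<epsilon> (\<Phi> \<alpha>) u s) \<longlongrightarrow> w s) (at_right 0) \<and>
     (integrable lborel (\<lambda>\<sigma>. Op_integrand lam \<epsilon> (\<lambda>c. 1) u s \<sigma>) \<longrightarrow>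
        integrable lborel (\<lambda>\<sigma>. Op_integrand lam \<epsilon> f u s \<sigma>) \<and> Op lam \<epsilon> f u s = w s))"

definition has_Op_vee ::
  "real \<Rightarrow> nat \<Rightarrow> (real \<Rightarrow> ('n::finite space \<times> 'n space) set \<Rightarrow> complex) \<Rightarrow>
   (('n space \<times> 'n space) set \<Rightarrow> complex) \<Rightarrow>
   (real ^ 'n \<Rightarrow> complex) \<Rightarrow> (real ^ 'n \<Rightarrow> complex) \<Rightarrow> bool" where
  "has_Op_vee lam \<epsilon> \<Phi> h u w \<longleftrightarrow> square_integrable w \<and> (AE \<sigma> in lborel.
     (\<forall>\<alpha>>0. integrable lborel (\<lambda>s. theta_Op_vee_integrand lam \<epsilon> (\<Phi> \<alpha>) u \<sigma> s)) \<and>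
     ((\<lambda>\<alpha>. theta_Op_vee lam \<epsilon> (\<Phi> \<alpha>) u \<sigma>) \<longlongrightarrow> theta lam \<epsilon> w \<sigma>) (at_right 0) \<and>
     (integrable lborel (\<lambda>s. theta_Op_vee_integrand lam \<epsilon> (\<lambda>c. 1) u \<sigma> s) \<longrightarrow>
        integrable lborel (\<lambda>s. theta_Op_vee_integrand lam \<epsilon> h u \<sigma> s) \<and>
        theta_Op_vee lam \<epsilon> h u \<sigma> = theta lam \<epsilon> w \<sigma>))"

end

theory Submission
  imports Defs "HOL-Probability.Characteristic_Functions" "HOL-Probability.Sinc_Integral"
begin

text \<open>The Fourier transform of the homogeneous function \<open>v\<^bsub>i\<lambda>,\<epsilon>\<^esub>\<close> is \<open>(\<F> v)\<^bsub>-i\<lambda>,\<epsilon>\<^esub>\<close>. By Fubini's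
  theorem, applying the damped symbol to it gives the same result as taking the homogeneous component
  of the damped operator applied to \<open>v\<close>; in the coordinates \<open>\<xi> = t (\<sigma>, 1)\<close> the homogeneity turns this
  integral into one over \<open>\<sigma>\<close>, with \<open>(\<F> v)\<^sup>\<flat>\<close> integrated against a kernel that is an integral over \<open>t\<close>.
  Substituting \<open>t / (1 + \<langle>s, \<sigma>\<rangle>)\<close> for \<open>t\<close> in the latter separates the power of
  \<open>\<bar>1 + \<langle>s, \<sigma>\<rangle>\<bar>\<close> from the symbol \<open>f\<close>.

  Removing the damping requires bounds independent of it, both for the integral over \<open>t\<close> and for the
  decay along rays of the operator applied to \<open>v\<close>. They hold because the assumption on \<open>H\<close> and its
  invariance make every derivative of \<open>H\<close> with respect to \<open>\<xi>\<close> gain a factor \<open>\<bar>\<xi>\<bar>\<^sup>-\<^sup>1\<close>, so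
  that the oscillation of the exponential can be used repeatedly.

  The transform \<open>\<F> Op\<^sub>1(H) v\<close> is of the same kind with \<open>x\<close> and \<open>\<xi>\<close> exchanged, and it is a Schwartz
  function because \<open>v\<close> is flat at \<open>0\<close>, near which the \<open>x\<close>-derivatives of \<open>H\<close> are bounded, uniformly
  in \<open>\<xi>\<close>, only by negative powers of \<open>\<bar>x\<bar>\<close>.\<close>

section \<open>Smooth functions\<close>

text \<open>Homogeneous functions are handled through pairings with rapidly decreasing ones. This is
  why the damping involves |\<xi>|: for fixed x \<noteq> 0 it makes the symbol times the plane wave
  rapidly decreasing in \<xi>, and the pairings converge absolutely.

  Repeated partial integration meets an obstacle at the origin: powers of |t| and the damping are
  singular there, and derivatives of the amplitudes are controlled only by negative powers of the
  distance. Oscillation is therefore exploited by differences over half a period, which need only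
  boundedness near the origin.

  \<open>theta\<close> is a choice in the closure of a graph, hence known only almost everywhere.
  Its values on components are found by testing homogeneous extensions against Gaussians.

  Existence of the induced operators also rests on the damped formulas: these involve
  \<open>v\<close> only through its component, hence so do their limits. For \<open>Op1\<close> this
  determines the component of the Fourier transform only, and continuity is needed to return from an
  almost everywhere equality.\<close>

definition dir_deriv :: "'a::euclidean_space \<Rightarrow> ('a \<Rightarrow> complex) \<Rightarrow> 'a \<Rightarrow> complex" where
  "dir_deriv b f = (\<lambda>x. frechet_derivative f (at x) b)"

lemma iter_deriv_Nil [simp]: "iter_deriv [] f = f"
  by (simp add: iter_deriv_def)

lemma iter_deriv_Cons: "iter_deriv (b # bs) f = dir_deriv b (iter_deriv bs f)"
  by (simp add: iter_deriv_def dir_deriv_def)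

lemma iter_deriv_snoc: "iter_deriv (bs @ [b]) f = iter_deriv bs (dir_deriv b f)"
  by (simp add: iter_deriv_def dir_deriv_def)

lemma dir_deriv_eqI:
  assumes "\<And>x. (f has_derivative f' x) (at x)"
  shows "dir_deriv b f = (\<lambda>x. f' x b)"
  unfolding dir_deriv_def using frechet_derivative_at[OF assms] by simp

text \<open>Iterated derivatives of a member never leave a family closed under partial derivatives,
  so only differentiability of the members has to be checked. Smoothness is shown by exhibiting such
  families, without formulas for higher derivatives.\<close>

lemma smooth_coinduct:
  assumes "f \<in> F" "\<And>g x. g \<in> F \<Longrightarrow> g differentiable (at x)"
    "\<And>g b. g \<in> F \<Longrightarrow> b \<in> Basis \<Longrightarrow> dir_deriv b g \<in> F"
  shows "smooth f"
proof -
  have "iter_deriv bs f \<in> F" if "bs \<in> lists Basis" for bs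
    using that by (induction bs) (auto simp: iter_deriv_Cons assms)
  then show ?thesis
    unfolding smooth_def using assms(2) by blast
qed

text \<open>The decay estimate, too, is needed for the members only, since every iterated derivative
  is a member.\<close>

lemma schwartz_coinduct:
  assumes "f \<in> F" "\<And>g x. g \<in> F \<Longrightarrow> g differentiable (at x)"
    "\<And>g b. g \<in> F \<Longrightarrow> b \<in> Basis \<Longrightarrow> dir_deriv b g \<in> F"
    "\<And>g N. g \<in> F \<Longrightarrow> \<exists>c. \<forall>x. (1 + norm x) ^ N * norm (g x) \<le> c"
  shows "f \<in> schwartz"
proof -
  have "iter_deriv bs f \<in> F" if "bs \<in> lists Basis" for bs
    using that by (induction bs) (auto simp: iter_deriv_Cons assms)
  then show ?thesis
    unfolding schwartz_def using assms(4) smooth_coinduct[OF assms(1-3)] by blast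
qed

lemma smooth_differentiable: "smooth f \<Longrightarrow> f differentiable (at x)"
  unfolding smooth_def by (metis iter_deriv_Nil lists.Nil)

lemma smooth_has_derivative:
  "smooth f \<Longrightarrow> (f has_derivative (\<lambda>h. dir_deriv h f x)) (at x)"
  unfolding dir_deriv_def using smooth_differentiable frechet_derivative_works by fastforce

lemma smooth_dir_deriv: "smooth f \<Longrightarrow> b \<in> Basis \<Longrightarrow> smooth (dir_deriv b f)"
  unfolding smooth_def by (metis iter_deriv_snoc append_in_lists_conv lists.Cons lists.Nil)

lemma smooth_iter_deriv: "smooth f \<Longrightarrow> bs \<in> lists Basis \<Longrightarrow> smooth (iter_deriv bs f)"
  by (induction bs) (auto simp: iter_deriv_Cons smooth_dir_deriv)

lemma smooth_continuous_on: "smooth f \<Longrightarrow> continuous_on S f"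
  by (meson continuous_at_imp_continuous_on differentiable_imp_continuous_within smooth_differentiable)

lemma smooth_borel: "smooth f \<Longrightarrow> f \<in> borel_measurable borel"
  by (intro borel_measurable_continuous_onI smooth_continuous_on)

lemma smooth_add:
  assumes "smooth f" "smooth g"
  shows "smooth (\<lambda>x. f x + g x)"
proof (rule smooth_coinduct[of _ "{\<lambda>x. f x + g x | f g. smooth f \<and> smooth g}"])
  fix k :: "'a \<Rightarrow> complex" and b assume "k \<in> {\<lambda>x. f x + g x | f g. smooth f \<and> smooth g}" and b: "(b::'a) \<in> Basis"
  then obtain f g where k: "k = (\<lambda>x. f x + g x)" and fg: "smooth f" "smooth g" by blast
  have "dir_deriv b k = (\<lambda>x. dir_deriv b f x + dir_deriv b g x)"
    unfolding k by (rule dir_deriv_eqI) (intro has_derivative_add smooth_has_derivative fg)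
  then show "dir_deriv b k \<in> {\<lambda>x. f x + g x | f g. smooth f \<and> smooth g}"
    using fg b smooth_dir_deriv by blast
qed (use assms in \<open>auto intro!: differentiable_add intro: smooth_differentiable\<close>)

lemma smooth_cmult:
  assumes "smooth f"
  shows "smooth (\<lambda>x. c * f x)"
proof (rule smooth_coinduct[of _ "{\<lambda>x. c * f x | f. smooth f}"])
  fix k :: "'a \<Rightarrow> complex" and b assume "k \<in> {\<lambda>x. c * f x | f. smooth f}" and b: "(b::'a) \<in> Basis"
  then obtain f where k: "k = (\<lambda>x. c * f x)" and f: "smooth f" by blast
  have "dir_deriv b k = (\<lambda>x. c * dir_deriv b f x)"
    unfolding k by (rule dir_deriv_eqI) (intro has_derivative_mult_right smooth_has_derivative f)
  then show "dir_deriv b k \<in> {\<lambda>x. c * f x | f. smooth f}"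
    using f b smooth_dir_deriv by blast
qed (use assms in \<open>auto intro!: differentiable_mult intro: smooth_differentiable\<close>)

lemma has_derivative_linear_times:
  fixes l :: "'a::euclidean_space \<Rightarrow> real"
  assumes "bounded_linear l" "smooth f"
  shows "((\<lambda>x. of_real (l x) * f x) has_derivative
    (\<lambda>h. of_real (l h) * f x + of_real (l x) * dir_deriv h f x)) (at x)"
proof -
  have "bounded_linear (\<lambda>x. complex_of_real (l x))"
    by (rule bounded_linear_compose[OF bounded_linear_of_real assms(1)])
  then have "((\<lambda>x. complex_of_real (l x)) has_derivative (\<lambda>h. of_real (l h))) (at x)"
    by (rule bounded_linear_imp_has_derivative)
  from has_derivative_mult[OF this smooth_has_derivative[OF assms(2)]]
  show ?thesis by (simp add: add.commute)
qed

lemma smooth_linear_times: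
  fixes l :: "'a::euclidean_space \<Rightarrow> real"
  assumes l: "bounded_linear l" and "smooth f"
  shows "smooth (\<lambda>x. of_real (l x) * f x)"
\<comment> \<open>The products alone are not closed under differentiation: differentiating
  \<open>l\<close> leaves a multiple of \<open>f\<close>, which the additional smooth summand
  \<open>g\<close> absorbs.\<close>
proof (rule smooth_coinduct[of _ "{\<lambda>x. of_real (l x) * f x + g x | f g. smooth f \<and> smooth g}"])
  have "smooth (\<lambda>_::'a. 0)"
    using smooth_cmult[OF assms(2), of 0] by (simp only: mult_zero_left)
  then show "(\<lambda>x. of_real (l x) * f x) \<in> {\<lambda>x. of_real (l x) * f x + g x | f g. smooth f \<and> smooth g}"
    using assms(2) by (intro CollectI exI[of _ f] exI[of _ "\<lambda>_. 0"]) simp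
next
  fix k b assume "k \<in> {\<lambda>x. of_real (l x) * f x + g x | f g. smooth f \<and> smooth g}" and b: "(b::'a) \<in> Basis"
  then obtain f g where k: "k = (\<lambda>x. of_real (l x) * f x + g x)" and fg: "smooth f" "smooth g" by blast
  have 1: "dir_deriv b k = (\<lambda>x. (of_real (l b) * f x + of_real (l x) * dir_deriv b f x) + dir_deriv b g x)"
    unfolding k by (rule dir_deriv_eqI) (intro has_derivative_add has_derivative_linear_times smooth_has_derivative fg l)
  have 2: "dir_deriv b k = (\<lambda>x. of_real (l x) * dir_deriv b f x + (of_real (l b) * f x + dir_deriv b g x))"
    unfolding 1 by (rule ext) (simp add: algebra_simps)
  have 3: "smooth (dir_deriv b f)" "smooth (\<lambda>x. of_real (l b) * f x + dir_deriv b g x)"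
    by (intro smooth_dir_deriv smooth_add smooth_cmult fg b)+
  show "dir_deriv b k \<in> {\<lambda>x. of_real (l x) * f x + g x | f g. smooth f \<and> smooth g}"
    unfolding mem_Collect_eq
    by (rule exI[of _ "dir_deriv b f"], rule exI[of _ "\<lambda>x. of_real (l b) * f x + dir_deriv b g x"]) (simp only: 2 3 simp_thms)
next
  fix k x assume "k \<in> {\<lambda>x. of_real (l x) * f x + g x | f g. smooth f \<and> smooth g}"
  then obtain f g where k: "k = (\<lambda>x. of_real (l x) * f x + g x)" and fg: "smooth f" "smooth g" by blast
  show "k differentiable (at x)"
    unfolding k using has_derivative_linear_times[OF l fg(1)] smooth_differentiable[OF fg(2)]
    by (intro differentiable_add) (auto simp: differentiable_def)
qed

lemma schwartz_smooth: "f \<in> schwartz \<Longrightarrow> smooth f"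
  by (simp add: schwartz_def)

section \<open>Integration on Euclidean spaces\<close>

lemma
  fixes f :: "'a::euclidean_space \<Rightarrow> real \<Rightarrow> complex"
  assumes int: "\<And>b. b \<in> Basis \<Longrightarrow> integrable lborel (f b)"
  shows integrable_lborel_prod: "integrable lborel (\<lambda>x. \<Prod>b\<in>Basis. f b (x \<bullet> b))"
    and integral_lborel_prod: "(LINT x|lborel. (\<Prod>b\<in>Basis. f b (x \<bullet> b))) = (\<Prod>b\<in>Basis. LINT t|lborel. f b t)"
proof -
  interpret product_sigma_finite "\<lambda>b::'a. lborel :: real measure"
    by (simp add: product_sigma_finite_def sigma_finite_lborel)
  have [measurable]: "\<And>b. b \<in> Basis \<Longrightarrow> f b \<in> borel_measurable borel"
    using borel_measurable_integrable[OF int] by simp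
  have *: "(\<Prod>b\<in>Basis. f b ((\<Sum>c\<in>Basis. g c *\<^sub>R c) \<bullet> b)) = (\<Prod>b\<in>Basis. f b (g b))" for g
    by (intro prod.cong refl) simp
  have m: "(\<lambda>f. \<Sum>b\<in>Basis. f b *\<^sub>R b) \<in> (\<Pi>\<^sub>M b\<in>Basis. lborel) \<rightarrow>\<^sub>M (borel :: 'a measure)"
    by measurable
  show "integrable lborel (\<lambda>x. \<Prod>b\<in>Basis. f b (x \<bullet> b))"
    by (subst lborel_eq, subst integrable_distr_eq[OF m])
       (auto simp: * intro!: product_integrable_prod int)
  show "(LINT x|lborel. (\<Prod>b\<in>Basis. f b (x \<bullet> b))) = (\<Prod>b\<in>Basis. LINT t|lborel. f b t)"
    by (subst lborel_eq, subst integral_distr[OF m])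
       (auto simp: * product_integral_prod int)
qed

lemma integrable_inverse_one_plus_square: "integrable lborel (\<lambda>t::real. inverse (1 + t\<^sup>2))"
  using integrable_inverse_1_plus_square by (simp add: set_integrable_def)

text \<open>Since 1 + (x \<bullet> b)^2 \<le> (1 + |x|)^2 for each basis vector, the weight is
  dominated by a product of one-dimensional functions 1 / (1 + t^2). The exponent
  \<open>2 * DIM('a)\<close> of the later majorants originates here.\<close>

lemma integrable_weight:
  "integrable lborel (\<lambda>x::'a::euclidean_space. inverse ((1 + norm x) ^ (2 * DIM('a))))"
proof -
  have "integrable lborel (\<lambda>x::'a. \<Prod>b\<in>Basis. complex_of_real (inverse (1 + (x \<bullet> b)\<^sup>2)))"
    by (rule integrable_lborel_prod[where f="\<lambda>b t. complex_of_real (inverse (1 + t\<^sup>2))"])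
       (intro integrable_of_real integrable_inverse_one_plus_square)
  then show ?thesis
  proof (rule Bochner_Integration.integrable_bound)
    show "AE x::'a in lborel. norm (inverse ((1 + norm x) ^ (2 * DIM('a))))
      \<le> norm (\<Prod>b\<in>Basis. complex_of_real (inverse (1 + (x \<bullet> b)\<^sup>2)))"
    proof (rule AE_I2)
      fix x :: 'a
      have "inverse ((1 + norm x) ^ (2 * DIM('a))) = (\<Prod>b\<in>(Basis::'a set). inverse ((1 + norm x)\<^sup>2))"
        by (simp add: power_mult power_inverse)
      also have "\<dots> \<le> (\<Prod>b\<in>Basis. inverse (1 + (x \<bullet> b)\<^sup>2))"
      proof (rule prod_mono)
        fix b :: 'a assume "b \<in> Basis"
        then have "(x \<bullet> b)\<^sup>2 \<le> (norm x)\<^sup>2"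
          using Basis_le_norm by (metis abs_le_square_iff abs_norm_cancel)
        moreover have "0 \<le> norm x" by simp
        ultimately have "1 + (x \<bullet> b)\<^sup>2 \<le> (1 + norm x)\<^sup>2"
          unfolding power2_sum one_power2 mult_1_right by linarith
        moreover have "0 < 1 + (x \<bullet> b)\<^sup>2"
          by (simp add: add_pos_nonneg)
        ultimately show "0 \<le> inverse ((1 + norm x)\<^sup>2) \<and> inverse ((1 + norm x)\<^sup>2) \<le> inverse (1 + (x \<bullet> b)\<^sup>2)"
          by (simp add: le_imp_inverse_le)
      qed
      also have "\<dots> = norm (\<Prod>b\<in>Basis. complex_of_real (inverse (1 + (x \<bullet> b)\<^sup>2)))"
        unfolding prod_norm[symmetric] norm_of_real
        by (intro prod.cong refl) (simp add: add_nonneg_nonneg)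
      finally show "norm (inverse ((1 + norm x) ^ (2 * DIM('a))))
        \<le> norm (\<Prod>b\<in>Basis. complex_of_real (inverse (1 + (x \<bullet> b)\<^sup>2)))"
        by simp
    qed
  qed measurable
qed

lemma
  fixes f :: "'a::euclidean_space \<Rightarrow> 'b::{banach, second_countable_topology}"
  assumes c: "c \<noteq> 0"
  shows integrable_lborel_scale: "integrable lborel (\<lambda>x. f (c *\<^sub>R x)) \<longleftrightarrow> integrable lborel f"
    and integral_lborel_scale: "(LINT x|lborel. f x) = \<bar>c\<bar> ^ DIM('a) *\<^sub>R (LINT x|lborel. f (c *\<^sub>R x))"
proof -
  have *: "integrable lborel (\<lambda>x. f (c *\<^sub>R x))" if "c \<noteq> 0" "integrable lborel f" for c and f :: "'a \<Rightarrow> 'b"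
  proof -
    have [measurable]: "f \<in> borel_measurable borel"
      using borel_measurable_integrable[OF that(2)] by simp
    have "integrable (density (distr lborel borel (\<lambda>x. 0 + c *\<^sub>R x)) (\<lambda>_. \<bar>c\<bar>^DIM('a))) f"
      using that lborel_affine[OF that(1), where t="0::'a"] by (metis (no_types, lifting))
    then have "integrable (distr lborel borel (\<lambda>x. 0 + c *\<^sub>R x)) (\<lambda>x. (\<bar>c\<bar>^DIM('a)) *\<^sub>R f x)"
      by (subst (asm) integrable_density) auto
    then have "integrable lborel (\<lambda>x. \<bar>c\<bar> ^ DIM('a) *\<^sub>R f (c *\<^sub>R x))"
      by (subst (asm) integrable_distr_eq) auto
    then have "integrable lborel (\<lambda>x. inverse (\<bar>c\<bar> ^ DIM('a)) *\<^sub>R \<bar>c\<bar> ^ DIM('a) *\<^sub>R f (c *\<^sub>R x))"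
      by (rule integrable_scaleR_right)
    then show ?thesis
      using that(1) by (simp del: power_abs)
  qed
  show iff: "integrable lborel (\<lambda>x. f (c *\<^sub>R x)) \<longleftrightarrow> integrable lborel f"
    using *[OF c] *[of "inverse c" "\<lambda>x. f (c *\<^sub>R x)"] c by auto
  show "(LINT x|lborel. f x) = \<bar>c\<bar> ^ DIM('a) *\<^sub>R (LINT x|lborel. f (c *\<^sub>R x))"
  proof (cases "integrable lborel f")
    case True
    then have [measurable]: "f \<in> borel_measurable borel"
      using borel_measurable_integrable[OF True] by simp
    have "(LINT x|lborel. f x) = (LINT x|density (distr lborel borel (\<lambda>x. 0 + c *\<^sub>R x)) (\<lambda>_. \<bar>c\<bar>^DIM('a)). f x)"
      using lborel_affine[OF c, where t="0::'a"] by (metis (no_types, lifting))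
    also have "\<dots> = \<bar>c\<bar> ^ DIM('a) *\<^sub>R (LINT x|lborel. f (c *\<^sub>R x))"
      by (subst integral_density) (auto simp: integral_distr)
    finally show ?thesis .
  next
    case False
    then show ?thesis using iff by (simp add: not_integrable_integral_eq)
  qed
qed

lemma
  fixes f :: "'a::euclidean_space \<Rightarrow> 'b::{banach, second_countable_topology}"
  shows integrable_lborel_translate: "integrable lborel (\<lambda>x. f (a + x)) \<longleftrightarrow> integrable lborel f"
    and integral_lborel_translate: "(LINT x|lborel. f (a + x)) = (LINT x|lborel. f x)"
proof -
  have *: "integrable lborel (\<lambda>x. f (a + x)) \<and> (LINT x|lborel. f (a + x)) = (LINT x|lborel. f x)"
    if "integrable lborel f" for a and f :: "'a \<Rightarrow> 'b"
  proof -
    have [measurable]: "f \<in> borel_measurable borel"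
      using borel_measurable_integrable[OF that] by simp
    have "integrable (distr lborel borel ((+) a)) f"
      using that by (simp add: lborel_distr_plus)
    moreover have "(LINT x|distr lborel borel ((+) a). f x) = (LINT x|lborel. f x)"
      by (simp add: lborel_distr_plus)
    ultimately show ?thesis
      by (subst (asm) integrable_distr_eq, simp, simp, subst (asm) integral_distr, auto)
  qed
  show iff: "integrable lborel (\<lambda>x. f (a + x)) \<longleftrightarrow> integrable lborel f"
    using *[of f a] *[of "\<lambda>x. f (a + x)" "- a"] by auto
  show "(LINT x|lborel. f (a + x)) = (LINT x|lborel. f x)"
    using iff * by (metis not_integrable_integral_eq)
qed

text \<open>First countability lets the limit be tested on sequences, where the usual theorem
  applies. Most uses are one-sided limits at 0 of a positive parameter.\<close>

lemma dominated_convergence_within: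
  fixes f :: "'a \<Rightarrow> 'b::{banach, second_countable_topology}" and a :: "'c::first_countable_topology"
  assumes f: "f \<in> borel_measurable M"
    and s: "\<And>t. t \<in> S \<Longrightarrow> t \<noteq> a \<Longrightarrow> s t \<in> borel_measurable M"
    and w: "integrable M w"
    and lim: "AE x in M. ((\<lambda>t. s t x) \<longlongrightarrow> f x) (at a within S)"
    and bound: "\<And>t. t \<in> S \<Longrightarrow> t \<noteq> a \<Longrightarrow> AE x in M. norm (s t x) \<le> w x"
  shows "((\<lambda>t. integral\<^sup>L M (s t)) \<longlongrightarrow> integral\<^sup>L M f) (at a within S)"
  unfolding tendsto_at_iff_sequentially
proof (intro allI impI)
  fix X assume X: "\<forall>i. X i \<in> S - {a}" "X \<longlonglongrightarrow> a"
  have "(\<lambda>i. integral\<^sup>L M (s (X i))) \<longlonglongrightarrow> integral\<^sup>L M f"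
  proof (rule integral_dominated_convergence[OF f _ w])
    show "AE x in M. (\<lambda>i. s (X i) x) \<longlonglongrightarrow> f x"
      using lim by eventually_elim (use X in \<open>auto simp: tendsto_at_iff_sequentially o_def\<close>)
  qed (use X s bound in auto)
  then show "((\<lambda>t. integral\<^sup>L M (s t)) \<circ> X) \<longlonglongrightarrow> integral\<^sup>L M f"
    by (simp add: o_def)
qed

text \<open>The mean value inequality bounds every difference quotient by \<open>w\<close>, so
  dominated convergence applies to the remainders divided by \<open>norm h\<close>.\<close>

lemma has_derivative_LINT:
  fixes f :: "'a \<Rightarrow> 'b::euclidean_space \<Rightarrow> complex"
  assumes e: "e > 0"
    and der: "\<And>x \<xi>. \<xi> \<in> ball \<xi>0 e \<Longrightarrow> (f x has_derivative f' x \<xi>) (at \<xi>)"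
    and bd: "\<And>x \<xi> h. \<xi> \<in> ball \<xi>0 e \<Longrightarrow> norm (f' x \<xi> h) \<le> w x * norm h"
    and w: "integrable M w"
    and int: "\<And>\<xi>. \<xi> \<in> ball \<xi>0 e \<Longrightarrow> integrable M (\<lambda>x. f x \<xi>)"
  shows "\<And>h. integrable M (\<lambda>x. f' x \<xi>0 h)"
    and "((\<lambda>\<xi>. LINT x|M. f x \<xi>) has_derivative (\<lambda>h. LINT x|M. f' x \<xi>0 h)) (at \<xi>0)"
proof -
  have lin: "linear (f' x \<xi>0)" for x
    using der[of \<xi>0 x] e has_derivative_linear by auto
  have w0: "w x \<ge> 0" for x
  proof -
    obtain b :: 'b where "b \<in> Basis" using nonempty_Basis by blast
    then show ?thesis using bd[of \<xi>0 x b] e by (metis centre_in_ball mult.right_neutral norm_Basis norm_ge_zero order_trans)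
  qed
  \<comment> \<open>Measurability of the derivative is not assumed but inherited from difference
    quotients along steps \<open>\<delta> n\<close> tending to 0; the factor e / 2 in
    \<open>\<delta>\<close> keeps all their base points inside the ball.\<close>
  have meas: "(\<lambda>x. f' x \<xi>0 h) \<in> borel_measurable M" for h
  proof (cases "h = 0")
    case True
    then show ?thesis by (simp add: linear_0[OF lin])
  next
    case False
    define \<delta> where "\<delta> n = (e / 2) / (norm h * real (Suc n))" for n
    have d0: "\<delta> n > 0" for n using e False by (simp add: \<delta>_def)
    have dn: "\<xi>0 + \<delta> n *\<^sub>R h \<in> ball \<xi>0 e" for n
    proof -
      have "norm (\<delta> n *\<^sub>R h) = (e / 2) / real (Suc n)"
        using d0[of n] False e by (simp add: \<delta>_def)
      also have "\<dots> \<le> e / 2" using e by (simp add: field_simps)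
      finally show ?thesis using e by (simp add: dist_norm)
    qed
    have "\<delta> \<longlonglongrightarrow> 0"
    proof -
      have "(\<lambda>n. (e / 2 / norm h) * (1 / real (Suc n))) \<longlonglongrightarrow> (e/2/norm h) * 0"
        by (intro tendsto_mult_left LIMSEQ_Suc lim_1_over_n)
      then show ?thesis by (simp add: \<delta>_def[abs_def] field_simps)
    qed
    have lim: "(\<lambda>n. (f x (\<xi>0 + \<delta> n *\<^sub>R h) - f x \<xi>0) /\<^sub>R \<delta> n) \<longlonglongrightarrow> f' x \<xi>0 h" for x
    proof -
      have 1: "((\<lambda>h. norm (f x (\<xi>0 + h) - f x \<xi>0 - f' x \<xi>0 h) / norm h) \<longlongrightarrow> 0) (at 0)"
        using der[of \<xi>0 x] e unfolding has_derivative_at by simp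
      have "(\<lambda>n. \<delta> n *\<^sub>R h) \<longlonglongrightarrow> 0"
        using tendsto_scaleR[OF \<open>\<delta> \<longlonglongrightarrow> 0\<close> tendsto_const[of h]] by simp
      moreover have "\<delta> n *\<^sub>R h \<noteq> 0" for n
        using d0[of n] False by simp
      ultimately have "filterlim (\<lambda>n. \<delta> n *\<^sub>R h) (at 0) sequentially"
        by (simp add: filterlim_at)
      from filterlim_compose[OF 1 this]
      have "(\<lambda>n. norm (f x (\<xi>0 + \<delta> n *\<^sub>R h) - f x \<xi>0 - f' x \<xi>0 (\<delta> n *\<^sub>R h)) / norm (\<delta> n *\<^sub>R h)) \<longlonglongrightarrow> 0" .
      from tendsto_mult_right[OF this, of "norm h"]
      have "(\<lambda>n. norm (f x (\<xi>0 + \<delta> n *\<^sub>R h) - f x \<xi>0 - \<delta> n *\<^sub>R f' x \<xi>0 h) / \<delta> n) \<longlonglongrightarrow> 0"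
        using abs_of_pos[OF d0] False by (simp add: linear_scale[OF lin])
      moreover have "norm (f x (\<xi>0 + \<delta> n *\<^sub>R h) - f x \<xi>0 - \<delta> n *\<^sub>R f' x \<xi>0 h) / \<delta> n
        = norm ((f x (\<xi>0 + \<delta> n *\<^sub>R h) - f x \<xi>0) /\<^sub>R \<delta> n - f' x \<xi>0 h)" for n
      proof -
        have "(f x (\<xi>0 + \<delta> n *\<^sub>R h) - f x \<xi>0) /\<^sub>R \<delta> n - f' x \<xi>0 h
          = (f x (\<xi>0 + \<delta> n *\<^sub>R h) - f x \<xi>0 - \<delta> n *\<^sub>R f' x \<xi>0 h) /\<^sub>R \<delta> n"
          using d0[of n] by (simp add: scaleR_diff_right)
        then show ?thesis
          using d0[of n] by (simp add: divide_inverse mult.commute)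
      qed
      ultimately show ?thesis
        by (simp add: LIM_zero_iff tendsto_norm_zero_iff)
    qed
    show ?thesis
    proof (rule borel_measurable_LIMSEQ_metric[OF _ lim])
      fix n
      show "(\<lambda>x. (f x (\<xi>0 + \<delta> n *\<^sub>R h) - f x \<xi>0) /\<^sub>R \<delta> n) \<in> borel_measurable M"
        using int[OF dn[of n]] int[of \<xi>0] e by (intro borel_measurable_scaleR borel_measurable_diff) auto
    qed
  qed
  show int': "integrable M (\<lambda>x. f' x \<xi>0 h)" for h
  proof (rule Bochner_Integration.integrable_bound[of _ "\<lambda>x. w x * norm h"])
    show "AE x in M. norm (f' x \<xi>0 h) \<le> norm (w x * norm h)"
      using bd[of \<xi>0 _ h] e w0 by (auto simp: abs_mult)
  qed (use w meas in auto)
  show "((\<lambda>\<xi>. LINT x|M. f x \<xi>) has_derivative (\<lambda>h. LINT x|M. f' x \<xi>0 h)) (at \<xi>0)"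
    unfolding has_derivative_at
  proof
    show "bounded_linear (\<lambda>h. LINT x|M. f' x \<xi>0 h)"
    proof (rule linear_conv_bounded_linear[THEN iffD1], rule linearI)
      show "(LINT x|M. f' x \<xi>0 (h + k)) = (LINT x|M. f' x \<xi>0 h) + (LINT x|M. f' x \<xi>0 k)" for h k
        using int' by (simp add: linear_add[OF lin])
      show "(LINT x|M. f' x \<xi>0 (r *\<^sub>R h)) = r *\<^sub>R (LINT x|M. f' x \<xi>0 h)" for h r
        by (simp add: linear_scale[OF lin])
    qed
    define q where "q h x = (f x (\<xi>0 + h) - f x \<xi>0 - f' x \<xi>0 h) /\<^sub>R norm h" for h x
    have nq: "norm (q h x) = norm (f x (\<xi>0 + h) - f x \<xi>0 - f' x \<xi>0 h) / norm h" for h x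
      by (simp add: q_def divide_inverse mult.commute)
    have "((\<lambda>h. LINT x|M. q h x) \<longlongrightarrow> (LINT x|M. 0)) (at 0 within ball 0 e)"
    proof (rule dominated_convergence_within[where w="\<lambda>x. 2 * w x"])
      fix h :: 'b assume h: "h \<in> ball 0 e" "h \<noteq> 0"
      then have h': "\<xi>0 + h \<in> ball \<xi>0 e" by (simp add: dist_norm)
      show "q h \<in> borel_measurable M"
        unfolding q_def using int[OF h'] int[of \<xi>0] e meas
        by (intro borel_measurable_scaleR borel_measurable_diff) auto
      \<comment> \<open>One \<open>w x\<close> comes from the difference, by the mean value
        inequality on the ball, the other from the linear term.\<close>
      show "AE x in M. norm (q h x) \<le> 2 * w x"
      proof (rule AE_I2)
        fix x
        have "norm (f x (\<xi>0 + h) - f x \<xi>0) \<le> w x * norm (\<xi>0 + h - \<xi>0)"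
        proof (rule differentiable_bound[of "ball \<xi>0 e" "f x" "f' x"])
          show "onorm (f' x y) \<le> w x" if "y \<in> ball \<xi>0 e" for y
            by (rule onorm_le) (use bd that in auto)
        qed (use h' e in \<open>auto intro!: has_derivative_at_withinI der\<close>)
        moreover have "norm (f' x \<xi>0 h) \<le> w x * norm h"
          using bd e by simp
        ultimately have "norm (f x (\<xi>0 + h) - f x \<xi>0 - f' x \<xi>0 h) \<le> 2 * w x * norm h"
          using norm_triangle_ineq4[of "f x (\<xi>0 + h) - f x \<xi>0" "f' x \<xi>0 h"] by simp
        then show "norm (q h x) \<le> 2 * w x"
          unfolding nq using h by (simp add: pos_divide_le_eq)
      qed
    next
      show "AE x in M. ((\<lambda>t. q t x) \<longlongrightarrow> 0) (at 0 within ball 0 e)"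
      proof (rule AE_I2)
        fix x
        have "((\<lambda>h. norm (f x (\<xi>0 + h) - f x \<xi>0 - f' x \<xi>0 h) / norm h) \<longlongrightarrow> 0) (at 0)"
          using der[of \<xi>0 x] e unfolding has_derivative_at by simp
        then have "((\<lambda>h. norm (q h x)) \<longlongrightarrow> 0) (at 0)"
          unfolding nq .
        then show "((\<lambda>t. q t x) \<longlongrightarrow> 0) (at 0 within ball 0 e)"
          using tendsto_norm_zero_iff tendsto_within_subset by blast
      qed
    qed (use w in auto)
    then have "((\<lambda>h. LINT x|M. q h x) \<longlongrightarrow> 0) (at 0)"
      using e by (simp add: at_within_open[of 0 "ball 0 e"])
    then have lim: "((\<lambda>h. norm (LINT x|M. q h x)) \<longlongrightarrow> 0) (at 0)"
      by (rule tendsto_norm_zero)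
    show "(\<lambda>h. norm ((LINT x|M. f x (\<xi>0 + h)) - (LINT x|M. f x \<xi>0) - (LINT x|M. f' x \<xi>0 h)) / norm h) \<midarrow>0\<rightarrow> 0"
    proof (rule Lim_transform_eventually[OF lim])
      have "eventually (\<lambda>h. h \<in> ball 0 e) (at (0::'b))"
        using e by (intro eventually_at_in_open') auto
      then show "\<forall>\<^sub>F h in at 0. norm (LINT x|M. q h x) =
         norm ((LINT x|M. f x (\<xi>0 + h)) - (LINT x|M. f x \<xi>0) - (LINT x|M. f' x \<xi>0 h)) / norm h"
      proof eventually_elim
        case (elim h)
        then have "\<xi>0 + h \<in> ball \<xi>0 e" by (simp add: dist_norm)
        from int[OF this] int[of \<xi>0] e int'[of h]
        show ?case unfolding q_def by (simp add: divide_inverse mult.commute)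
      qed
    qed
  qed
qed

section \<open>Rapid decay\<close>

text \<open>Derivatives are deliberately left out: the class has to contain damped plane waves,
  whose factor exp (- c |\<xi>|) is not differentiable at 0.\<close>

definition rapid :: "('a::euclidean_space \<Rightarrow> complex) \<Rightarrow> bool" where
  "rapid f \<longleftrightarrow> f \<in> borel_measurable borel \<and> (\<forall>N::nat. \<exists>c. \<forall>x. (1 + norm x) ^ N * norm (f x) \<le> c)"

lemma rapid_borel [measurable_dest]: "rapid f \<Longrightarrow> f \<in> borel_measurable borel"
  by (simp add: rapid_def)

lemma rapid_bound:
  assumes "rapid f"
  obtains c where "c \<ge> 0" "\<And>x. norm (f x) \<le> c * inverse ((1 + norm x) ^ N)"
proof -
  obtain c where c: "\<And>x. (1 + norm x) ^ N * norm (f x) \<le> c"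
    using assms unfolding rapid_def by blast
  have pos: "0 < (1 + norm x) ^ N" for x :: 'a
    by (simp add: add_pos_nonneg)
  show thesis
  proof (rule that)
    show "c \<ge> 0"
      by (rule order_trans[OF _ c[of 0]]) simp
    show "norm (f x) \<le> c * inverse ((1 + norm x) ^ N)" for x
      using c[of x] pos[of x] by (simp add: field_simps)
  qed
qed

lemma rapid_integrable:
  assumes "rapid f"
  shows "integrable lborel f"
proof -
  obtain c where c: "c \<ge> 0" "\<And>x. norm (f x) \<le> c * inverse ((1 + norm x) ^ (2 * DIM('a)))"
    using rapid_bound[OF assms] by blast
  show ?thesis
  proof (rule Bochner_Integration.integrable_bound)
    show "integrable lborel (\<lambda>x::'a. c * inverse ((1 + norm x) ^ (2 * DIM('a))))"
      by (intro integrable_mult_right integrable_weight)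
    show "AE x in lborel. norm (f x) \<le> norm (c * inverse ((1 + norm x) ^ (2 * DIM('a))))"
      using order_trans[OF c(2) abs_ge_self] by simp
  qed (use assms in \<open>simp add: rapid_def\<close>)
qed

lemma schwartz_rapid: "f \<in> schwartz \<Longrightarrow> rapid f"
proof -
  assume f: "f \<in> schwartz"
  have "\<exists>c. \<forall>x. (1 + norm x) ^ N * norm (iter_deriv [] f x) \<le> c" for N
    using f unfolding schwartz_def by (auto simp del: iter_deriv_Nil)
  then show ?thesis
    unfolding rapid_def using smooth_borel[OF schwartz_smooth[OF f]] by simp
qed

section \<open>Oscillatory integrals with rapidly decreasing amplitudes\<close>

text \<open>By translation invariance the integral of f (s + x) over x does not depend on s.
  Differentiating under the integral sign at s = 0 gives the claim, without boundary terms.\<close>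

lemma LINT_derivative_zero:
  fixes f :: "'a::euclidean_space \<Rightarrow> complex"
  assumes der: "\<And>x. (f has_derivative f' x) (at x)"
    and bd: "\<And>x h. norm (f' x h) \<le> c * inverse ((1 + norm x) ^ (2 * DIM('a))) * norm h"
    and int: "integrable lborel f"
  shows "(LINT x|lborel. f' x h) = 0"
proof -
  let ?M = "2 * DIM('a)"
  have c: "c \<ge> 0"
  proof -
    obtain b :: 'a where b: "b \<in> Basis" using nonempty_Basis by (meson equals0I)
    have "0 \<le> norm (f' 0 b)" by simp
    also have "\<dots> \<le> c" using bd[of 0 b] b by simp
    finally show ?thesis .
  qed
  have "((\<lambda>s. LINT x|lborel. f (s + x)) has_derivative (\<lambda>h. LINT x|lborel. f' (0 + x) h)) (at 0)"
  \<comment> \<open>For |s| < 1 one has 1 + |x| \<le> 2 (1 + |s + x|), so the factor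
    \<open>2 ^ ?M\<close> makes the majorant independent of s.\<close>
  proof (rule has_derivative_LINT[where e=1 and f="\<lambda>x s. f (s + x)" and f'="\<lambda>x s. f' (s + x)" and w="\<lambda>x. c * 2 ^ ?M * inverse ((1 + norm x) ^ ?M)"])
    show "((\<lambda>s. f (s + x)) has_derivative f' (s + x)) (at s)" for x s
      by (rule has_derivative_compose[of "\<lambda>s. s + x" "\<lambda>s. s", simplified]) (auto intro!: derivative_eq_intros der)
    show "norm (f' (s + x) h) \<le> c * 2 ^ ?M * inverse ((1 + norm x) ^ ?M) * norm h" if "s \<in> ball 0 1" for x s h
    proof -
      have "norm x \<le> norm (s + x) + norm s"
        using norm_triangle_ineq4[of "s + x" s] by simp
      then have "1 + norm x \<le> 2 * (1 + norm (s + x))"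
        using that norm_ge_zero[of "s + x"] unfolding mem_ball_0 by (smt (verit))
      then have "(1 + norm x) ^ ?M \<le> (2 * (1 + norm (s + x))) ^ ?M"
        by (intro power_mono) (auto simp: add_nonneg_nonneg)
      then have "inverse ((2 * (1 + norm (s + x))) ^ ?M) \<le> inverse ((1 + norm x) ^ ?M)"
        by (intro le_imp_inverse_le zero_less_power add_pos_nonneg) auto
      from mult_left_mono[OF this, of "2 ^ ?M"] have "inverse ((1 + norm (s + x)) ^ ?M) \<le> 2 ^ ?M * inverse ((1 + norm x) ^ ?M)"
        unfolding power_mult_distrib inverse_mult_distrib by (simp add: mult.assoc[symmetric])
      then have "c * inverse ((1 + norm (s + x)) ^ ?M) * norm h \<le> c * (2 ^ ?M * inverse ((1 + norm x) ^ ?M)) * norm h"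
        using c by (intro mult_right_mono mult_left_mono) auto
      with bd[of "s + x" h] show ?thesis by (simp add: mult.assoc)
    qed
    show "integrable lborel (\<lambda>x::'a. c * 2 ^ ?M * inverse ((1 + norm x) ^ ?M))"
      by (intro integrable_mult_right integrable_weight)
    show "integrable lborel (\<lambda>x. f (s + x))" for s
      using int by (simp add: integrable_lborel_translate)
  qed simp
  then have "((\<lambda>s. LINT x|lborel. f x) has_derivative (\<lambda>h. LINT x|lborel. f' x h)) (at (0::'a))"
    by (simp add: integral_lborel_translate)
  then have "(\<lambda>h. LINT x|lborel. f' x h) = (\<lambda>h. 0)"
    by (rule has_derivative_unique) simp
  then show ?thesis by metis
qed

text \<open>The amplitudes arising from \<open>H (x, \<xi>) * v x\<close> by differentiating the oscillatory integral
  with this amplitude: each \<open>\<xi>\<close>-derivative may produce a factor \<open>x\<^sub>b\<close>.\<close>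

inductive_set amplitudes ::
  "('a \<times> 'a \<Rightarrow> complex) \<Rightarrow> ('a::euclidean_space \<Rightarrow> complex) \<Rightarrow> ('a \<times> 'a \<Rightarrow> complex) set"
  for H v where
  base: "bs \<in> lists Basis \<Longrightarrow> cs \<in> lists Basis \<Longrightarrow>
    (\<lambda>z. iter_deriv bs H z * iter_deriv cs v (fst z)) \<in> amplitudes H v"
| add: "k \<in> amplitudes H v \<Longrightarrow> l \<in> amplitudes H v \<Longrightarrow> (\<lambda>z. k z + l z) \<in> amplitudes H v"
| scale: "k \<in> amplitudes H v \<Longrightarrow> (\<lambda>z. c * k z) \<in> amplitudes H v"
| mulx: "k \<in> amplitudes H v \<Longrightarrow> b \<in> Basis \<Longrightarrow> (\<lambda>z. of_real (fst z \<bullet> b) * k z) \<in> amplitudes H v"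

text \<open>The bound concerns products of derivatives of \<open>H\<close> and \<open>v\<close>
  rather than each factor: derivatives of the symbols of interest may blow up at x = 0, and only the
  flatness of \<open>v\<close> compensates for this. Uniformity in \<xi> is what allows
  differentiation under the integral.\<close>

locale amplitude =
  fixes H :: "'a::euclidean_space \<times> 'a \<Rightarrow> complex" and v :: "'a \<Rightarrow> complex" and \<kappa> :: real
  assumes H: "smooth H" and v: "smooth v"
    and bd: "\<And>bs cs N. bs \<in> lists Basis \<Longrightarrow> cs \<in> lists Basis \<Longrightarrow>
      \<exists>c. \<forall>x \<xi>. (1 + norm x) ^ N * norm (iter_deriv bs H (x, \<xi>) * iter_deriv cs v x) \<le> c"
    and \<kappa>: "\<kappa> \<noteq> 0"
begin

lemma amplitudes_differentiable:
  assumes "k \<in> amplitudes H v"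
  shows "(\<forall>z. k differentiable (at z)) \<and> (\<forall>b\<in>Basis. dir_deriv b k \<in> amplitudes H v)"
  using assms
proof induction
  case (base bs cs)
  note H' = smooth_iter_deriv[OF H base(1)] and v' = smooth_iter_deriv[OF v base(2)]
  have fst: "((\<lambda>z. iter_deriv cs v (fst z)) has_derivative (\<lambda>h. dir_deriv (fst h) (iter_deriv cs v) (fst z))) (at z)" for z :: "'a \<times> 'a"
    by (rule has_derivative_compose[OF _ smooth_has_derivative[OF v']]) (auto intro!: derivative_eq_intros)
  note der = has_derivative_mult[OF smooth_has_derivative[OF H'] fst]
  show ?case
  proof (intro conjI ballI allI)
    fix z show "(\<lambda>z. iter_deriv bs H z * iter_deriv cs v (fst z)) differentiable (at z)"
      using der unfolding differentiable_def by blast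
  next
    fix b :: "'a \<times> 'a" assume b: "b \<in> Basis"
    have eq: "dir_deriv b (\<lambda>z. iter_deriv bs H z * iter_deriv cs v (fst z)) =
      (\<lambda>z. iter_deriv bs H z * dir_deriv (fst b) (iter_deriv cs v) (fst z) + dir_deriv b (iter_deriv bs H) z * iter_deriv cs v (fst z))"
      by (rule dir_deriv_eqI[OF der])
    have 1: "(\<lambda>z. dir_deriv b (iter_deriv bs H) z * iter_deriv cs v (fst z)) \<in> amplitudes H v"
      using amplitudes.base[of "b # bs" cs H v] b base by (simp add: iter_deriv_Cons)
    show "dir_deriv b (\<lambda>z. iter_deriv bs H z * iter_deriv cs v (fst z)) \<in> amplitudes H v"
    \<comment> \<open>A basis vector of the product space is an x-direction or a \<xi>-direction. In
      the latter case \<open>v\<close> is differentiated in the direction 0, which contributes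
      nothing.\<close>
    proof (cases "fst b = 0")
      case True
      have "dir_deriv 0 (iter_deriv cs v) x = 0" for x
        using has_derivative_linear[OF smooth_has_derivative[OF v']] linear_0 by blast
      then show ?thesis using 1 by (simp add: eq True)
    next
      case False
      then have "fst b \<in> Basis" using b by (auto simp: Basis_prod_def)
      then have 2: "(\<lambda>z. iter_deriv bs H z * dir_deriv (fst b) (iter_deriv cs v) (fst z)) \<in> amplitudes H v"
        using amplitudes.base[of bs "fst b # cs" H v] base by (simp add: iter_deriv_Cons)
      show ?thesis unfolding eq by (rule amplitudes.add[OF 2 1])
    qed
  qed
next
  case (add k l)
  have "dir_deriv b (\<lambda>z. k z + l z) = (\<lambda>z. dir_deriv b k z + dir_deriv b l z)" for b
    using add by (intro dir_deriv_eqI has_derivative_add) (auto simp: dir_deriv_def frechet_derivative_works[symmetric])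
  then show ?case using add by (auto intro: amplitudes.add)
next
  case (scale k c)
  have "dir_deriv b (\<lambda>z. c * k z) = (\<lambda>z. c * dir_deriv b k z)" for b
    using scale by (intro dir_deriv_eqI has_derivative_mult_right) (auto simp: dir_deriv_def frechet_derivative_works[symmetric])
  then show ?case using scale by (auto intro: amplitudes.scale)
next
  case (mulx k b)
  have l: "bounded_linear (\<lambda>z::'a \<times> 'a. fst z \<bullet> b)"
    by (intro bounded_linear_intros)
  have "((\<lambda>z. complex_of_real (fst z \<bullet> b)) has_derivative (\<lambda>h. of_real (fst h \<bullet> b))) (at z)" for z :: "'a \<times> 'a"
    by (rule bounded_linear_imp_has_derivative[OF bounded_linear_compose[OF bounded_linear_of_real l]])
  moreover have "(k has_derivative (\<lambda>h. dir_deriv h k z)) (at z)" for z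
    using mulx unfolding dir_deriv_def by (auto simp: frechet_derivative_works[symmetric] simp del: split_paired_All)
  ultimately have der: "((\<lambda>z. of_real (fst z \<bullet> b) * k z) has_derivative
      (\<lambda>h. of_real (fst z \<bullet> b) * dir_deriv h k z + of_real (fst h \<bullet> b) * k z)) (at z)" for z
    by (intro has_derivative_mult)
  have "dir_deriv c (\<lambda>z. of_real (fst z \<bullet> b) * k z) = (\<lambda>z. of_real (fst z \<bullet> b) * dir_deriv c k z + of_real (fst c \<bullet> b) * k z)" for c
    by (rule dir_deriv_eqI[OF der])
  moreover have "(\<lambda>z. of_real (fst z \<bullet> b) * k z) differentiable (at z)" for z
    using der unfolding differentiable_def by blast
  ultimately show ?case using mulx
    by (auto intro!: amplitudes.add amplitudes.mulx amplitudes.scale simp del: split_paired_All)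
qed

lemma amplitudes_bound:
  assumes "k \<in> amplitudes H v"
  shows "\<exists>c\<ge>0. \<forall>x \<xi>. norm (k (x, \<xi>)) \<le> c * inverse ((1 + norm x) ^ N)"
proof -
  have pos: "0 < (1 + norm x) ^ N" for x :: 'a and N
    by (simp add: add_pos_nonneg)
  have "\<exists>c. \<forall>x \<xi>. (1 + norm x) ^ N * norm (k (x, \<xi>)) \<le> c"
    using assms
  proof (induction arbitrary: N)
    case (base bs cs)
    then show ?case using bd by simp
  next
    case (add k l)
    obtain c d where "\<forall>x \<xi>. (1 + norm x) ^ N * norm (k (x, \<xi>)) \<le> c" "\<forall>x \<xi>. (1 + norm x) ^ N * norm (l (x, \<xi>)) \<le> d"
      using add.IH by metis
    then have "(1 + norm x) ^ N * norm (k (x, \<xi>) + l (x, \<xi>)) \<le> c + d" for x \<xi>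
      using mult_left_mono[OF norm_triangle_ineq[of "k (x, \<xi>)" "l (x, \<xi>)"] less_imp_le[OF pos[of x N]]]
      by (smt (verit) distrib_left)
    then show ?case by blast
  next
    case (scale k c)
    obtain d where d: "\<forall>x \<xi>. (1 + norm x) ^ N * norm (k (x, \<xi>)) \<le> d"
      using scale.IH by metis
    have "(1 + norm x) ^ N * norm (c * k (x, \<xi>)) \<le> norm c * d" for x \<xi>
      using mult_left_mono[OF d[rule_format, of x \<xi>] norm_ge_zero[of c]] by (simp add: norm_mult mult_ac)
    then show ?case by blast
  next
    case (mulx k b)
    \<comment> \<open>The factor \<open>x \<bullet> b\<close> costs one power of 1 + |x|, so the
      induction hypothesis is taken at \<open>Suc N\<close>.\<close>
    obtain d where d: "\<forall>x \<xi>. (1 + norm x) ^ Suc N * norm (k (x, \<xi>)) \<le> d"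
      using mulx.IH by metis
    have "(1 + norm x) ^ N * norm (of_real (fst (x, \<xi>) \<bullet> b) * k (x, \<xi>)) \<le> d" for x \<xi>
    proof -
      have "\<bar>x \<bullet> b\<bar> \<le> 1 + norm x"
        using Basis_le_norm[OF mulx.hyps(2), of x] by simp
      then have "(1 + norm x) ^ N * (\<bar>x \<bullet> b\<bar> * norm (k (x, \<xi>))) \<le> (1 + norm x) ^ N * ((1 + norm x) * norm (k (x, \<xi>)))"
        using less_imp_le[OF pos[of x N]] by (intro mult_left_mono mult_right_mono) auto
      then show ?thesis using d[rule_format, of x \<xi>] by (simp add: norm_mult mult_ac)
    qed
    then show ?case by blast
  qed
  then obtain c where c: "\<And>x \<xi>. (1 + norm x) ^ N * norm (k (x, \<xi>)) \<le> c" by blast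
  have "c \<ge> 0"
    by (rule order_trans[OF _ c[of 0 0]]) simp
  moreover have "norm (k (x, \<xi>)) \<le> c * inverse ((1 + norm x) ^ N)" for x \<xi>
    using c[of x \<xi>] pos[of x N] by (simp add: field_simps)
  ultimately show ?thesis by blast
qed

lemma amplitudes_smooth: "k \<in> amplitudes H v \<Longrightarrow> smooth k"
  by (rule smooth_coinduct[of _ "amplitudes H v"]) (use amplitudes_differentiable in auto)

definition osc :: "('a \<times> 'a \<Rightarrow> complex) \<Rightarrow> 'a \<Rightarrow> complex" where
  "osc k \<xi> = (LINT x|lborel. k (x, \<xi>) * cis (2 * pi * \<kappa> * (x \<bullet> \<xi>)))"

lemma osc_integrable:
  assumes "k \<in> amplitudes H v"
  shows "integrable lborel (\<lambda>x. k (x, \<xi>) * cis (2 * pi * \<kappa> * (x \<bullet> \<xi>)))"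
proof -
  obtain c where c: "c \<ge> 0" "\<And>x \<xi>. norm (k (x, \<xi>)) \<le> c * inverse ((1 + norm x) ^ (2 * DIM('a)))"
    using amplitudes_bound[OF assms] by blast
  have [measurable]: "k \<in> borel_measurable borel"
    by (rule smooth_borel[OF amplitudes_smooth[OF assms]])
  show ?thesis
  proof (rule Bochner_Integration.integrable_bound)
    show "integrable lborel (\<lambda>x::'a. c * inverse ((1 + norm x) ^ (2 * DIM('a))))"
      by (intro integrable_mult_right integrable_weight)
    show "AE x in lborel. norm (k (x, \<xi>) * cis (2 * pi * \<kappa> * (x \<bullet> \<xi>))) \<le> norm (c * inverse ((1 + norm x) ^ (2 * DIM('a))))"
      using order_trans[OF c(2) abs_ge_self] by (simp add: norm_mult)
    show "(\<lambda>x. k (x, \<xi>) * cis (2 * pi * \<kappa> * (x \<bullet> \<xi>))) \<in> borel_measurable lborel"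
      by (intro borel_measurable_times borel_measurable_continuous_onI) (auto intro!: continuous_intros simp: cis_conv_exp)
  qed
qed

lemma has_derivative_cis_inner:
  "((\<lambda>\<xi>. cis (2 * pi * \<kappa> * (x \<bullet> \<xi>))) has_derivative
     (\<lambda>h. 2 * pi * \<i> * \<kappa> * (x \<bullet> h) * cis (2 * pi * \<kappa> * (x \<bullet> \<xi>)))) (at \<xi>)"
proof -
  have 1: "((\<lambda>\<xi>. \<i> * complex_of_real (2 * pi * \<kappa> * (x \<bullet> \<xi>))) has_derivative
      (\<lambda>h. \<i> * complex_of_real (2 * pi * \<kappa> * (x \<bullet> h)))) (at \<xi>)"
    by (intro has_derivative_mult_right has_derivative_of_real) (auto intro!: derivative_eq_intros)
  have 2: "(exp has_derivative (\<lambda>h. exp z * h)) (at z)" for z :: complex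
    using DERIV_exp[of z] by (simp add: has_field_derivative_def)
  show ?thesis
    using has_derivative_compose[OF 1 2] unfolding cis_conv_exp by (simp add: mult_ac)
qed

lemma
  assumes k: "k \<in> amplitudes H v"
  shows osc_differentiable: "osc k differentiable (at \<xi>)"
    and osc_dir_deriv: "b \<in> Basis \<Longrightarrow> dir_deriv b (osc k) =
      osc (\<lambda>z. dir_deriv (0, b) k z + (2 * pi * \<i> * \<kappa>) * (of_real (fst z \<bullet> b) * k z))"
proof -
  \<comment> \<open>Differentiating the integrand in the direction b gives \<open>kd b\<close> times
    the same exponential; this keeps the integrals \<open>osc k\<close> closed under partial
    derivatives.\<close>
  define kd where "kd b = (\<lambda>z. dir_deriv (0, b) k z + (2 * pi * \<i> * \<kappa>) * (of_real (fst z \<bullet> b) * k z))" for b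
  have kd: "kd b \<in> amplitudes H v" if "b \<in> Basis" for b
    unfolding kd_def using amplitudes_differentiable[OF k] k that
    by (intro amplitudes.add amplitudes.scale amplitudes.mulx) (auto simp: Basis_prod_def)
  \<comment> \<open>The derivative is expanded in the basis, so that the bounds for the finitely
    many amplitudes \<open>kd b\<close> add up to a majorant linear in
    \<open>norm h\<close>.\<close>
  define f' where "f' x \<xi> h = (\<Sum>b\<in>Basis. of_real (h \<bullet> b) * (kd b (x, \<xi>) * cis (2 * pi * \<kappa> * (x \<bullet> \<xi>))))" for x \<xi> h
  note sm = amplitudes_smooth[OF k]
  have "\<forall>b. \<exists>c\<ge>0. b \<in> Basis \<longrightarrow> (\<forall>x \<xi>. norm (kd b (x, \<xi>)) \<le> c * inverse ((1 + norm x) ^ (2 * DIM('a))))"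
    using amplitudes_bound[OF kd] by (metis order_refl)
  then obtain C where C: "\<And>b. C b \<ge> 0"
    "\<And>b x \<xi>. b \<in> Basis \<Longrightarrow> norm (kd b (x, \<xi>)) \<le> C b * inverse ((1 + norm x) ^ (2 * DIM('a)))"
    by metis
  have der: "(osc k has_derivative (\<lambda>h. LINT x|lborel. f' x \<xi> h)) (at \<xi>)" for \<xi>
    unfolding osc_def[abs_def]
  proof (rule has_derivative_LINT[where e=1 and w="\<lambda>x. (\<Sum>b\<in>Basis. C b) * inverse ((1 + norm x) ^ (2 * DIM('a)))"])
    fix x \<xi> :: 'a
    have 1: "((\<lambda>\<xi>. k (x, \<xi>)) has_derivative (\<lambda>h. dir_deriv (0, h) k (x, \<xi>))) (at \<xi>)"
      by (rule has_derivative_compose[OF _ smooth_has_derivative[OF sm]]) (auto intro!: derivative_eq_intros)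
    have 2: "dir_deriv (0, h) k (x, \<xi>) = (\<Sum>b\<in>Basis. of_real (h \<bullet> b) * dir_deriv (0, b) k (x, \<xi>))" for h
    proof -
      have lin: "linear (\<lambda>h. dir_deriv (0, h) k (x, \<xi>))"
        using 1 has_derivative_linear by blast
      have "dir_deriv (0, \<Sum>b\<in>Basis. (h \<bullet> b) *\<^sub>R b) k (x, \<xi>) = (\<Sum>b\<in>Basis. (h \<bullet> b) *\<^sub>R dir_deriv (0, b) k (x, \<xi>))"
        using linear_sum[OF lin, of "\<lambda>b. (h \<bullet> b) *\<^sub>R b" Basis] by (simp only: linear_scale[OF lin])
      then show ?thesis by (simp add: euclidean_representation scaleR_conv_of_real)
    qed
    have 3: "complex_of_real (x \<bullet> h) = (\<Sum>b\<in>Basis. of_real (h \<bullet> b) * of_real (x \<bullet> b))" for h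
      by (subst euclidean_inner) (simp add: mult.commute)
    have eq: "k (x, \<xi>) * (2 * pi * \<i> * \<kappa> * (x \<bullet> h) * cis (2 * pi * \<kappa> * (x \<bullet> \<xi>))) +
        dir_deriv (0, h) k (x, \<xi>) * cis (2 * pi * \<kappa> * (x \<bullet> \<xi>)) = f' x \<xi> h" for h
    proof -
      have "f' x \<xi> h = (\<Sum>b\<in>Basis. of_real (h \<bullet> b) * dir_deriv (0, b) k (x, \<xi>) * cis (2 * pi * \<kappa> * (x \<bullet> \<xi>))
        + of_real (h \<bullet> b) * of_real (x \<bullet> b) * (k (x, \<xi>) * (2 * pi * \<i> * \<kappa> * cis (2 * pi * \<kappa> * (x \<bullet> \<xi>)))))"
        unfolding f'_def kd_def by (intro sum.cong refl) (simp add: algebra_simps)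
      also have "\<dots> = dir_deriv (0, h) k (x, \<xi>) * cis (2 * pi * \<kappa> * (x \<bullet> \<xi>)) +
         of_real (x \<bullet> h) * (k (x, \<xi>) * (2 * pi * \<i> * \<kappa> * cis (2 * pi * \<kappa> * (x \<bullet> \<xi>))))"
        unfolding sum.distrib sum_distrib_right[symmetric] 2[of h] 3[of h] ..
      finally show ?thesis by (simp add: algebra_simps)
    qed
    show "((\<lambda>\<xi>. k (x, \<xi>) * cis (2 * pi * \<kappa> * (x \<bullet> \<xi>))) has_derivative f' x \<xi>) (at \<xi>)"
      by (rule has_derivative_eq_rhs[OF has_derivative_mult[OF 1 has_derivative_cis_inner]]) (rule ext, rule eq)
    show "norm (f' x \<xi> h) \<le> (\<Sum>b\<in>Basis. C b) * inverse ((1 + norm x) ^ (2 * DIM('a))) * norm h" for h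
      unfolding f'_def sum_distrib_right
    proof (rule sum_norm_le)
      fix b :: 'a assume b: "b \<in> Basis"
      have "norm (complex_of_real (h \<bullet> b) * (kd b (x, \<xi>) * cis (2 * pi * \<kappa> * (x \<bullet> \<xi>)))) = \<bar>h \<bullet> b\<bar> * norm (kd b (x, \<xi>))"
        by (simp add: norm_mult)
      also have "\<dots> \<le> norm h * (C b * inverse ((1 + norm x) ^ (2 * DIM('a))))"
        using C b Basis_le_norm by (intro mult_mono) auto
      finally show "norm (complex_of_real (h \<bullet> b) * (kd b (x, \<xi>) * cis (2 * pi * \<kappa> * (x \<bullet> \<xi>)))) \<le> C b * inverse ((1 + norm x) ^ (2 * DIM('a))) * norm h"
        by (simp add: mult_ac)
    qed
  qed (auto intro!: osc_integrable k integrable_weight integrable_mult_right simp del: inverse_eq_divide)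
  show "osc k differentiable (at \<xi>)"
    using der unfolding differentiable_def by blast
  show "dir_deriv b (osc k) = osc (\<lambda>z. dir_deriv (0, b) k z + (2 * pi * \<i> * \<kappa>) * (of_real (fst z \<bullet> b) * k z))" if b: "b \<in> Basis"
  proof -
    have "f' x \<xi> b = kd b (x, \<xi>) * cis (2 * pi * \<kappa> * (x \<bullet> \<xi>))" for x \<xi>
    proof -
      have "f' x \<xi> b = (\<Sum>c\<in>Basis. if c = b then kd c (x, \<xi>) * cis (2 * pi * \<kappa> * (x \<bullet> \<xi>)) else 0)"
        unfolding f'_def using b by (intro sum.cong refl) (auto simp: inner_Basis)
      then show ?thesis using b by simp
    qed
    then show ?thesis
      unfolding dir_deriv_eqI[OF der, of b] unfolding osc_def[abs_def] kd_def by (simp only:)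
  qed
qed

text \<open>Partial integration in x: the x-derivative of the whole integrand integrates to 0, and
  differentiating the exponential produces the factor \<open>\<xi> \<bullet> b\<close>.\<close>

lemma osc_times_coordinate:
  assumes k: "k \<in> amplitudes H v" and b: "b \<in> Basis"
  shows "2 * pi * \<i> * \<kappa> * (\<xi> \<bullet> b) * osc k \<xi> = - osc (dir_deriv (b, 0) k) \<xi>"
proof -
  note sm = amplitudes_smooth[OF k]
  have db: "dir_deriv (b, 0) k \<in> amplitudes H v" if "b \<in> Basis" for b
    using amplitudes_differentiable[OF k] that by (auto simp: Basis_prod_def)
  define e where "e x = cis (2 * pi * \<kappa> * (x \<bullet> \<xi>))" for x
  define f' where "f' x h = k (x, \<xi>) * (2 * pi * \<i> * \<kappa> * (\<xi> \<bullet> h) * e x) + dir_deriv (h, 0) k (x, \<xi>) * e x" for x h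
  have 1: "((\<lambda>x. k (x, \<xi>)) has_derivative (\<lambda>h. dir_deriv (h, 0) k (x, \<xi>))) (at x)" for x
    by (rule has_derivative_compose[OF _ smooth_has_derivative[OF sm]]) (auto intro!: derivative_eq_intros)
  have 2: "norm (dir_deriv (h, 0) k (x, \<xi>)) \<le> (\<Sum>b\<in>Basis. norm (dir_deriv (b, 0) k (x, \<xi>))) * norm h" for h x
  proof -
    have lin: "linear (\<lambda>h. dir_deriv (h, 0) k (x, \<xi>))"
      using 1 has_derivative_linear by blast
    have "dir_deriv (\<Sum>b\<in>Basis. (h \<bullet> b) *\<^sub>R b, 0) k (x, \<xi>) = (\<Sum>b\<in>Basis. (h \<bullet> b) *\<^sub>R dir_deriv (b, 0) k (x, \<xi>))"
      using linear_sum[OF lin, of "\<lambda>b. (h \<bullet> b) *\<^sub>R b" Basis] by (simp only: linear_scale[OF lin])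
    then have "dir_deriv (h, 0) k (x, \<xi>) = (\<Sum>b\<in>Basis. (h \<bullet> b) *\<^sub>R dir_deriv (b, 0) k (x, \<xi>))"
      by (simp add: euclidean_representation)
    then have "norm (dir_deriv (h, 0) k (x, \<xi>)) \<le> (\<Sum>b\<in>Basis. norm ((h \<bullet> b) *\<^sub>R dir_deriv (b, 0) k (x, \<xi>)))"
      by (simp only: norm_sum)
    also have "\<dots> \<le> (\<Sum>b\<in>Basis. norm (dir_deriv (b, 0) k (x, \<xi>)) * norm h)"
      using Basis_le_norm[of _ h] by (intro sum_mono) (auto simp: mult.commute intro!: mult_right_mono)
    finally show ?thesis by (simp add: sum_distrib_right)
  qed
  have "\<forall>b. \<exists>c\<ge>0. b \<in> Basis \<longrightarrow> (\<forall>x \<xi>. norm (dir_deriv (b, 0) k (x, \<xi>)) \<le> c * inverse ((1 + norm x) ^ (2 * DIM('a))))"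
    using amplitudes_bound[OF db] by (metis order_refl)
  then obtain C where C: "\<And>b. C b \<ge> 0"
    "\<And>b x \<xi>. b \<in> Basis \<Longrightarrow> norm (dir_deriv (b, 0) k (x, \<xi>)) \<le> C b * inverse ((1 + norm x) ^ (2 * DIM('a)))"
    by metis
  obtain c where c: "c \<ge> 0" "\<And>x \<xi>. norm (k (x, \<xi>)) \<le> c * inverse ((1 + norm x) ^ (2 * DIM('a)))"
    using amplitudes_bound[OF k] by blast
  have "(LINT x|lborel. f' x b) = 0"
  proof (rule LINT_derivative_zero)
    show "((\<lambda>x. k (x, \<xi>) * e x) has_derivative f' x) (at x)" for x
      unfolding f'_def using has_derivative_mult[OF 1 has_derivative_cis_inner[of \<xi>]]
      by (simp only: e_def inner_commute[of _ \<xi>])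
    show "integrable lborel (\<lambda>x. k (x, \<xi>) * e x)"
      unfolding e_def by (rule osc_integrable[OF k])
    fix x h :: 'a
    let ?w = "inverse ((1 + norm x) ^ (2 * DIM('a)))"
    have w: "?w \<ge> 0" by (simp add: add_nonneg_nonneg)
    have "norm (f' x h) \<le> norm (k (x, \<xi>)) * (2 * pi * \<bar>\<kappa>\<bar> * \<bar>\<xi> \<bullet> h\<bar>) + norm (dir_deriv (h, 0) k (x, \<xi>))"
      unfolding f'_def by (rule order_trans[OF norm_triangle_ineq]) (simp add: norm_mult e_def)
    also have "\<dots> \<le> (c * ?w) * (2 * pi * \<bar>\<kappa>\<bar> * (norm \<xi> * norm h)) + (\<Sum>b\<in>Basis. C b * ?w) * norm h"
    proof (rule add_mono)
      show "norm (k (x, \<xi>)) * (2 * pi * \<bar>\<kappa>\<bar> * \<bar>\<xi> \<bullet> h\<bar>) \<le> (c * ?w) * (2 * pi * \<bar>\<kappa>\<bar> * (norm \<xi> * norm h))"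
        using c w Cauchy_Schwarz_ineq2[of \<xi> h] by (intro mult_mono) auto
      have "(\<Sum>b\<in>Basis. norm (dir_deriv (b, 0) k (x, \<xi>))) \<le> (\<Sum>b\<in>Basis. C b * ?w)"
        by (intro sum_mono C(2))
      then show "norm (dir_deriv (h, 0) k (x, \<xi>)) \<le> (\<Sum>b\<in>Basis. C b * ?w) * norm h"
        using order_trans[OF 2 mult_right_mono[OF _ norm_ge_zero]] by blast
    qed
    also have "\<dots> = (c * 2 * pi * \<bar>\<kappa>\<bar> * norm \<xi> + (\<Sum>b\<in>Basis. C b)) * ?w * norm h"
      by (simp add: sum_distrib_right[symmetric] algebra_simps)
    finally show "norm (f' x h) \<le> (c * 2 * pi * \<bar>\<kappa>\<bar> * norm \<xi> + (\<Sum>b\<in>Basis. C b)) * ?w * norm h" .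
  qed
  moreover have "f' x b = (2 * pi * \<i> * \<kappa> * (\<xi> \<bullet> b)) * (k (x, \<xi>) * e x) + dir_deriv (b, 0) k (x, \<xi>) * e x" for x
    by (simp add: f'_def algebra_simps)
  ultimately have "(2 * pi * \<i> * \<kappa> * (\<xi> \<bullet> b)) * osc k \<xi> + osc (dir_deriv (b, 0) k) \<xi> = 0"
    using osc_integrable[OF k, of \<xi>] osc_integrable[OF db[OF b], of \<xi>] unfolding osc_def e_def by simp
  then show ?thesis by (simp add: eq_neg_iff_add_eq_0)
qed

text \<open>Since |\<xi>| is at most the sum of the |\<xi> \<bullet> b|, each further power of 1 +
  |\<xi>| is traded for one x-derivative of the amplitude. As this derivative is another amplitude,
  the induction has to run over all \<open>k\<close>.\<close>

lemma osc_decay: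
  assumes "k \<in> amplitudes H v"
  shows "\<exists>c. \<forall>\<xi>. (1 + norm \<xi>) ^ N * norm (osc k \<xi>) \<le> c"
  using assms
proof (induction N arbitrary: k)
  case 0
  obtain c where c: "c \<ge> 0" "\<And>x \<xi>. norm (k (x, \<xi>)) \<le> c * inverse ((1 + norm x) ^ (2 * DIM('a)))"
    using amplitudes_bound[OF 0] by blast
  have "norm (osc k \<xi>) \<le> (LINT x|lborel. c * inverse ((1 + norm (x::'a)) ^ (2 * DIM('a))))" for \<xi>
    unfolding osc_def
    by (rule Bochner_Integration.integral_norm_bound_integral[OF osc_integrable[OF 0]])
       (auto intro!: integrable_mult_right integrable_weight simp: norm_mult c(2) simp del: inverse_eq_divide)
  then show ?case by auto
next
  case (Suc N)
  have db: "dir_deriv (b, 0) k \<in> amplitudes H v" if "b \<in> Basis" for b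
    using amplitudes_differentiable[OF Suc.prems] that by (auto simp: Basis_prod_def)
  have "\<forall>b. \<exists>c. b \<in> Basis \<longrightarrow> (\<forall>\<xi>. (1 + norm \<xi>) ^ N * norm (osc (dir_deriv (b, 0) k) \<xi>) \<le> c)"
    using Suc.IH[OF db] by blast
  then obtain C where C: "\<And>b \<xi>. b \<in> Basis \<Longrightarrow> (1 + norm \<xi>) ^ N * norm (osc (dir_deriv (b, 0) k) \<xi>) \<le> C b"
    by metis
  obtain c where c: "\<And>\<xi>. (1 + norm \<xi>) ^ N * norm (osc k \<xi>) \<le> c"
    using Suc.IH[OF Suc.prems] by blast
  have "(1 + norm \<xi>) ^ Suc N * norm (osc k \<xi>) \<le> c + (\<Sum>b\<in>Basis. C b / (2 * pi * \<bar>\<kappa>\<bar>))" for \<xi>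
  proof -
    have pos: "0 \<le> (1 + norm \<xi>) ^ N" by (simp add: add_nonneg_nonneg)
    have eq: "\<bar>\<xi> \<bullet> b\<bar> * norm (osc k \<xi>) = norm (osc (dir_deriv (b, 0) k) \<xi>) / (2 * pi * \<bar>\<kappa>\<bar>)" if "b \<in> Basis" for b
      using arg_cong[OF osc_times_coordinate[OF Suc.prems that, of \<xi>], of norm] \<kappa>
      by (simp add: norm_mult field_simps)
    have "(1 + norm \<xi>) ^ Suc N * norm (osc k \<xi>) \<le> (1 + norm \<xi>) ^ N * ((1 + (\<Sum>b\<in>Basis. \<bar>\<xi> \<bullet> b\<bar>)) * norm (osc k \<xi>))"
      unfolding power_Suc2 mult.assoc using norm_le_l1[of \<xi>] pos by (intro mult_left_mono mult_right_mono) auto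
    also have "\<dots> = (1 + norm \<xi>) ^ N * norm (osc k \<xi>) + (\<Sum>b\<in>Basis. ((1 + norm \<xi>) ^ N * norm (osc (dir_deriv (b, 0) k) \<xi>)) / (2 * pi * \<bar>\<kappa>\<bar>))"
      by (simp add: distrib_left distrib_right sum_distrib_right sum_distrib_left eq)
    also have "\<dots> \<le> c + (\<Sum>b\<in>Basis. C b / (2 * pi * \<bar>\<kappa>\<bar>))"
      using c C by (intro add_mono sum_mono divide_right_mono) auto
    finally show ?thesis .
  qed
  then show ?case by blast
qed

theorem osc_schwartz: "(\<lambda>\<xi>. LINT x|lborel. H (x, \<xi>) * cis (2 * pi * \<kappa> * (x \<bullet> \<xi>)) * v x) \<in> schwartz"
proof -
  have base: "(\<lambda>z. H z * v (fst z)) \<in> amplitudes H v"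
    using amplitudes.base[of "[]" "[]" H v] by simp
  have "osc (\<lambda>z. H z * v (fst z)) \<in> schwartz"
  proof (rule schwartz_coinduct[of _ "osc ` amplitudes H v"])
    fix g b assume "g \<in> osc ` amplitudes H v" and b: "(b::'a) \<in> Basis"
    then obtain k where k: "g = osc k" "k \<in> amplitudes H v" by blast
    show "dir_deriv b g \<in> osc ` amplitudes H v"
      unfolding k osc_dir_deriv[OF k(2) b] using amplitudes_differentiable[OF k(2)] k b
      by (intro imageI amplitudes.add amplitudes.scale amplitudes.mulx) (auto simp: Basis_prod_def)
  qed (use base osc_differentiable osc_decay in auto)
  moreover have "osc (\<lambda>z. H z * v (fst z)) = (\<lambda>\<xi>. LINT x|lborel. H (x, \<xi>) * cis (2 * pi * \<kappa> * (x \<bullet> \<xi>)) * v x)"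
    unfolding osc_def[abs_def] by (simp add: mult_ac)
  ultimately show ?thesis by simp
qed

end

section \<open>The Fourier transformation on Schwartz functions\<close>

lemma iter_deriv_const: "iter_deriv bs (\<lambda>_. c) = (\<lambda>_. if bs = [] then c else 0)"
proof (induction bs)
  case (Cons b bs)
  have "dir_deriv b (\<lambda>_::'a. d) = (\<lambda>_. 0)" for d
    by (rule dir_deriv_eqI) (rule has_derivative_const)
  then show ?case by (simp add: iter_deriv_Cons Cons)
qed simp

lemma smooth_const: "smooth (\<lambda>_. c)"
  unfolding smooth_def iter_deriv_const by simp

text \<open>With a constant symbol, the result on oscillatory integrals yields the stability of the
  Schwartz space under both Fourier transformations, \<kappa> = -1 and \<kappa> = 1.\<close>

lemma amplitude_const:
  assumes "v \<in> schwartz" "\<kappa> \<noteq> 0"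
  shows "amplitude (\<lambda>_. 1) v \<kappa>"
proof
  fix bs :: "('a \<times> 'a) list" and cs :: "'a list" and N :: nat
  assume "cs \<in> lists Basis"
  then obtain c where c: "\<And>x. (1 + norm x) ^ N * norm (iter_deriv cs v x) \<le> c"
    using assms(1) unfolding schwartz_def by blast
  have "(1 + norm x) ^ N * norm (iter_deriv bs (\<lambda>_. 1) (x, \<xi>) * iter_deriv cs v x) \<le> c" for x \<xi> :: 'a
  proof (cases "bs = []")
    case False
    have "0 \<le> (1 + norm x) ^ N * norm (iter_deriv cs v x)"
      by (simp add: add_nonneg_nonneg)
    then have "0 \<le> c" using c[of x] by (rule order_trans)
    with False show ?thesis by (simp add: iter_deriv_const)
  qed (use c in \<open>simp add: iter_deriv_const\<close>)
  then show "\<exists>c. \<forall>x \<xi>. (1 + norm x) ^ N * norm (iter_deriv bs (\<lambda>_. 1) (x, \<xi>) * iter_deriv cs v x) \<le> c"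
    by blast
qed (use assms in \<open>auto intro: smooth_const schwartz_smooth\<close>)

lemma fourier_schwartz: "v \<in> schwartz \<Longrightarrow> fourier v \<in> schwartz"
  using amplitude.osc_schwartz[OF amplitude_const, of v "-1"]
  by (simp add: fourier_def[abs_def] inner_commute)

lemma inv_fourier_schwartz: "v \<in> schwartz \<Longrightarrow> inv_fourier v \<in> schwartz"
  using amplitude.osc_schwartz[OF amplitude_const, of v 1]
  by (simp add: inv_fourier_def[abs_def] inner_commute)

lemma integrable_pair_times:
  fixes f :: "'a::euclidean_space \<Rightarrow> complex" and g :: "'b::euclidean_space \<Rightarrow> complex"
  assumes f: "integrable lborel f" and g: "integrable lborel g"
  shows "integrable (lborel \<Otimes>\<^sub>M lborel) (\<lambda>(x, y). f x * g y)"
proof (rule lborel_pair.Fubini_integrable)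
  have [measurable]: "f \<in> borel_measurable borel" "g \<in> borel_measurable borel"
    using borel_measurable_integrable[OF f] borel_measurable_integrable[OF g] by simp_all
  show "(\<lambda>(x, y). f x * g y) \<in> borel_measurable (lborel \<Otimes>\<^sub>M lborel)"
    by measurable
  show "integrable lborel (\<lambda>x. LINT y|lborel. norm (case (x, y) of (x, y) \<Rightarrow> f x * g y))"
    using f by (simp add: norm_mult integrable_norm)
  show "AE x in lborel. integrable lborel (\<lambda>y. case (x, y) of (x, y) \<Rightarrow> f x * g y)"
    using g by simp
qed

lemma integrable_pair_bound:
  fixes f :: "'a::euclidean_space \<times> 'b::euclidean_space \<Rightarrow> complex"
  assumes [measurable]: "f \<in> borel_measurable (lborel \<Otimes>\<^sub>M lborel)"
    and g: "integrable lborel g" and h: "integrable lborel h"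
    and le: "\<And>x y. norm (f (x, y)) \<le> norm (g x :: complex) * norm (h y :: complex)"
  shows "integrable (lborel \<Otimes>\<^sub>M lborel) f"
  by (rule Bochner_Integration.integrable_bound[OF integrable_pair_times[OF g h]])
     (auto intro!: AE_I2 simp: norm_mult le)

text \<open>Both sides are iterated integrals of one absolutely integrable function of (x, y), the
  phase being symmetric.\<close>

lemma fourier_multiplication:
  assumes u: "integrable lborel u" and v: "integrable lborel v"
  shows "(LINT x|lborel. fourier u x * v x) = (LINT x|lborel. u x * fourier v x)"
proof -
  have [measurable]: "u \<in> borel_measurable borel" "v \<in> borel_measurable borel"
    using borel_measurable_integrable[OF u] borel_measurable_integrable[OF v] by simp_all
  have [measurable]: "(\<lambda>t. cis t) \<in> borel_measurable borel"
    by (intro borel_measurable_continuous_onI) (auto intro!: continuous_intros simp: cis_conv_exp)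
  have int: "integrable (lborel \<Otimes>\<^sub>M lborel) (\<lambda>(x, y). cis (- 2 * pi * (x \<bullet> y)) * u y * v x)"
    by (rule integrable_pair_bound[OF _ v u]) (auto simp: norm_mult)
  have "(LINT x|lborel. fourier u x * v x) = (LINT x|lborel. LINT y|lborel. cis (- 2 * pi * (x \<bullet> y)) * u y * v x)"
    unfolding fourier_def by simp
  also have "\<dots> = (LINT y|lborel. LINT x|lborel. cis (- 2 * pi * (x \<bullet> y)) * u y * v x)"
    by (rule lborel_pair.Fubini_integral[symmetric]) (use int in \<open>simp add: case_prod_unfold\<close>)
  also have "\<dots> = (LINT y|lborel. u y * fourier v y)"
    unfolding fourier_def by (simp add: inner_commute mult_ac)
  finally show ?thesis .
qed

section \<open>Gaussians\<close>

definition gauss :: "real \<Rightarrow> 'a::euclidean_space \<Rightarrow> 'a \<Rightarrow> complex" where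
  "gauss c a x = of_real (exp (- c * (norm (x - a))\<^sup>2))"

lemma gauss_borel [measurable]: "gauss c a \<in> borel_measurable borel"
  unfolding gauss_def[abs_def] by measurable

lemma norm_gauss: "norm (gauss c a x) = exp (- c * (norm (x - a))\<^sup>2)"
  by (simp add: gauss_def)

lemma power_over_fact_le_exp:
  fixes x :: real
  assumes "x \<ge> 0"
  shows "x ^ N / fact N \<le> exp x"
  using sum_le_suminf[OF summable_exp_generic[of x], of "{N}"] assms
  by (simp add: exp_def divide_inverse mult.commute)

lemma rapid_gauss:
  assumes c: "c > 0"
  shows "rapid (gauss c a)"
  unfolding rapid_def
proof (intro conjI allI)
  fix N
  \<comment> \<open>With r = |x - a|, the constant combines 1 + |x| \<le> (1 + |a|) (1 + r), then (1
    + r)^N \<le> 2^N (1 + r^(2N)), and the term of order N in the exponential series at c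
    r^2.\<close>
  have "(1 + norm x) ^ N * norm (gauss c a x) \<le> (2 * (1 + norm a)) ^ N * (1 + fact N / c ^ N)" for x
  proof -
    define r where "r = norm (x - a)"
    have r: "r \<ge> 0" by (simp add: r_def)
    have "norm x \<le> r + norm a"
      unfolding r_def using norm_triangle_sub[of x a] by simp
    moreover have "0 \<le> norm a * r" using r by simp
    ultimately have "1 + norm x \<le> (1 + norm a) * (1 + r)"
      by (simp add: algebra_simps)
    then have "(1 + norm x) ^ N \<le> ((1 + norm a) * (1 + r)) ^ N"
      by (intro power_mono) (auto simp: add_nonneg_nonneg)
    moreover have "(1 + r) ^ N \<le> 2 ^ N * (1 + (r\<^sup>2) ^ N)"
    proof (cases "r \<le> 1")
      case True
      then have "(1 + r) ^ N \<le> 2 ^ N" using r by (intro power_mono) auto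
      also have "\<dots> \<le> 2 ^ N * (1 + (r\<^sup>2) ^ N)" by simp
      finally show ?thesis .
    next
      case False
      then have "1 + r \<le> 2 * r\<^sup>2" using self_le_power[of r 2] by simp
      then have "(1 + r) ^ N \<le> (2 * r\<^sup>2) ^ N" using r by (intro power_mono) auto
      then show ?thesis by (simp add: power_mult_distrib distrib_left add_increasing)
    qed
    ultimately have "(1 + norm x) ^ N \<le> (1 + norm a) ^ N * (2 ^ N * (1 + (r\<^sup>2) ^ N))"
      unfolding power_mult_distrib by (elim order_trans) (intro mult_left_mono, auto)
    then have 1: "(1 + norm x) ^ N \<le> (2 * (1 + norm a)) ^ N * (1 + (r\<^sup>2) ^ N)"
      unfolding power_mult_distrib by (simp only: mult_ac)
    have "(c * r\<^sup>2) ^ N / fact N \<le> exp (c * r\<^sup>2)"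
      using c by (intro power_over_fact_le_exp) simp
    then have "(r\<^sup>2) ^ N * exp (- c * r\<^sup>2) \<le> fact N / c ^ N"
      using c by (simp add: power_mult_distrib exp_minus field_simps)
    moreover have "exp (- c * r\<^sup>2) \<le> 1" using c by simp
    ultimately have 2: "(1 + (r\<^sup>2) ^ N) * exp (- c * r\<^sup>2) \<le> 1 + fact N / c ^ N"
      unfolding distrib_right mult_1 by (intro add_mono)
    have "(1 + norm x) ^ N * norm (gauss c a x) \<le> ((2 * (1 + norm a)) ^ N * (1 + (r\<^sup>2) ^ N)) * exp (- c * r\<^sup>2)"
      unfolding norm_gauss r_def[symmetric] using 1 by (intro mult_right_mono) auto
    also have "\<dots> \<le> (2 * (1 + norm a)) ^ N * (1 + fact N / c ^ N)"
      unfolding mult.assoc[of "(2 * (1 + norm a)) ^ N"] using 2 by (intro mult_left_mono) auto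
    finally show ?thesis .
  qed
  then show "\<exists>d. \<forall>x. (1 + norm x) ^ N * norm (gauss c a x) \<le> d" by blast
qed simp

lemma gauss_integrable: "c > 0 \<Longrightarrow> integrable lborel (gauss c a)"
  by (intro rapid_integrable rapid_gauss)

lemma
  assumes c: "c > 0"
  shows integrable_gauss_line: "integrable lborel (\<lambda>t::real. cis (- 2 * pi * t * y) * of_real (exp (- c * t\<^sup>2)))"
    and integral_gauss_line: "(LINT t|lborel. cis (- 2 * pi * t * y) * of_real (exp (- c * t\<^sup>2))) = of_real (sqrt (pi / c) * exp (- (pi\<^sup>2 / c) * y\<^sup>2))"
proof -
  \<comment> \<open>The substitution u = s t turns exp (- c t^2) into a multiple of the standard
    normal density, whose characteristic function is known; \<open>\<tau>\<close> is the frequency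
    seen by u.\<close>
  define s where "s = sqrt (2 * c)"
  have s: "s > 0" "s\<^sup>2 = 2 * c" using c by (simp_all add: s_def)
  define \<tau> where "\<tau> = - 2 * pi * y / s"
  define g where "g u = std_normal_density u *\<^sub>R iexp (\<tau> * u)" for u
  have g: "g (0 + s * t) = of_real (1 / sqrt (2 * pi)) * (cis (- 2 * pi * t * y) * of_real (exp (- c * t\<^sup>2)))" for t
    unfolding g_def std_normal_density_def \<tau>_def cis_conv_exp using s
    by (simp add: scaleR_conv_of_real power_mult_distrib field_simps)
  have ig: "integrable lborel g"
    by (rule Bochner_Integration.integrable_bound[of _ std_normal_density])
       (auto simp: g_def[abs_def] intro!: integrable_normal_density)
  have "integrable lborel (\<lambda>t. g (0 + s * t))"
    using lborel_integrable_real_affine[OF ig, of s 0] s by simp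
  then have "integrable lborel (\<lambda>t. of_real (sqrt (2 * pi)) * g (0 + s * t))"
    by (rule integrable_mult_right)
  then show int: "integrable lborel (\<lambda>t::real. cis (- 2 * pi * t * y) * of_real (exp (- c * t\<^sup>2)))"
    unfolding g by (simp add: mult.assoc[symmetric])
  have "of_real (exp (- \<tau>\<^sup>2 / 2)) = (LINT u|lborel. g u)"
    using fun_cong[OF char_std_normal_distribution, of \<tau>] unfolding char_def g_def
    by (subst (asm) integral_density) auto
  also have "\<dots> = s *\<^sub>R (LINT t|lborel. g (0 + s * t))"
    using lborel_integral_real_affine[of s g 0] s by simp
  also have "\<dots> = of_real (s / sqrt (2 * pi)) * (LINT t|lborel. cis (- 2 * pi * t * y) * of_real (exp (- c * t\<^sup>2)))"
    unfolding g integral_mult_right_zero by (simp add: scaleR_conv_of_real)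
  finally have "(LINT t|lborel. cis (- 2 * pi * t * y) * of_real (exp (- c * t\<^sup>2))) = of_real (sqrt (2 * pi) / s * exp (- \<tau>\<^sup>2 / 2))"
    using s by (simp add: field_simps)
  also have "sqrt (2 * pi) / s = sqrt (pi / c)"
    using c by (simp add: s_def real_sqrt_divide[symmetric])
  also have "- \<tau>\<^sup>2 / 2 = - (pi\<^sup>2 / c) * y\<^sup>2"
    using s c by (simp add: \<tau>_def power_mult_distrib power_divide)
  finally show "(LINT t|lborel. cis (- 2 * pi * t * y) * of_real (exp (- c * t\<^sup>2))) = of_real (sqrt (pi / c) * exp (- (pi\<^sup>2 / c) * y\<^sup>2))" .
qed

lemma fourier_gauss_0:
  fixes y :: "'a::euclidean_space"
  assumes c: "c > 0"
  shows "fourier (gauss c 0) y = of_real (sqrt (pi / c) ^ DIM('a)) * gauss (pi\<^sup>2 / c) 0 y"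
proof -
  have prod: "(\<Prod>b\<in>Basis. cis (- 2 * pi * (x \<bullet> b) * (y \<bullet> b)) * of_real (exp (- c * (x \<bullet> b)\<^sup>2))) = cis (- 2 * pi * (y \<bullet> x)) * gauss c 0 x" for x :: 'a
  proof -
    have "(\<Prod>b\<in>Basis. cis (- 2 * pi * (x \<bullet> b) * (y \<bullet> b))) = cis (- 2 * pi * (y \<bullet> x))"
      unfolding cis_conv_exp exp_sum[OF finite_Basis, symmetric] euclidean_inner[of y x]
      by (simp add: sum_distrib_left mult_ac of_real_sum)
    moreover have "(\<Prod>b\<in>Basis. exp (- c * (x \<bullet> b)\<^sup>2)) = exp (- c * (norm x)\<^sup>2)"
      unfolding exp_sum[OF finite_Basis, symmetric] power2_norm_eq_inner euclidean_inner[of x x]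
      by (simp add: sum_distrib_left power2_eq_square)
    ultimately show ?thesis
      by (simp add: prod.distrib gauss_def of_real_prod[symmetric] del: of_real_prod of_real_exp)
  qed
  have "fourier (gauss c 0) y = (LINT x|lborel. (\<Prod>b\<in>Basis. cis (- 2 * pi * (x \<bullet> b) * (y \<bullet> b)) * of_real (exp (- c * (x \<bullet> b)\<^sup>2))))"
    unfolding prod fourier_def ..
  also have "\<dots> = (\<Prod>b\<in>Basis. of_real (sqrt (pi / c) * exp (- (pi\<^sup>2 / c) * (y \<bullet> b)\<^sup>2)))"
    unfolding integral_lborel_prod[where f="\<lambda>b t. cis (- 2 * pi * t * (y \<bullet> b)) * of_real (exp (- c * t\<^sup>2))", OF integrable_gauss_line[OF c]]
      integral_gauss_line[OF c] ..
  also have "\<dots> = of_real (\<Prod>b\<in>(Basis::'a set). sqrt (pi / c) * exp (- (pi\<^sup>2 / c) * (y \<bullet> b)\<^sup>2))"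
    by (simp only: of_real_prod)
  also have "(\<Prod>b\<in>(Basis::'a set). sqrt (pi / c) * exp (- (pi\<^sup>2 / c) * (y \<bullet> b)\<^sup>2)) = sqrt (pi / c) ^ DIM('a) * exp (- (pi\<^sup>2 / c) * (norm y)\<^sup>2)"
    unfolding prod.distrib prod_constant exp_sum[OF finite_Basis, symmetric] sum_distrib_left[symmetric] power2_norm_eq_inner euclidean_inner[of y y]
    by (simp add: power2_eq_square)
  finally show ?thesis unfolding gauss_def[of "pi\<^sup>2 / c" 0 y] by simp
qed

lemma fourier_gauss:
  fixes y :: "'a::euclidean_space"
  assumes c: "c > 0"
  shows "fourier (gauss c a) y = cis (- 2 * pi * (y \<bullet> a)) * (of_real (sqrt (pi / c) ^ DIM('a)) * gauss (pi\<^sup>2 / c) 0 y)"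
proof -
  have "fourier (gauss c a) y = (LINT x|lborel. cis (- 2 * pi * (y \<bullet> (a + x))) * gauss c a (a + x))"
    unfolding fourier_def by (rule integral_lborel_translate[symmetric])
  also have "\<dots> = (LINT x|lborel. cis (- 2 * pi * (y \<bullet> a)) * (cis (- 2 * pi * (y \<bullet> x)) * gauss c 0 x))"
  proof -
    have "cis (- 2 * pi * (y \<bullet> (a + x))) = cis (- 2 * pi * (y \<bullet> a)) * cis (- 2 * pi * (y \<bullet> x))" for x
      by (simp add: cis_mult inner_add_right algebra_simps)
    then show ?thesis by (simp only: gauss_def mult.assoc add_diff_cancel_left' diff_zero)
  qed
  also have "\<dots> = cis (- 2 * pi * (y \<bullet> a)) * fourier (gauss c 0) y"
    by (simp add: fourier_def)
  finally show ?thesis by (simp add: fourier_gauss_0[OF c])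
qed

text \<open>The pairings of homogeneous components below ask only for rapid decay of a test function
  and of its Fourier transform, so this makes Gaussians usable as test functions.\<close>

lemma rapid_fourier_gauss: 
  assumes c: "c > 0"
  shows "rapid (fourier (gauss c a) :: 'a::euclidean_space \<Rightarrow> complex)"
  unfolding rapid_def
proof (intro conjI allI)
  have [measurable]: "(\<lambda>t. cis t) \<in> borel_measurable borel"
    by (intro borel_measurable_continuous_onI) (auto intro!: continuous_intros simp: cis_conv_exp)
  show "(fourier (gauss c a) :: 'a \<Rightarrow> complex) \<in> borel_measurable borel"
    unfolding fourier_gauss[OF c, abs_def] by measurable
  fix N
  have "rapid (gauss (pi\<^sup>2 / c) 0 :: 'a \<Rightarrow> complex)"
    using c by (intro rapid_gauss) simp
  then obtain d where d: "\<And>y::'a. (1 + norm y) ^ N * norm (gauss (pi\<^sup>2 / c) 0 y) \<le> d"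
    unfolding rapid_def by blast
  have "(1 + norm y) ^ N * norm (fourier (gauss c a) y) \<le> sqrt (pi / c) ^ DIM('a) * d" for y :: 'a
    using mult_left_mono[OF d[of y], of "sqrt (pi / c) ^ DIM('a)"] c
    by (simp add: fourier_gauss norm_mult norm_power mult_ac)
  then show "\<exists>d. \<forall>y::'a. (1 + norm y) ^ N * norm (fourier (gauss c a) y) \<le> d" by blast
qed

section \<open>Fourier inversion\<close>

lemma cis_borel [measurable]: "cis \<in> borel_measurable borel"
  by (intro borel_measurable_continuous_onI) (auto intro!: continuous_intros simp: cis_conv_exp)

lemma integral_gauss_dilate:
  fixes h :: "'a::euclidean_space \<Rightarrow> complex"
  assumes r: "r > 0"
  shows "(LINT a|lborel. h a * gauss (m / r\<^sup>2) x a) = of_real (r ^ DIM('a)) * (LINT u|lborel. h (x + r *\<^sub>R u) * gauss m 0 u)"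
proof -
  have "(LINT a|lborel. h a * gauss (m / r\<^sup>2) x a) = (LINT a|lborel. h (x + a) * gauss (m / r\<^sup>2) x (x + a))"
    by (rule integral_lborel_translate[symmetric])
  also have "\<dots> = \<bar>r\<bar> ^ DIM('a) *\<^sub>R (LINT u|lborel. h (x + r *\<^sub>R u) * gauss (m / r\<^sup>2) x (x + r *\<^sub>R u))"
    using r by (intro integral_lborel_scale) simp
  also have "\<dots> = of_real (r ^ DIM('a)) * (LINT u|lborel. h (x + r *\<^sub>R u) * gauss m 0 u)"
    using r by (simp add: gauss_def power_mult_distrib scaleR_conv_of_real)
  finally show ?thesis .
qed

text \<open>A factor exp (- r^2 |y|^2) makes the double integral absolutely convergent. Exchanging
  the integrations turns it into an average of \<open>v\<close> around x, at scale r, against a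
  kernel of mass 1. Both forms converge as r tends to 0.\<close>

theorem fourier_inv_fourier:
  fixes v :: "'a::euclidean_space \<Rightarrow> complex"
  assumes v: "v \<in> schwartz"
  shows "fourier (inv_fourier v) = v"
proof
  fix x
  define w where "w = inv_fourier v"
  have w: "w \<in> schwartz" unfolding w_def by (rule inv_fourier_schwartz[OF v])
  have [measurable]: "v \<in> borel_measurable borel" "w \<in> borel_measurable borel"
    using v w by (simp_all add: schwartz_smooth smooth_borel)
  note iv = rapid_integrable[OF schwartz_rapid[OF v]] and iw = rapid_integrable[OF schwartz_rapid[OF w]]
  define A where "A r = (LINT y|lborel. cis (- 2 * pi * (x \<bullet> y)) * w y * gauss (r\<^sup>2) 0 y)" for r
  \<comment> \<open>\<open>K\<close> is the Fourier transform of exp (- |y|^2); its total mass is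
    1.\<close>
  define K where "K u = of_real (sqrt pi ^ DIM('a)) * gauss (pi\<^sup>2) 0 u" for u :: 'a
  have lim1: "(A \<longlongrightarrow> fourier w x) (at 0 within {0<..})"
    unfolding A_def fourier_def
  proof (rule dominated_convergence_within[where w="\<lambda>y. norm (w y)"])
    show "AE y in lborel. ((\<lambda>r. cis (- 2 * pi * (x \<bullet> y)) * w y * gauss (r\<^sup>2) 0 y) \<longlongrightarrow> cis (- 2 * pi * (x \<bullet> y)) * w y) (at 0 within {0<..})"
    proof (rule AE_I2)
      fix y
      have "((\<lambda>r. cis (- 2 * pi * (x \<bullet> y)) * w y * gauss (r\<^sup>2) 0 y) \<longlongrightarrow> cis (- 2 * pi * (x \<bullet> y)) * w y * of_real (exp (- (0\<^sup>2) * (norm (y - 0))\<^sup>2))) (at 0 within {0<..})"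
        unfolding gauss_def by (intro tendsto_intros)
      then show "((\<lambda>r. cis (- 2 * pi * (x \<bullet> y)) * w y * gauss (r\<^sup>2) 0 y) \<longlongrightarrow> cis (- 2 * pi * (x \<bullet> y)) * w y) (at 0 within {0<..})"
        by simp
    qed
  qed (use iw in \<open>auto simp: norm_mult norm_gauss mult_left_le\<close>)
  have A: "A r = (LINT u|lborel. v (x + r *\<^sub>R u) * K u)" if r: "r > 0" for r
  proof -
    have int: "integrable (lborel \<Otimes>\<^sub>M lborel) (\<lambda>(y, z). cis (- 2 * pi * (x \<bullet> y)) * (cis (2 * pi * (y \<bullet> z)) * v z) * gauss (r\<^sup>2) 0 y)"
      by (rule integrable_pair_bound[OF _ gauss_integrable[of "r\<^sup>2" 0] iv]) (use r in \<open>auto simp: norm_mult\<close>)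
    have "A r = (LINT y|lborel. LINT z|lborel. cis (- 2 * pi * (x \<bullet> y)) * (cis (2 * pi * (y \<bullet> z)) * v z) * gauss (r\<^sup>2) 0 y)"
      unfolding A_def w_def inv_fourier_def by simp
    also have "\<dots> = (LINT z|lborel. LINT y|lborel. cis (- 2 * pi * (x \<bullet> y)) * (cis (2 * pi * (y \<bullet> z)) * v z) * gauss (r\<^sup>2) 0 y)"
      by (rule lborel_pair.Fubini_integral[symmetric]) (use int in \<open>simp add: case_prod_unfold\<close>)
    also have "\<dots> = (LINT z|lborel. v z * fourier (gauss (r\<^sup>2) 0) (x - z))"
    proof (rule Bochner_Integration.integral_cong[OF refl])
      fix z
      have "(LINT y|lborel. cis (- 2 * pi * (x \<bullet> y)) * (cis (2 * pi * (y \<bullet> z)) * v z) * gauss (r\<^sup>2) 0 y) =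
        (LINT y|lborel. v z * (cis (- 2 * pi * ((x - z) \<bullet> y)) * gauss (r\<^sup>2) 0 y))"
      proof (rule Bochner_Integration.integral_cong[OF refl])
        fix y
        have "cis (- 2 * pi * ((x - z) \<bullet> y)) = cis (- 2 * pi * (x \<bullet> y)) * cis (2 * pi * (y \<bullet> z))"
          by (simp add: cis_mult inner_diff_left inner_commute algebra_simps)
        then show "cis (- 2 * pi * (x \<bullet> y)) * (cis (2 * pi * (y \<bullet> z)) * v z) * gauss (r\<^sup>2) 0 y = v z * (cis (- 2 * pi * ((x - z) \<bullet> y)) * gauss (r\<^sup>2) 0 y)"
          by (simp only: mult_ac)
      qed
      then show "(LINT y|lborel. cis (- 2 * pi * (x \<bullet> y)) * (cis (2 * pi * (y \<bullet> z)) * v z) * gauss (r\<^sup>2) 0 y) = v z * fourier (gauss (r\<^sup>2) 0) (x - z)"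
        by (simp add: fourier_def)
    qed
    also have "\<dots> = (LINT z|lborel. of_real (sqrt (pi / r\<^sup>2) ^ DIM('a)) * (v z * gauss (pi\<^sup>2 / r\<^sup>2) x z))"
    proof (rule Bochner_Integration.integral_cong[OF refl])
      fix z
      have "gauss (pi\<^sup>2 / r\<^sup>2) 0 (x - z) = gauss (pi\<^sup>2 / r\<^sup>2) x z"
        by (simp add: gauss_def norm_minus_commute)
      then show "v z * fourier (gauss (r\<^sup>2) 0) (x - z) = of_real (sqrt (pi / r\<^sup>2) ^ DIM('a)) * (v z * gauss (pi\<^sup>2 / r\<^sup>2) x z)"
        using r by (simp add: fourier_gauss_0 mult_ac)
    qed
    also have "\<dots> = of_real (sqrt (pi / r\<^sup>2) ^ DIM('a) * r ^ DIM('a)) * (LINT u|lborel. v (x + r *\<^sub>R u) * gauss (pi\<^sup>2) 0 u)"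
      by (simp add: integral_gauss_dilate[OF r])
    also have "sqrt (pi / r\<^sup>2) ^ DIM('a) * r ^ DIM('a) = sqrt pi ^ DIM('a)"
      using r by (simp add: real_sqrt_divide power_divide)
    finally show ?thesis
      unfolding K_def by (simp add: mult.left_commute)
  qed
  have ik: "integrable lborel K"
    unfolding K_def by (intro integrable_mult_right gauss_integrable) simp
  have K1: "(LINT u|lborel. K u) = 1"
  proof -
    have "(LINT u|lborel. gauss (pi\<^sup>2) 0 (u::'a)) = fourier (gauss (pi\<^sup>2) 0) (0::'a)"
      by (simp add: fourier_def)
    also have "\<dots> = of_real (sqrt (pi / pi\<^sup>2) ^ DIM('a))"
      by (subst fourier_gauss_0) (auto simp: gauss_def)
    finally have "(LINT u|lborel. K u) = of_real ((sqrt pi * sqrt (pi / pi\<^sup>2)) ^ DIM('a))"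
      unfolding K_def by (simp add: power_mult_distrib)
    also have "sqrt pi * sqrt (pi / pi\<^sup>2) = 1"
      by (simp add: real_sqrt_mult[symmetric] power2_eq_square)
    finally show ?thesis by simp
  qed
  obtain B where B: "\<And>z. norm (v z) \<le> B * inverse ((1 + norm z) ^ 0)"
    using rapid_bound[OF schwartz_rapid[OF v]] by metis
  have [measurable]: "K \<in> borel_measurable borel"
    unfolding K_def[abs_def] by measurable
  have "((\<lambda>r. LINT u|lborel. v (x + r *\<^sub>R u) * K u) \<longlongrightarrow> (LINT u|lborel. v x * K u)) (at 0 within {0<..})"
  proof (rule dominated_convergence_within[where w="\<lambda>u. B * norm (K u)"])
    show "AE u in lborel. ((\<lambda>r. v (x + r *\<^sub>R u) * K u) \<longlongrightarrow> v x * K u) (at 0 within {0<..})"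
    proof (rule AE_I2)
      fix u
      have "isCont v x"
        using smooth_differentiable[OF schwartz_smooth[OF v]] differentiable_imp_continuous_within by blast
      moreover have "((\<lambda>r. x + r *\<^sub>R u) \<longlongrightarrow> x + 0 *\<^sub>R u) (at 0 within {0<..})"
        by (intro tendsto_intros)
      ultimately have "((\<lambda>r. v (x + r *\<^sub>R u)) \<longlongrightarrow> v x) (at 0 within {0<..})"
        using isCont_tendsto_compose[of x v] by simp
      then show "((\<lambda>r. v (x + r *\<^sub>R u) * K u) \<longlongrightarrow> v x * K u) (at 0 within {0<..})"
        by (intro tendsto_intros)
    qed
    show "AE u in lborel. norm (v (x + r *\<^sub>R u) * K u) \<le> B * norm (K u)" for r
      using B by (auto simp: norm_mult mult_right_mono)
    show "integrable lborel (\<lambda>u. B * norm (K u))"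
      by (intro integrable_mult_right integrable_norm ik)
  qed auto
  moreover have "eventually (\<lambda>r. (LINT u|lborel. v (x + r *\<^sub>R u) * K u) = A r) (at 0 within {0<..})"
    using eventually_at_right_less[of "0::real"] by eventually_elim (simp add: A)
  ultimately have "(A \<longlongrightarrow> (LINT u|lborel. v x * K u)) (at 0 within {0<..})"
    using Lim_transform_eventually by blast
  then have "fourier w x = (LINT u|lborel. v x * K u)"
    using lim1 tendsto_unique[of "at_right (0::real)"] by force
  then show "fourier (inv_fourier v) x = v x"
    using K1 ik by (simp add: w_def)
qed

section \<open>Gaussians as a separating family of test functions\<close>

lemma gauss_mult_gauss:
  fixes x a :: "'a::euclidean_space"
  assumes m: "m > 0"
  shows "gauss 1 0 x * gauss m a x = of_real (exp (- (m / (1 + m)) * (norm a)\<^sup>2)) * gauss (1 + m) ((m / (1 + m)) *\<^sub>R a) x"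
proof -
  \<comment> \<open>The exponents add up to a quadratic polynomial in x with leading coefficient 1 +
    m. Completing the square puts the new centre at \<open>q *\<^sub>R a\<close> and leaves q
    |a|^2.\<close>
  define q where "q = m / (1 + m)"
  have q: "(1 + m) * q = m" using m by (simp add: q_def)
  have *: "X + m * (X - 2 * Y + A) = q * A + (1 + m) * (X - 2 * q * Y + q * q * A)" for X Y A :: real
  proof -
    have "(1 + m) * (X - 2 * q * Y + q * q * A) = (1 + m) * X - 2 * ((1 + m) * q) * Y + ((1 + m) * q) * q * A"
      by (simp add: algebra_simps)
    moreover have "q * A + m * q * A = m * A"
      using arg_cong[OF q, of "\<lambda>z. z * A"] by (simp add: algebra_simps)
    ultimately show ?thesis unfolding q by (simp add: algebra_simps)
  qed
  have "(norm x)\<^sup>2 + m * (norm (x - a))\<^sup>2 = (m / (1 + m)) * (norm a)\<^sup>2 + (1 + m) * (norm (x - (m / (1 + m)) *\<^sub>R a))\<^sup>2"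
    using *[of "x \<bullet> x" "x \<bullet> a" "a \<bullet> a"] unfolding q_def[symmetric] power2_norm_eq_inner
    by (simp add: inner_diff_left inner_diff_right inner_commute algebra_simps)
  then have "exp (- (norm x)\<^sup>2) * exp (- m * (norm (x - a))\<^sup>2) = exp (- (m / (1 + m)) * (norm a)\<^sup>2) * exp (- (1 + m) * (norm (x - (m / (1 + m)) *\<^sub>R a))\<^sup>2)"
    unfolding exp_add[symmetric] by (simp only: mult_minus_left minus_add_distrib[symmetric])
  then show ?thesis
    unfolding gauss_def of_real_mult[symmetric] by simp
qed

text \<open>Integrating against Gaussians of small width centred in a box gives the integral over the box.\<close>

theorem AE_zero_if_orthogonal_to_gauss:
  fixes W :: "'a::euclidean_space \<Rightarrow> complex"
  assumes W [measurable]: "W \<in> borel_measurable borel"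
    and int: "\<And>c a. c > 0 \<Longrightarrow> integrable lborel (\<lambda>x. W x * gauss c a x)"
    and zero: "\<And>c a. c > 0 \<Longrightarrow> (LINT x|lborel. W x * gauss c a x) = 0"
  shows "AE x in lborel. W x = 0"
proof -
  \<comment> \<open>\<open>W\<close> itself need not be integrable. The weight is harmless: a
    product of two Gaussians is a constant times a Gaussian, so \<open>g\<close> is orthogonal to
    Gaussians as well, and \<open>g\<close> vanishes only where \<open>W\<close> does.\<close>
  define g where "g x = W x * gauss 1 0 x" for x
  have [measurable]: "g \<in> borel_measurable borel" unfolding g_def by measurable
  have ig: "integrable lborel g" unfolding g_def by (rule int) simp
  define Z where "Z = (LINT u|lborel. gauss 1 0 (u::'a))"
  have Z: "Z \<noteq> 0"
  proof -
    have "Z = fourier (gauss 1 0) (0::'a)" by (simp add: Z_def fourier_def)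
    also have "\<dots> = of_real (sqrt pi ^ DIM('a))"
      by (subst fourier_gauss_0) (auto simp: gauss_def)
    finally show ?thesis by simp
  qed
  have box: "(LINT x:box l u|lborel. g x) = 0" for l u :: 'a
  proof -
    let ?B = "\<lambda>a. of_real (indicator (box l u) a) :: complex"
    \<comment> \<open>\<open>\<theta> r\<close> is a multiple of the indicator function of the box
      smoothed at scale r; up to the factor r ^ DIM('a) it is a superposition of narrow Gaussians
      centred in the box.\<close>
    define \<theta> where "\<theta> r x = (LINT y|lborel. ?B (x + r *\<^sub>R y) * gauss 1 0 y)" for r and x :: 'a
    have \<theta>0: "(LINT x|lborel. g x * \<theta> r x) = 0" if r: "r > 0" for r
    proof -
      have m: "1 / r\<^sup>2 > 0" using r by simp
      have ib: "integrable lborel ?B"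
        by (intro integrable_of_real) (simp add: integrable_indicator_iff emeasure_lborel_box_finite[unfolded infinity_ennreal_def])
      have i2: "integrable (lborel \<Otimes>\<^sub>M lborel) (\<lambda>(x, a). g x * (?B a * gauss (1 / r\<^sup>2) x a))"
        by (rule integrable_pair_bound[OF _ ig ib])
           (use r in \<open>auto simp: norm_mult norm_gauss gauss_def indicator_def intro!: mult_left_le\<close>)
      have "of_real (r ^ DIM('a)) * (LINT x|lborel. g x * \<theta> r x) = (LINT x|lborel. LINT a|lborel. g x * (?B a * gauss (1 / r\<^sup>2) x a))"
      proof -
        have "of_real (r ^ DIM('a)) * (LINT x|lborel. g x * \<theta> r x) = (LINT x|lborel. of_real (r ^ DIM('a)) * (g x * \<theta> r x))"
          by simp
        also have "\<dots> = (LINT x|lborel. g x * (of_real (r ^ DIM('a)) * \<theta> r x))"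
          by (simp only: mult.left_commute)
        also have "\<dots> = (LINT x|lborel. g x * (LINT a|lborel. ?B a * gauss (1 / r\<^sup>2) x a))"
          unfolding \<theta>_def by (subst integral_gauss_dilate[OF r, symmetric]) (rule refl)
        finally show ?thesis by simp
      qed
      also have "\<dots> = (LINT a|lborel. LINT x|lborel. g x * (?B a * gauss (1 / r\<^sup>2) x a))"
        by (rule lborel_pair.Fubini_integral[symmetric]) (use i2 in \<open>simp add: case_prod_unfold\<close>)
      also have "\<dots> = (LINT a|(lborel :: 'a measure). (0::complex))"
      proof (rule Bochner_Integration.integral_cong[OF refl])
        fix a :: 'a
        have eq: "g x * (?B a * gauss (1 / r\<^sup>2) x a) = ?B a * of_real (exp (- (1 / r\<^sup>2 / (1 + 1 / r\<^sup>2)) * (norm a)\<^sup>2))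
           * (W x * gauss (1 + 1 / r\<^sup>2) ((1 / r\<^sup>2 / (1 + 1 / r\<^sup>2)) *\<^sub>R a) x)" for x
        proof -
          have "gauss (1 / r\<^sup>2) x a = gauss (1 / r\<^sup>2) a x"
            by (simp add: gauss_def norm_minus_commute)
          then have "g x * (?B a * gauss (1 / r\<^sup>2) x a) = ?B a * W x * (gauss 1 0 x * gauss (1 / r\<^sup>2) a x)"
            by (simp add: g_def mult_ac)
          then show ?thesis unfolding gauss_mult_gauss[OF m] by (simp only: mult_ac)
        qed
        have p: "0 < 1 + 1 / r\<^sup>2" using m by linarith
        show "(LINT x|lborel. g x * (?B a * gauss (1 / r\<^sup>2) x a)) = 0"
          unfolding eq integral_mult_right_zero zero[OF p] by simp
      qed
      finally show ?thesis using r by simp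
    qed
    have ig1: "integrable lborel (gauss 1 (0::'a))" by (rule gauss_integrable) simp
    \<comment> \<open>The smoothed function is shown to converge to \<open>Z\<close> times the
      indicator off the boundary of the box, which is a null set.\<close>
    have nf: "AE x in lborel. x \<notin> cbox l u - box l u"
      using AE_not_in[of "cbox l u - box l u" "lborel"]
      by (simp add: null_sets_def emeasure_Diff emeasure_lborel_box_eq emeasure_lborel_cbox_eq box_subset_cbox)
    have lim: "((\<lambda>r. \<theta> r x) \<longlongrightarrow> ?B x * Z) (at 0 within {0<..})" if x: "x \<notin> cbox l u - box l u" for x
    proof -
      have "((\<lambda>r. \<theta> r x) \<longlongrightarrow> (LINT y|lborel. ?B x * gauss 1 0 (y::'a))) (at 0 within {0<..})"
        unfolding \<theta>_def
      proof (rule dominated_convergence_within[where w="\<lambda>y. norm (gauss 1 0 (y::'a))"])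
        show "AE y in lborel. ((\<lambda>r. ?B (x + r *\<^sub>R y) * gauss 1 0 y) \<longlongrightarrow> ?B x * gauss 1 0 y) (at 0 within {0<..})"
        proof (rule AE_I2)
          fix y
          have t: "((\<lambda>r. x + r *\<^sub>R y) \<longlongrightarrow> x + 0 *\<^sub>R y) (at 0 within {0<..})"
            by (intro tendsto_intros)
          have "eventually (\<lambda>r. indicator (box l u) (x + r *\<^sub>R y) = (indicator (box l u) x :: real)) (at 0 within {0<..})"
          proof (cases "x \<in> box l u")
            case True
            with topological_tendstoD[OF t open_box[of l u]] show ?thesis
              by (auto elim!: eventually_mono)
          next
            case False
            then have "x \<in> - cbox l u" using x by auto
            with topological_tendstoD[OF t, of "- cbox l u"]
            have "eventually (\<lambda>r. x + r *\<^sub>R y \<in> - cbox l u) (at 0 within {0<..})"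
              using closed_cbox[of l u] by (simp add: open_Compl)
            then show ?thesis
              by eventually_elim (use False box_subset_cbox[of l u] in \<open>auto simp: indicator_def\<close>)
          qed
          then have "eventually (\<lambda>r. ?B x * gauss 1 0 y = ?B (x + r *\<^sub>R y) * gauss 1 0 y) (at 0 within {0<..})"
            by eventually_elim simp
          then show "((\<lambda>r. ?B (x + r *\<^sub>R y) * gauss 1 0 y) \<longlongrightarrow> ?B x * gauss 1 0 y) (at 0 within {0<..})"
            by (rule Lim_transform_eventually[OF tendsto_const])
        qed
        show "integrable lborel (\<lambda>y. norm (gauss 1 (0::'a) y))"
          by (intro integrable_norm ig1)
      qed (auto simp: norm_mult indicator_def)
      then show ?thesis by (simp add: Z_def)
    qed
    have \<theta>b: "norm (\<theta> r x) \<le> (LINT y|lborel. norm (gauss 1 0 (y::'a)))" for r x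
      unfolding \<theta>_def
    proof (rule Bochner_Integration.integral_norm_bound_integral)
      show "integrable lborel (\<lambda>y. ?B (x + r *\<^sub>R y) * gauss 1 0 y)"
        by (rule Bochner_Integration.integrable_bound[OF ig1]) (auto simp: norm_mult indicator_def)
    qed (auto simp: norm_mult indicator_def intro!: integrable_norm ig1)
    have "((\<lambda>r. LINT x|lborel. g x * \<theta> r x) \<longlongrightarrow> (LINT x|lborel. g x * (?B x * Z))) (at 0 within {0<..})"
    proof (rule dominated_convergence_within[where w="\<lambda>x. norm (g x) * (LINT y|lborel. norm (gauss 1 0 (y::'a)))"])
      show "AE x in lborel. ((\<lambda>r. g x * \<theta> r x) \<longlongrightarrow> g x * (?B x * Z)) (at 0 within {0<..})"
        using nf by eventually_elim (intro tendsto_intros lim)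
      show "(\<lambda>x. g x * \<theta> r x) \<in> borel_measurable lborel" for r
        unfolding \<theta>_def by measurable
      show "AE x in lborel. norm (g x * \<theta> r x) \<le> norm (g x) * (LINT y|lborel. norm (gauss 1 0 (y::'a)))" for r
        using \<theta>b by (auto simp: norm_mult intro!: mult_left_mono)
      show "integrable lborel (\<lambda>x. norm (g x) * (LINT y|lborel. norm (gauss 1 0 (y::'a))))"
        by (intro integrable_mult_left integrable_norm ig)
    qed measurable
    moreover have "eventually (\<lambda>r. (LINT x|lborel. g x * \<theta> r x) = 0) (at 0 within {0<..})"
      using eventually_at_right_less[of "0::real"] by eventually_elim (simp add: \<theta>0)
    ultimately have "((\<lambda>r::real. 0) \<longlongrightarrow> (LINT x|lborel. g x * (?B x * Z))) (at 0 within {0<..})"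
      by (rule Lim_transform_eventually)
    then have "(LINT x|lborel. g x * (?B x * Z)) = 0"
      using tendsto_unique[of "at_right (0::real)", OF _ tendsto_const] by force
    moreover have "(LINT x|lborel. g x * (?B x * Z)) = (LINT x:box l u|lborel. g x) * Z"
      unfolding set_lebesgue_integral_def integral_mult_left_zero[symmetric]
      by (intro Bochner_Integration.integral_cong) (auto simp: scaleR_conv_of_real mult_ac)
    ultimately show ?thesis using Z by simp
  qed
  have "(LINT x:A|lborel. g x) = 0" if "A \<in> sets lborel" for A
  proof -
    let ?E = "range (\<lambda>(a, b). box a b :: 'a set)"
    \<comment> \<open>Boxes are stable under intersection and generate the Borel sets. The step to
      complements uses that the integral of \<open>g\<close> over the whole space is itself a
      pairing of \<open>W\<close> with a Gaussian.\<close>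
    have E: "sets borel = sigma_sets UNIV ?E"
      by (subst borel_eq_box) (auto simp: sets_measure_of_conv)
    have "A \<in> sigma_sets UNIV ?E" using that E by simp
    have 1: "Int_stable ?E" by (auto simp: Int_stable_def box_Int_box)
    have 2: "?E \<subseteq> Pow UNIV" by simp
    from 1 2 \<open>A \<in> sigma_sets UNIV ?E\<close> show ?thesis
    proof (induction rule: sigma_sets_induct_disjoint)
      case (basic A)
      then show ?case using box by auto
    next
      case empty
      show ?case by (simp add: set_lebesgue_integral_def)
    next
      case (compl A)
      then have A: "A \<in> sets borel" using E by simp
      have "(LINT x:UNIV - A|lborel. g x) = (LINT x|lborel. g x) - (LINT x:A|lborel. g x)"
      proof -
        have "indicator (UNIV - A) x *\<^sub>R g x = g x - indicator A x *\<^sub>R g x" for x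
          by (auto simp: indicator_def)
        then show ?thesis
          unfolding set_lebesgue_integral_def using ig A
          by (simp add: integrable_mult_indicator)
      qed
      then show ?case using compl zero[of 1 0] by (simp add: g_def)
    next
      case (union A)
      then have A: "A i \<in> sets lborel" for i using E by auto
      have "(LINT x:(\<Union>i. A i)|lborel. g x) = (\<Sum>i. (LINT x:(A i)|lborel. g x))"
        using union.hyps(1) A ig
        by (intro lebesgue_integral_countable_add)
           (auto simp: disjoint_family_on_def set_integrable_def intro!: integrable_mult_indicator)
      then show ?case using union by simp
    qed
  qed
  then have "AE x in lborel. g x = 0"
    by (rule sigma_finite_measure.density_zero[OF sigma_finite_lborel ig])
  then show ?thesis
    by eventually_elim (simp add: g_def gauss_def)
qed

section \<open>Homogeneous components\<close>

lemma spow_0 [simp]: "spow \<epsilon> a 0 = 0"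
  by (simp add: spow_def)

lemma spow_eq: "t \<noteq> 0 \<Longrightarrow> spow \<epsilon> a t = exp (a * of_real (ln \<bar>t\<bar>)) * of_real (sgn t) ^ \<epsilon>"
  by (simp add: spow_def powr_def Ln_of_real)

lemma spow_borel [measurable]: "spow \<epsilon> a \<in> borel_measurable borel"
proof -
  have [measurable]: "(exp :: complex \<Rightarrow> complex) \<in> borel_measurable borel"
    by (intro borel_measurable_continuous_onI continuous_intros)
  have "spow \<epsilon> a = (\<lambda>t. if t = 0 then 0 else exp (a * of_real (ln \<bar>t\<bar>)) * of_real (sgn t) ^ \<epsilon>)"
    by (rule ext) (simp add: spow_eq)
  then show ?thesis by simp
qed

lemma norm_spow: "norm (spow \<epsilon> a t) = \<bar>t\<bar> powr Re a"
proof (cases "t = 0")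
  case False
  then have "norm (complex_of_real (sgn t) ^ \<epsilon>) = 1"
    by (simp add: norm_power sgn_if)
  then show ?thesis
    using False by (simp add: spow_eq norm_mult powr_def)
qed simp

lemma spow_mult: "spow \<epsilon> a (s * t) = spow \<epsilon> a s * spow \<epsilon> a t"
proof (cases "s = 0 \<or> t = 0")
  case False
  then show ?thesis
    by (simp add: spow_eq abs_mult ln_mult sgn_mult power_mult_distrib distrib_left exp_add mult_ac)
qed auto

lemma spow_times_abs_power: "of_real (\<bar>t\<bar> ^ m) * spow \<epsilon> a t = spow \<epsilon> (a + of_nat m) t"
proof (cases "t = 0")
  case False
  then have "complex_of_real (\<bar>t\<bar> ^ m) = exp (of_nat m * of_real (ln \<bar>t\<bar>))"
    by (simp add: exp_of_nat_mult exp_of_real)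
  then show ?thesis
    using False by (simp add: spow_eq distrib_right exp_add mult_ac)
qed simp

lemma spow_inverse: "spow \<epsilon> a (inverse t) = spow \<epsilon> (- a) t"
proof (cases "t = 0")
  case False
  then show ?thesis by (simp add: spow_eq abs_inverse ln_inverse)
qed simp

text \<open>\<open>- hexp n lam - 1\<close> equals - (n + 1)/2 - i lam: it is the degree of
  homogeneity of the components and the exponent of |1 + s \<bullet> \<sigma>| in
  \<open>Op_integrand\<close>.\<close>

abbreviation hexp :: "nat \<Rightarrow> real \<Rightarrow> complex" where
  "hexp n lam \<equiv> (of_nat n - 1) / 2 + \<i> * of_real lam"

lemma Re_hexp [simp]: "Re (hexp n lam) = (real n - 1) / 2"
  by simp

subsection \<open>Projective coordinates\<close>

text \<open>For a fixed last coordinate \<tau> \<noteq> 0 the other n coordinates are those of s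
  dilated by \<tau>, with Jacobian |\<tau>|^n. The hyperplane \<tau> = 0 is a null set.\<close>

lemma polar_measure:
  "(lborel :: 'n::finite space measure) = distr (density (lborel \<Otimes>\<^sub>M lborel) (\<lambda>p. ennreal (\<bar>snd p\<bar> ^ CARD('n)))) borel
     (\<lambda>p. snd p *\<^sub>R (fst p, 1))" (is "_ = distr (density _ ?d) _ ?p")
proof (rule measure_eqI)
  have pm: "?p \<in> (lborel \<Otimes>\<^sub>M lborel) \<rightarrow>\<^sub>M borel"
    by measurable
  show "sets (lborel :: 'n space measure) = sets (distr (density (lborel \<Otimes>\<^sub>M lborel) ?d) borel ?p)"
    by simp
  fix A assume "A \<in> sets (lborel :: 'n space measure)"
  then have A [measurable]: "A \<in> sets borel" by simp
  let ?I = "\<lambda>x. indicator A x :: ennreal"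
  have Im [measurable]: "(\<lambda>p. ?I (?p p)) \<in> borel_measurable (lborel \<Otimes>\<^sub>M lborel)"
    by measurable
  have I2: "?I \<in> borel_measurable (lborel \<Otimes>\<^sub>M lborel)"
    unfolding lborel_prod by measurable
  have "emeasure (distr (density (lborel \<Otimes>\<^sub>M lborel) ?d) borel ?p) A
     = (\<integral>\<^sup>+p. ?I (?p p) \<partial>density (lborel \<Otimes>\<^sub>M lborel) ?d)"
    using A pm by (subst nn_integral_indicator[symmetric], simp, subst nn_integral_distr, auto)
  also have "\<dots> = (\<integral>\<^sup>+p. ?d p * ?I (?p p) \<partial>(lborel \<Otimes>\<^sub>M lborel))"
    by (subst nn_integral_density) auto
  also have "\<dots> = (\<integral>\<^sup>+\<tau>. \<integral>\<^sup>+s. ennreal (\<bar>\<tau>\<bar> ^ CARD('n)) * ?I (\<tau> *\<^sub>R (s, 1)) \<partial>lborel \<partial>lborel)"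
    by (subst lborel_pair.nn_integral_snd[symmetric]) auto
  also have "\<dots> = (\<integral>\<^sup>+\<tau>. \<integral>\<^sup>+s. ?I (s, \<tau>) \<partial>lborel \<partial>lborel)"
  proof (rule nn_integral_cong_AE)
    have "AE \<tau> in lborel. \<tau> \<noteq> (0::real)" by (rule AE_lborel_singleton)
    then show "AE \<tau> in lborel. (\<integral>\<^sup>+s. ennreal (\<bar>\<tau>\<bar> ^ CARD('n)) * ?I (\<tau> *\<^sub>R (s, 1)) \<partial>lborel) = (\<integral>\<^sup>+s. ?I (s, \<tau>) \<partial>lborel)"
    proof eventually_elim
      case (elim \<tau>)
      have "(\<lambda>s::real^'n. (s, \<tau>)) \<in> borel \<rightarrow>\<^sub>M borel"
        by (intro borel_measurable_continuous_onI continuous_intros)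
      then have m: "(\<lambda>s. ?I (s, \<tau>)) \<in> borel_measurable borel"
        by measurable
      have "(\<integral>\<^sup>+s. ?I (s, \<tau>) \<partial>lborel) = (\<integral>\<^sup>+s. ?I (s, \<tau>) \<partial>density (distr lborel borel (\<lambda>x. 0 + \<tau> *\<^sub>R x)) (\<lambda>_. \<bar>\<tau>\<bar> ^ DIM(real^'n)))"
        using lborel_affine[OF elim, where t="0::real^'n"] by (metis (no_types, lifting))
      also have "\<dots> = (\<integral>\<^sup>+s. ennreal (\<bar>\<tau>\<bar> ^ CARD('n)) * ?I (\<tau> *\<^sub>R (s, 1)) \<partial>lborel)"
        using m by (subst nn_integral_density, simp, simp) (subst nn_integral_distr, auto)
      finally show ?case by simp
    qed
  qed
  also have "\<dots> = (\<integral>\<^sup>+p. ?I p \<partial>(lborel \<Otimes>\<^sub>M lborel))"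
    using lborel_pair.nn_integral_snd[OF I2] by simp
  also have "\<dots> = (\<integral>\<^sup>+p. ?I p \<partial>lborel)"
    by (simp add: lborel_prod)
  also have "\<dots> = emeasure lborel A" using A by simp
  finally show "emeasure lborel A = emeasure (distr (density (lborel \<Otimes>\<^sub>M lborel) ?d) borel ?p) A"
    by simp
qed

lemma
  fixes f :: "'n::finite space \<Rightarrow> complex"
  assumes f [measurable]: "f \<in> borel_measurable borel"
  shows integrable_polar: "integrable lborel f \<longleftrightarrow> integrable (lborel \<Otimes>\<^sub>M lborel) (\<lambda>p. of_real (\<bar>snd p\<bar> ^ CARD('n)) * f (snd p *\<^sub>R (fst p, 1)))"
    and integral_polar: "(LINT x|lborel. f x) = (LINT p|(lborel \<Otimes>\<^sub>M lborel). of_real (\<bar>snd p\<bar> ^ CARD('n)) * f (snd p *\<^sub>R (fst p, 1)))"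
    and nn_integral_polar: "(\<integral>\<^sup>+x. norm (f x) \<partial>lborel) = (\<integral>\<^sup>+s. \<integral>\<^sup>+\<tau>. ennreal (\<bar>\<tau>\<bar> ^ CARD('n) * norm (f (\<tau> *\<^sub>R (s, 1)))) \<partial>lborel \<partial>lborel)"
proof -
  have pm: "(\<lambda>p. snd p *\<^sub>R (fst p, 1::real)) \<in> (density (lborel \<Otimes>\<^sub>M lborel) (\<lambda>p. ennreal (\<bar>snd p\<bar> ^ CARD('n)))) \<rightarrow>\<^sub>M (borel :: 'n space measure)"
    by measurable
  have fm: "(\<lambda>p. f (snd p *\<^sub>R (fst p, 1))) \<in> borel_measurable (lborel \<Otimes>\<^sub>M lborel)"
    by measurable
  show "integrable lborel f \<longleftrightarrow> integrable (lborel \<Otimes>\<^sub>M lborel) (\<lambda>p. of_real (\<bar>snd p\<bar> ^ CARD('n)) * f (snd p *\<^sub>R (fst p, 1)))"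
    using fm
    by (subst polar_measure, subst integrable_distr_eq[OF pm f], subst integrable_density)
       (auto simp: scaleR_conv_of_real)
  show "(LINT x|lborel. f x) = (LINT p|(lborel \<Otimes>\<^sub>M lborel). of_real (\<bar>snd p\<bar> ^ CARD('n)) * f (snd p *\<^sub>R (fst p, 1)))"
    using fm
    by (subst polar_measure, subst integral_distr[OF pm f], subst integral_density)
       (auto simp: scaleR_conv_of_real)
  have "(\<integral>\<^sup>+x. norm (f x) \<partial>lborel) = (\<integral>\<^sup>+p. ennreal (\<bar>snd p\<bar> ^ CARD('n) * norm (f (snd p *\<^sub>R (fst p, 1)))) \<partial>(lborel \<Otimes>\<^sub>M lborel))"
    using fm
    by (subst polar_measure, subst nn_integral_distr[OF pm], simp, subst nn_integral_density)
       (auto simp: ennreal_mult')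
  also have "\<dots> = (\<integral>\<^sup>+s. \<integral>\<^sup>+\<tau>. ennreal (\<bar>\<tau>\<bar> ^ CARD('n) * norm (f (\<tau> *\<^sub>R (s, 1)))) \<partial>lborel \<partial>lborel)"
    by (subst lborel.nn_integral_fst[symmetric]) auto
  finally show "(\<integral>\<^sup>+x. norm (f x) \<partial>lborel) = (\<integral>\<^sup>+s. \<integral>\<^sup>+\<tau>. ennreal (\<bar>\<tau>\<bar> ^ CARD('n) * norm (f (\<tau> *\<^sub>R (s, 1)))) \<partial>lborel \<partial>lborel)" .
qed

subsection \<open>Weights on a line\<close>

text \<open>The two powers by which N exceeds p leave the integrable function 1 / (1 + t^2); m = min
  1 r compares 1 + |t| r with 1 + |t|.\<close>

lemma integrable_line_weight:
  assumes p: "p \<ge> 0" "p + 2 \<le> real N" and r: "r > 0"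
  shows "integrable lborel (\<lambda>t::real. \<bar>t\<bar> powr p * inverse ((1 + \<bar>t\<bar> * r) ^ N))"
proof -
  define m where "m = min 1 r"
  have m: "m > 0" "m \<le> 1" "m \<le> r" using r by (auto simp: m_def)
  have b: "\<bar>t\<bar> powr p * inverse ((1 + \<bar>t\<bar> * r) ^ N) \<le> inverse (m ^ N) * inverse (1 + t\<^sup>2)" for t
  proof -
    have "m * (1 + \<bar>t\<bar>) \<le> 1 + \<bar>t\<bar> * r"
      using m mult_left_mono[OF m(3), of "\<bar>t\<bar>"] by (simp add: algebra_simps)
    then have "(m * (1 + \<bar>t\<bar>)) ^ N \<le> (1 + \<bar>t\<bar> * r) ^ N"
      using m by (intro power_mono) auto
    then have 1: "inverse ((1 + \<bar>t\<bar> * r) ^ N) \<le> inverse (m ^ N) * inverse ((1 + \<bar>t\<bar>) ^ N)"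
      using m by (subst inverse_mult_distrib[symmetric], subst power_mult_distrib[symmetric])
        (intro le_imp_inverse_le zero_less_power, auto intro!: mult_pos_pos)
    have "\<bar>t\<bar> powr p \<le> (1 + \<bar>t\<bar>) powr p" using p by (intro powr_mono2) auto
    also have "\<dots> * (1 + t\<^sup>2) \<le> (1 + \<bar>t\<bar>) powr p * (1 + \<bar>t\<bar>) powr 2"
      by (intro mult_left_mono) (auto simp: power2_sum powr_numeral)
    also have "(1 + \<bar>t\<bar>) powr p * (1 + \<bar>t\<bar>) powr 2 = (1 + \<bar>t\<bar>) powr (p + 2)" by (simp add: powr_add)
    also have "\<dots> \<le> (1 + \<bar>t\<bar>) powr real N" using p by (intro powr_mono) auto
    also have "\<dots> = (1 + \<bar>t\<bar>) ^ N" by (intro powr_realpow) auto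
    finally have 2: "\<bar>t\<bar> powr p * (1 + t\<^sup>2) \<le> (1 + \<bar>t\<bar>) ^ N"
      by (simp add: mult_right_mono)
    have pos: "0 < 1 + t\<^sup>2" "0 < (1 + \<bar>t\<bar>) ^ N" by (auto intro: add_pos_nonneg)
    have 3: "\<bar>t\<bar> powr p * inverse ((1 + \<bar>t\<bar>) ^ N) \<le> inverse (1 + t\<^sup>2)"
      using 2 pos by (simp add: field_simps)
    have "\<bar>t\<bar> powr p * inverse ((1 + \<bar>t\<bar> * r) ^ N) \<le> \<bar>t\<bar> powr p * (inverse (m ^ N) * inverse ((1 + \<bar>t\<bar>) ^ N))"
      by (intro mult_left_mono 1) auto
    also have "\<dots> = inverse (m ^ N) * (\<bar>t\<bar> powr p * inverse ((1 + \<bar>t\<bar>) ^ N))"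
      by (simp only: mult_ac)
    also have "\<dots> \<le> inverse (m ^ N) * inverse (1 + t\<^sup>2)"
      using m by (intro mult_left_mono 3) auto
    finally show ?thesis .
  qed
  show ?thesis
  proof (rule Bochner_Integration.integrable_bound)
    show "integrable lborel (\<lambda>t. inverse (m ^ N) * inverse (1 + t\<^sup>2))"
      by (intro integrable_mult_right integrable_inverse_one_plus_square)
    show "AE t in lborel. norm (\<bar>t\<bar> powr p * inverse ((1 + \<bar>t\<bar> * r) ^ N)) \<le> norm (inverse (m ^ N) * inverse (1 + t\<^sup>2))"
      using b r m by (auto simp: abs_mult intro!: order_trans[OF _ b])
  qed measurable
qed

definition line_weight :: "real \<Rightarrow> nat \<Rightarrow> real" where
  "line_weight p N = (LINT t|lborel. \<bar>t\<bar> powr p * inverse ((1 + \<bar>t\<bar>) ^ N))"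

lemma line_weight_scale:
  assumes r: "r > 0"
  shows "(LINT t|lborel. \<bar>t\<bar> powr p * inverse ((1 + \<bar>t\<bar> * r) ^ N)) = line_weight p N * r powr (- p - 1)"
proof -
  have "line_weight p N = \<bar>r\<bar> *\<^sub>R (LINT t|lborel. \<bar>0 + r * t\<bar> powr p * inverse ((1 + \<bar>0 + r * t\<bar>) ^ N))"
    unfolding line_weight_def using r by (intro lborel_integral_real_affine) auto
  also have "\<dots> = (r powr 1 * r powr p) * (LINT t|lborel. \<bar>t\<bar> powr p * inverse ((1 + \<bar>t\<bar> * r) ^ N))"
  proof -
    have "\<bar>0 + r * t\<bar> powr p * inverse ((1 + \<bar>0 + r * t\<bar>) ^ N) = r powr p * (\<bar>t\<bar> powr p * inverse ((1 + \<bar>t\<bar> * r) ^ N))" for t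
      using r by (simp add: abs_mult powr_mult mult_ac)
    then show ?thesis using r by simp
  qed
  finally show ?thesis
    using r by (simp add: powr_diff powr_minus field_simps)
qed

lemma line_weight_pos:
  assumes p: "p \<ge> 0" "p + 2 \<le> real N"
  shows "line_weight p N > 0"
proof -
  have int: "integrable lborel (\<lambda>t::real. \<bar>t\<bar> powr p * inverse ((1 + \<bar>t\<bar>) ^ N))"
    using integrable_line_weight[OF p, of 1] by simp
  have nn: "\<bar>t\<bar> powr p * inverse ((1 + \<bar>t\<bar>) ^ N) \<ge> 0" for t :: real
    by simp
  have "line_weight p N \<noteq> 0"
  proof
    assume "line_weight p N = 0"
    then have "AE t in lborel. \<bar>t\<bar> powr p * inverse ((1 + \<bar>t\<bar>) ^ N) = (0::real)"
      unfolding line_weight_def using integral_nonneg_eq_0_iff_AE[OF int] nn by auto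
    moreover have "AE t in lborel. t \<noteq> (0::real)" by (rule AE_lborel_singleton)
    ultimately have "AE t in (lborel::real measure). False"
      by eventually_elim auto
    then show False by (simp add: eventually_False ae_filter_eq_bot_iff emeasure_lborel_UNIV)
  qed
  moreover have "line_weight p N \<ge> 0"
    unfolding line_weight_def by (rule Bochner_Integration.integral_nonneg) (rule nn)
  ultimately show ?thesis by simp
qed

subsection \<open>Estimates\<close>

text \<open>Decay of \<open>v\<close> of one fixed order N \<ge> p + 2 makes the integral converge,
  and rescaling t by |x| gives the degree - p - 1 of the bound.\<close>

lemma rapid_line:
  fixes v :: "'a::euclidean_space \<Rightarrow> complex"
  assumes v: "rapid v" and p: "p \<ge> 0"
  obtains C where "C \<ge> 0"
    "\<And>\<epsilon> a x. Re a = p \<Longrightarrow> x \<noteq> 0 \<Longrightarrow> integrable lborel (\<lambda>t. spow \<epsilon> a t * v (t *\<^sub>R x))"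
    "\<And>\<epsilon> a x. Re a = p \<Longrightarrow> x \<noteq> 0 \<Longrightarrow> (LINT t|lborel. norm (spow \<epsilon> a t * v (t *\<^sub>R x))) \<le> C * norm x powr (- p - 1)"
proof -
  define N where "N = nat \<lceil>p\<rceil> + 2"
  have N: "p + 2 \<le> real N" unfolding N_def using p by linarith
  obtain c where c: "c \<ge> 0" "\<And>x. norm (v x) \<le> c * inverse ((1 + norm x) ^ N)"
    using rapid_bound[OF v] by blast
  have [measurable]: "v \<in> borel_measurable borel" using v by (rule rapid_borel)
  have b: "norm (spow \<epsilon> a t * v (t *\<^sub>R x)) \<le> c * (\<bar>t\<bar> powr p * inverse ((1 + \<bar>t\<bar> * norm x) ^ N))" if "Re a = p" for \<epsilon> a t x
  proof -
    have "norm (spow \<epsilon> a t * v (t *\<^sub>R x)) \<le> \<bar>t\<bar> powr p * (c * inverse ((1 + \<bar>t\<bar> * norm x) ^ N))"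
      unfolding norm_mult norm_spow that using c(2)[of "t *\<^sub>R x"] by (intro mult_left_mono) auto
    then show ?thesis by (simp only: mult_ac)
  qed
  have w: "integrable lborel (\<lambda>t. c * (\<bar>t\<bar> powr p * inverse ((1 + \<bar>t\<bar> * norm x) ^ N)))" if "x \<noteq> 0" for x :: 'a
    using that by (intro integrable_mult_right integrable_line_weight p N) simp
  have i: "integrable lborel (\<lambda>t. spow \<epsilon> a t * v (t *\<^sub>R x))" if "Re a = p" "x \<noteq> 0" for \<epsilon> a x
    by (rule Bochner_Integration.integrable_bound[OF w[OF that(2)]])
       (auto intro!: AE_I2 order_trans[OF b[OF that(1)]])
  show thesis
  proof (rule that[of "c * line_weight p N"])
    show "c * line_weight p N \<ge> 0"
      using c line_weight_pos[OF p N] by simp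
    fix \<epsilon> a and x :: 'a assume ax: "Re a = p" "x \<noteq> 0"
    have "(LINT t|lborel. norm (spow \<epsilon> a t * v (t *\<^sub>R x))) \<le> (LINT t|lborel. c * (\<bar>t\<bar> powr p * inverse ((1 + \<bar>t\<bar> * norm x) ^ N)))"
      by (intro integral_mono integrable_norm i ax w b)
    also have "\<dots> = c * (line_weight p N * norm x powr (- p - 1))"
      unfolding integral_mult_right_zero by (subst line_weight_scale) (use ax in auto)
    finally show "(LINT t|lborel. norm (spow \<epsilon> a t * v (t *\<^sub>R x))) \<le> c * line_weight p N * norm x powr (- p - 1)"
      by simp
  qed (rule i)
qed

text \<open>A type of class \<open>finite\<close> is inhabited, so n \<ge> 1.\<close>

lemma hexp_nonneg: "(real CARD('n::finite) - 1) / 2 \<ge> 0"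
  by (simp add: Suc_le_eq)

lemma hom_comp_line:
  fixes v :: "'n::finite space \<Rightarrow> complex"
  assumes v: "rapid v"
  obtains C where "C \<ge> 0"
    "\<And>\<epsilon> lam x. x \<noteq> 0 \<Longrightarrow> integrable lborel (\<lambda>t. spow \<epsilon> (hexp CARD('n) lam) t * v (t *\<^sub>R x))"
    "\<And>\<epsilon> lam x. x \<noteq> 0 \<Longrightarrow> (LINT t|lborel. norm (spow \<epsilon> (hexp CARD('n) lam) t * v (t *\<^sub>R x))) \<le> C * norm x powr (- (real CARD('n) + 1) / 2)"
    "\<And>\<epsilon> lam x. x \<noteq> 0 \<Longrightarrow> norm (hom_comp lam \<epsilon> v x) \<le> C * norm x powr (- (real CARD('n) + 1) / 2)"
proof -
  obtain C where C: "C \<ge> 0"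
    "\<And>\<epsilon> a x. Re a = (real CARD('n) - 1) / 2 \<Longrightarrow> x \<noteq> 0 \<Longrightarrow> integrable lborel (\<lambda>t. spow \<epsilon> a t * v (t *\<^sub>R x))"
    "\<And>\<epsilon> a x. Re a = (real CARD('n) - 1) / 2 \<Longrightarrow> x \<noteq> 0 \<Longrightarrow> (LINT t|lborel. norm (spow \<epsilon> a t * v (t *\<^sub>R x))) \<le> C * norm x powr (- ((real CARD('n) - 1) / 2) - 1)"
    by (rule rapid_line[OF v hexp_nonneg[where 'n='n]]) (rule that, assumption+)
  have e: "- ((real CARD('n) - 1) / 2) - 1 = - (real CARD('n) + 1) / 2" by (simp add: field_simps)
  note C3 = C(3)[OF Re_hexp, unfolded e]
  show thesis
  proof (rule that[OF C(1) C(2)[OF Re_hexp] C3])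
    fix \<epsilon> lam and x :: "'n space" assume x: "x \<noteq> 0"
    have "norm (hom_comp lam \<epsilon> v x) = norm (complex_of_real (1 / (4 * pi))) * norm (LINT t|lborel. spow \<epsilon> (hexp CARD('n) lam) t * v (t *\<^sub>R x))"
      unfolding hom_comp_def by (rule norm_mult)
    also have "norm (complex_of_real (1 / (4 * pi))) = 1 / (4 * pi)"
      unfolding norm_of_real by simp
    also have "1 / (4 * pi) * norm (LINT t|lborel. spow \<epsilon> (hexp CARD('n) lam) t * v (t *\<^sub>R x))
      \<le> 1 / (4 * pi) * (LINT t|lborel. norm (spow \<epsilon> (hexp CARD('n) lam) t * v (t *\<^sub>R x)))"
      by (intro mult_left_mono integral_norm_bound) simp
    also have "\<dots> \<le> 1 * (LINT t|lborel. norm (spow \<epsilon> (hexp CARD('n) lam) t * v (t *\<^sub>R x)))"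
      using pi_gt3 by (intro mult_right_mono) (auto intro!: Bochner_Integration.integral_nonneg)
    also have "\<dots> \<le> C * norm x powr (- (real CARD('n) + 1) / 2)"
      using C3[OF x] by simp
    finally show "norm (hom_comp lam \<epsilon> v x) \<le> C * norm x powr (- (real CARD('n) + 1) / 2)" .
  qed
qed

lemma hom_comp_borel [measurable (raw)]:
  fixes v :: "'n::finite space \<Rightarrow> complex"
  assumes [measurable]: "v \<in> borel_measurable borel"
  shows "hom_comp lam \<epsilon> v \<in> borel_measurable borel"
  unfolding hom_comp_def[abs_def] by measurable

lemma section_borel [measurable]: "(\<lambda>s. (s, 1)) \<in> borel \<rightarrow>\<^sub>M (borel :: 'n::finite space measure)"
  by (intro borel_measurable_continuous_onI continuous_intros)

lemma flat_borel [measurable (raw)]: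
  fixes v :: "'n::finite space \<Rightarrow> complex"
  assumes [measurable]: "v \<in> borel_measurable borel"
  shows "flat lam \<epsilon> v \<in> borel_measurable borel"
  unfolding flat_def[abs_def] by (rule measurable_compose[OF section_borel hom_comp_borel[OF assms]])

lemma spow_minus_one:
  assumes "t \<noteq> 0"
  shows "of_real \<bar>inverse t\<bar> * spow \<epsilon> (- a) t = spow \<epsilon> (- a - 1) t"
  using spow_times_abs_power[of t 1 \<epsilon> "- a - 1"] assms by (simp add: field_simps)

text \<open>Substituting t / \<tau> for t: the power of t contributes the exponent
  \<open>- hexp\<close> and the Jacobian -1.\<close>

lemma hom_comp_homogeneous:
  fixes v :: "'n::finite space \<Rightarrow> complex"
  assumes t: "\<tau> \<noteq> 0"
  shows "hom_comp lam \<epsilon> v (\<tau> *\<^sub>R x) = spow \<epsilon> (- hexp CARD('n) lam - 1) \<tau> * hom_comp lam \<epsilon> v x"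
proof -
  let ?e = "hexp CARD('n) lam"
  have "(LINT t|lborel. spow \<epsilon> ?e t * v (t *\<^sub>R \<tau> *\<^sub>R x)) = \<bar>inverse \<tau>\<bar> *\<^sub>R (LINT t|lborel. spow \<epsilon> ?e (0 + inverse \<tau> * t) * v ((0 + inverse \<tau> * t) *\<^sub>R \<tau> *\<^sub>R x))"
    using t by (intro lborel_integral_real_affine) simp
  also have "\<dots> = \<bar>inverse \<tau>\<bar> *\<^sub>R (LINT t|lborel. spow \<epsilon> ?e (inverse \<tau>) * (spow \<epsilon> ?e t * v (t *\<^sub>R x)))"
  proof -
    have "(0 + inverse \<tau> * t) *\<^sub>R \<tau> *\<^sub>R x = t *\<^sub>R x" for t
      using t by (simp add: field_simps)
    then show ?thesis by (simp only: spow_mult mult.assoc add_0)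
  qed
  also have "\<dots> = (of_real \<bar>inverse \<tau>\<bar> * spow \<epsilon> (- ?e) \<tau>) * (LINT t|lborel. spow \<epsilon> ?e t * v (t *\<^sub>R x))"
    by (simp only: integral_mult_right_zero spow_inverse scaleR_conv_of_real mult.assoc)
  also have "\<dots> = spow \<epsilon> (- ?e - 1) \<tau> * (LINT t|lborel. spow \<epsilon> ?e t * v (t *\<^sub>R x))"
    by (simp only: spow_minus_one[OF t])
  finally show ?thesis unfolding hom_comp_def by (simp only: mult.left_commute)
qed

lemma norm_section_pos: "0 < norm (s, 1::real)"
  by (simp add: prod_eq_iff)

text \<open>Projective coordinates are read backwards: integrating an integrable power of 1 + |x|,
  with the Jacobian, over the line through (s, 1) gives a positive constant times |(s, 1)|^(- n -
  1), and by Fubini's theorem this is integrable in s.\<close>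

lemma integrable_section_weight:
  "integrable lborel (\<lambda>s::real^'n::finite. norm (s, 1::real) powr (- (real CARD('n) + 1)))"
proof -
  let ?N = "2 * DIM('n space)"
  have N: "real CARD('n) \<ge> 0" "real CARD('n) + 2 \<le> real ?N"
    using hexp_nonneg[where 'n='n] by (auto simp: field_simps)
  have "integrable lborel (\<lambda>x::'n space. complex_of_real (inverse ((1 + norm x) ^ ?N)))"
    by (intro integrable_of_real integrable_weight)
  then have "integrable (lborel \<Otimes>\<^sub>M lborel) (\<lambda>p::('n space). of_real (\<bar>snd p\<bar> ^ CARD('n)) * complex_of_real (inverse ((1 + norm (snd p *\<^sub>R (fst p, 1::real))) ^ ?N)))"
    by (subst (asm) integrable_polar) simp_all
  moreover have "of_real (\<bar>\<tau>\<bar> ^ CARD('n)) * complex_of_real (inverse ((1 + norm (\<tau> *\<^sub>R (s, 1::real))) ^ ?N))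
      = complex_of_real (\<bar>\<tau>\<bar> powr real CARD('n) * inverse ((1 + \<bar>\<tau>\<bar> * norm (s, 1::real)) ^ ?N))" for s :: "real^'n" and \<tau>
    unfolding norm_scaleR of_real_mult[symmetric] by (cases "\<tau> = 0") (simp_all add: powr_realpow)
  ultimately have "integrable (lborel \<Otimes>\<^sub>M lborel) (\<lambda>p::('n space). complex_of_real (\<bar>snd p\<bar> powr real CARD('n) * inverse ((1 + \<bar>snd p\<bar> * norm (fst p, 1::real)) ^ ?N)))"
    by (simp only:)
  from lborel_pair.integrable_fst'[OF this]
  have "integrable lborel (\<lambda>s::real^'n. LINT \<tau>|lborel. complex_of_real (\<bar>\<tau>\<bar> powr real CARD('n) * inverse ((1 + \<bar>\<tau>\<bar> * norm (s, 1::real)) ^ ?N)))"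
    by (simp only: fst_conv snd_conv)
  then have "integrable lborel (\<lambda>s::real^'n. complex_of_real (line_weight (real CARD('n)) ?N * norm (s, 1::real) powr (- real CARD('n) - 1)))"
    by (simp only: integral_complex_of_real line_weight_scale[OF norm_section_pos])
  then have "integrable lborel (\<lambda>s::real^'n. Re (complex_of_real (line_weight (real CARD('n)) ?N * norm (s, 1::real) powr (- real CARD('n) - 1))))"
    by (rule integrable_Re)
  then have "integrable lborel (\<lambda>s::real^'n. line_weight (real CARD('n)) ?N * norm (s, 1::real) powr (- real CARD('n) - 1))"
    by simp
  from integrable_mult_right[OF this, of "inverse (line_weight (real CARD('n)) ?N)"]
  show ?thesis
    using line_weight_pos[OF N] by (simp add: mult.assoc[symmetric])
qed

lemma section_weight_square:
  "(norm (s::real^'n::finite, 1::real) powr (- (real CARD('n) + 1) / 2))\<^sup>2 = norm (s, 1::real) powr (- (real CARD('n) + 1))"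
  unfolding power2_eq_square powr_add[symmetric]
  by (rule arg_cong[where f="\<lambda>p. norm (s, 1::real) powr p"]) (simp add: field_simps)

lemma flat_bound:
  fixes v :: "'n::finite space \<Rightarrow> complex"
  assumes "rapid v"
  obtains C where "C \<ge> 0" "\<And>\<epsilon> lam s. norm (flat lam \<epsilon> v s) \<le> C * norm (s, 1::real) powr (- (real CARD('n) + 1) / 2)"
proof -
  obtain C where "C \<ge> 0" "\<And>\<epsilon> lam x. x \<noteq> 0 \<Longrightarrow> norm (hom_comp lam \<epsilon> v x) \<le> C * norm x powr (- (real CARD('n) + 1) / 2)"
    by (rule hom_comp_line[OF assms]) (rule that, assumption+)
  then show thesis
    using that[of C] norm_section_pos unfolding flat_def zero_less_norm_iff by blast
qed

lemma square_integrable_flat: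
  fixes v :: "'n::finite space \<Rightarrow> complex"
  assumes v: "rapid v"
  shows "square_integrable (flat lam \<epsilon> v)"
  unfolding square_integrable_def
proof
  have [measurable]: "v \<in> borel_measurable borel" using v by (rule rapid_borel)
  show m: "flat lam \<epsilon> v \<in> borel_measurable borel" by measurable
  obtain C where C: "C \<ge> 0" "\<And>\<epsilon> lam s. norm (flat lam \<epsilon> v s) \<le> C * norm (s, 1::real) powr (- (real CARD('n) + 1) / 2)"
    by (rule flat_bound[OF v]) (rule that, assumption+)
  show "integrable lborel (\<lambda>s. (norm (flat lam \<epsilon> v s))\<^sup>2)"
  proof (rule Bochner_Integration.integrable_bound)
    show "integrable lborel (\<lambda>s::real^'n. C\<^sup>2 * norm (s, 1::real) powr (- (real CARD('n) + 1)))"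
      by (intro integrable_mult_right integrable_section_weight)
    show "AE s in lborel. norm ((norm (flat lam \<epsilon> v s))\<^sup>2) \<le> norm (C\<^sup>2 * norm (s, 1::real) powr (- (real CARD('n) + 1)))"
    proof (rule AE_I2)
      fix s :: "real^'n"
      show "norm ((norm (flat lam \<epsilon> v s))\<^sup>2) \<le> norm (C\<^sup>2 * norm (s, 1::real) powr (- (real CARD('n) + 1)))"
        using power_mono[OF C(2)[of lam \<epsilon> s] norm_ge_zero, of 2]
        unfolding power_mult_distrib section_weight_square by simp
    qed
  qed (use m in measurable)
qed

subsection \<open>Pairings\<close>

text \<open>An inverse of \<open>flat\<close> off the hyperplane \<open>snd x = 0\<close>: the
  function of the degree and parity of a component that restricts to \<open>u\<close> on the points
  (s, 1). On the hyperplane its value is 0, as \<open>spow\<close> vanishes at 0.\<close>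

definition hom_ext :: "real \<Rightarrow> nat \<Rightarrow> (real ^ 'n \<Rightarrow> complex) \<Rightarrow> 'n::finite space \<Rightarrow> complex" where
  "hom_ext lam \<epsilon> u x = spow \<epsilon> (- hexp CARD('n) lam - 1) (snd x) * u (inverse (snd x) *\<^sub>R fst x)"

lemma hom_ext_borel [measurable (raw)]:
  fixes u :: "real ^ 'n::finite \<Rightarrow> complex"
  assumes [measurable]: "u \<in> borel_measurable borel"
  shows "hom_ext lam \<epsilon> u \<in> borel_measurable borel"
proof -
  have [measurable]: "(\<lambda>x. inverse (snd x) *\<^sub>R fst x) \<in> (borel :: 'n space measure) \<rightarrow>\<^sub>M borel"
    unfolding borel_prod[symmetric] by measurable
  have [measurable]: "snd \<in> (borel :: 'n space measure) \<rightarrow>\<^sub>M borel"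
    unfolding borel_prod[symmetric] by measurable
  show ?thesis unfolding hom_ext_def[abs_def] by measurable
qed

lemma AE_snd_nonzero: "AE x in (lborel :: 'n::finite space measure). snd x \<noteq> 0"
proof -
  have "AE x in (lborel \<Otimes>\<^sub>M lborel :: 'n space measure). snd x \<noteq> 0"
  proof (rule lborel_pair.AE_pair_measure)
    show "{x \<in> space (lborel \<Otimes>\<^sub>M lborel). snd x \<noteq> 0} \<in> sets (lborel \<Otimes>\<^sub>M (lborel :: real measure))"
      by measurable
    show "AE x in lborel. AE y in lborel. snd (x, y) \<noteq> (0::real)"
      by (simp add: AE_lborel_singleton)
  qed
  then show ?thesis unfolding lborel_prod .
qed

lemma hom_ext_flat:
  fixes v :: "'n::finite space \<Rightarrow> complex"
  assumes "snd x \<noteq> 0"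
  shows "hom_ext lam \<epsilon> (flat lam \<epsilon> v) x = hom_comp lam \<epsilon> v x"
proof -
  have "x = snd x *\<^sub>R (inverse (snd x) *\<^sub>R fst x, 1)"
    using assms by (simp add: prod_eq_iff)
  then show ?thesis
    using hom_comp_homogeneous[OF assms] unfolding hom_ext_def flat_def by metis
qed

lemma
  fixes u :: "real ^ 'n::finite \<Rightarrow> complex" and \<psi> :: "'n space \<Rightarrow> complex"
  assumes u [measurable]: "u \<in> borel_measurable borel"
    and int: "integrable lborel (\<lambda>s. norm (u s) * norm (s, 1::real) powr (- (real CARD('n) + 1) / 2))"
    and \<psi>: "rapid \<psi>"
  shows hom_ext_pairing_integrable: "integrable lborel (\<lambda>x. hom_ext lam \<epsilon> u x * \<psi> x)"
    and flat_pairing_integrable: "integrable lborel (\<lambda>s. u s * flat (- lam) \<epsilon> \<psi> s)"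
    and hom_ext_pairing: "(LINT x|lborel. hom_ext lam \<epsilon> u x * \<psi> x) = of_real (4 * pi) * (LINT s|lborel. u s * flat (- lam) \<epsilon> \<psi> s)"
proof -
  have [measurable]: "\<psi> \<in> borel_measurable borel" using \<psi> by (rule rapid_borel)
  obtain C where C: "C \<ge> 0"
    "\<And>\<epsilon> lam x. x \<noteq> 0 \<Longrightarrow> integrable lborel (\<lambda>t. spow \<epsilon> (hexp CARD('n) lam) t * \<psi> (t *\<^sub>R x))"
    "\<And>\<epsilon> lam x. x \<noteq> 0 \<Longrightarrow> (LINT t|lborel. norm (spow \<epsilon> (hexp CARD('n) lam) t * \<psi> (t *\<^sub>R x))) \<le> C * norm x powr (- (real CARD('n) + 1) / 2)"
    by (rule hom_comp_line[OF \<psi>]) (rule that, assumption+)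
  have nz: "(s, 1::real) \<noteq> 0" for s :: "real^'n" by (simp add: prod_eq_iff)
  let ?e = "hexp CARD('n) (- lam)"
  \<comment> \<open>In the coordinates \<tau> (s, 1) the Jacobian |\<tau>|^n raises the exponent -
    (n + 1)/2 - i lam to (n - 1)/2 - i lam. The integral over \<tau> is then the one defining
    \<open>flat (- lam) \<epsilon> \<psi> s\<close>, up to the normalizing factor 4 \<pi>.\<close>
  define F where "F p = u (fst p) * (spow \<epsilon> ?e (snd p) * \<psi> (snd p *\<^sub>R (fst p, 1)))" for p :: "'n space"
  have F: "of_real (\<bar>snd p\<bar> ^ CARD('n)) * (hom_ext lam \<epsilon> u (snd p *\<^sub>R (fst p, 1)) * \<psi> (snd p *\<^sub>R (fst p, 1))) = F p" for p
  proof (cases "snd p = 0")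
    case False
    have "- hexp CARD('n) lam - 1 + of_nat CARD('n) = ?e"
      by (simp add: field_simps)
    then have "of_real (\<bar>snd p\<bar> ^ CARD('n)) * spow \<epsilon> (- hexp CARD('n) lam - 1) (snd p) = spow \<epsilon> ?e (snd p)"
      by (simp only: spow_times_abs_power)
    then show ?thesis
      unfolding F_def hom_ext_def using False by (simp add: mult.assoc[symmetric])
  qed (simp add: F_def)
  have Fm [measurable]: "F \<in> borel_measurable (lborel \<Otimes>\<^sub>M lborel)"
    unfolding F_def by measurable
  have iF: "integrable (lborel \<Otimes>\<^sub>M lborel) F"
  proof (rule lborel_pair.Fubini_integrable[OF Fm])
    show "AE s in lborel. integrable lborel (\<lambda>\<tau>. F (s, \<tau>))"
      unfolding F_def fst_conv snd_conv by (intro AE_I2 integrable_mult_right C(2) nz)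
    have n: "(LINT \<tau>|lborel. norm (F (s, \<tau>))) = norm (u s) * (LINT \<tau>|lborel. norm (spow \<epsilon> ?e \<tau> * \<psi> (\<tau> *\<^sub>R (s, 1))))" for s
      unfolding F_def by (simp add: norm_mult)
    show "integrable lborel (\<lambda>s. LINT \<tau>|lborel. norm (F (s, \<tau>)))"
    proof (rule Bochner_Integration.integrable_bound)
      show "integrable lborel (\<lambda>s. C * (norm (u s) * norm (s, 1::real) powr (- (real CARD('n) + 1) / 2)))"
        by (intro integrable_mult_right int)
      show "AE s in lborel. norm (LINT \<tau>|lborel. norm (F (s, \<tau>))) \<le> norm (C * (norm (u s) * norm (s, 1::real) powr (- (real CARD('n) + 1) / 2)))"
      proof (rule AE_I2)
        fix s
        have "(LINT \<tau>|lborel. norm (F (s, \<tau>))) \<le> norm (u s) * (C * norm (s, 1::real) powr (- (real CARD('n) + 1) / 2))"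
          unfolding n by (intro mult_left_mono C(3)[OF nz]) simp
        moreover have "0 \<le> (LINT \<tau>|lborel. norm (F (s, \<tau>)))"
          by (rule Bochner_Integration.integral_nonneg) simp
        ultimately show "norm (LINT \<tau>|lborel. norm (F (s, \<tau>))) \<le> norm (C * (norm (u s) * norm (s, 1::real) powr (- (real CARD('n) + 1) / 2)))"
          using C(1) by (simp add: abs_mult mult_ac)
      qed
    qed measurable
  qed
  show "integrable lborel (\<lambda>x. hom_ext lam \<epsilon> u x * \<psi> x)"
    by (subst integrable_polar) (use iF in \<open>simp_all only: F eta_contract_eq\<close>, measurable)
  have inner: "(LINT \<tau>|lborel. F (s, \<tau>)) = of_real (4 * pi) * (u s * flat (- lam) \<epsilon> \<psi> s)" for s
    unfolding F_def flat_def hom_comp_def by simp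
  have "integrable lborel (\<lambda>s. LINT \<tau>|lborel. F (s, \<tau>))"
    by (rule lborel_pair.integrable_fst'[OF iF])
  from integrable_mult_right[OF this[unfolded inner], of "inverse (of_real (4 * pi))"]
  show "integrable lborel (\<lambda>s. u s * flat (- lam) \<epsilon> \<psi> s)"
    by (simp add: mult.assoc[symmetric])
  have "(LINT x|lborel. hom_ext lam \<epsilon> u x * \<psi> x) = (LINT p|(lborel \<Otimes>\<^sub>M lborel). F p)"
    by (subst integral_polar) (simp_all only: F, measurable)
  also have "\<dots> = (LINT s|lborel. LINT \<tau>|lborel. F (s, \<tau>))"
    by (rule lborel_pair.integral_fst'[OF iF, symmetric])
  finally show "(LINT x|lborel. hom_ext lam \<epsilon> u x * \<psi> x) = of_real (4 * pi) * (LINT s|lborel. u s * flat (- lam) \<epsilon> \<psi> s)"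
    unfolding inner by simp
qed

text \<open>The weight is square integrable itself, so 2 a b \<le> a^2 + b^2 suffices. This is the
  condition under which homogeneous extensions are paired with test functions.\<close>

lemma square_integrable_section_weight:
  fixes u :: "real ^ 'n::finite \<Rightarrow> complex"
  assumes u: "square_integrable u"
  shows "integrable lborel (\<lambda>s. norm (u s) * norm (s, 1::real) powr (- (real CARD('n) + 1) / 2))"
proof -
  have [measurable]: "u \<in> borel_measurable borel" using u by (simp add: square_integrable_def)
  show ?thesis
  proof (rule Bochner_Integration.integrable_bound)
    show "integrable lborel (\<lambda>s::real^'n. (norm (u s))\<^sup>2 + norm (s, 1::real) powr (- (real CARD('n) + 1)))"
      using u integrable_section_weight[where 'n='n] by (intro Bochner_Integration.integrable_add) (auto simp: square_integrable_def)
    show "AE s in lborel. norm (norm (u s) * norm (s, 1::real) powr (- (real CARD('n) + 1) / 2)) \<le> norm ((norm (u s))\<^sup>2 + norm (s, 1::real) powr (- (real CARD('n) + 1)))"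
    proof (rule AE_I2)
      fix s :: "real^'n"
      let ?w = "norm (s, 1::real) powr (- (real CARD('n) + 1) / 2)"
      have "2 * (norm (u s) * ?w) \<le> (norm (u s))\<^sup>2 + ?w\<^sup>2"
        using sum_squares_bound[of "norm (u s)" ?w] by simp
      moreover have "0 \<le> norm (u s) * ?w" by simp
      ultimately have "norm (u s) * ?w \<le> (norm (u s))\<^sup>2 + ?w\<^sup>2" by linarith
      then show "norm (norm (u s) * ?w) \<le> norm ((norm (u s))\<^sup>2 + norm (s, 1::real) powr (- (real CARD('n) + 1)))"
        unfolding section_weight_square[symmetric] by simp
    qed
  qed measurable
qed


lemma hom_comp_cong_flat:
  fixes v :: "'n::finite space \<Rightarrow> complex"
  shows "AE x in lborel. hom_ext lam \<epsilon> (flat lam \<epsilon> v) x = hom_comp lam \<epsilon> v x"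
  using AE_snd_nonzero by eventually_elim (rule hom_ext_flat)

lemma
  fixes v \<psi> :: "'n::finite space \<Rightarrow> complex"
  assumes v: "rapid v" and \<psi>: "rapid \<psi>"
  shows hom_comp_pairing_integrable: "integrable lborel (\<lambda>x. hom_comp lam \<epsilon> v x * \<psi> x)"
    and hom_comp_pairing: "(LINT x|lborel. hom_comp lam \<epsilon> v x * \<psi> x) = of_real (4 * pi) * (LINT s|lborel. flat lam \<epsilon> v s * flat (- lam) \<epsilon> \<psi> s)"
proof -
  have [measurable]: "v \<in> borel_measurable borel" "\<psi> \<in> borel_measurable borel"
    using v \<psi> by (auto intro: rapid_borel)
  note sq = square_integrable_section_weight[OF square_integrable_flat[OF v]]
  have ae: "AE x in lborel. hom_ext lam \<epsilon> (flat lam \<epsilon> v) x * \<psi> x = hom_comp lam \<epsilon> v x * \<psi> x"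
    using hom_comp_cong_flat[of lam \<epsilon> v] by eventually_elim simp
  have fm: "flat lam \<epsilon> v \<in> borel_measurable borel" by measurable
  note hom_ext_borel[OF fm, measurable]
  have m1: "(\<lambda>x. hom_ext lam \<epsilon> (flat lam \<epsilon> v) x * \<psi> x) \<in> borel_measurable lborel"
    by measurable
  have m2: "(\<lambda>x. hom_comp lam \<epsilon> v x * \<psi> x) \<in> borel_measurable lborel"
    by measurable
  show "integrable lborel (\<lambda>x. hom_comp lam \<epsilon> v x * \<psi> x)"
    using hom_ext_pairing_integrable[OF fm sq \<psi>] integrable_cong_AE[OF m1 m2 ae] by blast
  show "(LINT x|lborel. hom_comp lam \<epsilon> v x * \<psi> x) = of_real (4 * pi) * (LINT s|lborel. flat lam \<epsilon> v s * flat (- lam) \<epsilon> \<psi> s)"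
    using hom_ext_pairing[OF fm sq \<psi>] integral_cong_AE[OF m1 m2 ae] by metis
qed

text \<open>Almost everywhere |x|^(- (n + 1)/2) is the absolute value of the homogeneous extension
  of its restriction to the points (s, 1), which is square integrable. The singularity at 0 is
  thereby covered by the pairing already treated.\<close>

lemma integrable_radial_weight:
  fixes \<psi> :: "'n::finite space \<Rightarrow> complex"
  assumes \<psi>: "rapid \<psi>"
  shows "integrable lborel (\<lambda>x. norm x powr (- (real CARD('n) + 1) / 2) * norm (\<psi> x))"
proof -
  let ?p = "- (real CARD('n) + 1) / 2"
  have [measurable]: "\<psi> \<in> borel_measurable borel" using \<psi> by (rule rapid_borel)
  define u where "u s = complex_of_real (norm (s, 1::real) powr ?p)" for s :: "real^'n"
  have um: "u \<in> borel_measurable borel"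
    unfolding u_def by measurable
  have nu: "(norm (u s))\<^sup>2 = norm (s, 1::real) powr (- (real CARD('n) + 1))" for s
    unfolding u_def norm_of_real power2_abs by (rule section_weight_square)
  have "square_integrable u"
    unfolding square_integrable_def nu using um integrable_section_weight by (rule conjI)
  then have "integrable lborel (\<lambda>x. norm (hom_ext 0 0 u x * \<psi> x))"
    by (intro integrable_norm hom_ext_pairing_integrable[OF um _ \<psi>] square_integrable_section_weight)
  moreover have "AE x in lborel. norm (hom_ext 0 0 u x * \<psi> x) = norm x powr ?p * norm (\<psi> x)"
    using AE_snd_nonzero
  proof eventually_elim
    case (elim x)
    have "\<bar>snd x\<bar> * norm (inverse (snd x) *\<^sub>R fst x, 1::real) = norm (snd x *\<^sub>R (inverse (snd x) *\<^sub>R fst x, 1::real))"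
      by (simp only: norm_scaleR)
    also have "snd x *\<^sub>R (inverse (snd x) *\<^sub>R fst x, 1::real) = x"
      using elim by (simp add: prod_eq_iff)
    finally have eq: "norm x powr ?p = \<bar>snd x\<bar> powr ?p * norm (inverse (snd x) *\<^sub>R fst x, 1::real) powr ?p"
      by (metis abs_ge_zero norm_ge_zero powr_mult)
    have re: "Re (- hexp CARD('n) 0 - 1) = ?p" by (simp add: field_simps)
    show ?case
      unfolding hom_ext_def norm_mult norm_spow u_def norm_of_real re eq abs_of_nonneg[OF powr_ge_zero] ..
  qed
  moreover have "(\<lambda>x. norm (hom_ext 0 0 u x * \<psi> x)) \<in> borel_measurable lborel"
    using hom_ext_borel[OF um, measurable] by measurable
  moreover have "(\<lambda>x. norm x powr ?p * norm (\<psi> x)) \<in> borel_measurable lborel"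
    by measurable
  ultimately show ?thesis
    using integrable_cong_AE by blast
qed

section \<open>Fourier transforms of homogeneous components\<close>

lemma fourier_scale:
  fixes f :: "'a::euclidean_space \<Rightarrow> complex"
  assumes t: "t \<noteq> 0"
  shows "fourier f (inverse t *\<^sub>R y) = of_real (\<bar>t\<bar> ^ DIM('a)) * fourier (\<lambda>x. f (t *\<^sub>R x)) y"
  unfolding fourier_def
  by (subst integral_lborel_scale[OF t]) (use t in \<open>simp add: scaleR_conv_of_real mult.assoc[symmetric]\<close>)

text \<open>Changing variables moves the dilation from \<open>v\<close> to
  \<open>fourier \<phi>\<close>, where it becomes the opposite dilation of \<phi>; the Jacobians
  cancel.\<close>

lemma fourier_multiplication_scale:
  fixes v \<phi> :: "'a::euclidean_space \<Rightarrow> complex"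
  assumes v: "integrable lborel v" and \<phi>: "integrable lborel \<phi>" and t: "t \<noteq> 0"
  shows "(LINT x|lborel. v (t *\<^sub>R x) * fourier \<phi> x) = (LINT y|lborel. fourier v y * \<phi> (t *\<^sub>R y))"
proof -
  have i: "inverse t \<noteq> 0" using t by simp
  have "(LINT x|lborel. v (t *\<^sub>R x) * fourier \<phi> x) = \<bar>inverse t\<bar> ^ DIM('a) *\<^sub>R (LINT x|lborel. v x * fourier \<phi> (inverse t *\<^sub>R x))"
    by (subst integral_lborel_scale[OF i]) (use t in simp)
  also have "\<dots> = (LINT x|lborel. v x * fourier (\<lambda>x. \<phi> (t *\<^sub>R x)) x)"
    using t by (simp add: fourier_scale[OF t] scaleR_conv_of_real mult.left_commute[of "v _"] power_inverse)
  also have "\<dots> = (LINT y|lborel. fourier v y * \<phi> (t *\<^sub>R y))"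
    using v \<phi> t by (intro fourier_multiplication[symmetric]) (simp_all add: integrable_lborel_scale)
  finally show ?thesis .
qed

text \<open>The integral over t of the absolute value is O(|x|^(- (n + 1)/2)), which is integrable
  against a rapidly decreasing function.\<close>

lemma hom_comp_Fubini:
  fixes v w :: "'n::finite space \<Rightarrow> complex"
  assumes vw: "rapid v" "rapid w"
  shows "integrable (lborel \<Otimes>\<^sub>M lborel) (\<lambda>(x, t). spow \<epsilon> (hexp CARD('n) lam) t * v (t *\<^sub>R x) * w x)"
proof (rule lborel_pair.Fubini_integrable)
  have [measurable]: "v \<in> borel_measurable borel" "w \<in> borel_measurable borel"
    using vw by (auto intro: rapid_borel)
  obtain C where C: "C \<ge> 0"
    "\<And>\<epsilon> lam x. x \<noteq> 0 \<Longrightarrow> integrable lborel (\<lambda>t. spow \<epsilon> (hexp CARD('n) lam) t * v (t *\<^sub>R x))"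
    "\<And>\<epsilon> lam x. x \<noteq> 0 \<Longrightarrow> (LINT t|lborel. norm (spow \<epsilon> (hexp CARD('n) lam) t * v (t *\<^sub>R x))) \<le> C * norm x powr (- (real CARD('n) + 1) / 2)"
    by (rule hom_comp_line[OF vw(1)]) (rule that, assumption+)
  show "(\<lambda>(x, t). spow \<epsilon> (hexp CARD('n) lam) t * v (t *\<^sub>R x) * w x) \<in> borel_measurable (lborel \<Otimes>\<^sub>M lborel)"
    unfolding case_prod_unfold by measurable
  have x0: "AE x in lborel. x \<noteq> (0::'n space)" by (rule AE_lborel_singleton)
  then show "AE x in lborel. integrable lborel (\<lambda>t. case (x, t) of (x, t) \<Rightarrow> spow \<epsilon> (hexp CARD('n) lam) t * v (t *\<^sub>R x) * w x)"
    unfolding case_prod_unfold fst_conv snd_conv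
    by eventually_elim (intro integrable_mult_left C(2))
  show "integrable lborel (\<lambda>x. LINT t|lborel. norm (case (x, t) of (x, t) \<Rightarrow> spow \<epsilon> (hexp CARD('n) lam) t * v (t *\<^sub>R x) * w x))"
  proof (rule Bochner_Integration.integrable_bound)
    show "integrable lborel (\<lambda>x. C * (norm x powr (- (real CARD('n) + 1) / 2) * norm (w x)))"
      by (intro integrable_mult_right integrable_radial_weight vw)
    show "AE x in lborel. norm (LINT t|lborel. norm (case (x, t) of (x, t) \<Rightarrow> spow \<epsilon> (hexp CARD('n) lam) t * v (t *\<^sub>R x) * w x))
        \<le> norm (C * (norm x powr (- (real CARD('n) + 1) / 2) * norm (w x)))"
      using x0
    proof eventually_elim
      case (elim x)
      have "(LINT t|lborel. norm (spow \<epsilon> (hexp CARD('n) lam) t * v (t *\<^sub>R x) * w x)) = (LINT t|lborel. norm (spow \<epsilon> (hexp CARD('n) lam) t * v (t *\<^sub>R x))) * norm (w x)"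
        by (simp only: norm_mult[of "_ * _" "w x"] integral_mult_left_zero)
      also have "\<dots> \<le> C * norm x powr (- (real CARD('n) + 1) / 2) * norm (w x)"
        by (intro mult_right_mono C(3) elim) simp
      finally have le: "(LINT t|lborel. norm (spow \<epsilon> (hexp CARD('n) lam) t * v (t *\<^sub>R x) * w x)) \<le> C * norm x powr (- (real CARD('n) + 1) / 2) * norm (w x)" .
      have "0 \<le> (LINT t|lborel. norm (spow \<epsilon> (hexp CARD('n) lam) t * v (t *\<^sub>R x) * w x))"
        by (rule Bochner_Integration.integral_nonneg) simp
      with le C(1) show ?case by (simp add: mult.assoc abs_mult)
    qed
  qed measurable
qed

text \<open>With the integral over t outside, the multiplication formula moves the dilation from
  \<open>v\<close> to \<phi> for each t \<noteq> 0. This gives the component of \<phi> for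
  \<open>lam\<close> paired with \<open>fourier v\<close>; the symmetry of the pairing, which
  exchanges \<open>lam\<close> and \<open>- lam\<close>, does the rest.\<close>

theorem hom_comp_fourier:
  fixes v \<phi> :: "'n::finite space \<Rightarrow> complex"
  assumes v: "rapid v" and \<phi>: "rapid \<phi>" and Fv: "rapid (fourier v)" and F\<phi>: "rapid (fourier \<phi>)"
  shows "(LINT x|lborel. hom_comp lam \<epsilon> v x * fourier \<phi> x) = (LINT x|lborel. hom_comp (- lam) \<epsilon> (fourier v) x * \<phi> x)"
proof -
  have [measurable]: "v \<in> borel_measurable borel" "\<phi> \<in> borel_measurable borel"
    "fourier v \<in> borel_measurable borel" "fourier \<phi> \<in> borel_measurable borel"
    using assms by (auto intro: rapid_borel)
  let ?e = "hexp CARD('n) lam"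
  note int = hom_comp_Fubini[of _ _ \<epsilon> lam]
  have "of_real (4 * pi) * (LINT x|lborel. hom_comp lam \<epsilon> v x * fourier \<phi> x) = (LINT x|lborel. LINT t|lborel. spow \<epsilon> ?e t * v (t *\<^sub>R x) * fourier \<phi> x)"
    unfolding hom_comp_def by simp
  also have "\<dots> = (LINT t|lborel. LINT x|lborel. spow \<epsilon> ?e t * v (t *\<^sub>R x) * fourier \<phi> x)"
    by (rule lborel_pair.Fubini_integral[symmetric]) (rule int[OF v F\<phi>])
  also have "\<dots> = (LINT t|lborel. LINT x|lborel. spow \<epsilon> ?e t * \<phi> (t *\<^sub>R x) * fourier v x)"
  proof (rule integral_cong_AE)
    have "AE t in lborel. t \<noteq> (0::real)" by (rule AE_lborel_singleton)
    then show "AE t in lborel. (LINT x|lborel. spow \<epsilon> ?e t * v (t *\<^sub>R x) * fourier \<phi> x) = (LINT x|lborel. spow \<epsilon> ?e t * \<phi> (t *\<^sub>R x) * fourier v x)"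
    proof eventually_elim
      case (elim t)
      show ?case
        using fourier_multiplication_scale[OF rapid_integrable[OF v] rapid_integrable[OF \<phi>] elim]
        by (simp add: mult.assoc mult.commute[of "\<phi> _"])
    qed
  qed measurable
  also have "\<dots> = (LINT x|lborel. LINT t|lborel. spow \<epsilon> ?e t * \<phi> (t *\<^sub>R x) * fourier v x)"
    by (rule lborel_pair.Fubini_integral) (rule int[OF \<phi> Fv])
  also have "\<dots> = of_real (4 * pi) * (LINT x|lborel. hom_comp lam \<epsilon> \<phi> x * fourier v x)"
    unfolding hom_comp_def by simp
  also have "(LINT x|lborel. hom_comp lam \<epsilon> \<phi> x * fourier v x) = (LINT x|lborel. hom_comp (- lam) \<epsilon> (fourier v) x * \<phi> x)"
    using hom_comp_pairing[OF \<phi> Fv, of lam \<epsilon>] hom_comp_pairing[OF Fv \<phi>, of "- lam" \<epsilon>] by (simp add: mult.commute)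
  finally show ?thesis by simp
qed

lemma schwartz_rapid_fourier: "v \<in> schwartz \<Longrightarrow> rapid (fourier v)"
  by (intro schwartz_rapid fourier_schwartz)

lemma distr_fourier_hom_comp:
  fixes v :: "'n::finite space \<Rightarrow> complex"
  assumes v: "v \<in> schwartz"
  shows "distr_fourier (hom_comp lam \<epsilon> v) (hom_comp (- lam) \<epsilon> (fourier v))"
  unfolding distr_fourier_def
proof (intro conjI ballI)
  note r = schwartz_rapid[OF v] schwartz_rapid_fourier[OF v]
  show "hom_comp lam \<epsilon> v \<in> borel_measurable borel" "hom_comp (- lam) \<epsilon> (fourier v) \<in> borel_measurable borel"
    using r by (auto intro: rapid_borel hom_comp_borel)
  fix \<phi> :: "'n space \<Rightarrow> complex" assume "\<phi> \<in> schwartz"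
  note s = schwartz_rapid[OF this] schwartz_rapid_fourier[OF this]
  show "integrable lborel (\<lambda>x. hom_comp lam \<epsilon> v x * fourier \<phi> x)"
    "integrable lborel (\<lambda>\<xi>. hom_comp (- lam) \<epsilon> (fourier v) \<xi> * \<phi> \<xi>)"
    by (intro hom_comp_pairing_integrable r s)+
  show "(LINT x|lborel. hom_comp lam \<epsilon> v x * fourier \<phi> x) = (LINT \<xi>|lborel. hom_comp (- lam) \<epsilon> (fourier v) \<xi> * \<phi> \<xi>)"
    by (rule hom_comp_fourier[OF r(1) s(1) r(2) s(2)])
qed

section \<open>The intertwining operator\<close>

text \<open>The Cauchy-Schwarz inequality enters in the form |a b| \<le> |a|^2 / r + r |b|^2, with r
  depending on the index.\<close>

lemma L2_tendsto_pairing: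
  assumes uk: "L2_tendsto uk u" and q: "square_integrable q"
  shows "(\<lambda>k. LINT s|lborel. uk k s * q s) \<longlonglongrightarrow> (LINT s|lborel. u s * q s)"
proof -
  have prod: "integrable lborel (\<lambda>s. f s * g s)" if "square_integrable f" "square_integrable g" for f g :: "'a \<Rightarrow> complex"
  proof -
    have [measurable]: "f \<in> borel_measurable borel" "g \<in> borel_measurable borel"
      using that by (auto simp: square_integrable_def)
    show ?thesis
    proof (rule Bochner_Integration.integrable_bound)
      show "integrable lborel (\<lambda>s. (norm (f s))\<^sup>2 + (norm (g s))\<^sup>2)"
        using that by (intro Bochner_Integration.integrable_add) (auto simp: square_integrable_def)
      show "AE s in lborel. norm (f s * g s) \<le> norm ((norm (f s))\<^sup>2 + (norm (g s))\<^sup>2)"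
      proof (rule AE_I2)
        fix s
        have "2 * (norm (f s) * norm (g s)) \<le> (norm (f s))\<^sup>2 + (norm (g s))\<^sup>2"
          using sum_squares_bound[of "norm (f s)" "norm (g s)"] by simp
        moreover have "0 \<le> norm (f s) * norm (g s)" by simp
        ultimately have "norm (f s) * norm (g s) \<le> (norm (f s))\<^sup>2 + (norm (g s))\<^sup>2" by linarith
        then show "norm (f s * g s) \<le> norm ((norm (f s))\<^sup>2 + (norm (g s))\<^sup>2)"
          by (simp add: norm_mult)
      qed
    qed measurable
  qed
  have u: "square_integrable u" and uk': "square_integrable (uk k)" for k
    using uk by (auto simp: L2_tendsto_def)
  have [measurable]: "u \<in> borel_measurable borel" "uk k \<in> borel_measurable borel" "q \<in> borel_measurable borel" for k
    using u uk' q by (auto simp: square_integrable_def)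
  have d: "square_integrable (\<lambda>s. uk k s - u s)" for k
    unfolding square_integrable_def
  proof
    show "integrable lborel (\<lambda>s. (norm (uk k s - u s))\<^sup>2)"
    proof (rule Bochner_Integration.integrable_bound)
      show "integrable lborel (\<lambda>s. 2 * (norm (uk k s))\<^sup>2 + 2 * (norm (u s))\<^sup>2)"
        using u uk'[of k] by (intro Bochner_Integration.integrable_add integrable_mult_right) (auto simp: square_integrable_def)
      show "AE s in lborel. norm ((norm (uk k s - u s))\<^sup>2) \<le> norm (2 * (norm (uk k s))\<^sup>2 + 2 * (norm (u s))\<^sup>2)"
      proof (rule AE_I2)
        fix s
        have "(norm (uk k s - u s))\<^sup>2 \<le> (norm (uk k s) + norm (u s))\<^sup>2"
          by (intro power_mono norm_triangle_ineq4) simp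
        also have "\<dots> \<le> 2 * (norm (uk k s))\<^sup>2 + 2 * (norm (u s))\<^sup>2"
          using sum_squares_bound[of "norm (uk k s)" "norm (u s)"] by (simp add: power2_sum)
        finally show "norm ((norm (uk k s - u s))\<^sup>2) \<le> norm (2 * (norm (uk k s))\<^sup>2 + 2 * (norm (u s))\<^sup>2)"
          by simp
      qed
    qed measurable
  qed measurable
  define D where "D k = (LINT s|lborel. (norm (uk k s - u s))\<^sup>2)" for k
  define Q where "Q = (LINT s|lborel. (norm (q s))\<^sup>2)"
  have D0: "D \<longlonglongrightarrow> 0" using uk by (simp add: L2_tendsto_def D_def[abs_def])
  have Dn: "D k \<ge> 0" for k unfolding D_def by (rule Bochner_Integration.integral_nonneg) simp
  \<comment> \<open>Essentially sqrt (D k); the summand 1 / (k + 1) keeps \<open>r k\<close>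
    positive even if \<open>D k\<close> is 0. Both D k / r k and r k tend to 0.\<close>
  define r where "r k = sqrt (D k) + 1 / real (Suc k)" for k
  have rp: "r k > 0" for k unfolding r_def using Dn[of k] by (intro add_nonneg_pos) auto
  have Dr: "D k / r k \<le> sqrt (D k)" for k
  proof -
    have "D k = sqrt (D k) * sqrt (D k)" using Dn by simp
    also have "\<dots> \<le> sqrt (D k) * r k" using Dn by (intro mult_left_mono) (auto simp: r_def)
    finally show ?thesis using rp[of k] by (simp add: pos_divide_le_eq)
  qed
  have "(\<lambda>k. LINT s|lborel. (uk k s - u s) * q s) \<longlonglongrightarrow> 0"
  proof (rule Lim_null_comparison)
    show "\<forall>\<^sub>F k in sequentially. norm (LINT s|lborel. (uk k s - u s) * q s) \<le> sqrt (D k) + r k * Q"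
    proof (rule always_eventually, rule allI)
      fix k
      have "norm (LINT s|lborel. (uk k s - u s) * q s) \<le> (LINT s|lborel. inverse (r k) * (norm (uk k s - u s))\<^sup>2 + r k * (norm (q s))\<^sup>2)"
      proof (rule Bochner_Integration.integral_norm_bound_integral)
        show "integrable lborel (\<lambda>s. (uk k s - u s) * q s)" by (rule prod[OF d q])
        show "integrable lborel (\<lambda>s. inverse (r k) * (norm (uk k s - u s))\<^sup>2 + r k * (norm (q s))\<^sup>2)"
          using d q by (intro Bochner_Integration.integrable_add integrable_mult_right) (auto simp: square_integrable_def)
        fix s
        define A where "A = norm (uk k s - u s)"
        define B where "B = norm (q s)"
        have "0 \<le> inverse (r k) * (A - r k * B)\<^sup>2" using rp[of k] by simp
        also have "\<dots> = inverse (r k) * A\<^sup>2 + r k * B\<^sup>2 - 2 * (A * B)"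
          using rp[of k] by (simp add: power2_eq_square algebra_simps)
        finally have "2 * (A * B) \<le> inverse (r k) * A\<^sup>2 + r k * B\<^sup>2" by simp
        moreover have "0 \<le> A * B" by (simp add: A_def B_def)
        ultimately show "norm ((uk k s - u s) * q s) \<le> inverse (r k) * (norm (uk k s - u s))\<^sup>2 + r k * (norm (q s))\<^sup>2"
          unfolding norm_mult A_def B_def by linarith
      qed
      also have "\<dots> = D k / r k + r k * Q"
        unfolding D_def Q_def using d q by (subst Bochner_Integration.integral_add) (auto simp: square_integrable_def divide_inverse mult.commute)
      also have "\<dots> \<le> sqrt (D k) + r k * Q" using Dr[of k] by simp
      finally show "norm (LINT s|lborel. (uk k s - u s) * q s) \<le> sqrt (D k) + r k * Q" .
    qed
    have "(\<lambda>k. sqrt (D k)) \<longlonglongrightarrow> sqrt 0" by (intro tendsto_intros D0)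
    moreover have "(\<lambda>k. 1 / real (Suc k)) \<longlonglongrightarrow> 0" by (rule LIMSEQ_Suc[OF lim_1_over_n])
    ultimately have "(\<lambda>k. sqrt (D k) + r k * Q) \<longlonglongrightarrow> sqrt 0 + (sqrt 0 + 0) * Q"
      unfolding r_def by (intro tendsto_add tendsto_mult tendsto_const)
    then show "(\<lambda>k. sqrt (D k) + r k * Q) \<longlonglongrightarrow> 0" by simp
  qed
  moreover have "(LINT s|lborel. (uk k s - u s) * q s) = (LINT s|lborel. uk k s * q s) - (LINT s|lborel. u s * q s)" for k
    using prod[OF uk' q] prod[OF u q] by (simp add: left_diff_distrib)
  ultimately show ?thesis by (simp add: LIM_zero_iff)
qed

text \<open>For the approximating Schwartz functions this is the duality between the components of a
  function and of its Fourier transform; both sides are continuous for convergence in L2.\<close>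

lemma theta_graph_pairing:
  fixes u w :: "real ^ 'n::finite \<Rightarrow> complex"
  assumes g: "theta_graph lam \<epsilon> u w" and \<phi>: "rapid \<phi>" "rapid (fourier \<phi>)"
  shows "(LINT s|lborel. u s * flat (- lam) \<epsilon> (fourier \<phi>) s) = (LINT s|lborel. w s * flat lam \<epsilon> \<phi> s)"
proof -
  obtain v where v: "\<And>k. v k \<in> schwartz" "L2_tendsto (\<lambda>k. flat lam \<epsilon> (v k)) u"
      "L2_tendsto (\<lambda>k. flat (- lam) \<epsilon> (fourier (v k))) w"
    using g unfolding theta_graph_def by blast
  have eq: "(LINT s|lborel. flat lam \<epsilon> (v k) s * flat (- lam) \<epsilon> (fourier \<phi>) s) = (LINT s|lborel. flat (- lam) \<epsilon> (fourier (v k)) s * flat lam \<epsilon> \<phi> s)" for k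
  proof -
    note r = schwartz_rapid[OF v(1)] schwartz_rapid_fourier[OF v(1)]
    show ?thesis
      using hom_comp_fourier[OF r(1) \<phi>(1) r(2) \<phi>(2), of lam \<epsilon> k] hom_comp_pairing[OF r(1) \<phi>(2), of lam \<epsilon> k]
        hom_comp_pairing[OF r(2) \<phi>(1), of "- lam" \<epsilon> k] by simp
  qed
  note 1 = L2_tendsto_pairing[OF v(2) square_integrable_flat[OF \<phi>(2), of "- lam" \<epsilon>]]
  note 2 = L2_tendsto_pairing[OF v(3) square_integrable_flat[OF \<phi>(1), of lam \<epsilon>]]
  show ?thesis using LIMSEQ_unique[OF 1[unfolded eq] 2] .
qed

lemma theta_graph_square_integrable:
  "theta_graph lam \<epsilon> u w \<Longrightarrow> square_integrable u \<and> square_integrable w"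
  unfolding theta_graph_def L2_tendsto_def by blast

text \<open>The difference of two values pairs to 0 with the components of all Gaussians, so its
  homogeneous extension is orthogonal to all Gaussians and vanishes almost everywhere. Projective
  coordinates carry this back to functions of s.\<close>

lemma theta_graph_unique:
  fixes u w w' :: "real ^ 'n::finite \<Rightarrow> complex"
  assumes g: "theta_graph lam \<epsilon> u w" and g': "theta_graph lam \<epsilon> u w'"
  shows "AE s in lborel. w s = w' s"
proof -
  have sq: "square_integrable w" "square_integrable w'"
    using g g' theta_graph_square_integrable by blast+
  have [measurable]: "w \<in> borel_measurable borel" "w' \<in> borel_measurable borel"
    using sq by (auto simp: square_integrable_def)
  define d where "d s = w s - w' s" for s
  have dm [measurable]: "d \<in> borel_measurable borel" unfolding d_def by measurable
  have int: "integrable lborel (\<lambda>s. norm (d s) * norm (s, 1::real) powr (- (real CARD('n) + 1) / 2))"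
  proof (rule Bochner_Integration.integrable_bound)
    show "integrable lborel (\<lambda>s. norm (w s) * norm (s, 1::real) powr (- (real CARD('n) + 1) / 2) + norm (w' s) * norm (s, 1::real) powr (- (real CARD('n) + 1) / 2))"
      by (intro Bochner_Integration.integrable_add square_integrable_section_weight sq)
    show "AE s in lborel. norm (norm (d s) * norm (s, 1::real) powr (- (real CARD('n) + 1) / 2)) \<le> norm (norm (w s) * norm (s, 1::real) powr (- (real CARD('n) + 1) / 2) + norm (w' s) * norm (s, 1::real) powr (- (real CARD('n) + 1) / 2))"
      unfolding distrib_right[symmetric] d_def
      by (rule AE_I2) (simp add: abs_mult mult_right_mono norm_triangle_ineq4)
  qed measurable
  have ext [measurable]: "hom_ext (- lam) \<epsilon> d \<in> borel_measurable borel" by (rule hom_ext_borel[OF dm])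
  have "AE x in lborel. hom_ext (- lam) \<epsilon> d x = 0"
  proof (rule AE_zero_if_orthogonal_to_gauss[OF ext])
    fix c :: real and a :: "'n space" assume c: "c > 0"
    note \<phi> = rapid_gauss[OF c, of a] rapid_fourier_gauss[OF c, of a]
    show "integrable lborel (\<lambda>x. hom_ext (- lam) \<epsilon> d x * gauss c a x)"
      by (rule hom_ext_pairing_integrable[OF dm int \<phi>(1)])
    have "(LINT s|lborel. d s * flat lam \<epsilon> (gauss c a) s) = (LINT s|lborel. w s * flat lam \<epsilon> (gauss c a) s) - (LINT s|lborel. w' s * flat lam \<epsilon> (gauss c a) s)"
      unfolding d_def left_diff_distrib
      using flat_pairing_integrable[OF _ square_integrable_section_weight[OF sq(1)] \<phi>(1), of "- lam" \<epsilon>]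
        flat_pairing_integrable[OF _ square_integrable_section_weight[OF sq(2)] \<phi>(1), of "- lam" \<epsilon>]
      by (subst Bochner_Integration.integral_diff) auto
    also have "\<dots> = 0"
      using theta_graph_pairing[OF g \<phi>] theta_graph_pairing[OF g' \<phi>] by simp
    finally show "(LINT x|lborel. hom_ext (- lam) \<epsilon> d x * gauss c a x) = 0"
      by (simp add: hom_ext_pairing[OF dm int \<phi>(1)])
  qed
  then have "(\<integral>\<^sup>+x. norm (hom_ext (- lam) \<epsilon> d x) \<partial>lborel) = 0"
    by (subst nn_integral_0_iff_AE) auto
  then have "(\<integral>\<^sup>+s. \<integral>\<^sup>+\<tau>. ennreal (\<bar>\<tau>\<bar> ^ CARD('n) * norm (hom_ext (- lam) \<epsilon> d (\<tau> *\<^sub>R (s, 1)))) \<partial>lborel \<partial>lborel) = 0"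
    unfolding nn_integral_polar[OF ext] .
  then have "AE s in lborel. (\<integral>\<^sup>+\<tau>. ennreal (\<bar>\<tau>\<bar> ^ CARD('n) * norm (hom_ext (- lam) \<epsilon> d (\<tau> *\<^sub>R (s, 1)))) \<partial>lborel) = 0"
    by (subst (asm) nn_integral_0_iff_AE) measurable
  then show ?thesis
  proof eventually_elim
    case (elim s)
    have "AE \<tau> in lborel. ennreal (\<bar>\<tau>\<bar> ^ CARD('n) * norm (hom_ext (- lam) \<epsilon> d (\<tau> *\<^sub>R (s, 1)))) = 0"
      using elim by (subst (asm) nn_integral_0_iff_AE) measurable
    moreover have "AE \<tau> in lborel. \<tau> \<noteq> (0::real)" by (rule AE_lborel_singleton)
    \<comment> \<open>The statement does not involve \<tau>; since Lebesgue measure is not zero, its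
      holding almost everywhere means that it holds.\<close>
    ultimately have "AE \<tau> in (lborel :: real measure). d s = 0"
    proof eventually_elim
      case (elim \<tau>)
      then have "hom_ext (- lam) \<epsilon> d (\<tau> *\<^sub>R (s, 1)) = 0"
        using zero_less_power[of "\<bar>\<tau>\<bar>" "CARD('n)"] by (auto simp: ennreal_eq_0_iff mult_le_0_iff dest: leD)
      moreover have "spow \<epsilon> a \<tau> \<noteq> 0" for a
        using elim(2) by (simp add: spow_eq sgn_if)
      ultimately show ?case using elim(2) by (simp add: hom_ext_def)
    qed
    then have "d s = 0"
      by (simp add: eventually_const_iff ae_filter_eq_bot_iff emeasure_lborel_UNIV)
    then show ?case by (simp add: d_def)
  qed
qed

text \<open>The constant sequence \<open>v\<close> puts the expected pair into the graph, so the
  choice in \<open>theta\<close> succeeds and uniqueness applies. The chosen value is free on null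
  sets; its measurability is recorded because it enters integrands.\<close>

theorem
  fixes v :: "'n::finite space \<Rightarrow> complex"
  assumes v: "v \<in> schwartz"
  shows theta_flat: "AE s in lborel. theta lam \<epsilon> (flat lam \<epsilon> v) s = flat (- lam) \<epsilon> (fourier v) s"
    and theta_flat_borel: "theta lam \<epsilon> (flat lam \<epsilon> v) \<in> borel_measurable borel"
proof -
  have sq: "square_integrable (flat lam \<epsilon> v)" "square_integrable (flat (- lam) \<epsilon> (fourier v))"
    by (intro square_integrable_flat schwartz_rapid v fourier_schwartz)+
  have g: "theta_graph lam \<epsilon> (flat lam \<epsilon> v) (flat (- lam) \<epsilon> (fourier v))"
    unfolding theta_graph_def L2_tendsto_def using v sq by (intro exI[of _ "\<lambda>_. v"]) simp
  then have g': "theta_graph lam \<epsilon> (flat lam \<epsilon> v) (theta lam \<epsilon> (flat lam \<epsilon> v))"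
    unfolding theta_def by (rule someI[of "theta_graph lam \<epsilon> (flat lam \<epsilon> v)"])
  show "AE s in lborel. theta lam \<epsilon> (flat lam \<epsilon> v) s = flat (- lam) \<epsilon> (fourier v) s"
    by (rule theta_graph_unique[OF g' g])
  show "theta lam \<epsilon> (flat lam \<epsilon> v) \<in> borel_measurable borel"
    using theta_graph_square_integrable[OF g'] by (simp add: square_integrable_def)
qed

section \<open>Functions of symbol type along a direction\<close>

text \<open>Away from the origin, \<open>j\<close> derivatives of \<open>F p\<close> in the direction \<open>i\<close> cost a factor
  \<open>\<bar>\<xi>\<bar>\<close> powr \<open>- (m + j)\<close> for \<open>j \<le> k\<close>, uniformly in the parameter \<open>p\<close>.\<close>

primrec symb :: "'a::euclidean_space \<Rightarrow> nat \<Rightarrow> real \<Rightarrow> ('p \<Rightarrow> 'a \<Rightarrow> complex) \<Rightarrow> bool" where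
  "symb i 0 m F \<longleftrightarrow> (\<exists>C. \<forall>p \<xi>. \<xi> \<noteq> 0 \<longrightarrow> norm (F p \<xi>) \<le> C * norm \<xi> powr (- m))"
| "symb i (Suc k) m F \<longleftrightarrow> (\<exists>C. \<forall>p \<xi>. \<xi> \<noteq> 0 \<longrightarrow> norm (F p \<xi>) \<le> C * norm \<xi> powr (- m)) \<and>
    (\<exists>F'. (\<forall>p \<xi>. \<xi> \<noteq> 0 \<longrightarrow> ((\<lambda>s. F p (\<xi> + s *\<^sub>R i)) has_vector_derivative F' p \<xi>) (at 0)) \<and> symb i k (m + 1) F')"

lemma symb_bound:
  assumes "symb i k m F"
  obtains C where "C \<ge> 0" "\<And>p \<xi>. \<xi> \<noteq> 0 \<Longrightarrow> norm (F p \<xi>) \<le> C * norm \<xi> powr (- m)"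
proof -
  obtain C where C: "\<And>p \<xi>. \<xi> \<noteq> 0 \<Longrightarrow> norm (F p \<xi>) \<le> C * norm \<xi> powr (- m)"
    using assms by (cases k) auto
  show thesis
  proof (rule that[of "\<bar>C\<bar>"])
    show "norm (F p \<xi>) \<le> \<bar>C\<bar> * norm \<xi> powr (- m)" if "\<xi> \<noteq> 0" for p \<xi>
      using C[OF that, of p] mult_right_mono[OF abs_ge_self[of C], of "norm \<xi> powr (- m)"] by simp
  qed simp
qed

lemma symb_SucI:
  assumes "symb i 0 m F"
    "\<And>p \<xi>. \<xi> \<noteq> 0 \<Longrightarrow> ((\<lambda>s. F p (\<xi> + s *\<^sub>R i)) has_vector_derivative F' p \<xi>) (at 0)"
    "symb i k (m + 1) F'"
  shows "symb i (Suc k) m F"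
  using assms by auto

lemma symb_lower: "symb i (Suc k) m F \<Longrightarrow> symb i k m F"
proof (induction k arbitrary: m F)
  case (Suc k)
  then obtain F' where "\<forall>p \<xi>. \<xi> \<noteq> 0 \<longrightarrow> ((\<lambda>s. F p (\<xi> + s *\<^sub>R i)) has_vector_derivative F' p \<xi>) (at 0)" "symb i (Suc k) (m + 1) F'"
    by auto
  moreover from this(2) have "symb i k (m + 1) F'" by (rule Suc.IH)
  ultimately show ?case using Suc.prems by auto
qed auto

lemma symb_0: "symb i k m F \<Longrightarrow> symb i 0 m F"
  by (cases k) auto

text \<open>Factors that depend on different parameters are brought to a common parameter type in
  this way before they are multiplied.\<close>

lemma symb_reparam: "symb i k m F \<Longrightarrow> symb i k m (\<lambda>q. F (f q))"
proof (induction k arbitrary: m F)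
  case (Suc k)
  then obtain F' where F': "\<And>p \<xi>. \<xi> \<noteq> 0 \<Longrightarrow> ((\<lambda>s. F p (\<xi> + s *\<^sub>R i)) has_vector_derivative F' p \<xi>) (at 0)" "symb i k (m + 1) F'"
    by auto
  show ?case
  proof (rule symb_SucI[of _ _ _ "\<lambda>q. F' (f q)"])
    show "symb i 0 m (\<lambda>q. F (f q))" using Suc.prems by auto
  qed (use F' Suc.IH in auto)
qed auto

lemma symb_add_0:
  assumes "symb i 0 m F" "symb i 0 m G"
  shows "symb i 0 m (\<lambda>p \<xi>. F p \<xi> + G p \<xi>)"
proof -
  obtain C D where "\<And>p \<xi>. \<xi> \<noteq> 0 \<Longrightarrow> norm (F p \<xi>) \<le> C * norm \<xi> powr (- m)" "\<And>p \<xi>. \<xi> \<noteq> 0 \<Longrightarrow> norm (G p \<xi>) \<le> D * norm \<xi> powr (- m)"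
    using assms by auto
  then have "norm (F p \<xi> + G p \<xi>) \<le> (C + D) * norm \<xi> powr (- m)" if "\<xi> \<noteq> 0" for p \<xi>
    using that norm_triangle_ineq[of "F p \<xi>" "G p \<xi>"] by (smt (verit) distrib_right)
  then show ?thesis by auto
qed

lemma symb_add: "symb i k m F \<Longrightarrow> symb i k m G \<Longrightarrow> symb i k m (\<lambda>p \<xi>. F p \<xi> + G p \<xi>)"
proof (induction k arbitrary: m F G)
  case 0
  then show ?case by (rule symb_add_0)
next
  case (Suc k)
  obtain F' where F': "\<And>p \<xi>. \<xi> \<noteq> 0 \<Longrightarrow> ((\<lambda>s. F p (\<xi> + s *\<^sub>R i)) has_vector_derivative F' p \<xi>) (at 0)" "symb i k (m + 1) F'"
    using Suc.prems(1) by auto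
  obtain G' where G': "\<And>p \<xi>. \<xi> \<noteq> 0 \<Longrightarrow> ((\<lambda>s. G p (\<xi> + s *\<^sub>R i)) has_vector_derivative G' p \<xi>) (at 0)" "symb i k (m + 1) G'"
    using Suc.prems(2) by auto
  show ?case
  proof (rule symb_SucI[of _ _ _ "\<lambda>p \<xi>. F' p \<xi> + G' p \<xi>"])
    show "symb i 0 m (\<lambda>p \<xi>. F p \<xi> + G p \<xi>)"
      by (intro symb_add_0 symb_0[OF Suc.prems(1)] symb_0[OF Suc.prems(2)])
  qed (auto intro!: has_vector_derivative_add F' G' Suc.IH)
qed

lemma symb_mult: "symb i k m F \<Longrightarrow> symb i k m' G \<Longrightarrow> symb i k (m + m') (\<lambda>p \<xi>. F p \<xi> * G p \<xi>)"
proof (induction k arbitrary: m m' F G)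
  case 0
  obtain C where C: "C \<ge> 0" "\<And>p \<xi>. \<xi> \<noteq> 0 \<Longrightarrow> norm (F p \<xi>) \<le> C * norm \<xi> powr (- m)"
    using symb_bound[OF 0(1)] by blast
  obtain D where D: "D \<ge> 0" "\<And>p \<xi>. \<xi> \<noteq> 0 \<Longrightarrow> norm (G p \<xi>) \<le> D * norm \<xi> powr (- m')"
    using symb_bound[OF 0(2)] by blast
  have "norm (F p \<xi> * G p \<xi>) \<le> (C * D) * norm \<xi> powr (- (m + m'))" if "\<xi> \<noteq> 0" for p \<xi>
  proof -
    have "norm (F p \<xi> * G p \<xi>) \<le> (C * norm \<xi> powr (- m)) * (D * norm \<xi> powr (- m'))"
      unfolding norm_mult using C D that by (intro mult_mono) auto
    also have "\<dots> = (C * D) * (norm \<xi> powr (- m) * norm \<xi> powr (- m'))" by (simp only: mult_ac)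
    also have "norm \<xi> powr (- m) * norm \<xi> powr (- m') = norm \<xi> powr (- (m + m'))"
      by (simp add: powr_add[symmetric])
    finally show ?thesis .
  qed
  then show ?case unfolding symb.simps by blast
next
  case (Suc k)
  obtain F' where F': "\<And>p \<xi>. \<xi> \<noteq> 0 \<Longrightarrow> ((\<lambda>s. F p (\<xi> + s *\<^sub>R i)) has_vector_derivative F' p \<xi>) (at 0)" "symb i k (m + 1) F'"
    using Suc.prems(1) by auto
  obtain G' where G': "\<And>p \<xi>. \<xi> \<noteq> 0 \<Longrightarrow> ((\<lambda>s. G p (\<xi> + s *\<^sub>R i)) has_vector_derivative G' p \<xi>) (at 0)" "symb i k (m' + 1) G'"
    using Suc.prems(2) by auto
  show ?case
  proof (rule symb_SucI[of _ _ _ "\<lambda>p \<xi>. F p \<xi> * G' p \<xi> + F' p \<xi> * G p \<xi>"])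
    show "symb i 0 (m + m') (\<lambda>p \<xi>. F p \<xi> * G p \<xi>)"
      by (rule symb_0) (rule Suc.IH[OF symb_lower[OF Suc.prems(1)] symb_lower[OF Suc.prems(2)]])
    show "((\<lambda>s. F p (\<xi> + s *\<^sub>R i) * G p (\<xi> + s *\<^sub>R i)) has_vector_derivative F p \<xi> * G' p \<xi> + F' p \<xi> * G p \<xi>) (at 0)" if "\<xi> \<noteq> 0" for p \<xi>
      using has_vector_derivative_mult[OF F'(1)[OF that] G'(1)[OF that]] by simp
    have 1: "symb i k (m + m' + 1) (\<lambda>p \<xi>. F p \<xi> * G' p \<xi>)"
      using Suc.IH[OF symb_lower[OF Suc.prems(1)] G'(2)] by (simp add: add.assoc)
    have 2: "symb i k (m + m' + 1) (\<lambda>p \<xi>. F' p \<xi> * G p \<xi>)"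
      using Suc.IH[OF F'(2) symb_lower[OF Suc.prems(2)]] by (simp add: ac_simps)
    show "symb i k (m + m' + 1) (\<lambda>p \<xi>. F p \<xi> * G' p \<xi> + F' p \<xi> * G p \<xi>)"
      by (rule symb_add[OF 1 2])
  qed
qed

lemma symb_zero: "symb i k m (\<lambda>(p::'p) \<xi>. 0)"
proof (induction k arbitrary: m)
  case 0
  show ?case by (auto intro: exI[of _ 0])
next
  case (Suc k)
  show ?case
    by (rule symb_SucI[of _ _ _ "\<lambda>(p::'p) \<xi>. 0"]) (auto intro: exI[of _ 0] Suc)
qed

lemma symb_const: "symb i k 0 (\<lambda>(p::'p) \<xi>. c)"
proof (cases k)
  case (Suc l)
  show ?thesis unfolding Suc
    by (rule symb_SucI[of _ _ _ "\<lambda>(p::'p) \<xi>. 0"]) (auto intro!: exI[of _ "norm c"] symb_zero)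
qed (auto intro!: exI[of _ "norm c"])

lemma symb_cmult: "symb i k m F \<Longrightarrow> symb i k m (\<lambda>p \<xi>. c * F p \<xi>)"
  using symb_mult[OF symb_const] by fastforce

lemma symb_sum:
  assumes "finite A" "\<And>a. a \<in> A \<Longrightarrow> symb i k m (F a)"
  shows "symb i k m (\<lambda>p \<xi>. \<Sum>a\<in>A. F a p \<xi>)"
  using assms by (induction A rule: finite_induct) (auto intro: symb_zero symb_add)

lemma symb_inner:
  assumes "norm j \<le> 1"
  shows "symb i k (- 1) (\<lambda>(p::'p) \<xi>. of_real (\<xi> \<bullet> j))"
proof -
  have b: "symb i 0 (- 1) (\<lambda>(p::'p) \<xi>. of_real (\<xi> \<bullet> j))"
    using Cauchy_Schwarz_ineq2[of _ j] assms
    by (auto intro!: exI[of _ 1]) (meson mult_left_le norm_ge_zero order_trans)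
  show ?thesis
  proof (cases k)
    case (Suc l)
    show ?thesis unfolding Suc
    proof (rule symb_SucI[OF b])
      show "((\<lambda>s. complex_of_real ((\<xi> + s *\<^sub>R i) \<bullet> j)) has_vector_derivative of_real (i \<bullet> j)) (at 0)" for \<xi>
        by (auto intro!: derivative_eq_intros simp: inner_add_left)
      show "symb i l (- 1 + 1) (\<lambda>(p::'p) \<xi>. complex_of_real (i \<bullet> j))"
        using symb_const by simp
    qed
  qed (use b in simp)
qed

lemma has_real_derivative_norm_square:
  fixes \<xi> i :: "'a::euclidean_space"
  shows "((\<lambda>s. (norm (\<xi> + s *\<^sub>R i))\<^sup>2) has_real_derivative 2 * (\<xi> \<bullet> i)) (at 0)"
  unfolding power2_norm_eq_inner
  by (auto intro!: derivative_eq_intros simp: inner_add_left inner_add_right inner_commute)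

lemma symb_inverse_square:
  assumes i: "norm i \<le> 1"
  shows "symb i k 2 (\<lambda>(p::'p) \<xi>. of_real (inverse ((norm \<xi>)\<^sup>2)))"
proof (induction k)
  case 0
  show ?case
    by (auto intro!: exI[of _ 1] simp: powr_minus powr_numeral inverse_eq_divide norm_divide norm_power)
next
  case (Suc k)
  show ?case
  proof (rule symb_SucI[of _ _ _ "\<lambda>(p::'p) \<xi>. (- 2) * (of_real (\<xi> \<bullet> i) * (of_real (inverse ((norm \<xi>)\<^sup>2)) * of_real (inverse ((norm \<xi>)\<^sup>2))))"])
    show "symb i 0 2 (\<lambda>(p::'p) \<xi>. of_real (inverse ((norm \<xi>)\<^sup>2)))" using Suc by (rule symb_0)
    show "((\<lambda>s. complex_of_real (inverse ((norm (\<xi> + s *\<^sub>R i))\<^sup>2))) has_vector_derivative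
      (- 2) * (of_real (\<xi> \<bullet> i) * (of_real (inverse ((norm \<xi>)\<^sup>2)) * of_real (inverse ((norm \<xi>)\<^sup>2))))) (at 0)" if "\<xi> \<noteq> 0" for p :: 'p and \<xi>
    proof -
      have "((\<lambda>s. inverse ((norm (\<xi> + s *\<^sub>R i))\<^sup>2)) has_real_derivative - (inverse ((norm \<xi>)\<^sup>2) * (2 * (\<xi> \<bullet> i)) * inverse ((norm \<xi>)\<^sup>2))) (at 0)"
        using DERIV_inverse'[OF has_real_derivative_norm_square[of \<xi> i]] that by simp
      then have "((\<lambda>s. complex_of_real (inverse ((norm (\<xi> + s *\<^sub>R i))\<^sup>2))) has_vector_derivative of_real (- (inverse ((norm \<xi>)\<^sup>2) * (2 * (\<xi> \<bullet> i)) * inverse ((norm \<xi>)\<^sup>2)))) (at 0)"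
        by (rule has_vector_derivative_of_real)
      then show ?thesis by (rule has_vector_derivative_eq_rhs) (simp add: mult_ac)
    qed
    have "symb i k (- 1 + (2 + 2)) (\<lambda>(p::'p) \<xi>. of_real (\<xi> \<bullet> i) * (of_real (inverse ((norm \<xi>)\<^sup>2)) * of_real (inverse ((norm \<xi>)\<^sup>2))))"
      by (intro symb_mult symb_inner i Suc)
    then show "symb i k (2 + 1) (\<lambda>(p::'p) \<xi>. (- 2) * (of_real (\<xi> \<bullet> i) * (of_real (inverse ((norm \<xi>)\<^sup>2)) * of_real (inverse ((norm \<xi>)\<^sup>2)))))"
      by (intro symb_cmult) simp
  qed
qed

text \<open>The derivatives of the families of exponentials and powers below are members of these families
  times such quotients, whence their symbol estimates by induction on the number of derivatives.\<close>

lemma symb_times_quotient: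
  assumes "norm i \<le> 1" "norm j \<le> 1" "symb i k m F"
  shows "symb i k (m + 1) (\<lambda>p \<xi>. of_real ((\<xi> \<bullet> j) * inverse ((norm \<xi>)\<^sup>2)) * F p \<xi>)"
proof -
  have "symb i k ((- 1 + 2) + m) (\<lambda>p \<xi>. (of_real (\<xi> \<bullet> j) * of_real (inverse ((norm \<xi>)\<^sup>2))) * F p \<xi>)"
    by (intro symb_mult symb_inner symb_inverse_square assms)
  then show ?thesis by (simp add: add.commute)
qed

lemma has_real_derivative_norm_line:
  fixes \<xi> i :: "'a::euclidean_space"
  assumes "\<xi> \<noteq> 0"
  shows "((\<lambda>s. norm (\<xi> + s *\<^sub>R i)) has_real_derivative (\<xi> \<bullet> i) / norm \<xi>) (at 0)"
proof -
  have "((\<lambda>s. sqrt ((norm (\<xi> + s *\<^sub>R i))\<^sup>2)) has_real_derivative (2 * (\<xi> \<bullet> i)) * (inverse (sqrt ((norm \<xi>)\<^sup>2)) / 2)) (at 0)"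
  proof -
    have "(sqrt has_real_derivative inverse (sqrt ((norm \<xi>)\<^sup>2)) / 2) (at ((norm (\<xi> + 0 *\<^sub>R i))\<^sup>2))"
      using DERIV_real_sqrt[of "(norm \<xi>)\<^sup>2"] assms by simp
    from DERIV_chain2[OF this has_real_derivative_norm_square] show ?thesis
      by (rule DERIV_cong) (rule mult.commute)
  qed
  then have "((\<lambda>s. norm (\<xi> + s *\<^sub>R i)) has_real_derivative (2 * (\<xi> \<bullet> i)) * (inverse (norm \<xi>) / 2)) (at 0)"
    by (simp only: real_sqrt_abs abs_norm_cancel)
  moreover have "(2 * (\<xi> \<bullet> i)) * (inverse (norm \<xi>) / 2) = (\<xi> \<bullet> i) / norm \<xi>"
    using assms by (simp add: field_simps)
  ultimately show ?thesis by (simp only:)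
qed

lemma symb_exp_family:
  assumes i: "norm i \<le> 1"
  shows "symb i k 0 (\<lambda>\<beta> \<xi>. of_real ((\<bar>\<beta>\<bar> * norm \<xi>) ^ q * exp (- \<bar>\<beta>\<bar> * norm \<xi>)))"
proof (induction k arbitrary: q)
  case 0
  \<comment> \<open>Since y^q exp (- y) \<le> q! for y \<ge> 0, the bound does not depend on
    \<beta>. From here stems the uniformity in the damping parameter of the later estimates.\<close>
  have "(\<bar>\<beta>\<bar> * norm \<xi>) ^ q * exp (- \<bar>\<beta>\<bar> * norm \<xi>) \<le> fact q" for \<beta> :: real and \<xi> :: 'a
    using power_over_fact_le_exp[of "\<bar>\<beta>\<bar> * norm \<xi>" q] by (simp add: exp_minus field_simps)
  then show ?case by (auto intro!: exI[of _ "fact q"] simp: norm_mult norm_power abs_mult simp del: of_real_mult of_real_power of_real_exp)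
next
  case (Suc k)
  let ?E = "\<lambda>q \<beta> \<xi>. (\<bar>\<beta>\<bar> * norm (\<xi>::'a)) ^ q * exp (- \<bar>\<beta>\<bar> * norm \<xi>)"
  show ?case
  proof (rule symb_SucI[of _ _ _ "\<lambda>\<beta> \<xi>. of_real ((\<xi> \<bullet> i) * inverse ((norm \<xi>)\<^sup>2)) * (of_nat q * of_real (?E q \<beta> \<xi>) + (- 1) * of_real (?E (Suc q) \<beta> \<xi>))"])
    show "symb i 0 0 (\<lambda>\<beta> \<xi>. of_real (?E q \<beta> \<xi>))" using Suc by (rule symb_0)
    show "symb i k (0 + 1) (\<lambda>\<beta> \<xi>. of_real ((\<xi> \<bullet> i) * inverse ((norm \<xi>)\<^sup>2)) * (of_nat q * of_real (?E q \<beta> \<xi>) + (- 1) * of_real (?E (Suc q) \<beta> \<xi>)))"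
      by (intro symb_times_quotient symb_add symb_cmult Suc i)
    fix \<beta> and \<xi> :: 'a assume \<xi>: "\<xi> \<noteq> 0"
    have d1: "((\<lambda>s. \<bar>\<beta>\<bar> * norm (\<xi> + s *\<^sub>R i)) has_real_derivative \<bar>\<beta>\<bar> * ((\<xi> \<bullet> i) / norm \<xi>)) (at 0)"
      by (intro DERIV_cmult has_real_derivative_norm_line \<xi>)
    have d2: "((\<lambda>s. - \<bar>\<beta>\<bar> * norm (\<xi> + s *\<^sub>R i)) has_real_derivative - \<bar>\<beta>\<bar> * ((\<xi> \<bullet> i) / norm \<xi>)) (at 0)"
      by (intro DERIV_cmult has_real_derivative_norm_line \<xi>)
    have "((\<lambda>s. ?E q \<beta> (\<xi> + s *\<^sub>R i)) has_real_derivative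
       (of_nat q * (\<bar>\<beta>\<bar> * ((\<xi> \<bullet> i) / norm \<xi>) * (\<bar>\<beta>\<bar> * norm \<xi>) ^ (q - Suc 0))) * exp (- \<bar>\<beta>\<bar> * norm \<xi>)
       + (exp (- \<bar>\<beta>\<bar> * norm \<xi>) * (- \<bar>\<beta>\<bar> * ((\<xi> \<bullet> i) / norm \<xi>))) * (\<bar>\<beta>\<bar> * norm \<xi>) ^ q) (at 0)"
      using DERIV_mult[OF DERIV_power[OF d1, of q] DERIV_fun_exp[OF d2]] by simp
    moreover have "(of_nat q * (\<bar>\<beta>\<bar> * ((\<xi> \<bullet> i) / norm \<xi>) * (\<bar>\<beta>\<bar> * norm \<xi>) ^ (q - Suc 0))) * exp (- \<bar>\<beta>\<bar> * norm \<xi>)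
       + (exp (- \<bar>\<beta>\<bar> * norm \<xi>) * (- \<bar>\<beta>\<bar> * ((\<xi> \<bullet> i) / norm \<xi>))) * (\<bar>\<beta>\<bar> * norm \<xi>) ^ q
       = (\<xi> \<bullet> i) * inverse ((norm \<xi>)\<^sup>2) * (of_nat q * ?E q \<beta> \<xi> + (- 1) * ?E (Suc q) \<beta> \<xi>)"
    proof (cases q)
      case 0
      then show ?thesis using \<xi> by (simp add: field_simps power2_eq_square)
    next
      case (Suc r)
      then show ?thesis using \<xi> by (simp add: field_simps power2_eq_square)
    qed
    ultimately have "((\<lambda>s. ?E q \<beta> (\<xi> + s *\<^sub>R i)) has_real_derivative (\<xi> \<bullet> i) * inverse ((norm \<xi>)\<^sup>2) * (of_nat q * ?E q \<beta> \<xi> + (- 1) * ?E (Suc q) \<beta> \<xi>)) (at 0)"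
      by (simp only:)
    from has_vector_derivative_of_real[OF this]
    show "((\<lambda>s. complex_of_real (?E q \<beta> (\<xi> + s *\<^sub>R i))) has_vector_derivative
       of_real ((\<xi> \<bullet> i) * inverse ((norm \<xi>)\<^sup>2)) * (of_nat q * of_real (?E q \<beta> \<xi>) + (- 1) * of_real (?E (Suc q) \<beta> \<xi>))) (at 0)"
      by (simp only: of_real_mult of_real_add of_real_of_nat_eq of_real_minus of_real_1)
  qed
qed

lemma symb_exp:
  assumes i: "norm i \<le> 1"
  shows "symb i k 0 (\<lambda>\<beta> \<xi>. of_real (exp (- \<bar>\<beta>\<bar> * norm \<xi>)))"
  using symb_exp_family[OF i, of k 0] by simp

lemma symb_spow: "symb (1::real) k (- Re a) (\<lambda>(p::'p) t. spow \<epsilon> a t)"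
proof (induction k)
  case 0
  show ?case by (auto intro!: exI[of _ 1] simp: norm_spow)
next
  case (Suc k)
  show ?case
  proof (rule symb_SucI[of _ _ _ "\<lambda>(p::'p) t. of_real ((t \<bullet> 1) * inverse ((norm t)\<^sup>2)) * (a * spow \<epsilon> a t)"])
    show "symb (1::real) 0 (- Re a) (\<lambda>(p::'p) t. spow \<epsilon> a t)" using Suc by (rule symb_0)
    show "symb (1::real) k (- Re a + 1) (\<lambda>(p::'p) t. of_real ((t \<bullet> 1) * inverse ((norm t)\<^sup>2)) * (a * spow \<epsilon> a t))"
      by (intro symb_times_quotient symb_cmult Suc) auto
    fix p :: 'p and t :: real assume t: "t \<noteq> 0"
    \<comment> \<open>Near t \<noteq> 0 the sign is constant and |x| = \<sigma> x, so
      \<open>spow\<close> is locally a constant times exp (a ln (\<sigma> x)).\<close>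
    define \<sigma> where "\<sigma> = sgn t"
    have \<sigma>: "\<sigma> * \<sigma> = 1" "\<sigma> \<noteq> 0" "\<sigma> * t > 0" using t by (auto simp: \<sigma>_def sgn_if)
    have eq: "spow \<epsilon> a x = exp (a * of_real (ln (\<sigma> * x))) * of_real \<sigma> ^ \<epsilon>" if "\<sigma> * x > 0" for x
    proof -
      have "sgn x = \<sigma>" "\<bar>x\<bar> = \<sigma> * x"
        using that t by (auto simp: \<sigma>_def sgn_if zero_less_mult_iff split: if_splits)
      then show ?thesis using that by (subst spow_eq) auto
    qed
    have "((\<lambda>s. ln (\<sigma> * (t + s))) has_real_derivative inverse t) (at 0)"
      using \<sigma> t by (auto intro!: derivative_eq_intros simp: field_simps)
    then have "((\<lambda>s. complex_of_real (ln (\<sigma> * (t + s)))) has_vector_derivative of_real (inverse t)) (at 0)"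
      by (rule has_vector_derivative_of_real)
    then have "((\<lambda>s. a * complex_of_real (ln (\<sigma> * (t + s)))) has_vector_derivative a * of_real (inverse t)) (at 0)"
      by (rule has_vector_derivative_mult_right)
    then have "((exp \<circ> (\<lambda>s. a * complex_of_real (ln (\<sigma> * (t + s))))) has_vector_derivative (a * of_real (inverse t)) * exp (a * of_real (ln (\<sigma> * (t + 0))))) (at 0)"
      by (rule field_vector_diff_chain_at) (rule DERIV_exp)
    then have "((\<lambda>s. exp (a * complex_of_real (ln (\<sigma> * (t + s)))) * of_real \<sigma> ^ \<epsilon>) has_vector_derivative (a * of_real (inverse t)) * exp (a * of_real (ln (\<sigma> * t))) * of_real \<sigma> ^ \<epsilon>) (at 0)"
      unfolding o_def add_0_right by (rule has_vector_derivative_mult_left)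
    then have d: "((\<lambda>s. exp (a * complex_of_real (ln (\<sigma> * (t + s)))) * of_real \<sigma> ^ \<epsilon>) has_vector_derivative (a * of_real (inverse t)) * spow \<epsilon> a t) (at 0)"
      unfolding eq[OF \<sigma>(3)] by (simp only: mult.assoc)
    have "open {s. 0 < \<sigma> * (t + s)}"
      by (intro open_Collect_less continuous_intros)
    from d this have "((\<lambda>s. spow \<epsilon> a (t + s *\<^sub>R 1)) has_vector_derivative (a * of_real (inverse t)) * spow \<epsilon> a t) (at 0)"
      by (rule has_vector_derivative_transform_within_open) (use \<sigma>(3) in \<open>simp_all add: eq\<close>)
    moreover have "(a * of_real (inverse t)) * spow \<epsilon> a t = of_real ((t \<bullet> 1) * inverse ((norm t)\<^sup>2)) * (a * spow \<epsilon> a t)"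
      using t by (simp add: power2_eq_square field_simps)
    ultimately show "((\<lambda>s. spow \<epsilon> a (t + s *\<^sub>R 1)) has_vector_derivative of_real ((t \<bullet> 1) * inverse ((norm t)\<^sup>2)) * (a * spow \<epsilon> a t)) (at 0)"
      by (simp only:)
  qed
qed

lemma schwartz_dir_deriv: "f \<in> schwartz \<Longrightarrow> b \<in> Basis \<Longrightarrow> dir_deriv b f \<in> schwartz"
  unfolding schwartz_def mem_Collect_eq
  by (metis iter_deriv_snoc append_in_lists_conv lists.Cons lists.Nil smooth_dir_deriv)

lemma has_vector_derivative_line:
  assumes "smooth f"
  shows "((\<lambda>s. f (\<xi> + s *\<^sub>R i)) has_vector_derivative dir_deriv i f \<xi>) (at 0)"
proof -
  have lin: "linear (\<lambda>h. dir_deriv h f \<xi>)"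
    using smooth_has_derivative[OF assms] has_derivative_linear by blast
  have "((\<lambda>s. \<xi> + s *\<^sub>R i) has_derivative (\<lambda>s. s *\<^sub>R i)) (at 0)"
    by (auto intro!: derivative_eq_intros)
  moreover have "(f has_derivative (\<lambda>h. dir_deriv h f \<xi>)) (at (\<xi> + 0 *\<^sub>R i))"
    using smooth_has_derivative[OF assms, of \<xi>] by simp
  ultimately have "((\<lambda>s. f (\<xi> + s *\<^sub>R i)) has_derivative (\<lambda>s. dir_deriv (s *\<^sub>R i) f \<xi>)) (at 0)"
    by (rule has_derivative_compose)
  then show ?thesis
    unfolding has_vector_derivative_def by (simp only: linear_scale[OF lin])
qed

lemma symb_schwartz:
  assumes i: "i \<in> Basis" and "\<psi> \<in> schwartz"
  shows "symb i k (of_nat m) (\<lambda>p::'p. \<psi>)"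
  using assms(2)
proof (induction k arbitrary: m \<psi>)
  have b: "symb i 0 (of_nat m) (\<lambda>p::'p. \<psi>)" if \<psi>: "\<psi> \<in> schwartz" for m \<psi>
  proof -
    obtain c where c: "c \<ge> 0" "\<And>x. norm (\<psi> x) \<le> c * inverse ((1 + norm x) ^ m)"
      using rapid_bound[OF schwartz_rapid[OF \<psi>]] by blast
    have "norm (\<psi> x) \<le> c * norm x powr (- of_nat m)" if "x \<noteq> 0" for x
    proof -
      have "inverse ((1 + norm x) ^ m) \<le> inverse (norm x ^ m)"
        using that by (intro le_imp_inverse_le power_mono zero_less_power) auto
      also have "\<dots> = norm x powr (- of_nat m)"
        using that by (simp add: powr_minus powr_realpow)
      finally have "c * inverse ((1 + norm x) ^ m) \<le> c * norm x powr (- of_nat m)"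
        using c(1) by (rule mult_left_mono)
      then show ?thesis using c(2)[of x] by simp
    qed
    then show ?thesis by auto
  qed
  case 0
  then show ?case by (rule b)
  case (Suc k)
  show ?case
  proof (rule symb_SucI[of _ _ _ "\<lambda>p::'p. dir_deriv i \<psi>"])
    show "symb i 0 (real m) (\<lambda>p::'p. \<psi>)" by (rule b[OF Suc.prems])
    show "symb i k (real m + 1) (\<lambda>p::'p. dir_deriv i \<psi>)"
      using Suc.IH[OF schwartz_dir_deriv[OF Suc.prems i], of "Suc m"] by (simp add: add.commute)
  qed (rule has_vector_derivative_line[OF schwartz_smooth[OF Suc.prems]])
qed

section \<open>Oscillatory integrals with amplitudes of symbol type\<close>

text \<open>Shifting the variable by half a period of the exponential replaces the amplitude by half its
  difference with its translate. Iterating this has the effect of repeated integration by parts,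
  but requires no differentiability at the origin.\<close>

definition dif :: "'a::euclidean_space \<Rightarrow> ('a \<Rightarrow> complex) \<Rightarrow> 'a \<Rightarrow> complex" where
  "dif h F \<xi> = (F \<xi> - F (\<xi> + h)) / 2"

lemma
  assumes F: "integrable lborel F" and h: "cis (2 * pi * (\<theta> \<bullet> h)) = - 1"
  shows integrable_dif: "integrable lborel (dif h F)"
    and integral_dif: "(LINT \<xi>|lborel. dif h F \<xi> * cis (2 * pi * (\<theta> \<bullet> \<xi>))) = (LINT \<xi>|lborel. F \<xi> * cis (2 * pi * (\<theta> \<bullet> \<xi>)))"
proof -
  have Fh: "integrable lborel (\<lambda>\<xi>. F (\<xi> + h))"
    using F integrable_lborel_translate[of F h] by (simp add: add.commute)
  show "integrable lborel (dif h F)"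
    unfolding dif_def[abs_def] by (intro integrable_divide Bochner_Integration.integrable_diff F Fh)
  have c: "integrable lborel (\<lambda>\<xi>. G \<xi> * cis (2 * pi * (\<theta> \<bullet> \<xi>)))" if G: "integrable lborel G" for G :: "'a \<Rightarrow> complex"
  proof (rule Bochner_Integration.integrable_bound[OF G])
    show "(\<lambda>\<xi>. G \<xi> * cis (2 * pi * (\<theta> \<bullet> \<xi>))) \<in> borel_measurable lborel"
      using borel_measurable_integrable[OF G] by measurable
  qed (simp add: norm_mult)
  have "cis (2 * pi * (\<theta> \<bullet> (h + \<xi>))) = - cis (2 * pi * (\<theta> \<bullet> \<xi>))" for \<xi>
    by (simp add: inner_add_right distrib_left cis_mult[symmetric] h)
  then have "(LINT \<xi>|lborel. F (\<xi> + h) * cis (2 * pi * (\<theta> \<bullet> \<xi>))) = - (LINT \<xi>|lborel. F (h + \<xi>) * cis (2 * pi * (\<theta> \<bullet> (h + \<xi>))))"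
    by (simp add: add.commute)
  also have "\<dots> = - (LINT \<xi>|lborel. F \<xi> * cis (2 * pi * (\<theta> \<bullet> \<xi>)))"
    by (simp only: integral_lborel_translate[of "\<lambda>\<xi>. F \<xi> * cis (2 * pi * (\<theta> \<bullet> \<xi>))" h])
  finally have s: "(LINT \<xi>|lborel. F (\<xi> + h) * cis (2 * pi * (\<theta> \<bullet> \<xi>))) = - (LINT \<xi>|lborel. F \<xi> * cis (2 * pi * (\<theta> \<bullet> \<xi>)))" .
  have "(LINT \<xi>|lborel. dif h F \<xi> * cis (2 * pi * (\<theta> \<bullet> \<xi>))) = (LINT \<xi>|lborel. (F \<xi> * cis (2 * pi * (\<theta> \<bullet> \<xi>)) - F (\<xi> + h) * cis (2 * pi * (\<theta> \<bullet> \<xi>))) / 2)"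
    by (simp add: dif_def left_diff_distrib diff_divide_distrib)
  also have "\<dots> = ((LINT \<xi>|lborel. F \<xi> * cis (2 * pi * (\<theta> \<bullet> \<xi>))) - (LINT \<xi>|lborel. F (\<xi> + h) * cis (2 * pi * (\<theta> \<bullet> \<xi>)))) / 2"
    using c[OF F] c[OF Fh] by simp
  also have "\<dots> = (LINT \<xi>|lborel. F \<xi> * cis (2 * pi * (\<theta> \<bullet> \<xi>)))"
    unfolding s by simp
  finally show "(LINT \<xi>|lborel. dif h F \<xi> * cis (2 * pi * (\<theta> \<bullet> \<xi>))) = (LINT \<xi>|lborel. F \<xi> * cis (2 * pi * (\<theta> \<bullet> \<xi>)))" .
qed

lemma
  assumes F: "integrable lborel F" and h: "cis (2 * pi * (\<theta> \<bullet> h)) = - 1"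
  shows integrable_difs: "integrable lborel ((dif h ^^ k) F)"
    and integral_difs: "(LINT \<xi>|lborel. (dif h ^^ k) F \<xi> * cis (2 * pi * (\<theta> \<bullet> \<xi>))) = (LINT \<xi>|lborel. F \<xi> * cis (2 * pi * (\<theta> \<bullet> \<xi>)))"
proof (induction k)
  case 0
  show "integrable lborel ((dif h ^^ 0) F)" using F by simp
  show "(LINT \<xi>|lborel. (dif h ^^ 0) F \<xi> * cis (2 * pi * (\<theta> \<bullet> \<xi>))) = (LINT \<xi>|lborel. F \<xi> * cis (2 * pi * (\<theta> \<bullet> \<xi>)))" by simp
next
  case (Suc k)
  show "integrable lborel ((dif h ^^ Suc k) F)"
    using integrable_dif[OF Suc(1) h] by simp
  show "(LINT \<xi>|lborel. (dif h ^^ Suc k) F \<xi> * cis (2 * pi * (\<theta> \<bullet> \<xi>))) = (LINT \<xi>|lborel. F \<xi> * cis (2 * pi * (\<theta> \<bullet> \<xi>)))"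
    using integral_dif[OF Suc(1) h] Suc(2) by simp
qed

lemma dif_borel:
  assumes [measurable]: "F \<in> borel_measurable borel"
  shows "dif h F \<in> borel_measurable borel"
  unfolding dif_def[abs_def] by measurable

lemma difs_borel:
  assumes "F \<in> borel_measurable borel"
  shows "(dif h ^^ k) F \<in> borel_measurable borel"
  by (induction k) (simp_all add: assms dif_borel)

lemma difs_bound:
  assumes "\<And>\<xi>'. norm (\<xi>' - \<xi>) \<le> real k * norm h \<Longrightarrow> norm (F \<xi>') \<le> C"
  shows "norm ((dif h ^^ k) F \<xi>) \<le> C"
  using assms
proof (induction k arbitrary: \<xi>)
  case (Suc k)
  have 1: "norm ((dif h ^^ k) F \<xi>) \<le> C"
  proof (rule Suc.IH)
    fix \<xi>' assume "norm (\<xi>' - \<xi>) \<le> real k * norm h"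
    also have "\<dots> \<le> real (Suc k) * norm h" by (intro mult_right_mono) auto
    finally show "norm (F \<xi>') \<le> C" by (rule Suc.prems)
  qed
  have 2: "norm ((dif h ^^ k) F (\<xi> + h)) \<le> C"
  proof (rule Suc.IH)
    fix \<xi>' assume "norm (\<xi>' - (\<xi> + h)) \<le> real k * norm h"
    moreover have "norm (\<xi>' - \<xi>) \<le> norm (\<xi>' - (\<xi> + h)) + norm h"
      using norm_triangle_ineq[of "\<xi>' - (\<xi> + h)" h] by simp
    ultimately have "norm (\<xi>' - \<xi>) \<le> real (Suc k) * norm h" by (simp add: distrib_right)
    then show "norm (F \<xi>') \<le> C" by (rule Suc.prems)
  qed
  have "norm (dif h ((dif h ^^ k) F) \<xi>) \<le> C"
    unfolding dif_def[of h "(dif h ^^ k) F"]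
    using 1 2 norm_triangle_ineq4[of "(dif h ^^ k) F \<xi>" "(dif h ^^ k) F (\<xi> + h)"] by (simp add: norm_divide)
  then show ?case by simp
qed simp

text \<open>The condition on |\<xi>| keeps the points \<xi> + j \<eta> i with j \<le> k away from
  the origin, where nothing is known about derivatives.\<close>

lemma difs_has_vector_derivative:
  fixes i :: "'a::euclidean_space"
  assumes "\<And>\<xi>. \<xi> \<noteq> 0 \<Longrightarrow> ((\<lambda>s. F (\<xi> + s *\<^sub>R i)) has_vector_derivative F' \<xi>) (at 0)"
    and i: "norm i = 1" and "real k * \<bar>\<eta>\<bar> < norm \<xi>"
  shows "((\<lambda>s. (dif (\<eta> *\<^sub>R i) ^^ k) F (\<xi> + s *\<^sub>R i)) has_vector_derivative (dif (\<eta> *\<^sub>R i) ^^ k) F' \<xi>) (at 0)"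
  using assms(3)
proof (induction k arbitrary: \<xi>)
  case 0
  then show ?case using assms(1) by simp
next
  case (Suc k)
  have "real k * \<bar>\<eta>\<bar> \<le> real (Suc k) * \<bar>\<eta>\<bar>" by (intro mult_right_mono) auto
  then have 1: "((\<lambda>s. (dif (\<eta> *\<^sub>R i) ^^ k) F (\<xi> + s *\<^sub>R i)) has_vector_derivative (dif (\<eta> *\<^sub>R i) ^^ k) F' \<xi>) (at 0)"
    using Suc.prems by (intro Suc.IH) simp
  have "norm \<xi> \<le> norm (\<xi> + \<eta> *\<^sub>R i) + \<bar>\<eta>\<bar>"
    using norm_triangle_ineq4[of "\<xi> + \<eta> *\<^sub>R i" "\<eta> *\<^sub>R i"] i by simp
  then have 2: "((\<lambda>s. (dif (\<eta> *\<^sub>R i) ^^ k) F (\<xi> + \<eta> *\<^sub>R i + s *\<^sub>R i)) has_vector_derivative (dif (\<eta> *\<^sub>R i) ^^ k) F' (\<xi> + \<eta> *\<^sub>R i)) (at 0)"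
    using Suc.prems by (intro Suc.IH) (simp add: distrib_right)
  have "((\<lambda>s. dif (\<eta> *\<^sub>R i) ((dif (\<eta> *\<^sub>R i) ^^ k) F) (\<xi> + s *\<^sub>R i)) has_vector_derivative dif (\<eta> *\<^sub>R i) ((dif (\<eta> *\<^sub>R i) ^^ k) F') \<xi>) (at 0)"
    unfolding dif_def[of _ "(dif (\<eta> *\<^sub>R i) ^^ k) F"] dif_def[of _ "(dif (\<eta> *\<^sub>R i) ^^ k) F'"]
    using has_vector_derivative_divide[OF has_vector_derivative_diff[OF 1 2], of 2] by (simp add: algebra_simps)
  then show ?case by simp
qed

lemma powr_comparable:
  fixes a b e :: real
  assumes "a > 0" "a / 2 \<le> b" "b \<le> 2 * a"
  shows "b powr e \<le> 2 powr \<bar>e\<bar> * a powr e"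
proof (cases "e \<ge> 0")
  case True
  then have "b powr e \<le> (2 * a) powr e" using assms by (intro powr_mono2) auto
  then show ?thesis using True assms by (simp add: powr_mult)
next
  case False
  then have "b powr e \<le> (a / 2) powr e" using assms by (intro powr_mono2') auto
  also have "\<dots> = 2 powr \<bar>e\<bar> * a powr e" using False assms by (simp add: abs_of_neg powr_divide powr_minus field_simps)
  finally show ?thesis .
qed

text \<open>Differences commute with derivatives. By the mean value inequality one further
  difference costs at most |\<eta>| times a bound for the derivative, which has order m + 1; so each
  difference gains |\<eta>| / |\<xi>|.\<close>

lemma difs_symb:
  fixes i :: "'a::euclidean_space"
  assumes i: "norm i = 1" and "symb i k m F"
  shows "\<exists>C\<ge>0. \<forall>p \<eta> \<xi>. 2 * real k * \<bar>\<eta>\<bar> < norm \<xi> \<longrightarrow>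
    norm ((dif (\<eta> *\<^sub>R i) ^^ k) (F p) \<xi>) \<le> C * \<bar>\<eta>\<bar> ^ k * norm \<xi> powr (- (m + k))"
  using assms(2)
proof (induction k arbitrary: m F)
  case 0
  obtain C where C: "C \<ge> 0" "\<And>p \<xi>. \<xi> \<noteq> 0 \<Longrightarrow> norm (F p \<xi>) \<le> C * norm \<xi> powr (- m)"
    using symb_bound[OF 0] by blast
  then show ?case by (intro exI[of _ C]) auto
next
  case (Suc k)
  obtain F' where F': "\<And>p \<xi>. \<xi> \<noteq> 0 \<Longrightarrow> ((\<lambda>s. F p (\<xi> + s *\<^sub>R i)) has_vector_derivative F' p \<xi>) (at 0)" "symb i k (m + 1) F'"
    using Suc.prems by auto
  obtain C where C: "C \<ge> 0" "\<And>p \<eta> \<xi>. 2 * real k * \<bar>\<eta>\<bar> < norm \<xi> \<Longrightarrow>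
    norm ((dif (\<eta> *\<^sub>R i) ^^ k) (F' p) \<xi>) \<le> C * \<bar>\<eta>\<bar> ^ k * norm \<xi> powr (- (m + 1 + k))"
    using Suc.IH[OF F'(2)] by blast
  define e where "e = - (m + 1 + k)"
  have "norm ((dif (\<eta> *\<^sub>R i) ^^ Suc k) (F p) \<xi>) \<le> C * 2 powr \<bar>e\<bar> * \<bar>\<eta>\<bar> ^ Suc k * norm \<xi> powr (- (m + Suc k))"
    if \<xi>: "2 * real (Suc k) * \<bar>\<eta>\<bar> < norm \<xi>" for p \<eta> \<xi>
  proof -
    have \<xi>0: "0 < norm \<xi>" by (rule le_less_trans[OF _ \<xi>]) simp
    let ?D = "\<lambda>F. (dif (\<eta> *\<^sub>R i) ^^ k) F"
    define B where "B = C * \<bar>\<eta>\<bar> ^ k * (2 powr \<bar>e\<bar> * norm \<xi> powr e)"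
    \<comment> \<open>The factor 2 in the condition on |\<xi>| leaves room: along the segment of
      length |\<eta>| the condition for k persists and the norm stays comparable to |\<xi>|.\<close>
    have near: "2 * real k * \<bar>\<eta>\<bar> < norm (\<xi> + s *\<^sub>R i) \<and> norm \<xi> / 2 \<le> norm (\<xi> + s *\<^sub>R i) \<and> norm (\<xi> + s *\<^sub>R i) \<le> 2 * norm \<xi> \<and> real k * \<bar>\<eta>\<bar> < norm (\<xi> + s *\<^sub>R i)"
      if "\<bar>s\<bar> \<le> \<bar>\<eta>\<bar>" for s
    proof -
      have 1: "norm \<xi> \<le> norm (\<xi> + s *\<^sub>R i) + \<bar>s\<bar>"
        using norm_triangle_ineq4[of "\<xi> + s *\<^sub>R i" "s *\<^sub>R i"] i by simp
      have 2: "norm (\<xi> + s *\<^sub>R i) \<le> norm \<xi> + \<bar>s\<bar>"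
        using norm_triangle_ineq[of \<xi> "s *\<^sub>R i"] i by simp
      have 3: "2 * real k * \<bar>\<eta>\<bar> + 2 * \<bar>\<eta>\<bar> < norm \<xi>"
        using \<xi> by (simp add: algebra_simps)
      have 4: "0 \<le> real k * \<bar>\<eta>\<bar>" by simp
      show ?thesis using 1 2 3 4 that by (intro conjI) linarith+
    qed
    have der: "((\<lambda>s. ?D (F p) (\<xi> + s *\<^sub>R i)) has_vector_derivative ?D (F' p) (\<xi> + s *\<^sub>R i)) (at s)" if "\<bar>s\<bar> \<le> \<bar>\<eta>\<bar>" for s
    proof -
      have "((\<lambda>r. ?D (F p) ((\<xi> + s *\<^sub>R i) + r *\<^sub>R i)) has_vector_derivative ?D (F' p) (\<xi> + s *\<^sub>R i)) (at (s - s))"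
        using difs_has_vector_derivative[of "F p" i "F' p" k \<eta> "\<xi> + s *\<^sub>R i"] F'(1) i near[OF that] by simp
      moreover have "((\<lambda>x. x - s) has_vector_derivative 1) (at s)"
        by (auto intro!: derivative_eq_intros)
      ultimately have "(((\<lambda>r. ?D (F p) ((\<xi> + s *\<^sub>R i) + r *\<^sub>R i)) \<circ> (\<lambda>x. x - s)) has_vector_derivative 1 *\<^sub>R ?D (F' p) (\<xi> + s *\<^sub>R i)) (at s)"
        by (intro vector_diff_chain_at)
      then show ?thesis by (simp add: o_def algebra_simps)
    qed
    have "norm (?D (F p) (\<xi> + \<eta> *\<^sub>R i) - ?D (F p) (\<xi> + 0 *\<^sub>R i)) \<le> B * norm (\<eta> - 0)"
    proof (rule differentiable_bound[of "closed_segment 0 \<eta>" "\<lambda>s. ?D (F p) (\<xi> + s *\<^sub>R i)" "\<lambda>s h. h *\<^sub>R ?D (F' p) (\<xi> + s *\<^sub>R i)"])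
      fix s assume "s \<in> closed_segment 0 \<eta>"
      then have s: "\<bar>s\<bar> \<le> \<bar>\<eta>\<bar>" by (auto simp: closed_segment_eq_real_ivl split: if_splits)
      show "((\<lambda>s. ?D (F p) (\<xi> + s *\<^sub>R i)) has_derivative (\<lambda>h. h *\<^sub>R ?D (F' p) (\<xi> + s *\<^sub>R i))) (at s within closed_segment 0 \<eta>)"
        using der[OF s] unfolding has_vector_derivative_def by (rule has_derivative_at_withinI)
      have "norm (?D (F' p) (\<xi> + s *\<^sub>R i)) \<le> C * \<bar>\<eta>\<bar> ^ k * norm (\<xi> + s *\<^sub>R i) powr e"
        unfolding e_def using near[OF s] by (intro C(2)) auto
      also have "\<dots> \<le> B"
        unfolding B_def using near[OF s] C(1) \<xi>0 by (intro mult_left_mono powr_comparable) auto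
      finally have n: "norm (?D (F' p) (\<xi> + s *\<^sub>R i)) \<le> B" .
      show "onorm (\<lambda>h. h *\<^sub>R ?D (F' p) (\<xi> + s *\<^sub>R i)) \<le> B"
        by (rule onorm_le) (use mult_left_mono[OF n abs_ge_zero] in \<open>simp add: mult.commute[of B]\<close>)
    qed auto
    then have "norm (?D (F p) \<xi> - ?D (F p) (\<xi> + \<eta> *\<^sub>R i)) \<le> B * \<bar>\<eta>\<bar>"
      by (simp add: norm_minus_commute)
    then have "norm (dif (\<eta> *\<^sub>R i) (?D (F p)) \<xi>) \<le> B * \<bar>\<eta>\<bar>"
      unfolding dif_def[of _ "?D (F p)"] norm_divide norm_numeral
      using norm_ge_zero[of "?D (F p) \<xi> - ?D (F p) (\<xi> + \<eta> *\<^sub>R i)"] by linarith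
    also have "B * \<bar>\<eta>\<bar> = C * 2 powr \<bar>e\<bar> * \<bar>\<eta>\<bar> ^ Suc k * norm \<xi> powr (- (m + Suc k))"
      by (simp add: B_def e_def algebra_simps)
    finally show ?thesis by simp
  qed
  then show ?case using C(1) by (intro exI[of _ "C * 2 powr \<bar>e\<bar>"]) auto
qed

text \<open>Half a period in the direction i has length |\<eta>| = 1 / (2 |\<theta> \<bullet> i|).
  After 2 DIM('a) differences the amplitude is at most a constant times (1 + |\<xi>| / |\<eta>|)^(-
  2 DIM('a)), whose integral is proportional to |\<eta>|^DIM('a). Near the origin a bounded
  amplitude is enough, as the region |\<xi>| = O(|\<eta>|) has this volume.\<close>

theorem osc_decay_symb:
  fixes F :: "'p \<Rightarrow> 'a::euclidean_space \<Rightarrow> complex"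
  assumes i: "norm i = 1" and F: "symb i (2 * DIM('a)) 0 F"
    and C0: "\<And>p \<xi>. norm (F p \<xi>) \<le> C0" and int: "\<And>p. integrable lborel (F p)"
  shows "\<exists>C\<ge>0. \<forall>p \<theta>. \<theta> \<bullet> i \<noteq> 0 \<longrightarrow> norm (LINT \<xi>|lborel. F p \<xi> * cis (2 * pi * (\<theta> \<bullet> \<xi>))) \<le> C * inverse (\<bar>\<theta> \<bullet> i\<bar> ^ DIM('a))"
proof -
  let ?K = "2 * DIM('a)"
  obtain C where C': "C \<ge> 0" "\<forall>p \<eta> \<xi>. 2 * real ?K * \<bar>\<eta>\<bar> < norm \<xi> \<longrightarrow>
    norm ((dif (\<eta> *\<^sub>R i) ^^ ?K) (F p) \<xi>) \<le> C * \<bar>\<eta>\<bar> ^ ?K * norm \<xi> powr (- (0 + real ?K))"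
    using difs_symb[OF i F] by (elim exE conjE) (rule that)
  note C = C'(1) C'(2)[rule_format]
  have C00: "C0 \<ge> 0" by (rule order_trans[OF norm_ge_zero C0])
  \<comment> \<open>With r = |\<xi>| / |\<eta>|, the first summand serves r \<le> 2 ?K, where only
    \<open>C0\<close> is available, the second serves larger r, through 1 + r \<le> 2 r.\<close>
  define C1 where "C1 = C0 * (1 + 2 * real ?K) ^ ?K + C * 2 ^ ?K"
  have C1: "C1 \<ge> 0" unfolding C1_def using C C00 by simp
  define I where "I = (LINT u|lborel. inverse ((1 + norm (u::'a)) ^ ?K))"
  have I: "I \<ge> 0" unfolding I_def by (rule Bochner_Integration.integral_nonneg) (simp add: add_nonneg_nonneg)
  have pt: "norm ((dif (\<eta> *\<^sub>R i) ^^ ?K) (F p) \<xi>) \<le> C1 * inverse ((1 + norm (inverse \<eta> *\<^sub>R \<xi>)) ^ ?K)" if \<eta>: "\<eta> \<noteq> 0" for p \<eta> \<xi>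
  proof -
    define r where "r = norm \<xi> / \<bar>\<eta>\<bar>"
    have r: "norm (inverse \<eta> *\<^sub>R \<xi>) = r" by (simp add: r_def divide_inverse mult.commute)
    have r0: "r \<ge> 0" by (simp add: r_def)
    have pos: "0 < (1 + r) ^ ?K" using r0 by simp
    have "norm ((dif (\<eta> *\<^sub>R i) ^^ ?K) (F p) \<xi>) * (1 + r) ^ ?K \<le> C1"
    proof (cases "2 * real ?K < r")
      case True
      then have lt: "2 * real ?K * \<bar>\<eta>\<bar> < norm \<xi>" using \<eta> by (simp add: r_def field_simps)
      then have \<xi>0: "norm \<xi> > 0" by (meson abs_ge_zero le_less_trans mult_nonneg_nonneg of_nat_0_le_iff zero_le_numeral)
      have r1: "1 \<le> r" using True DIM_positive[where 'a='a] by linarith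
      have "norm ((dif (\<eta> *\<^sub>R i) ^^ ?K) (F p) \<xi>) \<le> C * (\<bar>\<eta>\<bar> ^ ?K * norm \<xi> powr (- (0 + real ?K)))"
        using C(2)[OF lt, of p] by (simp only: mult.assoc)
      also have "\<bar>\<eta>\<bar> ^ ?K * norm \<xi> powr (- (0 + real ?K)) = inverse (r ^ ?K)"
      proof -
        have "norm \<xi> powr (- (0 + real ?K)) = inverse (norm \<xi> ^ ?K)"
          unfolding add_0 powr_minus using \<xi>0 by (simp only: powr_realpow)
        then show ?thesis
          unfolding r_def power_divide inverse_divide unfolding divide_inverse by (simp only:)
      qed
      finally have "norm ((dif (\<eta> *\<^sub>R i) ^^ ?K) (F p) \<xi>) * (1 + r) ^ ?K \<le> C * inverse (r ^ ?K) * (2 * r) ^ ?K"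
        using r1 C(1) by (intro mult_mono power_mono) auto
      also have "\<dots> = C * 2 ^ ?K"
        using r1 unfolding power_mult_distrib by simp
      also have "\<dots> \<le> C1" unfolding C1_def using C00 by simp
      finally show ?thesis .
    next
      case False
      have "norm ((dif (\<eta> *\<^sub>R i) ^^ ?K) (F p) \<xi>) \<le> C0" by (rule difs_bound) (rule C0)
      moreover have "(1 + r) ^ ?K \<le> (1 + 2 * real ?K) ^ ?K" using False r0 by (intro power_mono) auto
      ultimately have "norm ((dif (\<eta> *\<^sub>R i) ^^ ?K) (F p) \<xi>) * (1 + r) ^ ?K \<le> C0 * (1 + 2 * real ?K) ^ ?K"
        using pos C00 by (intro mult_mono) auto
      also have "\<dots> \<le> C1" unfolding C1_def using C by simp
      finally show ?thesis .
    qed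
    then show ?thesis unfolding r using pos by (simp add: field_simps)
  qed
  have "norm (LINT \<xi>|lborel. F p \<xi> * cis (2 * pi * (\<theta> \<bullet> \<xi>))) \<le> (C1 * I * inverse (2 ^ DIM('a))) * inverse (\<bar>\<theta> \<bullet> i\<bar> ^ DIM('a))" if \<theta>: "\<theta> \<bullet> i \<noteq> 0" for p \<theta>
  proof -
    define \<eta> where "\<eta> = 1 / (2 * (\<theta> \<bullet> i))"
    have \<eta>: "\<eta> \<noteq> 0" using \<theta> by (simp add: \<eta>_def)
    have h: "cis (2 * pi * (\<theta> \<bullet> (\<eta> *\<^sub>R i))) = - 1" using \<theta> by (simp add: \<eta>_def)
    let ?G = "(dif (\<eta> *\<^sub>R i) ^^ ?K) (F p)"
    have iG: "integrable lborel ?G" by (rule integrable_difs[OF int h])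
    have iw: "integrable lborel (\<lambda>\<xi>. C1 * inverse ((1 + norm (inverse \<eta> *\<^sub>R (\<xi>::'a))) ^ ?K))"
      using \<eta> integrable_lborel_scale[of "inverse \<eta>" "\<lambda>u::'a. inverse ((1 + norm u) ^ ?K)"] integrable_weight[where 'a='a]
      by (intro integrable_mult_right) simp
    have "norm (LINT \<xi>|lborel. F p \<xi> * cis (2 * pi * (\<theta> \<bullet> \<xi>))) = norm (LINT \<xi>|lborel. ?G \<xi> * cis (2 * pi * (\<theta> \<bullet> \<xi>)))"
      by (simp only: integral_difs[OF int h])
    also have "\<dots> \<le> (LINT \<xi>|lborel. C1 * inverse ((1 + norm (inverse \<eta> *\<^sub>R (\<xi>::'a))) ^ ?K))"
    proof (rule Bochner_Integration.integral_norm_bound_integral[OF _ iw])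
      show "integrable lborel (\<lambda>\<xi>. ?G \<xi> * cis (2 * pi * (\<theta> \<bullet> \<xi>)))"
        using borel_measurable_integrable[OF iG]
        by (intro Bochner_Integration.integrable_bound[OF iG]) (measurable, auto simp: norm_mult)
      show "norm (?G \<xi> * cis (2 * pi * (\<theta> \<bullet> \<xi>))) \<le> C1 * inverse ((1 + norm (inverse \<eta> *\<^sub>R \<xi>)) ^ ?K)" for \<xi>
        unfolding norm_mult norm_cis mult_1_right by (rule pt[OF \<eta>])
    qed
    also have "\<dots> = C1 * (\<bar>\<eta>\<bar> ^ DIM('a) * I)"
      using \<eta> by (subst integral_lborel_scale[OF \<eta>]) (simp add: I_def)
    also have "\<bar>\<eta>\<bar> ^ DIM('a) = inverse (2 ^ DIM('a)) * inverse (\<bar>\<theta> \<bullet> i\<bar> ^ DIM('a))"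
    proof -
      have "\<bar>\<eta>\<bar> = inverse 2 * inverse \<bar>\<theta> \<bullet> i\<bar>"
        by (simp add: \<eta>_def abs_mult field_simps)
      then show ?thesis by (simp only: power_mult_distrib power_inverse)
    qed
    finally show ?thesis by (simp only: mult_ac)
  qed
  then show ?thesis using C1 I by (intro exI[of _ "C1 * I * inverse (2 ^ DIM('a))"]) auto
qed

section \<open>Symbols\<close>

definition admissible :: "('a::euclidean_space \<Rightarrow> 'a \<Rightarrow> complex) \<Rightarrow> bool" where
  "admissible H \<longleftrightarrow> smooth (case_prod H) \<and> dilation_invariant H \<and>
     (\<forall>P\<in>symbol_ops. bounded (range (case_prod (P H))))"

lemma
  assumes "smooth (case_prod G)"
  shows frechet_derivative_fst: "frechet_derivative (\<lambda>y. G y \<xi>) (at x) k = dir_deriv (k, 0) (case_prod G) (x, \<xi>)"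
    and frechet_derivative_snd: "frechet_derivative (\<lambda>\<eta>. G x \<eta>) (at \<xi>) k = dir_deriv (0, k) (case_prod G) (x, \<xi>)"
proof -
  have "((\<lambda>y. case_prod G (y, \<xi>)) has_derivative (\<lambda>h. dir_deriv (h, 0) (case_prod G) (x, \<xi>))) (at x)"
    by (rule has_derivative_compose[OF _ smooth_has_derivative[OF assms]]) (auto intro!: derivative_eq_intros)
  from frechet_derivative_at[OF this]
  show "frechet_derivative (\<lambda>y. G y \<xi>) (at x) k = dir_deriv (k, 0) (case_prod G) (x, \<xi>)"
    by (simp add: fun_eq_iff)
  have "((\<lambda>\<eta>. case_prod G (x, \<eta>)) has_derivative (\<lambda>h. dir_deriv (0, h) (case_prod G) (x, \<xi>))) (at \<xi>)"
    by (rule has_derivative_compose[OF _ smooth_has_derivative[OF assms]]) (auto intro!: derivative_eq_intros)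
  from frechet_derivative_at[OF this]
  show "frechet_derivative (\<lambda>\<eta>. G x \<eta>) (at \<xi>) k = dir_deriv (0, k) (case_prod G) (x, \<xi>)"
    by (simp add: fun_eq_iff)
qed

lemma Basis_pairI:
  "k \<in> Basis \<Longrightarrow> (k, 0) \<in> Basis" "k \<in> Basis \<Longrightarrow> (0, k) \<in> Basis"
  by (auto simp: Basis_prod_def)

lemma symbol_ops_smooth:
  assumes "P \<in> symbol_ops" "smooth (case_prod G)"
  shows "smooth (case_prod (P G))"
  using assms
proof (induction arbitrary: G)
  case (gen_x j k)
  have "case_prod (\<lambda>x \<xi>. of_real (x \<bullet> j) * frechet_derivative (\<lambda>y. G y \<xi>) (at x) k)
    = (\<lambda>z. of_real (fst z \<bullet> j) * dir_deriv (k, 0) (case_prod G) z)"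
    by (simp add: fun_eq_iff frechet_derivative_fst[OF gen_x(3)])
  moreover have "smooth (\<lambda>z. of_real (fst z \<bullet> j) * dir_deriv (k, 0) (case_prod G) z)"
    by (intro smooth_linear_times smooth_dir_deriv gen_x Basis_pairI bounded_linear_intros)
  ultimately show ?case by simp
next
  case (gen_xi j k)
  have "case_prod (\<lambda>x \<xi>. of_real (\<xi> \<bullet> j) * frechet_derivative (\<lambda>\<eta>. G x \<eta>) (at \<xi>) k)
    = (\<lambda>z. of_real (snd z \<bullet> j) * dir_deriv (0, k) (case_prod G) z)"
    by (simp add: fun_eq_iff frechet_derivative_snd[OF gen_xi(3)])
  moreover have "smooth (\<lambda>z. of_real (snd z \<bullet> j) * dir_deriv (0, k) (case_prod G) z)"
    by (intro smooth_linear_times smooth_dir_deriv gen_xi Basis_pairI bounded_linear_intros)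
  ultimately show ?case by simp
next
  case one
  then show ?case by simp
next
  case (add P Q)
  have "case_prod (\<lambda>x \<xi>. P G x \<xi> + Q G x \<xi>) = (\<lambda>z. case_prod (P G) z + case_prod (Q G) z)"
    by (auto simp: fun_eq_iff)
  then show ?case using smooth_add add by metis
next
  case (scale P c)
  have "case_prod (\<lambda>x \<xi>. c * P G x \<xi>) = (\<lambda>z. c * case_prod (P G) z)"
    by (auto simp: fun_eq_iff)
  then show ?case using smooth_cmult scale by metis
next
  case (comp P Q)
  then show ?case by blast
qed

text \<open>Exchanging x and \<xi> exchanges the two kinds of generators.\<close>

lemma symbol_ops_swap:
  assumes "P \<in> symbol_ops"
  shows "\<exists>Q\<in>symbol_ops. \<forall>G. P (\<lambda>x \<xi>. G \<xi> x) = (\<lambda>x \<xi>. Q G \<xi> x)"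
  using assms
proof induction
  case (gen_x j k)
  show ?case
    by (rule bexI[OF _ symbol_ops.gen_xi[OF gen_x]]) simp
next
  case (gen_xi j k)
  show ?case
    by (rule bexI[OF _ symbol_ops.gen_x[OF gen_xi]]) simp
next
  case one
  show ?case by (rule bexI[OF _ symbol_ops.one]) simp
next
  case (add P Q)
  then obtain P' Q' where "P' \<in> symbol_ops" "Q' \<in> symbol_ops"
    "\<forall>G. P (\<lambda>x \<xi>. G \<xi> x) = (\<lambda>x \<xi>. P' G \<xi> x)" "\<forall>G. Q (\<lambda>x \<xi>. G \<xi> x) = (\<lambda>x \<xi>. Q' G \<xi> x)" by blast
  then show ?case by (intro bexI[OF _ symbol_ops.add[of P' Q']]) simp_all
next
  case (scale P c)
  then obtain P' where "P' \<in> symbol_ops" "\<forall>G. P (\<lambda>x \<xi>. G \<xi> x) = (\<lambda>x \<xi>. P' G \<xi> x)" by blast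
  then show ?case by (intro bexI[OF _ symbol_ops.scale[of P' c]]) simp_all
next
  case (comp P Q)
  then obtain P' Q' where "P' \<in> symbol_ops" "Q' \<in> symbol_ops"
    "\<forall>G. P (\<lambda>x \<xi>. G \<xi> x) = (\<lambda>x \<xi>. P' G \<xi> x)" "\<forall>G. Q (\<lambda>x \<xi>. G \<xi> x) = (\<lambda>x \<xi>. Q' G \<xi> x)" by blast
  then show ?case by (intro bexI[OF _ symbol_ops.comp[of P' Q']]) simp_all
qed

lemma smooth_swap:
  assumes "smooth (case_prod H)"
  shows "smooth (case_prod (\<lambda>x \<xi>. H \<xi> x))"
proof (rule smooth_coinduct[of _ "{f \<circ> prod.swap | f. smooth f}"])
  show "case_prod (\<lambda>x \<xi>. H \<xi> x) \<in> {f \<circ> prod.swap | f. smooth f}"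
    using assms by (auto intro!: exI[of _ "case_prod H"])
next
  have der: "(f \<circ> prod.swap has_derivative (\<lambda>h. dir_deriv (prod.swap h) f (prod.swap z))) (at z)"
    if "smooth f" for f :: "'a \<times> 'b \<Rightarrow> complex" and z
    unfolding o_def
    by (rule has_derivative_compose[OF _ smooth_has_derivative[OF that]])
       (auto intro!: derivative_eq_intros simp: prod.swap_def)
  fix g :: "'b \<times> 'a \<Rightarrow> complex" assume "g \<in> {f \<circ> prod.swap | f. smooth f}"
  then obtain f where f: "g = f \<circ> prod.swap" "smooth f" by blast
  show "g differentiable (at z)" for z
    unfolding f differentiable_def using der[OF f(2)] by blast
  show "dir_deriv b g \<in> {f \<circ> prod.swap | f. smooth f}" if b: "b \<in> Basis" for b
  proof -
    have "prod.swap b \<in> Basis" using b by (auto simp: Basis_prod_def)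
    moreover have "dir_deriv b g = dir_deriv (prod.swap b) f \<circ> prod.swap"
      unfolding f(1) by (subst dir_deriv_eqI[OF der[OF f(2)]]) (simp add: fun_eq_iff)
    ultimately show ?thesis using smooth_dir_deriv[OF f(2)] by blast
  qed
qed

text \<open>The antistandard calculus integrates over x; by this symmetry it is covered by the
  estimates made for integration over \<xi>.\<close>

lemma admissible_swap:
  assumes H: "admissible H"
  shows "admissible (\<lambda>x \<xi>. H \<xi> x)"
  unfolding admissible_def
proof (intro conjI ballI)
  show "smooth (case_prod (\<lambda>x \<xi>. H \<xi> x))"
    using H smooth_swap unfolding admissible_def by blast
  show "dilation_invariant (\<lambda>x \<xi>. H \<xi> x)"
    unfolding dilation_invariant_def
  proof (intro allI impI)
    fix t :: real and x \<xi> assume "t \<noteq> 0"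
    then have "H (inverse t *\<^sub>R \<xi>) (inverse (inverse t) *\<^sub>R x) = H \<xi> x"
      using H unfolding admissible_def dilation_invariant_def by (meson nonzero_imp_inverse_nonzero)
    then show "H (inverse t *\<^sub>R \<xi>) (t *\<^sub>R x) = H \<xi> x" by simp
  qed
  fix P :: "('a \<Rightarrow> 'a \<Rightarrow> complex) \<Rightarrow> 'a \<Rightarrow> 'a \<Rightarrow> complex" assume "P \<in> symbol_ops"
  then obtain Q where Q: "Q \<in> symbol_ops" "P (\<lambda>x \<xi>. H \<xi> x) = (\<lambda>x \<xi>. Q H \<xi> x)"
    using symbol_ops_swap by metis
  have "range (case_prod (P (\<lambda>x \<xi>. H \<xi> x))) \<subseteq> range (case_prod (Q H))"
    unfolding Q(2) by auto
  then show "bounded (range (case_prod (P (\<lambda>x \<xi>. H \<xi> x))))"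
    using H Q(1) bounded_subset unfolding admissible_def by blast
qed

lemma admissible_bound:
  assumes "admissible H" "P \<in> symbol_ops"
  obtains C where "C \<ge> 0" "\<And>x \<xi>. norm (P H x \<xi>) \<le> C"
proof -
  obtain C where C: "\<And>z. norm (case_prod (P H) z) \<le> C"
    using assms unfolding admissible_def bounded_iff by blast
  have "0 \<le> C" by (rule order_trans[OF norm_ge_zero C])
  moreover have "norm (P H x \<xi>) \<le> C" for x \<xi> using C[of "(x, \<xi>)"] by simp
  ultimately show thesis by (rule that)
qed

lemma admissible_dilation: "admissible H \<Longrightarrow> t \<noteq> 0 \<Longrightarrow> H (t *\<^sub>R x) \<xi> = H x (t *\<^sub>R \<xi>)"
proof -
  assume H: "admissible H" and t: "t \<noteq> 0"
  have "H (t *\<^sub>R x) (inverse t *\<^sub>R (t *\<^sub>R \<xi>)) = H x (t *\<^sub>R \<xi>)"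
    using H t unfolding admissible_def dilation_invariant_def by blast
  then show ?thesis using t by simp
qed

lemma sum_inner_square: "(\<Sum>j\<in>Basis. (\<xi> \<bullet> j) * (\<xi> \<bullet> j)) = (norm \<xi>)\<^sup>2"
  by (simp add: power2_norm_eq_inner euclidean_inner[symmetric])

text \<open>Away from \<xi> = 0 the derivative in the direction i is the sum over j of (\<xi>
  \<bullet> j) / |\<xi>|^2 times the generator formed from \<xi> \<bullet> j and that derivative.
  The quotients supply the gained power, and the generators stay in the algebra, so the induction is
  over all \<open>P\<close>.\<close>

lemma symb_direction:
  assumes H: "admissible H" and i: "i \<in> Basis"
  shows "P \<in> symbol_ops \<Longrightarrow> symb i k 0 (\<lambda>y \<xi>. P H y \<xi>)"
proof (induction k arbitrary: P)
  case 0
  obtain C where "\<And>x \<xi>. norm (P H x \<xi>) \<le> C"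
    using admissible_bound[OF H 0] by metis
  then show ?case by (auto intro!: exI[of _ C])
next
  case (Suc k)
  note sm = symbol_ops_smooth[OF Suc.prems, of H]
  have smP: "smooth (case_prod (P H))" using sm H unfolding admissible_def by blast
  define Q where "Q j G = (\<lambda>x \<xi>. of_real (\<xi> \<bullet> j) * frechet_derivative (\<lambda>\<eta>. P G x \<eta>) (at \<xi>) i)" for j G
  have Q: "Q j \<in> symbol_ops" if "j \<in> Basis" for j
    using symbol_ops.comp[OF symbol_ops.gen_xi[OF that i] Suc.prems] by (simp add: Q_def[abs_def])
  show ?case
  proof (rule symb_SucI[of _ _ _ "\<lambda>y \<xi>. \<Sum>j\<in>Basis. of_real ((\<xi> \<bullet> j) * inverse ((norm \<xi>)\<^sup>2)) * Q j H y \<xi>"])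
    show "symb i 0 0 (\<lambda>y \<xi>. P H y \<xi>)" using Suc.IH[OF Suc.prems] by (rule symb_0)
    show "symb i k (0 + 1) (\<lambda>y \<xi>. \<Sum>j\<in>Basis. of_real ((\<xi> \<bullet> j) * inverse ((norm \<xi>)\<^sup>2)) * Q j H y \<xi>)"
      using i by (intro symb_sum symb_times_quotient Suc.IH Q) auto
    fix y \<xi> :: 'a assume \<xi>: "\<xi> \<noteq> 0"
    have "((\<lambda>s. case_prod (P H) ((y, \<xi>) + s *\<^sub>R (0, i))) has_vector_derivative dir_deriv (0, i) (case_prod (P H)) (y, \<xi>)) (at 0)"
      by (rule has_vector_derivative_line[OF smP])
    then have d: "((\<lambda>s. P H y (\<xi> + s *\<^sub>R i)) has_vector_derivative dir_deriv (0, i) (case_prod (P H)) (y, \<xi>)) (at 0)"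
      by simp
    have "(\<Sum>j\<in>Basis. of_real ((\<xi> \<bullet> j) * inverse ((norm \<xi>)\<^sup>2)) * Q j H y \<xi>)
      = (\<Sum>j\<in>Basis. of_real ((\<xi> \<bullet> j) * (\<xi> \<bullet> j)) * (of_real (inverse ((norm \<xi>)\<^sup>2)) * dir_deriv (0, i) (case_prod (P H)) (y, \<xi>)))"
      unfolding Q_def frechet_derivative_snd[OF smP] by (intro sum.cong refl) (simp add: mult_ac)
    also have "\<dots> = of_real (\<Sum>j\<in>Basis. (\<xi> \<bullet> j) * (\<xi> \<bullet> j)) * (of_real (inverse ((norm \<xi>)\<^sup>2)) * dir_deriv (0, i) (case_prod (P H)) (y, \<xi>))"
      by (simp only: of_real_sum sum_distrib_right)
    also have "\<dots> = dir_deriv (0, i) (case_prod (P H)) (y, \<xi>)"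
      unfolding sum_inner_square mult.assoc[symmetric] of_real_mult[symmetric] using \<xi> by simp
    finally show "((\<lambda>s. P H y (\<xi> + s *\<^sub>R i)) has_vector_derivative (\<Sum>j\<in>Basis. of_real ((\<xi> \<bullet> j) * inverse ((norm \<xi>)\<^sup>2)) * Q j H y \<xi>)) (at 0)"
      using d by (simp only:)
  qed
qed

text \<open>Along a ray, t d/dt acts as the Euler operator, the sum of the diagonal generators in
  \<xi>. Its bounds involve neither the length nor the direction of \<xi>, which gives uniformity in
  both variables.\<close>

lemma symb_radial:
  assumes H: "admissible H"
  shows "P \<in> symbol_ops \<Longrightarrow> symb (1::real) k 0 (\<lambda>p t. P H (fst p) (t *\<^sub>R snd p))"
proof (induction k arbitrary: P)
  case 0
  obtain C where "\<And>x \<xi>. norm (P H x \<xi>) \<le> C"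
    using admissible_bound[OF H 0] by metis
  then show ?case by (auto intro!: exI[of _ C])
next
  case (Suc k)
  note sm = symbol_ops_smooth[OF Suc.prems, of H]
  have smP: "smooth (case_prod (P H))" using sm H unfolding admissible_def by blast
  define Q where "Q j G = (\<lambda>x \<xi>. of_real (\<xi> \<bullet> j) * frechet_derivative (\<lambda>\<eta>. P G x \<eta>) (at \<xi>) j)" for j :: 'a and G
  have Q: "Q j \<in> symbol_ops" if "j \<in> Basis" for j
    using symbol_ops.comp[OF symbol_ops.gen_xi[OF that that] Suc.prems] by (simp add: Q_def[abs_def])
  show ?case
  proof (rule symb_SucI[of _ _ _ "\<lambda>p t. of_real ((t \<bullet> 1) * inverse ((norm t)\<^sup>2)) * (\<Sum>j\<in>Basis. Q j H (fst p) (t *\<^sub>R snd p))"])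
    show "symb (1::real) 0 0 (\<lambda>p t. P H (fst p) (t *\<^sub>R snd p))" using Suc.IH[OF Suc.prems] by (rule symb_0)
    show "symb (1::real) k (0 + 1) (\<lambda>p t. of_real ((t \<bullet> 1) * inverse ((norm t)\<^sup>2)) * (\<Sum>j\<in>Basis. Q j H (fst p) (t *\<^sub>R snd p)))"
      by (intro symb_times_quotient symb_sum Suc.IH Q) auto
    fix p :: "'a \<times> 'a" and t :: real assume t: "t \<noteq> 0"
    obtain y \<xi> where p: "p = (y, \<xi>)" by (cases p)
    have "((\<lambda>s. case_prod (P H) ((y, t *\<^sub>R \<xi>) + s *\<^sub>R (0, \<xi>))) has_vector_derivative dir_deriv (0, \<xi>) (case_prod (P H)) (y, t *\<^sub>R \<xi>)) (at 0)"
      by (rule has_vector_derivative_line[OF smP])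
    then have d: "((\<lambda>s. P H (fst p) ((t + s *\<^sub>R 1) *\<^sub>R snd p)) has_vector_derivative dir_deriv (0, \<xi>) (case_prod (P H)) (y, t *\<^sub>R \<xi>)) (at 0)"
      by (simp add: p scaleR_add_left)
    have dd: "dir_deriv (0, \<xi>) (case_prod (P H)) (y, t *\<^sub>R \<xi>) = (\<Sum>j\<in>Basis. of_real (\<xi> \<bullet> j) * dir_deriv (0, j) (case_prod (P H)) (y, t *\<^sub>R \<xi>))"
    proof -
      have lin: "linear (\<lambda>h. dir_deriv h (case_prod (P H)) (y, t *\<^sub>R \<xi>))"
        using smooth_has_derivative[OF smP] has_derivative_linear by blast
      have "(0, \<xi>) = (\<Sum>j\<in>Basis. (\<xi> \<bullet> j) *\<^sub>R (0::'a, j))"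
        by (simp add: prod_eq_iff fst_sum snd_sum euclidean_representation)
      then have "dir_deriv (0, \<xi>) (case_prod (P H)) (y, t *\<^sub>R \<xi>) = (\<Sum>j\<in>Basis. dir_deriv ((\<xi> \<bullet> j) *\<^sub>R (0, j)) (case_prod (P H)) (y, t *\<^sub>R \<xi>))"
        using linear_sum[OF lin] by metis
      then show ?thesis by (simp only: linear_scale[OF lin] scaleR_conv_of_real)
    qed
    have "of_real ((t \<bullet> 1) * inverse ((norm t)\<^sup>2)) * (\<Sum>j\<in>Basis. Q j H (fst p) (t *\<^sub>R snd p))
      = of_real ((t \<bullet> 1) * inverse ((norm t)\<^sup>2)) * (\<Sum>j\<in>Basis. of_real t * (of_real (\<xi> \<bullet> j) * dir_deriv (0, j) (case_prod (P H)) (y, t *\<^sub>R \<xi>)))"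
      unfolding Q_def frechet_derivative_snd[OF smP] by (simp add: p mult.assoc)
    also have "\<dots> = dir_deriv (0, \<xi>) (case_prod (P H)) (y, t *\<^sub>R \<xi>)"
    proof -
      have "(t \<bullet> 1) * inverse ((norm t)\<^sup>2) * t = 1"
        using t by (simp add: power2_eq_square field_simps)
      then show ?thesis
        unfolding dd sum_distrib_left[symmetric]
        by (simp only: mult.assoc[symmetric] of_real_mult[symmetric] of_real_1 mult_1)
    qed
    finally show "((\<lambda>s. P H (fst p) ((t + s *\<^sub>R 1) *\<^sub>R snd p)) has_vector_derivative of_real ((t \<bullet> 1) * inverse ((norm t)\<^sup>2)) * (\<Sum>j\<in>Basis. Q j H (fst p) (t *\<^sub>R snd p))) (at 0)"
      using d by (simp only:)
  qed
qed

lemma admissible_borel: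
  "admissible H \<Longrightarrow> (\<lambda>z. H (fst z) (snd z)) \<in> borel_measurable borel"
  using smooth_borel[of "case_prod H"] unfolding admissible_def by (simp add: case_prod_unfold)

lemma admissible_borel_comp:
  assumes H: "admissible H" and [measurable]: "f \<in> M \<rightarrow>\<^sub>M borel" "g \<in> M \<rightarrow>\<^sub>M borel"
  shows "(\<lambda>x. H (f x) (g x)) \<in> borel_measurable M"
proof -
  have "(\<lambda>x. (f x, g x)) \<in> M \<rightarrow>\<^sub>M borel"
    unfolding borel_prod[symmetric] by measurable
  from measurable_compose[OF this admissible_borel[OF H]] show ?thesis by simp
qed

lemma damp_borel_comp:
  assumes H: "admissible H" and [measurable]: "f \<in> M \<rightarrow>\<^sub>M borel" "g \<in> M \<rightarrow>\<^sub>M borel"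
  shows "(\<lambda>x. damp \<alpha> H (f x) (g x)) \<in> borel_measurable M"
  unfolding damp_def using admissible_borel_comp[OF assms] by measurable

lemma admissible_bound_self:
  assumes "admissible H"
  obtains C where "C \<ge> 0" "\<And>x \<xi>. norm (H x \<xi>) \<le> C"
  using admissible_bound[OF assms symbol_ops.one] by metis

lemma norm_damp: "norm (damp \<alpha> H x \<xi>) = exp (- \<alpha> * (norm x * norm \<xi>)) * norm (H x \<xi>)"
  by (simp add: damp_def norm_mult)

lemma norm_damp_le: "\<alpha> \<ge> 0 \<Longrightarrow> norm (damp \<alpha> H x \<xi>) \<le> norm (H x \<xi>)"
  unfolding norm_damp by (rule mult_left_le_one_le) auto

lemma damp_bound: "\<alpha> \<ge> 0 \<Longrightarrow> norm (H x \<xi>) \<le> C \<Longrightarrow> norm (damp \<alpha> H x \<xi>) \<le> C"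
  by (rule order_trans[OF norm_damp_le])

section \<open>The operator applied to a Schwartz function\<close>

text \<open>One operator for both calculi: \<kappa> = 1 and \<psi> = \<open>fourier v\<close> give
  \<open>Op0\<close>; \<kappa> = -1, the transposed symbol and \<psi> = \<open>v\<close> give the
  integral inside \<open>Op1\<close>. The value \<alpha> = 0 is the undamped case.\<close>

definition osc_op :: "real \<Rightarrow> real \<Rightarrow> ('a::euclidean_space \<Rightarrow> 'a \<Rightarrow> complex) \<Rightarrow> ('a \<Rightarrow> complex) \<Rightarrow> 'a \<Rightarrow> complex" where
  "osc_op \<kappa> \<alpha> H \<psi> y = (LINT \<xi>|lborel. damp \<alpha> H y \<xi> * cis (2 * pi * \<kappa> * (y \<bullet> \<xi>)) * \<psi> \<xi>)"

lemma damp_0 [simp]: "damp 0 H = H"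
  by (simp add: damp_def fun_eq_iff)

lemma osc_op_borel:
  assumes H: "admissible H" and [measurable]: "\<psi> \<in> borel_measurable borel"
  shows "osc_op \<kappa> \<alpha> H \<psi> \<in> borel_measurable borel"
proof -
  have [measurable]: "(\<lambda>p. damp \<alpha> H (fst p) (snd p)) \<in> borel_measurable (borel \<Otimes>\<^sub>M lborel)"
    by (rule damp_borel_comp[OF H]) measurable
  show ?thesis unfolding osc_op_def[abs_def]
    by (rule lborel.borel_measurable_lebesgue_integral) (simp add: case_prod_unfold, measurable)
qed

lemma osc_op_integrable:
  assumes H: "admissible H" and \<psi>: "rapid \<psi>" and \<alpha>: "\<alpha> \<ge> 0"
  shows "integrable lborel (\<lambda>\<xi>. damp \<alpha> H y \<xi> * cis (2 * pi * \<kappa> * (y \<bullet> \<xi>)) * \<psi> \<xi>)"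
proof -
  obtain C where C: "C \<ge> 0" "\<And>x \<xi>. norm (H x \<xi>) \<le> C" by (rule admissible_bound_self[OF H]) (rule that, assumption+)
  have [measurable]: "\<psi> \<in> borel_measurable borel" using \<psi> by (rule rapid_borel)
  have [measurable]: "(\<lambda>\<xi>. damp \<alpha> H y \<xi>) \<in> borel_measurable borel"
    by (rule damp_borel_comp[OF H]) auto
  show ?thesis
  proof (rule Bochner_Integration.integrable_bound)
    show "integrable lborel (\<lambda>\<xi>. of_real C * \<psi> \<xi>)"
      by (intro integrable_mult_right rapid_integrable \<psi>)
    show "AE \<xi> in lborel. norm (damp \<alpha> H y \<xi> * cis (2 * pi * \<kappa> * (y \<bullet> \<xi>)) * \<psi> \<xi>) \<le> norm (of_real C * \<psi> \<xi>)"
      using C damp_bound[where H=H, OF \<alpha> C(2)] by (auto simp: norm_mult intro!: mult_right_mono)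
  qed measurable
qed

text \<open>For a coordinate i in which x does not vanish, the exponential oscillates in the
  direction i with frequency proportional to t, and \<open>osc_decay_symb\<close> applies. The
  constant may depend on x but not on \<alpha>, since it is to dominate the passage to \<alpha> =
  0.\<close>

lemma osc_op_bound:
  fixes H :: "'a::euclidean_space \<Rightarrow> 'a \<Rightarrow> complex"
  assumes H: "admissible H" and \<psi>: "\<psi> \<in> schwartz" and \<kappa>: "\<kappa> \<noteq> 0" and x: "x \<noteq> 0"
  shows "\<exists>C\<ge>0. \<forall>\<alpha>\<ge>0. \<forall>t. norm (osc_op \<kappa> \<alpha> H \<psi> (t *\<^sub>R x)) \<le> C * inverse ((1 + \<bar>t\<bar>) ^ DIM('a))"
proof -
  let ?N = "DIM('a)"
  obtain i :: 'a where i: "i \<in> Basis" "x \<bullet> i \<noteq> 0"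
    using x euclidean_all_zero_iff by metis
  obtain C where C: "C \<ge> 0" "\<And>x \<xi>. norm (H x \<xi>) \<le> C" by (rule admissible_bound_self[OF H]) (rule that, assumption+)
  note r\<psi> = schwartz_rapid[OF \<psi>]
  obtain D where D: "D \<ge> 0" "\<And>\<xi>. norm (\<psi> \<xi>) \<le> D * inverse ((1 + norm \<xi>) ^ 0)"
    by (rule rapid_bound[OF r\<psi>]) (rule that, assumption+)
  \<comment> \<open>The damping factor is exp (- \<beta> |\<xi>|) with \<beta> = \<alpha> |y|.
    Treating (y, \<beta>) as a free parameter gives bounds uniform in \<alpha> and in the point of
    the ray.\<close>
  define F where "F p \<xi> = of_real (exp (- \<bar>snd p\<bar> * norm \<xi>)) * (H (fst p) \<xi> * \<psi> \<xi>)" for p :: "'a \<times> real" and \<xi>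
  have sF: "symb i (2 * ?N) 0 F"
  proof -
    have 1: "symb i (2 * ?N) 0 (\<lambda>p::'a \<times> real. \<lambda>\<xi>. of_real (exp (- \<bar>snd p\<bar> * norm \<xi>)))"
      using symb_reparam[OF symb_exp, of i "2 * ?N" snd] i by simp
    have 2: "symb i (2 * ?N) 0 (\<lambda>p::'a \<times> real. \<lambda>\<xi>. H (fst p) \<xi>)"
      using symb_reparam[OF symb_direction[OF H i(1) symbol_ops.one], of "2 * ?N" fst] by simp
    have 3: "symb i (2 * ?N) 0 (\<lambda>p::'a \<times> real. \<lambda>\<xi>. \<psi> \<xi>)"
      using symb_schwartz[OF i(1) \<psi>, of "2 * ?N" 0] by simp
    show ?thesis unfolding F_def using symb_mult[OF 1 symb_mult[OF 2 3]] by simp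
  qed
  have bF: "norm (F p \<xi>) \<le> C * norm (\<psi> \<xi>)" for p \<xi>
  proof -
    have "norm (F p \<xi>) \<le> 1 * (C * norm (\<psi> \<xi>))"
      unfolding F_def norm_mult using C by (intro mult_mono) auto
    then show ?thesis by simp
  qed
  have C0: "norm (F p \<xi>) \<le> C * D" for p \<xi>
    using order_trans[OF bF mult_left_mono[OF D(2) C(1)]] by simp
  have [measurable]: "\<psi> \<in> borel_measurable borel" using r\<psi> by (rule rapid_borel)
  have iF: "integrable lborel (F p)" for p
  proof (rule Bochner_Integration.integrable_bound)
    show "integrable lborel (\<lambda>\<xi>. of_real C * \<psi> \<xi>)"
      by (intro integrable_mult_right rapid_integrable r\<psi>)
    have [measurable]: "(\<lambda>\<xi>. H (fst p) \<xi>) \<in> borel_measurable borel"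
      by (rule admissible_borel_comp[OF H]) auto
    show "F p \<in> borel_measurable lborel" unfolding F_def by measurable
    show "AE \<xi> in lborel. norm (F p \<xi>) \<le> norm (of_real C * \<psi> \<xi>)"
      using bF[of p] C by (simp add: norm_mult)
  qed
  obtain E where E: "E \<ge> 0" "\<forall>p \<theta>. \<theta> \<bullet> i \<noteq> 0 \<longrightarrow> norm (LINT \<xi>|lborel. F p \<xi> * cis (2 * pi * (\<theta> \<bullet> \<xi>))) \<le> E * inverse (\<bar>\<theta> \<bullet> i\<bar> ^ ?N)"
    using osc_decay_symb[OF norm_Basis[OF i(1)] sF C0 iF] by (elim exE conjE) (rule that)
  have osc: "osc_op \<kappa> \<alpha> H \<psi> y = (LINT \<xi>|lborel. F (y, \<alpha> * norm y) \<xi> * cis (2 * pi * ((\<kappa> *\<^sub>R y) \<bullet> \<xi>)))" if "\<alpha> \<ge> 0" for \<alpha> y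
    unfolding osc_op_def F_def damp_def using that by (simp add: mult_ac)
  define M where "M = C * (LINT \<xi>|lborel. norm (\<psi> \<xi>))"
  have M: "M \<ge> 0" unfolding M_def using C by (intro mult_nonneg_nonneg Bochner_Integration.integral_nonneg) auto
  define K where "K = E * inverse (\<bar>\<kappa> * (x \<bullet> i)\<bar> ^ ?N)"
  have K: "K \<ge> 0" unfolding K_def using E by simp
  have "norm (osc_op \<kappa> \<alpha> H \<psi> (t *\<^sub>R x)) \<le> ((M + K) * 2 ^ ?N) * inverse ((1 + \<bar>t\<bar>) ^ ?N)" if \<alpha>: "\<alpha> \<ge> 0" for \<alpha> t
  proof -
    have pos: "0 < (1 + \<bar>t\<bar>) ^ ?N" by (simp add: add_pos_nonneg)
    have "norm (osc_op \<kappa> \<alpha> H \<psi> (t *\<^sub>R x)) * (1 + \<bar>t\<bar>) ^ ?N \<le> (M + K) * 2 ^ ?N"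
    proof (cases "\<bar>t\<bar> \<le> 1")
      case True
      have "norm (osc_op \<kappa> \<alpha> H \<psi> (t *\<^sub>R x)) \<le> (LINT \<xi>|lborel. C * norm (\<psi> \<xi>))"
        unfolding osc_op_def
      proof (rule Bochner_Integration.integral_norm_bound_integral[OF osc_op_integrable[OF H r\<psi> \<alpha>]])
        show "integrable lborel (\<lambda>\<xi>. C * norm (\<psi> \<xi>))"
          by (intro integrable_mult_right integrable_norm rapid_integrable r\<psi>)
        show "norm (damp \<alpha> H (t *\<^sub>R x) \<xi> * cis (2 * pi * \<kappa> * (t *\<^sub>R x \<bullet> \<xi>)) * \<psi> \<xi>) \<le> C * norm (\<psi> \<xi>)" for \<xi>
          using damp_bound[where H=H, OF \<alpha> C(2)] by (auto simp: norm_mult intro!: mult_right_mono)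
      qed
      then have "norm (osc_op \<kappa> \<alpha> H \<psi> (t *\<^sub>R x)) \<le> M + K" using K by (simp add: M_def)
      moreover have "(1 + \<bar>t\<bar>) ^ ?N \<le> 2 ^ ?N" using True by (intro power_mono) auto
      ultimately show ?thesis using pos M K by (intro mult_mono) auto
    next
      case False
      then have t0: "t \<noteq> 0" by auto
      have "(\<kappa> *\<^sub>R t *\<^sub>R x) \<bullet> i \<noteq> 0" using \<kappa> t0 i by simp
      then have "norm (osc_op \<kappa> \<alpha> H \<psi> (t *\<^sub>R x)) \<le> E * inverse (\<bar>(\<kappa> *\<^sub>R t *\<^sub>R x) \<bullet> i\<bar> ^ ?N)"
        unfolding osc[OF \<alpha>] using E(2) by blast
      also have "\<dots> = K * inverse (\<bar>t\<bar> ^ ?N)"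
        unfolding K_def by (simp add: abs_mult power_mult_distrib mult_ac)
      finally have "norm (osc_op \<kappa> \<alpha> H \<psi> (t *\<^sub>R x)) * (1 + \<bar>t\<bar>) ^ ?N \<le> (K * inverse (\<bar>t\<bar> ^ ?N)) * (2 * \<bar>t\<bar>) ^ ?N"
        using False K by (intro mult_mono power_mono) auto
      also have "\<dots> = K * 2 ^ ?N" using t0 unfolding power_mult_distrib by simp
      also have "\<dots> \<le> (M + K) * 2 ^ ?N" using M by (intro mult_right_mono) auto
      finally show ?thesis .
    qed
    then show ?thesis using pos by (simp add: field_simps)
  qed
  then show ?thesis using M K by (intro exI[of _ "(M + K) * 2 ^ ?N"]) auto
qed

lemma tendsto_damp: "((\<lambda>\<alpha>. damp \<alpha> H x \<xi>) \<longlongrightarrow> H x \<xi>) (at_right 0)"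
proof -
  have "((\<lambda>\<alpha>. of_real (exp (- \<alpha> * (norm x * norm \<xi>))) * H x \<xi>) \<longlongrightarrow> of_real (exp (- 0 * (norm x * norm \<xi>))) * H x \<xi>) (at_right 0)"
    by (intro tendsto_intros)
  then show ?thesis by (simp add: damp_def[abs_def])
qed

lemma osc_op_tendsto:
  assumes H: "admissible H" and \<psi>: "rapid \<psi>"
  shows "((\<lambda>\<alpha>. osc_op \<kappa> \<alpha> H \<psi> y) \<longlongrightarrow> osc_op \<kappa> 0 H \<psi> y) (at_right 0)"
proof -
  obtain C where C: "C \<ge> 0" "\<And>x \<xi>. norm (H x \<xi>) \<le> C" by (rule admissible_bound_self[OF H]) (rule that, assumption+)
  have m: "(\<lambda>\<xi>. damp \<alpha> H y \<xi> * cis (2 * pi * \<kappa> * (y \<bullet> \<xi>)) * \<psi> \<xi>) \<in> borel_measurable lborel" if "\<alpha> \<ge> 0" for \<alpha>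
    using borel_measurable_integrable[OF osc_op_integrable[OF H \<psi> that]] .
  show ?thesis unfolding osc_op_def
  proof (rule dominated_convergence_within[where w="\<lambda>\<xi>. C * norm (\<psi> \<xi>)"])
    show "integrable lborel (\<lambda>\<xi>. C * norm (\<psi> \<xi>))"
      by (intro integrable_mult_right integrable_norm rapid_integrable \<psi>)
    show "AE \<xi> in lborel. ((\<lambda>\<alpha>. damp \<alpha> H y \<xi> * cis (2 * pi * \<kappa> * (y \<bullet> \<xi>)) * \<psi> \<xi>) \<longlongrightarrow> damp 0 H y \<xi> * cis (2 * pi * \<kappa> * (y \<bullet> \<xi>)) * \<psi> \<xi>) (at_right 0)"
      unfolding damp_0 by (intro AE_I2 tendsto_mult tendsto_const tendsto_damp)
    show "AE \<xi> in lborel. norm (damp \<alpha> H y \<xi> * cis (2 * pi * \<kappa> * (y \<bullet> \<xi>)) * \<psi> \<xi>) \<le> C * norm (\<psi> \<xi>)" if "\<alpha> \<in> {0<..}" for \<alpha>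
      using damp_bound[where H=H, OF less_imp_le C(2)] that by (auto simp: norm_mult intro!: mult_right_mono)
  qed (use m m[of 0] in auto)
qed

text \<open>The decay of order n + 1 along the ray outweighs |t|^((n - 1)/2), because (n - 1)/2 + 2
  \<le> n + 1; dominated convergence in t follows.\<close>

theorem hom_comp_osc_op_tendsto:
  fixes H :: "'n::finite space \<Rightarrow> 'n space \<Rightarrow> complex"
  assumes H: "admissible H" and \<psi>: "\<psi> \<in> schwartz" and \<kappa>: "\<kappa> \<noteq> 0" and x: "x \<noteq> 0"
  shows "((\<lambda>\<alpha>. hom_comp lam \<epsilon> (osc_op \<kappa> \<alpha> H \<psi>) x) \<longlongrightarrow> hom_comp lam \<epsilon> (osc_op \<kappa> 0 H \<psi>) x) (at_right 0)"
proof -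
  note r\<psi> = schwartz_rapid[OF \<psi>]
  have [measurable]: "osc_op \<kappa> \<alpha> H \<psi> \<in> borel_measurable borel" for \<alpha>
    by (rule osc_op_borel[OF H rapid_borel[OF r\<psi>]])
  let ?e = "hexp CARD('n) lam"
  let ?p = "(real CARD('n) - 1) / 2"
  let ?N = "DIM('n space)"
  obtain C where C: "C \<ge> 0" "\<forall>\<alpha>\<ge>0. \<forall>t. norm (osc_op \<kappa> \<alpha> H \<psi> (t *\<^sub>R x)) \<le> C * inverse ((1 + \<bar>t\<bar>) ^ ?N)"
    using osc_op_bound[OF H \<psi> \<kappa> x] by (elim exE conjE) (rule that)
  have pN: "?p + 2 \<le> real ?N"
    using hexp_nonneg[where 'n='n] by (simp add: field_simps)
  have "((\<lambda>\<alpha>. LINT t|lborel. spow \<epsilon> ?e t * osc_op \<kappa> \<alpha> H \<psi> (t *\<^sub>R x)) \<longlongrightarrow> (LINT t|lborel. spow \<epsilon> ?e t * osc_op \<kappa> 0 H \<psi> (t *\<^sub>R x))) (at_right 0)"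
  proof (rule dominated_convergence_within[where w="\<lambda>t. C * (\<bar>t\<bar> powr ?p * inverse ((1 + \<bar>t\<bar> * 1) ^ ?N))"])
    show "integrable lborel (\<lambda>t. C * (\<bar>t\<bar> powr ?p * inverse ((1 + \<bar>t\<bar> * 1) ^ ?N)))"
      by (intro integrable_mult_right integrable_line_weight hexp_nonneg pN) simp
    show "AE t in lborel. ((\<lambda>\<alpha>. spow \<epsilon> ?e t * osc_op \<kappa> \<alpha> H \<psi> (t *\<^sub>R x)) \<longlongrightarrow> spow \<epsilon> ?e t * osc_op \<kappa> 0 H \<psi> (t *\<^sub>R x)) (at_right 0)"
      by (intro AE_I2 tendsto_mult tendsto_const osc_op_tendsto H r\<psi>)
    show "AE t in lborel. norm (spow \<epsilon> ?e t * osc_op \<kappa> \<alpha> H \<psi> (t *\<^sub>R x)) \<le> C * (\<bar>t\<bar> powr ?p * inverse ((1 + \<bar>t\<bar> * 1) ^ ?N))" if "\<alpha> \<in> {0<..}" for \<alpha>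
    proof (rule AE_I2)
      fix t
      have "norm (spow \<epsilon> ?e t * osc_op \<kappa> \<alpha> H \<psi> (t *\<^sub>R x)) \<le> \<bar>t\<bar> powr ?p * (C * inverse ((1 + \<bar>t\<bar>) ^ ?N))"
        unfolding norm_mult norm_spow Re_hexp using C(2) that by (intro mult_left_mono) auto
      then show "norm (spow \<epsilon> ?e t * osc_op \<kappa> \<alpha> H \<psi> (t *\<^sub>R x)) \<le> C * (\<bar>t\<bar> powr ?p * inverse ((1 + \<bar>t\<bar> * 1) ^ ?N))"
        by (simp add: mult_ac)
    qed
  qed measurable
  then show ?thesis unfolding hom_comp_def by (intro tendsto_mult tendsto_const)
qed

section \<open>Fourier integrals along rays\<close>

text \<open>Up to the constant, \<kappa> = 1 gives the regularized integral for f; the one for h has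
  \<kappa> = -1, the transposed symbol and \<open>- lam\<close>.\<close>

definition ray_integral ::
  "real \<Rightarrow> real \<Rightarrow> nat \<Rightarrow> complex \<Rightarrow> ('a::euclidean_space \<Rightarrow> 'a \<Rightarrow> complex) \<Rightarrow> 'a \<Rightarrow> 'a \<Rightarrow> complex" where
  "ray_integral \<kappa> \<alpha> \<epsilon> a H x \<xi> = (LINT t|lborel. damp \<alpha> H x (t *\<^sub>R \<xi>) * cis (2 * pi * \<kappa> * t) * spow \<epsilon> a t)"

lemma difs_tendsto:
  assumes "\<And>\<xi>. ((\<lambda>\<alpha>. F \<alpha> \<xi>) \<longlongrightarrow> F0 \<xi>) A"
  shows "((\<lambda>\<alpha>. (dif h ^^ k) (F \<alpha>) \<xi>) \<longlongrightarrow> (dif h ^^ k) F0 \<xi>) A"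
proof (induction k arbitrary: \<xi>)
  case (Suc k)
  have "((\<lambda>\<alpha>. dif h ((dif h ^^ k) (F \<alpha>)) \<xi>) \<longlongrightarrow> dif h ((dif h ^^ k) F0) \<xi>) A"
    unfolding dif_def[of h "(dif h ^^ k) _"] by (intro tendsto_intros Suc) simp
  then show ?case by simp
qed (use assms in simp)

lemma exp_decay_bound:
  fixes b :: real
  assumes "b \<ge> 0"
  shows "exp (- b) \<le> (exp 1 * fact N) * inverse ((1 + b) ^ N)"
proof -
  have pos: "0 < (1 + b) ^ N" using assms by simp
  have "(1 + b) ^ N / fact N \<le> exp (1 + b)"
    using assms by (intro power_over_fact_le_exp) simp
  then have "(1 + b) ^ N \<le> fact N * exp 1 * exp b" by (simp add: field_simps exp_add)
  then have "(1 + b) ^ N * exp (- b) \<le> fact N * exp 1 * exp b * exp (- b)"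
    by (intro mult_right_mono) auto
  also have "\<dots> = exp 1 * fact N" by (simp add: exp_minus)
  finally show ?thesis using pos by (simp add: field_simps)
qed

text \<open>The amplitude grows like |t|^p with p = Re a, and \<open>K\<close> \<ge> p + 2
  differences over half a period, here 1/2, reduce this to t^(-2). The estimate is uniform because
  \<alpha>, |x| and |\<xi>| enter the damping only through their product, a parameter of the symbol
  class.\<close>

theorem
  fixes H :: "'a::euclidean_space \<Rightarrow> 'a \<Rightarrow> complex"
  assumes H: "admissible H" and \<kappa>: "\<kappa> = 1 \<or> \<kappa> = - 1" and a: "Re a \<ge> 0"
  shows ray_integral_bound: "\<exists>C\<ge>0. \<forall>\<alpha>>0. \<forall>x \<xi>. x \<noteq> 0 \<longrightarrow> \<xi> \<noteq> 0 \<longrightarrow> norm (ray_integral \<kappa> \<alpha> \<epsilon> a H x \<xi>) \<le> C"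
    and ray_integral_tendsto: "\<And>x \<xi>. x \<noteq> 0 \<Longrightarrow> \<xi> \<noteq> 0 \<Longrightarrow> \<exists>l. ((\<lambda>\<alpha>. ray_integral \<kappa> \<alpha> \<epsilon> a H x \<xi>) \<longlongrightarrow> l) (at_right 0)"
proof -
  define p where "p = Re a"
  have p: "p \<ge> 0" using a by (simp add: p_def)
  define K where "K = nat \<lceil>p\<rceil> + 2"
  have K: "p + 2 \<le> real K" unfolding K_def using p by linarith
  obtain C where C: "C \<ge> 0" "\<And>x \<xi>. norm (H x \<xi>) \<le> C"
    by (rule admissible_bound_self[OF H]) (rule that, assumption+)
  define F where "F q t = of_real (exp (- \<bar>fst q\<bar> * norm t)) * (H (fst (snd q)) (t *\<^sub>R snd (snd q)) * spow \<epsilon> a t)"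
    for q :: "real \<times> 'a \<times> 'a" and t :: real
  have sF: "symb (1::real) K (- p) F"
  proof -
    have 1: "symb (1::real) K 0 (\<lambda>q::real \<times> 'a \<times> 'a. \<lambda>t. of_real (exp (- \<bar>fst q\<bar> * norm t)))"
      by (rule symb_reparam[OF symb_exp, of "1::real" K fst]) simp
    have 2: "symb (1::real) K 0 (\<lambda>q::real \<times> 'a \<times> 'a. \<lambda>t. H (fst (snd q)) (t *\<^sub>R snd (snd q)))"
      by (rule symb_reparam[OF symb_radial[OF H symbol_ops.one], of K snd])
    have 3: "symb (1::real) K (- p) (\<lambda>q::real \<times> 'a \<times> 'a. \<lambda>t. spow \<epsilon> a t)"
      unfolding p_def by (rule symb_spow)
    show ?thesis unfolding F_def using symb_mult[OF 1 symb_mult[OF 2 3]] by simp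
  qed
  have bF: "norm (F q t) \<le> exp (- \<bar>fst q\<bar> * \<bar>t\<bar>) * (C * \<bar>t\<bar> powr p)" for q t
    unfolding F_def norm_mult norm_spow p_def[symmetric] using C by (intro mult_mono) auto
  have bF1: "norm (F q t) \<le> C * \<bar>t\<bar> powr p" for q t
  proof -
    have "exp (- \<bar>fst q\<bar> * \<bar>t\<bar>) * (C * \<bar>t\<bar> powr p) \<le> 1 * (C * \<bar>t\<bar> powr p)"
      using C by (intro mult_right_mono) auto
    then show ?thesis using bF[of q t] by simp
  qed
  have Fm: "F q \<in> borel_measurable borel" for q
  proof -
    have [measurable]: "(\<lambda>t. H (fst (snd q)) (t *\<^sub>R snd (snd q))) \<in> borel_measurable borel"
      by (rule admissible_borel_comp[OF H]) measurable
    show ?thesis unfolding F_def by measurable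
  qed
  have iF: "integrable lborel (F q)" if q: "fst q \<noteq> 0" for q
  proof (rule Bochner_Integration.integrable_bound)
    define E where "E = C * (exp 1 * fact K)"
    show "integrable lborel (\<lambda>t. E * (\<bar>t\<bar> powr p * inverse ((1 + \<bar>t\<bar> * \<bar>fst q\<bar>) ^ K)))"
      using q by (intro integrable_mult_right integrable_line_weight p K) simp
    show "AE t in lborel. norm (F q t) \<le> norm (E * (\<bar>t\<bar> powr p * inverse ((1 + \<bar>t\<bar> * \<bar>fst q\<bar>) ^ K)))"
    proof (rule AE_I2)
      fix t :: real
      have "norm (F q t) \<le> exp (- (\<bar>t\<bar> * \<bar>fst q\<bar>)) * (C * \<bar>t\<bar> powr p)"
        using bF[of q t] by (simp add: mult.commute)
      also have "\<dots> \<le> ((exp 1 * fact K) * inverse ((1 + \<bar>t\<bar> * \<bar>fst q\<bar>) ^ K)) * (C * \<bar>t\<bar> powr p)"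
        using C by (intro mult_right_mono exp_decay_bound) auto
      also have "\<dots> = E * (\<bar>t\<bar> powr p * inverse ((1 + \<bar>t\<bar> * \<bar>fst q\<bar>) ^ K))"
        by (simp only: E_def mult_ac)
      also have "\<dots> \<le> norm (E * (\<bar>t\<bar> powr p * inverse ((1 + \<bar>t\<bar> * \<bar>fst q\<bar>) ^ K)))"
        by simp
      finally show "norm (F q t) \<le> norm (E * (\<bar>t\<bar> powr p * inverse ((1 + \<bar>t\<bar> * \<bar>fst q\<bar>) ^ K)))" .
    qed
  qed (use Fm in simp)
  let ?h = "(1 / 2) *\<^sub>R (1::real)"
  \<comment> \<open>Without damping \<open>F q\<close> is in general not integrable, whereas
    \<open>G q\<close> is. The two integrals are identified for positive damping only, and the limit
    is taken in the integral of \<open>G\<close>.\<close>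
  define G where "G q = (dif ?h ^^ K) (F q)" for q
  obtain D where D': "D \<ge> 0" "\<forall>q \<eta> t. 2 * real K * \<bar>\<eta>\<bar> < norm t \<longrightarrow>
      norm ((dif (\<eta> *\<^sub>R (1::real)) ^^ K) (F q) t) \<le> D * \<bar>\<eta>\<bar> ^ K * norm t powr (- (- p + real K))"
    using difs_symb[OF _ sF] by (elim meta_impE exE conjE) (simp, rule that)
  \<comment> \<open>\<open>D * 2\<close> serves |t| > K, through 1 + t^2 \<le> 2 t^2; the other
    summand serves |t| \<le> K, where all shifted points stay within 2 K.\<close>
  define M where "M = D * 2 + C * (2 * real K) powr p * (1 + (real K)\<^sup>2)"
  have M: "M \<ge> 0" unfolding M_def using D'(1) C by simp
  have bG: "norm (G q t) \<le> M * inverse (1 + t\<^sup>2)" for q t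
  proof -
    have pos: "0 < 1 + t\<^sup>2" by (simp add: add_pos_nonneg)
    have "norm (G q t) * (1 + t\<^sup>2) \<le> M"
    proof (cases "real K < \<bar>t\<bar>")
      case True
      have t1: "1 \<le> \<bar>t\<bar>" using True unfolding K_def by simp
      have "norm (G q t) \<le> D * \<bar>1 / 2\<bar> ^ K * norm t powr (- (- p + real K))"
        unfolding G_def by (rule D'(2)[THEN spec[of _ q], THEN spec[of _ "1 / 2"], THEN spec[of _ t], THEN mp]) (use True in simp)
      also have "\<dots> \<le> D * 1 * \<bar>t\<bar> powr (- 2)"
      proof -
        have "norm t powr (- (- p + real K)) \<le> \<bar>t\<bar> powr (- 2)"
          unfolding real_norm_def using t1 K by (intro powr_mono) auto
        then show ?thesis
          using D'(1) by (intro mult_mono) (auto simp: power_le_one)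
      qed
      finally have "norm (G q t) * (1 + t\<^sup>2) \<le> (D * 1 * \<bar>t\<bar> powr (- 2)) * (2 * t\<^sup>2)"
        using t1 D'(1) self_le_power[of "\<bar>t\<bar>" 2] by (intro mult_mono) (auto simp: abs_le_square_iff[symmetric] one_le_power)
      also have "\<dots> = D * 2" using t1 by (simp add: powr_minus powr_numeral)
      also have "\<dots> \<le> M" unfolding M_def using C by simp
      finally show ?thesis .
    next
      case False
      have "norm (G q t) \<le> C * (2 * real K) powr p"
        unfolding G_def
      proof (rule difs_bound)
        fix t' assume "norm (t' - t) \<le> real K * norm ?h"
        then have "\<bar>t'\<bar> \<le> 2 * real K" using False by (simp add: abs_if split: if_splits)
        then have "\<bar>t'\<bar> powr p \<le> (2 * real K) powr p" using p by (intro powr_mono2) auto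
        then show "norm (F q t') \<le> C * (2 * real K) powr p"
          using bF1[of q t'] C(1) by (meson mult_left_mono order_trans)
      qed
      moreover have "1 + t\<^sup>2 \<le> 1 + (real K)\<^sup>2"
        using False by (simp add: abs_le_square_iff[symmetric])
      ultimately have "norm (G q t) * (1 + t\<^sup>2) \<le> C * (2 * real K) powr p * (1 + (real K)\<^sup>2)"
        using pos C(1) by (intro mult_mono) auto
      also have "\<dots> \<le> M" unfolding M_def using D'(1) by simp
      finally show ?thesis .
    qed
    then show ?thesis using pos by (simp add: field_simps)
  qed
  have Gm: "G q \<in> borel_measurable borel" for q
    unfolding G_def by (rule difs_borel[OF Fm])
  have iW: "integrable lborel (\<lambda>t. M * inverse (1 + t\<^sup>2))"
    by (intro integrable_mult_right integrable_inverse_one_plus_square)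
  have h: "cis (2 * pi * (\<kappa> \<bullet> ?h)) = - 1"
    using \<kappa> by (auto simp: complex_eq_iff)
  have ray: "ray_integral \<kappa> \<alpha> \<epsilon> a H x \<xi> = (LINT t|lborel. G (\<alpha> * (norm x * norm \<xi>), x, \<xi>) t * cis (2 * pi * (\<kappa> \<bullet> t)))"
    if \<alpha>: "\<alpha> > 0" and "x \<noteq> 0" "\<xi> \<noteq> 0" for \<alpha> x \<xi>
  proof -
    have "ray_integral \<kappa> \<alpha> \<epsilon> a H x \<xi> = (LINT t|lborel. F (\<alpha> * (norm x * norm \<xi>), x, \<xi>) t * cis (2 * pi * (\<kappa> \<bullet> t)))"
      unfolding ray_integral_def F_def damp_def using \<alpha> by (simp add: abs_mult mult_ac)
    also have "\<dots> = (LINT t|lborel. G (\<alpha> * (norm x * norm \<xi>), x, \<xi>) t * cis (2 * pi * (\<kappa> \<bullet> t)))"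
      unfolding G_def by (rule integral_difs[OF iF h, symmetric]) (use that in simp)
    finally show ?thesis .
  qed
  have bc: "norm (G q t * cis (2 * pi * (\<kappa> \<bullet> t))) \<le> M * inverse (1 + t\<^sup>2)" for q t
    unfolding norm_mult norm_cis mult_1_right by (rule bG)
  have mc: "(\<lambda>t. G q t * cis (2 * pi * (\<kappa> \<bullet> t))) \<in> borel_measurable lborel" for q
    using Gm[of q] by measurable
  have ic: "integrable lborel (\<lambda>t. G q t * cis (2 * pi * (\<kappa> \<bullet> t)))" for q
    by (rule Bochner_Integration.integrable_bound[OF iW mc]) (use bc M in \<open>auto intro!: AE_I2 order_trans[OF bc]\<close>)
  show "\<exists>C\<ge>0. \<forall>\<alpha>>0. \<forall>x \<xi>. x \<noteq> 0 \<longrightarrow> \<xi> \<noteq> 0 \<longrightarrow> norm (ray_integral \<kappa> \<alpha> \<epsilon> a H x \<xi>) \<le> C"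
  proof (intro exI[of _ "LINT t|lborel. M * inverse (1 + t\<^sup>2)"] conjI allI impI)
    show "0 \<le> (LINT t|lborel. M * inverse (1 + t\<^sup>2))"
      using M by (intro Bochner_Integration.integral_nonneg) (simp add: add_nonneg_nonneg)
    fix \<alpha> :: real and x \<xi> :: 'a assume A: "\<alpha> > 0" "x \<noteq> 0" "\<xi> \<noteq> 0"
    show "norm (ray_integral \<kappa> \<alpha> \<epsilon> a H x \<xi>) \<le> (LINT t|lborel. M * inverse (1 + t\<^sup>2))"
      unfolding ray[OF A] by (rule Bochner_Integration.integral_norm_bound_integral[OF ic iW bc])
  qed
  fix x \<xi> :: 'a assume x: "x \<noteq> 0" "\<xi> \<noteq> 0"
  define c where "c = norm x * norm \<xi>"
  have limF: "((\<lambda>\<alpha>. F (\<alpha> * c, x, \<xi>) t) \<longlongrightarrow> F (0 * c, x, \<xi>) t) (at_right 0)" for t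
    unfolding F_def fst_conv snd_conv by (intro tendsto_intros)
  have "((\<lambda>\<alpha>. LINT t|lborel. G (\<alpha> * c, x, \<xi>) t * cis (2 * pi * (\<kappa> \<bullet> t))) \<longlongrightarrow> (LINT t|lborel. G (0 * c, x, \<xi>) t * cis (2 * pi * (\<kappa> \<bullet> t)))) (at_right 0)"
  proof (rule dominated_convergence_within[OF mc mc iW])
    show "AE t in lborel. ((\<lambda>\<alpha>. G (\<alpha> * c, x, \<xi>) t * cis (2 * pi * (\<kappa> \<bullet> t))) \<longlongrightarrow> G (0 * c, x, \<xi>) t * cis (2 * pi * (\<kappa> \<bullet> t))) (at_right 0)"
      unfolding G_def by (intro AE_I2 tendsto_mult tendsto_const difs_tendsto limF)
  qed (use bc in auto)
  moreover have "eventually (\<lambda>\<alpha>. (LINT t|lborel. G (\<alpha> * c, x, \<xi>) t * cis (2 * pi * (\<kappa> \<bullet> t))) = ray_integral \<kappa> \<alpha> \<epsilon> a H x \<xi>) (at_right 0)"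
    using eventually_at_right_less[of "0::real"] by eventually_elim (simp add: ray x c_def)
  ultimately have "((\<lambda>\<alpha>. ray_integral \<kappa> \<alpha> \<epsilon> a H x \<xi>) \<longlongrightarrow> (LINT t|lborel. G (0 * c, x, \<xi>) t * cis (2 * pi * (\<kappa> \<bullet> t)))) (at_right 0)"
    by (rule Lim_transform_eventually)
  then show "\<exists>l. ((\<lambda>\<alpha>. ray_integral \<kappa> \<alpha> \<epsilon> a H x \<xi>) \<longlongrightarrow> l) (at_right 0)" by blast
qed

section \<open>The regularized operators in projective coordinates\<close>

definition ray_kernel ::
  "real \<Rightarrow> real \<Rightarrow> nat \<Rightarrow> real \<Rightarrow> ('n::finite space \<Rightarrow> 'n space \<Rightarrow> complex) \<Rightarrow> 'n space \<Rightarrow> real ^ 'n \<Rightarrow> complex" where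
  "ray_kernel \<kappa> \<alpha> \<epsilon> lam H x \<sigma> = (LINT t|lborel. spow \<epsilon> (hexp CARD('n) lam) t *
     (damp \<alpha> H x (t *\<^sub>R (\<sigma>, 1)) * cis (2 * pi * \<kappa> * (x \<bullet> (t *\<^sub>R (\<sigma>, 1))))))"

lemma
  fixes H :: "'n::finite space \<Rightarrow> 'n space \<Rightarrow> complex"
  assumes H: "admissible H" and \<psi>: "rapid \<psi>" and \<alpha>: "\<alpha> > 0" and x: "x \<noteq> 0"
  shows regularized_integrable: "integrable lborel (\<lambda>\<xi>. damp \<alpha> H x \<xi> * cis (2 * pi * \<kappa> * (x \<bullet> \<xi>)) * hom_comp (- lam) \<epsilon> \<psi> \<xi>)"
    and regularized_hom_comp: "(LINT \<xi>|lborel. damp \<alpha> H x \<xi> * cis (2 * pi * \<kappa> * (x \<bullet> \<xi>)) * hom_comp (- lam) \<epsilon> \<psi> \<xi>) = hom_comp lam \<epsilon> (osc_op \<kappa> \<alpha> H \<psi>) x"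
    and ray_kernel_integrable: "integrable lborel (\<lambda>\<sigma>. ray_kernel \<kappa> \<alpha> \<epsilon> lam H x \<sigma> * flat (- lam) \<epsilon> \<psi> \<sigma>)"
    and ray_kernel_hom_comp: "(LINT \<sigma>|lborel. ray_kernel \<kappa> \<alpha> \<epsilon> lam H x \<sigma> * flat (- lam) \<epsilon> \<psi> \<sigma>) = hom_comp lam \<epsilon> (osc_op \<kappa> \<alpha> H \<psi>) x"
proof -
  \<comment> \<open>With x \<noteq> 0 and \<alpha> > 0 fixed, this damped plane wave decreases
    rapidly in \<xi>, so the pairing results apply to it. The two integrals and the right-hand side
    all turn out to be the pairing of the component of \<open>q\<close> with \<psi>.\<close>
  define q where "q \<xi> = damp \<alpha> H x \<xi> * cis (2 * pi * \<kappa> * (x \<bullet> \<xi>))" for \<xi>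
  obtain C where C: "C \<ge> 0" "\<And>x \<xi>. norm (H x \<xi>) \<le> C"
    by (rule admissible_bound_self[OF H]) (rule that, assumption+)
  have [measurable]: "(\<lambda>\<xi>. damp \<alpha> H x \<xi>) \<in> borel_measurable borel"
    by (rule damp_borel_comp[OF H]) auto
  have [measurable]: "\<psi> \<in> borel_measurable borel" using \<psi> by (rule rapid_borel)
  define \<beta> where "\<beta> = \<alpha> * norm x"
  have \<beta>: "\<beta> > 0" using \<alpha> x by (simp add: \<beta>_def)
  have q: "rapid q"
    unfolding rapid_def
  proof (intro conjI allI)
    show "q \<in> borel_measurable borel" unfolding q_def by measurable
    fix N
    define m where "m = min 1 \<beta>"
    have m: "m > 0" "m \<le> 1" "m \<le> \<beta>" using \<beta> by (auto simp: m_def)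
    have "(1 + norm \<xi>) ^ N * norm (q \<xi>) \<le> C * (exp 1 * fact N) * inverse (m ^ N)" for \<xi>
    proof -
      have "norm (q \<xi>) \<le> exp (- (\<beta> * norm \<xi>)) * C"
        unfolding q_def norm_mult norm_cis mult_1_right norm_damp \<beta>_def using C(2) by (simp add: mult.assoc mult_left_mono)
      also have "\<dots> \<le> ((exp 1 * fact N) * inverse ((1 + \<beta> * norm \<xi>) ^ N)) * C"
        using C(1) \<beta> by (intro mult_right_mono exp_decay_bound) auto
      finally have 1: "norm (q \<xi>) \<le> C * (exp 1 * fact N) * inverse ((1 + \<beta> * norm \<xi>) ^ N)" by (simp only: mult_ac)
      have "m * (1 + norm \<xi>) \<le> 1 + \<beta> * norm \<xi>"
        using m mult_right_mono[OF m(3), of "norm \<xi>"] by (simp add: distrib_left)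
      then have "(m * (1 + norm \<xi>)) ^ N \<le> (1 + \<beta> * norm \<xi>) ^ N"
        using m by (intro power_mono) (auto simp: add_nonneg_nonneg)
      then have "inverse ((1 + \<beta> * norm \<xi>) ^ N) \<le> inverse ((m * (1 + norm \<xi>)) ^ N)"
        using m by (intro le_imp_inverse_le zero_less_power mult_pos_pos) (auto intro: add_pos_nonneg)
      then have "norm (q \<xi>) \<le> C * (exp 1 * fact N) * inverse ((m * (1 + norm \<xi>)) ^ N)"
        using 1 C(1) by (meson mult_left_mono order_trans mult_nonneg_nonneg exp_ge_zero fact_ge_zero)
      then have "(1 + norm \<xi>) ^ N * norm (q \<xi>) \<le> (1 + norm \<xi>) ^ N * (C * (exp 1 * fact N) * inverse ((m * (1 + norm \<xi>)) ^ N))"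
        by (intro mult_left_mono) (auto simp: add_nonneg_nonneg)
      also have "\<dots> = C * (exp 1 * fact N) * inverse (m ^ N)"
      proof -
        have "(1 + norm \<xi>) ^ N \<noteq> 0" by (simp add: add_nonneg_eq_0_iff)
        then show ?thesis unfolding power_mult_distrib inverse_mult_distrib by simp
      qed
      finally show ?thesis .
    qed
    then show "\<exists>c. \<forall>\<xi>. (1 + norm \<xi>) ^ N * norm (q \<xi>) \<le> c" by blast
  qed
  show "integrable lborel (\<lambda>\<xi>. damp \<alpha> H x \<xi> * cis (2 * pi * \<kappa> * (x \<bullet> \<xi>)) * hom_comp (- lam) \<epsilon> \<psi> \<xi>)"
    using hom_comp_pairing_integrable[OF \<psi> q, of "- lam" \<epsilon>] unfolding q_def by (simp add: mult_ac)
  have flat: "ray_kernel \<kappa> \<alpha> \<epsilon> lam H x \<sigma> = of_real (4 * pi) * flat lam \<epsilon> q \<sigma>" for \<sigma>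
    unfolding ray_kernel_def flat_def hom_comp_def q_def by simp
  have fi: "integrable lborel (\<lambda>\<sigma>. flat lam \<epsilon> q \<sigma> * flat (- lam) \<epsilon> \<psi> \<sigma>)"
    by (rule flat_pairing_integrable[OF flat_borel[OF rapid_borel[OF q]] square_integrable_section_weight[OF square_integrable_flat[OF q]] \<psi>])
  show "integrable lborel (\<lambda>\<sigma>. ray_kernel \<kappa> \<alpha> \<epsilon> lam H x \<sigma> * flat (- lam) \<epsilon> \<psi> \<sigma>)"
    unfolding flat mult.assoc by (intro integrable_mult_right fi)
  have 1: "(LINT \<sigma>|lborel. ray_kernel \<kappa> \<alpha> \<epsilon> lam H x \<sigma> * flat (- lam) \<epsilon> \<psi> \<sigma>) = (LINT \<xi>|lborel. hom_comp lam \<epsilon> q \<xi> * \<psi> \<xi>)"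
    unfolding flat mult.assoc integral_mult_right_zero hom_comp_pairing[OF q \<psi>] ..
  have 2: "(LINT \<xi>|lborel. damp \<alpha> H x \<xi> * cis (2 * pi * \<kappa> * (x \<bullet> \<xi>)) * hom_comp (- lam) \<epsilon> \<psi> \<xi>) = (LINT \<xi>|lborel. hom_comp lam \<epsilon> q \<xi> * \<psi> \<xi>)"
  proof -
    have "(LINT \<xi>|lborel. q \<xi> * hom_comp (- lam) \<epsilon> \<psi> \<xi>) = (LINT \<xi>|lborel. hom_comp (- lam) \<epsilon> \<psi> \<xi> * q \<xi>)"
      by (simp only: mult.commute)
    also have "\<dots> = of_real (4 * pi) * (LINT s|lborel. flat (- lam) \<epsilon> \<psi> s * flat lam \<epsilon> q s)"
      using hom_comp_pairing[OF \<psi> q, of "- lam" \<epsilon>] by simp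
    also have "\<dots> = (LINT \<xi>|lborel. hom_comp lam \<epsilon> q \<xi> * \<psi> \<xi>)"
      unfolding hom_comp_pairing[OF q \<psi>] by (simp only: mult.commute)
    finally show ?thesis by (simp only: q_def)
  qed
  have 3: "(LINT \<xi>|lborel. hom_comp lam \<epsilon> q \<xi> * \<psi> \<xi>) = hom_comp lam \<epsilon> (osc_op \<kappa> \<alpha> H \<psi>) x"
  proof -
    let ?e = "hexp CARD('n) lam"
    have "of_real (4 * pi) * (LINT \<xi>|lborel. hom_comp lam \<epsilon> q \<xi> * \<psi> \<xi>) = (LINT \<xi>|lborel. LINT t|lborel. spow \<epsilon> ?e t * q (t *\<^sub>R \<xi>) * \<psi> \<xi>)"
      unfolding hom_comp_def by simp
    also have "\<dots> = (LINT t|lborel. LINT \<xi>|lborel. spow \<epsilon> ?e t * q (t *\<^sub>R \<xi>) * \<psi> \<xi>)"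
      by (rule lborel_pair.Fubini_integral[symmetric]) (rule hom_comp_Fubini[OF q \<psi>])
    also have "\<dots> = (LINT t|lborel. spow \<epsilon> ?e t * osc_op \<kappa> \<alpha> H \<psi> (t *\<^sub>R x))"
    proof (rule Bochner_Integration.integral_cong[OF refl])
      fix t :: real
      show "(LINT \<xi>|lborel. spow \<epsilon> ?e t * q (t *\<^sub>R \<xi>) * \<psi> \<xi>) = spow \<epsilon> ?e t * osc_op \<kappa> \<alpha> H \<psi> (t *\<^sub>R x)"
      proof (cases "t = 0")
        case False
        \<comment> \<open>Invariance of the symbol and of the damping turns the dilation of \<xi> in
          \<open>q\<close> into one of x, so the inner integral is \<open>osc_op\<close> at a point
          of the ray through x.\<close>
        then have "damp \<alpha> H (t *\<^sub>R x) \<xi> = damp \<alpha> H x (t *\<^sub>R \<xi>)" for \<xi>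
          unfolding damp_def admissible_dilation[OF H False] by simp
        then show ?thesis unfolding osc_op_def q_def by (simp add: mult.assoc)
      qed simp
    qed
    finally show ?thesis unfolding hom_comp_def[of lam \<epsilon> "osc_op \<kappa> \<alpha> H \<psi>"] by (simp add: field_simps)
  qed
  show "(LINT \<xi>|lborel. damp \<alpha> H x \<xi> * cis (2 * pi * \<kappa> * (x \<bullet> \<xi>)) * hom_comp (- lam) \<epsilon> \<psi> \<xi>) = hom_comp lam \<epsilon> (osc_op \<kappa> \<alpha> H \<psi>) x"
    unfolding 2 3 ..
  show "(LINT \<sigma>|lborel. ray_kernel \<kappa> \<alpha> \<epsilon> lam H x \<sigma> * flat (- lam) \<epsilon> \<psi> \<sigma>) = hom_comp lam \<epsilon> (osc_op \<kappa> \<alpha> H \<psi>) x"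
    unfolding 1 3 ..
qed

text \<open>With k = x \<bullet> (\<sigma>, 1), substituting t / k for t normalizes the phase; the
  power of t and the Jacobian give k the exponent \<open>- hexp - 1\<close>. For x = (s, 1) the
  number k is 1 + s \<bullet> \<sigma>.\<close>

lemma ray_kernel_eq:
  fixes H :: "'n::finite space \<Rightarrow> 'n space \<Rightarrow> complex"
  assumes k: "x \<bullet> (\<sigma>, 1) \<noteq> 0"
  shows "ray_kernel \<kappa> \<alpha> \<epsilon> lam H x \<sigma> = spow \<epsilon> (- hexp CARD('n) lam - 1) (x \<bullet> (\<sigma>, 1)) *
    ray_integral \<kappa> \<alpha> \<epsilon> (hexp CARD('n) lam) H x (inverse (x \<bullet> (\<sigma>, 1)) *\<^sub>R (\<sigma>, 1))"
proof -
  define k where "k = x \<bullet> (\<sigma>, 1)"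
  have k0: "k \<noteq> 0" using k by (simp add: k_def)
  let ?e = "hexp CARD('n) lam"
  let ?f = "\<lambda>t. spow \<epsilon> ?e t * (damp \<alpha> H x (t *\<^sub>R (\<sigma>, 1)) * cis (2 * pi * \<kappa> * (t * k)))"
  have "ray_kernel \<kappa> \<alpha> \<epsilon> lam H x \<sigma> = (LINT t|lborel. ?f t)"
    unfolding ray_kernel_def inner_scaleR_right k_def ..
  also have "\<dots> = \<bar>inverse k\<bar> *\<^sub>R (LINT t|lborel. ?f (0 + inverse k * t))"
    using k0 by (intro lborel_integral_real_affine) simp
  also have "(\<lambda>t. ?f (0 + inverse k * t)) = (\<lambda>t. spow \<epsilon> ?e (inverse k) * (damp \<alpha> H x (t *\<^sub>R inverse k *\<^sub>R (\<sigma>, 1)) * cis (2 * pi * \<kappa> * t) * spow \<epsilon> ?e t))"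
  proof
    fix t
    have 1: "(inverse k * t) * k = t" using k0 by simp
    have 2: "(inverse k * t) *\<^sub>R (\<sigma>, 1::real) = t *\<^sub>R inverse k *\<^sub>R (\<sigma>, 1)" by (simp add: mult.commute)
    show "?f (0 + inverse k * t) = spow \<epsilon> ?e (inverse k) * (damp \<alpha> H x (t *\<^sub>R inverse k *\<^sub>R (\<sigma>, 1)) * cis (2 * pi * \<kappa> * t) * spow \<epsilon> ?e t)"
      unfolding add_0 1 2 spow_mult by (simp only: mult_ac)
  qed
  also have "\<bar>inverse k\<bar> *\<^sub>R (LINT t|lborel. spow \<epsilon> ?e (inverse k) * (damp \<alpha> H x (t *\<^sub>R inverse k *\<^sub>R (\<sigma>, 1)) * cis (2 * pi * \<kappa> * t) * spow \<epsilon> ?e t))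
    = (of_real \<bar>inverse k\<bar> * spow \<epsilon> (- ?e) k) * ray_integral \<kappa> \<alpha> \<epsilon> ?e H x (inverse k *\<^sub>R (\<sigma>, 1))"
    unfolding integral_mult_right_zero spow_inverse scaleR_conv_of_real ray_integral_def by (simp only: mult.assoc)
  finally show ?thesis unfolding spow_minus_one[OF k0] unfolding k_def .
qed

section \<open>Amplitudes given by a symbol and a flat function\<close>

text \<open>A basis vector of the product has nonzero first component exactly if it is an
  x-direction, so this is the number of x-derivatives in the list; \<open>count_snd\<close> is that
  of \<xi>-derivatives.\<close>

definition count_fst :: "('a::euclidean_space \<times> 'a) list \<Rightarrow> nat" where
  "count_fst bs = length (filter (\<lambda>b. fst b \<noteq> 0) bs)"

definition count_snd :: "('a::euclidean_space \<times> 'a) list \<Rightarrow> nat" where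
  "count_snd bs = length (filter (\<lambda>b. fst b = 0) bs)"

lemma Basis_pair_cases:
  assumes "b \<in> Basis"
  obtains k where "k \<in> Basis" "b = (k, 0)" | k where "k \<in> Basis" "b = (0, k)"
  using assms by (auto simp: Basis_prod_def)

lemma mult_power_minus_one:
  fixes z :: "'a::comm_semiring_1"
  shows "z * (of_nat p * z ^ (p - 1)) = of_nat p * z ^ p"
  by (cases p) (auto simp: mult_ac)

text \<open>A generator applied to the operator already built gives the wanted term plus a multiple
  of that operator, from differentiating the monomial; subtracting the multiple stays in the
  algebra. In this way the hypothesis on the algebra controls ordinary derivatives.\<close>

lemma monomial_times_iter_deriv:
  fixes H :: "'a::euclidean_space \<Rightarrow> 'a \<Rightarrow> complex"
  assumes H: "admissible H" and "bs \<in> lists Basis" and j: "j \<in> Basis" and l: "l \<in> Basis"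
  shows "\<exists>P\<in>symbol_ops. P H = (\<lambda>x \<xi>. of_real ((x \<bullet> j) ^ count_fst bs * (\<xi> \<bullet> l) ^ count_snd bs) * iter_deriv bs (case_prod H) (x, \<xi>))"
  using assms(2)
proof (induction bs)
  case Nil
  show ?case
    by (rule bexI[OF _ symbol_ops.one]) (simp add: count_fst_def count_snd_def)
next
  case (Cons b bs)
  define D where "D = iter_deriv bs (case_prod H)"
  have D: "smooth D"
    unfolding D_def using H Cons.hyps by (intro smooth_iter_deriv) (auto simp: admissible_def)
  define p where "p = count_fst bs"
  define q where "q = count_snd bs"
  obtain P where P: "P \<in> symbol_ops" "P H = (\<lambda>x \<xi>. of_real ((x \<bullet> j) ^ p * (\<xi> \<bullet> l) ^ q) * D (x, \<xi>))"
    using Cons.IH unfolding D_def p_def q_def by blast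
  have it: "iter_deriv (b # bs) (case_prod H) = dir_deriv b D"
    by (simp add: iter_deriv_Cons D_def)
  from Cons.hyps(1) show ?case
  proof (cases rule: Basis_pair_cases)
    case (1 k)
    then have k0: "k \<noteq> 0" by auto
    have c: "count_fst (b # bs) = Suc p" "count_snd (b # bs) = q"
      using 1 k0 by (simp_all add: count_fst_def count_snd_def p_def q_def)
    define P' where "P' G x \<xi> = of_real (x \<bullet> j) * frechet_derivative (\<lambda>y. P G y \<xi>) (at x) k + of_real (- (of_nat p * (k \<bullet> j))) * P G x \<xi>" for G x \<xi>
    have "P' \<in> symbol_ops"
      unfolding P'_def[abs_def]
      by (intro symbol_ops.add symbol_ops.scale P(1) symbol_ops.comp[OF symbol_ops.gen_x[OF j 1(1)] P(1)])
    moreover have "P' H = (\<lambda>x \<xi>. of_real ((x \<bullet> j) ^ Suc p * (\<xi> \<bullet> l) ^ q) * dir_deriv b D (x, \<xi>))"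
    proof (intro ext)
      fix x \<xi>
      have d1: "((\<lambda>y. D (y, \<xi>)) has_derivative (\<lambda>h. dir_deriv (h, 0) D (x, \<xi>))) (at x)"
        by (rule has_derivative_compose[OF _ smooth_has_derivative[OF D]]) (auto intro!: derivative_eq_intros)
      have d2: "((\<lambda>y. complex_of_real ((y \<bullet> j) ^ p * (\<xi> \<bullet> l) ^ q)) has_derivative (\<lambda>h. of_real (of_nat p * (h \<bullet> j) * (x \<bullet> j) ^ (p - 1) * (\<xi> \<bullet> l) ^ q))) (at x)"
        by (intro has_derivative_of_real) (auto intro!: derivative_eq_intros)
      have "frechet_derivative (\<lambda>y. P H y \<xi>) (at x) = (\<lambda>h. of_real ((x \<bullet> j) ^ p * (\<xi> \<bullet> l) ^ q) * dir_deriv (h, 0) D (x, \<xi>)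
          + of_real (of_nat p * (h \<bullet> j) * (x \<bullet> j) ^ (p - 1) * (\<xi> \<bullet> l) ^ q) * D (x, \<xi>))"
        unfolding P(2) by (rule frechet_derivative_at[OF has_derivative_mult[OF d2 d1], symmetric])
      then have "P' H x \<xi> = of_real (x \<bullet> j) * (of_real ((x \<bullet> j) ^ p * (\<xi> \<bullet> l) ^ q) * dir_deriv b D (x, \<xi>)
          + of_real (of_nat p * (k \<bullet> j) * (x \<bullet> j) ^ (p - 1) * (\<xi> \<bullet> l) ^ q) * D (x, \<xi>))
          + of_real (- (of_nat p * (k \<bullet> j))) * (of_real ((x \<bullet> j) ^ p * (\<xi> \<bullet> l) ^ q) * D (x, \<xi>))"
        unfolding P'_def P(2) 1(2) by simp
      also have "\<dots> = of_real ((x \<bullet> j) ^ Suc p * (\<xi> \<bullet> l) ^ q) * dir_deriv b D (x, \<xi>)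
          + of_real ((x \<bullet> j) * (of_nat p * (x \<bullet> j) ^ (p - 1)) * ((k \<bullet> j) * (\<xi> \<bullet> l) ^ q)) * D (x, \<xi>)
          - of_real (of_nat p * (x \<bullet> j) ^ p * ((k \<bullet> j) * (\<xi> \<bullet> l) ^ q)) * D (x, \<xi>)"
        by (simp add: algebra_simps)
      also have "\<dots> = of_real ((x \<bullet> j) ^ Suc p * (\<xi> \<bullet> l) ^ q) * dir_deriv b D (x, \<xi>)"
        unfolding mult_power_minus_one by simp
      finally show "P' H x \<xi> = of_real ((x \<bullet> j) ^ Suc p * (\<xi> \<bullet> l) ^ q) * dir_deriv b D (x, \<xi>)" .
    qed
    ultimately show ?thesis unfolding c it by blast
  next
    case (2 k)
    have c: "count_fst (b # bs) = p" "count_snd (b # bs) = Suc q"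
      using 2 by (simp_all add: count_fst_def count_snd_def p_def q_def)
    define P' where "P' G x \<xi> = of_real (\<xi> \<bullet> l) * frechet_derivative (\<lambda>\<eta>. P G x \<eta>) (at \<xi>) k + of_real (- (of_nat q * (k \<bullet> l))) * P G x \<xi>" for G x \<xi>
    have "P' \<in> symbol_ops"
      unfolding P'_def[abs_def]
      by (intro symbol_ops.add symbol_ops.scale P(1) symbol_ops.comp[OF symbol_ops.gen_xi[OF l 2(1)] P(1)])
    moreover have "P' H = (\<lambda>x \<xi>. of_real ((x \<bullet> j) ^ p * (\<xi> \<bullet> l) ^ Suc q) * dir_deriv b D (x, \<xi>))"
    proof (intro ext)
      fix x \<xi>
      have d1: "((\<lambda>\<eta>. D (x, \<eta>)) has_derivative (\<lambda>h. dir_deriv (0, h) D (x, \<xi>))) (at \<xi>)"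
        by (rule has_derivative_compose[OF _ smooth_has_derivative[OF D]]) (auto intro!: derivative_eq_intros)
      have d2: "((\<lambda>\<eta>. complex_of_real ((x \<bullet> j) ^ p * (\<eta> \<bullet> l) ^ q)) has_derivative (\<lambda>h. of_real ((x \<bullet> j) ^ p * (of_nat q * (h \<bullet> l) * (\<xi> \<bullet> l) ^ (q - 1))))) (at \<xi>)"
        by (intro has_derivative_of_real) (auto intro!: derivative_eq_intros)
      have "frechet_derivative (\<lambda>\<eta>. P H x \<eta>) (at \<xi>) = (\<lambda>h. of_real ((x \<bullet> j) ^ p * (\<xi> \<bullet> l) ^ q) * dir_deriv (0, h) D (x, \<xi>)
          + of_real ((x \<bullet> j) ^ p * (of_nat q * (h \<bullet> l) * (\<xi> \<bullet> l) ^ (q - 1))) * D (x, \<xi>))"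
        unfolding P(2) by (rule frechet_derivative_at[OF has_derivative_mult[OF d2 d1], symmetric])
      then have "P' H x \<xi> = of_real (\<xi> \<bullet> l) * (of_real ((x \<bullet> j) ^ p * (\<xi> \<bullet> l) ^ q) * dir_deriv b D (x, \<xi>)
          + of_real ((x \<bullet> j) ^ p * (of_nat q * (k \<bullet> l) * (\<xi> \<bullet> l) ^ (q - 1))) * D (x, \<xi>))
          + of_real (- (of_nat q * (k \<bullet> l))) * (of_real ((x \<bullet> j) ^ p * (\<xi> \<bullet> l) ^ q) * D (x, \<xi>))"
        unfolding P'_def P(2) 2(2) by simp
      also have "\<dots> = of_real ((x \<bullet> j) ^ p * (\<xi> \<bullet> l) ^ Suc q) * dir_deriv b D (x, \<xi>)
          + of_real ((\<xi> \<bullet> l) * (of_nat q * (\<xi> \<bullet> l) ^ (q - 1)) * ((k \<bullet> l) * (x \<bullet> j) ^ p)) * D (x, \<xi>)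
          - of_real (of_nat q * (\<xi> \<bullet> l) ^ q * ((k \<bullet> l) * (x \<bullet> j) ^ p)) * D (x, \<xi>)"
        by (simp add: algebra_simps)
      also have "\<dots> = of_real ((x \<bullet> j) ^ p * (\<xi> \<bullet> l) ^ Suc q) * dir_deriv b D (x, \<xi>)"
        unfolding mult_power_minus_one by simp
      finally show "P' H x \<xi> = of_real ((x \<bullet> j) ^ p * (\<xi> \<bullet> l) ^ Suc q) * dir_deriv b D (x, \<xi>)" .
    qed
    ultimately show ?thesis unfolding c it by blast
  qed
qed

text \<open>Differentiating the invariance relation, each x-derivative brings out a factor s and
  each \<xi>-derivative a factor 1 / s.\<close>

lemma iter_deriv_dilation:
  fixes H :: "'a::euclidean_space \<Rightarrow> 'a \<Rightarrow> complex"
  assumes H: "admissible H" and "bs \<in> lists Basis" and s: "s > 0"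
  shows "of_real (s ^ count_fst bs) * iter_deriv bs (case_prod H) (s *\<^sub>R fst z, inverse s *\<^sub>R snd z)
    = of_real (s ^ count_snd bs) * iter_deriv bs (case_prod H) z"
  using assms(2)
proof (induction bs arbitrary: z)
  case Nil
  show ?case
    using H s unfolding admissible_def dilation_invariant_def
    by (cases z) (simp add: count_fst_def count_snd_def)
next
  case (Cons b bs)
  define D where "D = iter_deriv bs (case_prod H)"
  have D: "smooth D"
    unfolding D_def using H Cons.hyps by (intro smooth_iter_deriv) (auto simp: admissible_def)
  define p where "p = count_fst bs"
  define q where "q = count_snd bs"
  define M where "M z = (s *\<^sub>R fst z, inverse s *\<^sub>R snd z)" for z :: "'a \<times> 'a"
  have M: "(M has_derivative M) (at z)" for z
    unfolding M_def[abs_def] by (auto intro!: derivative_eq_intros)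
  have d1: "((\<lambda>z. of_real (s ^ p) * D (M z)) has_derivative (\<lambda>h. of_real (s ^ p) * dir_deriv (M h) D (M z))) (at z)" for z
    by (intro has_derivative_mult_right has_derivative_compose[OF M smooth_has_derivative[OF D]])
  have d2: "((\<lambda>z. of_real (s ^ q) * D z) has_derivative (\<lambda>h. of_real (s ^ q) * dir_deriv h D z)) (at z)" for z
    by (intro has_derivative_mult_right smooth_has_derivative[OF D])
  have "(\<lambda>z. of_real (s ^ p) * D (M z)) = (\<lambda>z. of_real (s ^ q) * D z)"
    unfolding M_def D_def p_def q_def by (rule ext) (rule Cons.IH)
  then have "(\<lambda>h. of_real (s ^ p) * dir_deriv (M h) D (M z)) = (\<lambda>h. of_real (s ^ q) * dir_deriv h D z)"
    using has_derivative_unique[OF d1[of z]] d2[of z] by simp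
  then have eq: "of_real (s ^ p) * dir_deriv (M b) D (M z) = of_real (s ^ q) * dir_deriv b D z"
    by meson
  have sc: "dir_deriv (c *\<^sub>R b) D y = of_real c * dir_deriv b D y" for c y
  proof -
    have lin: "linear (\<lambda>h. dir_deriv h D y)"
      by (rule has_derivative_linear[OF smooth_has_derivative[OF D]])
    show ?thesis using linear_scale[OF lin, of c b] by (simp only: scaleR_conv_of_real)
  qed
  have it: "iter_deriv (b # bs) (case_prod H) = dir_deriv b D"
    by (simp add: iter_deriv_Cons D_def)
  from Cons.hyps(1) show ?case
  proof (cases rule: Basis_pair_cases)
    case (1 k)
    then have "k \<noteq> 0" by auto
    then have c: "count_fst (b # bs) = Suc p" "count_snd (b # bs) = q"
      using 1 by (simp_all add: count_fst_def count_snd_def p_def q_def)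
    have "M b = s *\<^sub>R b" using 1 by (simp add: M_def)
    then show ?thesis
      using eq unfolding c it M_def[symmetric] by (simp add: sc mult_ac)
  next
    case (2 k)
    have c: "count_fst (b # bs) = p" "count_snd (b # bs) = Suc q"
      using 2 by (simp_all add: count_fst_def count_snd_def p_def q_def)
    have "M b = inverse s *\<^sub>R b" using 2 by (simp add: M_def)
    then have "of_real (s ^ p) * (of_real (inverse s) * dir_deriv b D (M z)) = of_real (s ^ q) * dir_deriv b D z"
      using eq by (simp add: sc)
    then have "of_real s * (of_real (s ^ p) * (of_real (inverse s) * dir_deriv b D (M z))) = of_real s * (of_real (s ^ q) * dir_deriv b D z)"
      by (simp only:)
    then show ?thesis
      using s unfolding c it M_def[symmetric] by (simp add: field_simps)
  qed
qed

lemma large_coordinate: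
  fixes x :: "'a::euclidean_space"
  obtains j where "j \<in> Basis" "norm x \<le> real DIM('a) * \<bar>x \<bullet> j\<bar>"
proof -
  obtain j where j: "j \<in> Basis" "\<And>b. b \<in> Basis \<Longrightarrow> \<bar>x \<bullet> b\<bar> \<le> \<bar>x \<bullet> j\<bar>"
  proof -
    have "finite ((\<lambda>b. \<bar>x \<bullet> b\<bar>) ` Basis)" "(\<lambda>b. \<bar>x \<bullet> b\<bar>) ` Basis \<noteq> {}" by simp_all
    then have "Max ((\<lambda>b. \<bar>x \<bullet> b\<bar>) ` Basis) \<in> (\<lambda>b. \<bar>x \<bullet> b\<bar>) ` Basis" by (rule Max_in)
    then obtain j where "j \<in> Basis" "Max ((\<lambda>b. \<bar>x \<bullet> b\<bar>) ` Basis) = \<bar>x \<bullet> j\<bar>" by blast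
    then show ?thesis using that[of j] by (metis Max_ge finite_Basis finite_imageI imageI)
  qed
  have "norm x \<le> (\<Sum>b\<in>Basis. \<bar>x \<bullet> b\<bar>)" by (rule norm_le_l1)
  also have "\<dots> \<le> (\<Sum>b\<in>(Basis::'a set). \<bar>x \<bullet> j\<bar>)" by (intro sum_mono j(2))
  finally show thesis using that[OF j(1)] by simp
qed

text \<open>For |\<xi>| \<le> 1 the points in question form a compact set. For |\<xi>| > 1 both x
  and \<xi> have a coordinate of absolute value at least 1 / DIM('a), so the monomials of the
  preceding result can be divided out.\<close>

lemma iter_deriv_bound_sphere:
  fixes H :: "'a::euclidean_space \<Rightarrow> 'a \<Rightarrow> complex"
  assumes H: "admissible H" and bs: "bs \<in> lists Basis"
  shows "\<exists>C\<ge>0. \<forall>x \<xi>. norm x = 1 \<longrightarrow> norm (iter_deriv bs (case_prod H) (x, \<xi>)) \<le> C"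
proof -
  define D where "D = iter_deriv bs (case_prod H)"
  have D: "smooth D"
    unfolding D_def using H bs by (intro smooth_iter_deriv) (auto simp: admissible_def)
  let ?N = "real DIM('a)"
  have N: "?N \<ge> 1" using DIM_positive[where 'a='a] by simp
  have "compact (D ` (sphere 0 1 \<times> cball 0 1))"
    by (intro compact_continuous_image smooth_continuous_on D compact_Times compact_sphere compact_cball)
  then have "bounded (D ` (sphere 0 1 \<times> cball 0 1))" by (rule compact_imp_bounded)
  then obtain B where B: "\<And>z. z \<in> sphere 0 1 \<times> cball 0 1 \<Longrightarrow> norm (D z) \<le> B"
    unfolding bounded_iff by blast
  have "\<forall>j l. \<exists>C\<ge>0. j \<in> Basis \<longrightarrow> l \<in> Basis \<longrightarrow> (\<forall>x \<xi>. \<bar>x \<bullet> j\<bar> ^ count_fst bs * \<bar>\<xi> \<bullet> l\<bar> ^ count_snd bs * norm (D (x, \<xi>)) \<le> C)"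
  proof (intro allI)
    fix j l :: 'a
    show "\<exists>C\<ge>0. j \<in> Basis \<longrightarrow> l \<in> Basis \<longrightarrow> (\<forall>x \<xi>. \<bar>x \<bullet> j\<bar> ^ count_fst bs * \<bar>\<xi> \<bullet> l\<bar> ^ count_snd bs * norm (D (x, \<xi>)) \<le> C)"
    proof (cases "j \<in> Basis \<and> l \<in> Basis")
      case True
      then obtain P where P: "P \<in> symbol_ops" "P H = (\<lambda>x \<xi>. of_real ((x \<bullet> j) ^ count_fst bs * (\<xi> \<bullet> l) ^ count_snd bs) * D (x, \<xi>))"
        using monomial_times_iter_deriv[OF H bs] unfolding D_def by blast
      obtain C where C: "C \<ge> 0" "\<And>x \<xi>. norm (P H x \<xi>) \<le> C"
        by (rule admissible_bound[OF H P(1)]) (rule that, assumption+)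
      have "\<bar>x \<bullet> j\<bar> ^ count_fst bs * \<bar>\<xi> \<bullet> l\<bar> ^ count_snd bs * norm (D (x, \<xi>)) \<le> C" for x \<xi>
        using C(2)[of x \<xi>] unfolding P(2) by (simp add: norm_mult norm_power abs_mult power_abs)
      then show ?thesis using C(1) by blast
    qed (auto intro: exI[of _ 0])
  qed
  then obtain C where C: "\<And>j l. C j l \<ge> 0"
    "\<And>j l x \<xi>. j \<in> Basis \<Longrightarrow> l \<in> Basis \<Longrightarrow> \<bar>x \<bullet> j\<bar> ^ count_fst bs * \<bar>\<xi> \<bullet> l\<bar> ^ count_snd bs * norm (D (x, \<xi>)) \<le> C j l"
    by metis
  \<comment> \<open>The large coordinates j and l depend on the point; summing over all pairs
    removes this dependence from the bound.\<close>
  define S where "S = (\<Sum>j\<in>Basis. \<Sum>l\<in>Basis. C j l)"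
  have S: "C j l \<le> S" if "j \<in> Basis" "l \<in> Basis" for j l
  proof -
    have "C j l \<le> (\<Sum>l\<in>Basis. C j l)" using that C(1) by (intro member_le_sum) auto
    also have "\<dots> \<le> S" unfolding S_def using that C(1) by (intro member_le_sum) (auto intro: sum_nonneg)
    finally show ?thesis .
  qed
  have S0: "S \<ge> 0" unfolding S_def using C(1) by (intro sum_nonneg) auto
  then have X0: "?N ^ count_fst bs * ?N ^ count_snd bs * S \<ge> 0" by simp
  have "norm (D (x, \<xi>)) \<le> \<bar>B\<bar> + ?N ^ count_fst bs * ?N ^ count_snd bs * S" if x: "norm x = 1" for x \<xi>
  proof (cases "norm \<xi> \<le> 1")
    case True
    then have "norm (D (x, \<xi>)) \<le> B" using x by (intro B) auto
    also have "\<dots> \<le> \<bar>B\<bar> + ?N ^ count_fst bs * ?N ^ count_snd bs * S"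
      using X0 abs_ge_self[of B] by linarith
    finally show ?thesis .
  next
    case False
    obtain j where j: "j \<in> Basis" "norm x \<le> ?N * \<bar>x \<bullet> j\<bar>" by (rule large_coordinate)
    obtain l where l: "l \<in> Basis" "norm \<xi> \<le> ?N * \<bar>\<xi> \<bullet> l\<bar>" by (rule large_coordinate)
    have 1: "1 \<le> (?N * \<bar>x \<bullet> j\<bar>) ^ count_fst bs" using j x by (intro one_le_power) simp
    have 2: "1 \<le> (?N * \<bar>\<xi> \<bullet> l\<bar>) ^ count_snd bs" using l False by (intro one_le_power) linarith
    have "1 * 1 \<le> (?N * \<bar>x \<bullet> j\<bar>) ^ count_fst bs * (?N * \<bar>\<xi> \<bullet> l\<bar>) ^ count_snd bs"
      using 1 2 by (intro mult_mono) auto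
    then have "1 * 1 * norm (D (x, \<xi>)) \<le> (?N * \<bar>x \<bullet> j\<bar>) ^ count_fst bs * (?N * \<bar>\<xi> \<bullet> l\<bar>) ^ count_snd bs * norm (D (x, \<xi>))"
      by (rule mult_right_mono) simp
    also have "\<dots> = ?N ^ count_fst bs * ?N ^ count_snd bs * (\<bar>x \<bullet> j\<bar> ^ count_fst bs * \<bar>\<xi> \<bullet> l\<bar> ^ count_snd bs * norm (D (x, \<xi>)))"
      unfolding power_mult_distrib by (simp only: mult_ac)
    also have "\<dots> \<le> ?N ^ count_fst bs * ?N ^ count_snd bs * S"
      using order_trans[OF C(2)[OF j(1) l(1)] S[OF j(1) l(1)]] by (intro mult_left_mono) auto
    also have "\<dots> \<le> \<bar>B\<bar> + ?N ^ count_fst bs * ?N ^ count_snd bs * S" by simp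
    finally show ?thesis by simp
  qed
  then have "\<forall>x \<xi>. norm x = 1 \<longrightarrow> norm (D (x, \<xi>)) \<le> \<bar>B\<bar> + ?N ^ count_fst bs * ?N ^ count_snd bs * S" by blast
  moreover have "\<bar>B\<bar> + ?N ^ count_fst bs * ?N ^ count_snd bs * S \<ge> 0" using X0 by linarith
  ultimately show ?thesis unfolding D_def by blast
qed

text \<open>A dilation by |x| reduces to |x| = 1, where the bound holds for every \<xi>; the powers
  of |x| are those by which derivatives scale under dilations.\<close>

lemma iter_deriv_bound:
  fixes H :: "'a::euclidean_space \<Rightarrow> 'a \<Rightarrow> complex"
  assumes H: "admissible H" and bs: "bs \<in> lists Basis"
  shows "\<exists>C\<ge>0. \<forall>x \<xi>. x \<noteq> 0 \<longrightarrow> norm x ^ count_fst bs * norm (iter_deriv bs (case_prod H) (x, \<xi>)) \<le> C * norm x ^ count_snd bs"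
proof -
  obtain C where C: "C \<ge> 0" "\<forall>x \<xi>. norm x = 1 \<longrightarrow> norm (iter_deriv bs (case_prod H) (x, \<xi>)) \<le> C"
    using iter_deriv_bound_sphere[OF H bs] by blast
  have "norm x ^ count_fst bs * norm (iter_deriv bs (case_prod H) (x, \<xi>)) \<le> C * norm x ^ count_snd bs" if x: "x \<noteq> 0" for x \<xi>
  proof -
    define z where "z = (inverse (norm x) *\<^sub>R x, norm x *\<^sub>R \<xi>)"
    have "(norm x *\<^sub>R fst z, inverse (norm x) *\<^sub>R snd z) = (x, \<xi>)" using x by (simp add: z_def)
    then have "of_real (norm x ^ count_fst bs) * iter_deriv bs (case_prod H) (x, \<xi>) = of_real (norm x ^ count_snd bs) * iter_deriv bs (case_prod H) z"
      using iter_deriv_dilation[OF H bs, of "norm x" z] x by simp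
    from arg_cong[OF this, of norm]
    have "norm x ^ count_fst bs * norm (iter_deriv bs (case_prod H) (x, \<xi>)) = norm x ^ count_snd bs * norm (iter_deriv bs (case_prod H) z)"
      by (simp add: norm_mult norm_power)
    also have "\<dots> \<le> norm x ^ count_snd bs * C"
      using C(2) x unfolding z_def by (intro mult_left_mono) auto
    finally show ?thesis by (simp add: mult.commute)
  qed
  then show ?thesis using C(1) by blast
qed

text \<open>Flatness supplies the power of |x| for |x| < \<delta>; elsewhere |x|^p \<ge> \<delta>^p,
  and the Schwartz bound is enough.\<close>

lemma flat_bound_power:
  fixes v :: "'a::euclidean_space \<Rightarrow> complex"
  assumes v: "v \<in> schwartz_flat" and cs: "cs \<in> lists Basis"
  shows "\<exists>c\<ge>0. \<forall>x. x \<noteq> 0 \<longrightarrow> (1 + norm x) ^ M * norm (iter_deriv cs v x) \<le> c * norm x ^ p"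
proof -
  obtain c \<delta> where c: "\<delta> > 0" "\<And>x. norm x < \<delta> \<Longrightarrow> norm (iter_deriv cs v x) \<le> c * norm x ^ p"
    using v cs unfolding schwartz_flat_def by blast
  obtain d where d: "\<And>x. (1 + norm x) ^ M * norm (iter_deriv cs v x) \<le> d"
    using v cs unfolding schwartz_flat_def schwartz_def by blast
  have d0: "d \<ge> 0" by (rule order_trans[OF _ d[of 0]]) simp
  have "(1 + norm x) ^ M * norm (iter_deriv cs v x) \<le> ((1 + \<delta>) ^ M * \<bar>c\<bar> + d * inverse (\<delta> ^ p)) * norm x ^ p" for x
  proof (cases "norm x < \<delta>")
    case True
    have "norm (iter_deriv cs v x) \<le> \<bar>c\<bar> * norm x ^ p"
      using c(2)[OF True] by (meson abs_ge_self mult_right_mono norm_ge_zero order_trans zero_le_power)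
    moreover have "(1 + norm x) ^ M \<le> (1 + \<delta>) ^ M" using True by (intro power_mono) auto
    ultimately have "(1 + norm x) ^ M * norm (iter_deriv cs v x) \<le> (1 + \<delta>) ^ M * (\<bar>c\<bar> * norm x ^ p)"
      using c(1) by (intro mult_mono) auto
    also have "\<dots> \<le> ((1 + \<delta>) ^ M * \<bar>c\<bar> + d * inverse (\<delta> ^ p)) * norm x ^ p"
      using d0 c(1) by (simp add: distrib_right)
    finally show ?thesis .
  next
    case False
    have "1 \<le> inverse (\<delta> ^ p) * norm x ^ p"
      using False c(1) power_mono[of \<delta> "norm x" p] by (simp add: field_simps)
    then have "d * 1 \<le> d * (inverse (\<delta> ^ p) * norm x ^ p)" using d0 by (rule mult_left_mono)
    also have "\<dots> \<le> ((1 + \<delta>) ^ M * \<bar>c\<bar> + d * inverse (\<delta> ^ p)) * norm x ^ p"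
      using c(1) by (simp add: distrib_right mult.assoc)
    finally show ?thesis using d[of x] by simp
  qed
  moreover have "(1 + \<delta>) ^ M * \<bar>c\<bar> + d * inverse (\<delta> ^ p) \<ge> 0" using c(1) d0 by simp
  ultimately show ?thesis by blast
qed

text \<open>With p derivatives in x and q in \<xi>, the symbol is O(|x|^(q - p)) uniformly in \<xi>.
  Flatness of order p cancels the singularity at 0, and q additional powers in the Schwartz bound
  cancel the growth at infinity.\<close>

lemma amplitude_flat:
  fixes H :: "'a::euclidean_space \<Rightarrow> 'a \<Rightarrow> complex"
  assumes H: "admissible H" and v: "v \<in> schwartz_flat" and \<kappa>: "\<kappa> \<noteq> 0"
  shows "amplitude (case_prod H) v \<kappa>"
proof
  show "smooth (case_prod H)" using H by (simp add: admissible_def)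
  show "smooth v" using v by (simp add: schwartz_flat_def schwartz_def)
  show "\<kappa> \<noteq> 0" by (rule \<kappa>)
  fix bs :: "('a \<times> 'a) list" and cs :: "'a list" and N :: nat
  assume bs: "bs \<in> lists Basis" and cs: "cs \<in> lists Basis"
  define p where "p = count_fst bs"
  define q where "q = count_snd bs"
  obtain C where C: "C \<ge> 0" "\<And>x \<xi>. x \<noteq> 0 \<Longrightarrow> norm x ^ p * norm (iter_deriv bs (case_prod H) (x, \<xi>)) \<le> C * norm x ^ q"
    using iter_deriv_bound[OF H bs] unfolding p_def q_def by blast
  obtain c where c: "c \<ge> 0" "\<And>x. x \<noteq> 0 \<Longrightarrow> (1 + norm x) ^ (N + q) * norm (iter_deriv cs v x) \<le> c * norm x ^ p"
    using flat_bound_power[OF v cs] by blast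
  \<comment> \<open>The scaling estimate for the symbol says nothing at x = 0; there the product
    vanishes for this reason.\<close>
  have v0: "iter_deriv cs v 0 = 0"
  proof -
    obtain e \<delta> where "\<delta> > 0" "\<And>x. norm x < \<delta> \<Longrightarrow> norm (iter_deriv cs v x) \<le> e * norm x ^ 1"
      using v cs unfolding schwartz_flat_def by blast
    from this(2)[of 0] this(1) show ?thesis by simp
  qed
  have "(1 + norm x) ^ N * norm (iter_deriv bs (case_prod H) (x, \<xi>) * iter_deriv cs v x) \<le> C * c" for x \<xi>
  proof (cases "x = 0")
    case True
    then show ?thesis using v0 C(1) c(1) by simp
  next
    case False
    let ?D = "norm (iter_deriv bs (case_prod H) (x, \<xi>))" and ?V = "norm (iter_deriv cs v x)"
    have pos: "0 < norm x ^ p" "0 < (1 + norm x) ^ q" using False by (auto simp: add_pos_nonneg)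
    have "(norm x ^ p * (1 + norm x) ^ q) * ((1 + norm x) ^ N * (?D * ?V)) = (norm x ^ p * ?D) * ((1 + norm x) ^ (N + q) * ?V)"
      unfolding power_add by (simp only: mult_ac)
    also have "\<dots> \<le> (C * norm x ^ q) * (c * norm x ^ p)"
      by (rule mult_mono[OF C(2)[OF False] c(2)[OF False]]) (use C(1) in auto)
    also have "\<dots> \<le> (C * (1 + norm x) ^ q) * (c * norm x ^ p)"
      using C(1) c(1) by (intro mult_right_mono mult_left_mono power_mono) auto
    also have "\<dots> = (norm x ^ p * (1 + norm x) ^ q) * (C * c)" by (simp only: mult_ac)
    finally show ?thesis
      using mult_pos_pos[OF pos] unfolding norm_mult by (simp only: mult_le_cancel_left_pos)
  qed
  then show "\<exists>c. \<forall>x \<xi>. (1 + norm x) ^ N * norm (iter_deriv bs (case_prod H) (x, \<xi>) * iter_deriv cs v x) \<le> c"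
    by blast
qed

section \<open>The operators with symbols given by Fourier integrals\<close>

lemma AE_hyperplane:
  fixes s :: "real ^ 'n::finite"
  shows "AE \<sigma> in lborel. 1 + s \<bullet> \<sigma> \<noteq> 0"
proof -
  have eq: "{\<sigma>. s \<bullet> \<sigma> = - 1} = {\<sigma>. 1 + s \<bullet> \<sigma> = 0}" by (auto simp: eq_neg_iff_add_eq_0 add.commute)
  have "negligible {\<sigma>. s \<bullet> \<sigma> = - 1}" by (rule negligible_hyperplane) simp
  then have "{\<sigma>. 1 + s \<bullet> \<sigma> = 0} \<in> null_sets (completion lborel)"
    by (simp only: negligible_iff_null_sets eq)
  moreover have "{\<sigma>. 1 + s \<bullet> \<sigma> = 0} \<in> sets lborel" by measurable
  ultimately have "{\<sigma>. 1 + s \<bullet> \<sigma> = 0} \<in> null_sets lborel"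
    using null_sets_completion_iff by blast
  from AE_not_in[OF this] show ?thesis by simp
qed

text \<open>The set where the functions differ is open and negligible, hence empty.\<close>

lemma continuous_AE_eq:
  fixes f g :: "'a::euclidean_space \<Rightarrow> complex"
  assumes "continuous_on UNIV f" "continuous_on UNIV g" "AE x in lborel. f x = g x"
  shows "f = g"
proof -
  define S where "S = {x. f x \<noteq> g x}"
  have "open S" unfolding S_def by (intro open_Collect_neq assms)
  moreover have "negligible S"
  proof -
    have "S \<in> sets lborel" using \<open>open S\<close> by simp
    moreover have "AE x in lborel. x \<notin> S" using assms(3) by (simp add: S_def)
    ultimately have "S \<in> null_sets lborel" using AE_iff_null_sets by blast
    then show ?thesis by (simp add: negligible_iff_null_sets null_sets_completionI)
  qed
  ultimately have "S = {}" using open_not_negligible by blast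
  then show ?thesis unfolding S_def by auto
qed

text \<open>Since |(s, 1)| \<ge> 1, one integrable majorant in t serves all s. Continuity is needed
  to turn almost everywhere equalities of components into equalities.\<close>

lemma flat_continuous:
  fixes v :: "'n::finite space \<Rightarrow> complex"
  assumes v: "v \<in> schwartz"
  shows "continuous_on UNIV (flat lam \<epsilon> v)"
proof -
  have [measurable]: "v \<in> borel_measurable borel" by (rule rapid_borel[OF schwartz_rapid[OF v]])
  define p where "p = (real CARD('n) - 1) / 2"
  obtain N where N: "p + 2 \<le> real N" using real_arch_simple by blast
  have p: "p \<ge> 0" unfolding p_def by (rule hexp_nonneg)
  obtain C where C: "C \<ge> 0" "\<And>x. norm (v x) \<le> C * inverse ((1 + norm x) ^ N)"
    by (rule rapid_bound[OF schwartz_rapid[OF v]]) (rule that, assumption+)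
  have "((\<lambda>s. LINT t|lborel. spow \<epsilon> (hexp CARD('n) lam) t * v (t *\<^sub>R (s, 1))) \<longlongrightarrow>
      (LINT t|lborel. spow \<epsilon> (hexp CARD('n) lam) t * v (t *\<^sub>R (s0, 1)))) (at s0 within UNIV)" for s0
  proof (rule dominated_convergence_within)
    show "integrable lborel (\<lambda>t. C * (\<bar>t\<bar> powr p * inverse ((1 + \<bar>t\<bar> * 1) ^ N)))"
      by (intro integrable_mult_right integrable_line_weight p N) simp
    have "continuous_on UNIV v" by (rule smooth_continuous_on[OF schwartz_smooth[OF v]])
    then have "isCont v x" for x using continuous_on_eq_continuous_at[OF open_UNIV, of v] by blast
    then have "((\<lambda>s. v (t *\<^sub>R (s, 1))) \<longlongrightarrow> v (t *\<^sub>R (s0, 1))) (at s0)" for t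
      by (rule isCont_tendsto_compose) (intro tendsto_intros)
    then show "AE t in lborel. ((\<lambda>s. spow \<epsilon> (hexp CARD('n) lam) t * v (t *\<^sub>R (s, 1))) \<longlongrightarrow> spow \<epsilon> (hexp CARD('n) lam) t * v (t *\<^sub>R (s0, 1))) (at s0)"
      by (intro AE_I2 tendsto_mult_left)
    fix s :: "real ^ 'n"
    have "norm (spow \<epsilon> (hexp CARD('n) lam) t * v (t *\<^sub>R (s, 1))) \<le> C * (\<bar>t\<bar> powr p * inverse ((1 + \<bar>t\<bar> * 1) ^ N))" for t
    proof -
      have "1 \<le> norm (s, 1::real)" using norm_snd_le[of "1::real" s] by simp
      then have "\<bar>t\<bar> * 1 \<le> norm (t *\<^sub>R (s, 1::real))" unfolding norm_scaleR by (intro mult_left_mono) auto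
      then have "(1 + \<bar>t\<bar> * 1) ^ N \<le> (1 + norm (t *\<^sub>R (s, 1::real))) ^ N" by (intro power_mono) auto
      then have "inverse ((1 + norm (t *\<^sub>R (s, 1::real))) ^ N) \<le> inverse ((1 + \<bar>t\<bar> * 1) ^ N)"
        by (intro le_imp_inverse_le zero_less_power) (auto simp: add_pos_nonneg)
      then have "norm (v (t *\<^sub>R (s, 1))) \<le> C * inverse ((1 + \<bar>t\<bar> * 1) ^ N)"
        using C(2)[of "t *\<^sub>R (s, 1)"] C(1) by (meson mult_left_mono order_trans)
      moreover have "norm (spow \<epsilon> (hexp CARD('n) lam) t) \<le> \<bar>t\<bar> powr p"
        using norm_spow[of \<epsilon> "hexp CARD('n) lam" t] by (simp add: p_def)
      ultimately have "norm (spow \<epsilon> (hexp CARD('n) lam) t) * norm (v (t *\<^sub>R (s, 1))) \<le> \<bar>t\<bar> powr p * (C * inverse ((1 + \<bar>t\<bar> * 1) ^ N))"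
        by (intro mult_mono) auto
      then show ?thesis unfolding norm_mult by (simp only: mult_ac)
    qed
    then show "AE t in lborel. norm (spow \<epsilon> (hexp CARD('n) lam) t * v (t *\<^sub>R (s, 1))) \<le> C * (\<bar>t\<bar> powr p * inverse ((1 + \<bar>t\<bar> * 1) ^ N))"
      by (intro AE_I2)
  qed measurable
  then have "((\<lambda>s. flat lam \<epsilon> v s) \<longlongrightarrow> flat lam \<epsilon> v s0) (at s0 within UNIV)" for s0
    unfolding flat_def hom_comp_def by (intro tendsto_mult_left)
  then show ?thesis by (simp add: continuous_on_def)
qed

text \<open>The inverse transformation is \<open>fourier\<close> followed by the reflection at 0,
  under which a homogeneous function is multiplied by its parity sign, the value of
  \<open>spow\<close> at -1.\<close>

lemma flat_inv_fourier:
  fixes v :: "'n::finite space \<Rightarrow> complex"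
  shows "flat lam \<epsilon> (inv_fourier v) s = spow \<epsilon> (- hexp CARD('n) lam - 1) (- 1) * flat lam \<epsilon> (fourier v) s"
proof -
  have "inv_fourier v = (\<lambda>x. fourier v (- x))"
    by (rule ext) (simp add: inv_fourier_def fourier_def)
  then have "flat lam \<epsilon> (inv_fourier v) s = hom_comp lam \<epsilon> (fourier v) ((- 1) *\<^sub>R (s, 1))"
    unfolding flat_def hom_comp_def by simp
  then show ?thesis
    unfolding flat_def by (subst (asm) hom_comp_homogeneous) simp_all
qed

text \<open>A majorant |J| lets the limit enter the integral, which is thereby identified with the
  value L known from elsewhere. Measurability of \<open>F0\<close> comes from a sequence of
  parameters tending to 0.\<close>

lemma regularized_limit:
  fixes F :: "real \<Rightarrow> 'a \<Rightarrow> complex"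
  assumes F: "\<And>\<alpha>. \<alpha> > 0 \<Longrightarrow> integrable M (F \<alpha>)"
    and lim: "\<And>x. x \<in> space M \<Longrightarrow> ((\<lambda>\<alpha>. F \<alpha> x) \<longlongrightarrow> F0 x) (at_right 0)"
    and J: "integrable M J"
    and bound: "\<And>\<alpha> x. \<alpha> > 0 \<Longrightarrow> norm (F \<alpha> x) \<le> c * norm (J x :: complex)"
    and L: "((\<lambda>\<alpha>. LINT x|M. F \<alpha> x) \<longlongrightarrow> L) (at_right 0)"
  shows "integrable M F0 \<and> (LINT x|M. F0 x) = L"
proof -
  have seq: "filterlim (\<lambda>n. inverse (real (Suc n))) (at_right 0) sequentially"
    unfolding filterlim_at_right_to_top
    using LIMSEQ_inverse_real_of_nat
    by (auto simp: filterlim_at intro!: always_eventually)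
  have F0: "F0 \<in> borel_measurable M"
  proof (rule borel_measurable_LIMSEQ_metric)
    show "F (inverse (real (Suc n))) \<in> borel_measurable M" for n
      by (rule borel_measurable_integrable[OF F]) simp
    show "(\<lambda>n. F (inverse (real (Suc n))) x) \<longlonglongrightarrow> F0 x" if "x \<in> space M" for x
      by (rule filterlim_compose[OF lim[OF that] seq])
  qed
  have int: "integrable M (\<lambda>x. c * norm (J x))" by (intro integrable_mult_right integrable_norm J)
  have "norm (F0 x) \<le> c * norm (J x)" if "x \<in> space M" for x
    by (rule tendsto_upperbound[OF tendsto_norm[OF lim[OF that]]])
       (auto intro!: eventually_mono[OF eventually_at_right_less[of 0]] bound)
  then have "integrable M F0"
    using abs_ge_self by (intro Bochner_Integration.integrable_bound[OF int F0] AE_I2) fastforce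
  moreover have "((\<lambda>\<alpha>. LINT x|M. F \<alpha> x) \<longlongrightarrow> (LINT x|M. F0 x)) (at 0 within {0<..})"
  proof (rule dominated_convergence_within[OF F0 _ int])
    show "F \<alpha> \<in> borel_measurable M" if "\<alpha> \<in> {0<..}" for \<alpha>
      by (rule borel_measurable_integrable[OF F]) (use that in simp)
    show "AE x in M. ((\<lambda>\<alpha>. F \<alpha> x) \<longlongrightarrow> F0 x) (at_right 0)" by (intro AE_I2 lim)
    show "AE x in M. norm (F \<alpha> x) \<le> c * norm (J x)" if "\<alpha> \<in> {0<..}" for \<alpha>
      by (intro AE_I2 bound) (use that in simp)
  qed
  ultimately show ?thesis using tendsto_unique[OF _ _ L] by (auto simp: trivial_limit_at_right_real)
qed

section \<open>The symbols f and h as ray integrals\<close>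

lemma ray_integral_dilation:
  assumes "admissible H" "k \<noteq> 0"
  shows "ray_integral \<kappa> \<alpha> \<epsilon> a H (k *\<^sub>R x) \<xi> = ray_integral \<kappa> \<alpha> \<epsilon> a H x (k *\<^sub>R \<xi>)"
proof -
  have "damp \<alpha> H (k *\<^sub>R x) \<zeta> = damp \<alpha> H x (k *\<^sub>R \<zeta>)" for \<zeta>
    using admissible_dilation[OF assms] by (simp add: damp_def mult_ac)
  then show ?thesis by (simp add: ray_integral_def mult.commute)
qed

lemma bullet_constant:
  assumes H: "admissible H"
  shows "on_classes (\<lambda>x \<xi>. c * ray_integral \<kappa> \<alpha> \<epsilon> a H x \<xi>) (bullet x \<xi>) = c * ray_integral \<kappa> \<alpha> \<epsilon> a H x \<xi>"
  by (rule on_classes_bullet) (simp add: dilation_invariant_def ray_integral_dilation[OF H])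

lemma f_symbol_bullet:
  fixes H :: "'n::finite space \<Rightarrow> 'n space \<Rightarrow> complex"
  assumes H: "admissible H"
  shows "f_symbol lam \<epsilon> (damp \<alpha> H) (bullet x \<xi>) =
    (- 1) ^ \<epsilon> * inverse (C_norm CARD('n) (- lam) \<epsilon>) * ray_integral 1 \<alpha> \<epsilon> (hexp CARD('n) lam) H x \<xi>"
proof -
  have "dilation_invariant (damp \<alpha> H)"
    using H by (intro dilation_invariant_damp) (simp add: admissible_def)
  from on_classes_bullet[OF this] have "f_symbol lam \<epsilon> (damp \<alpha> H) =
    on_classes (\<lambda>x \<xi>. (- 1) ^ \<epsilon> * inverse (C_norm CARD('n) (- lam) \<epsilon>) * ray_integral 1 \<alpha> \<epsilon> (hexp CARD('n) lam) H x \<xi>)"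
    unfolding f_symbol_def ray_integral_def by simp
  then show ?thesis by (simp only: bullet_constant[OF H])
qed

lemma damp_swap: "damp \<alpha> (\<lambda>x \<xi>. H \<xi> x) x \<xi> = damp \<alpha> H \<xi> x"
  by (simp add: damp_def mult.commute)

lemma h_symbol_bullet:
  fixes H :: "'n::finite space \<Rightarrow> 'n space \<Rightarrow> complex"
  assumes H: "admissible H"
  shows "h_symbol lam \<epsilon> (damp \<alpha> H) (bullet x \<xi>) =
    inverse (C_norm CARD('n) lam \<epsilon>) * ray_integral (- 1) \<alpha> \<epsilon> (hexp CARD('n) (- lam)) (\<lambda>x \<xi>. H \<xi> x) \<xi> x"
proof -
  note H' = admissible_swap[OF H]
  have "dilation_invariant (damp \<alpha> H)"
    using H by (intro dilation_invariant_damp) (simp add: admissible_def)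
  note D = on_classes_bullet[OF this]
  have "h_symbol lam \<epsilon> (damp \<alpha> H) =
    on_classes (\<lambda>x \<xi>. inverse (C_norm CARD('n) lam \<epsilon>) * ray_integral (- 1) \<alpha> \<epsilon> (hexp CARD('n) (- lam)) (\<lambda>x \<xi>. H \<xi> x) \<xi> x)"
    unfolding h_symbol_def ray_integral_def D damp_swap[of _ H] by simp
  moreover have "dilation_invariant (\<lambda>x \<xi>. inverse (C_norm CARD('n) lam \<epsilon>) * ray_integral (- 1) \<alpha> \<epsilon> (hexp CARD('n) (- lam)) (\<lambda>x \<xi>. H \<xi> x) \<xi> x)"
    by (simp add: dilation_invariant_def ray_integral_dilation[OF H'])
  ultimately show ?thesis by (simp only: on_classes_bullet)
qed

lemma C_norm_nonzero: "C_norm n lam \<epsilon> \<noteq> 0"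
  by (simp add: C_norm_def)

lemma X_bullet_nonzero:
  assumes "c \<in> X_bullet"
  obtains x \<xi> where "c = bullet x \<xi>" "x \<noteq> 0" "\<xi> \<noteq> 0"
  using assms unfolding X_bullet_def by fastforce

text \<open>Representatives of a class in \<open>X_bullet\<close> have both entries nonzero, so
  their ray integrals converge. The first alternative for \<Phi> is for f; the second, with the
  variables in reverse order, is for h and the transposed symbol.\<close>

lemma fourier_symbol_exists:
  fixes H :: "'a::euclidean_space \<Rightarrow> 'a \<Rightarrow> complex"
  assumes H: "admissible H" and \<kappa>: "\<kappa> = 1 \<or> \<kappa> = - 1" and a: "Re a \<ge> 0"
    and \<Phi>: "(\<forall>\<alpha> x \<xi>. \<Phi> \<alpha> (bullet x \<xi>) = c * ray_integral \<kappa> \<alpha> \<epsilon> a H x \<xi>) \<or>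
      (\<forall>\<alpha> x \<xi>. \<Phi> \<alpha> (bullet x \<xi>) = c * ray_integral \<kappa> \<alpha> \<epsilon> a H \<xi> x)"
  shows "\<exists>f. fourier_symbol \<Phi> f"
proof -
  have "\<exists>l. ((\<lambda>\<alpha>. \<Phi> \<alpha> z) \<longlongrightarrow> l) (at_right 0)" if c: "z \<in> X_bullet" for z
  proof -
    obtain x \<xi> where z: "z = bullet x \<xi>" "x \<noteq> 0" "\<xi> \<noteq> 0"
      by (rule X_bullet_nonzero[OF c]) (rule that, assumption+)
    obtain l where l: "((\<lambda>\<alpha>. ray_integral \<kappa> \<alpha> \<epsilon> a H x \<xi>) \<longlongrightarrow> l) (at_right 0)"
      using ray_integral_tendsto[OF H \<kappa> a z(2,3)] by blast
    obtain l' where l': "((\<lambda>\<alpha>. ray_integral \<kappa> \<alpha> \<epsilon> a H \<xi> x) \<longlongrightarrow> l') (at_right 0)"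
      using ray_integral_tendsto[OF H \<kappa> a z(3,2)] by blast
    from \<Phi> show ?thesis
    proof
      assume "\<forall>\<alpha> x \<xi>. \<Phi> \<alpha> (bullet x \<xi>) = c * ray_integral \<kappa> \<alpha> \<epsilon> a H x \<xi>"
      then show ?thesis using tendsto_mult_left[OF l, of c] unfolding z by auto
    next
      assume "\<forall>\<alpha> x \<xi>. \<Phi> \<alpha> (bullet x \<xi>) = c * ray_integral \<kappa> \<alpha> \<epsilon> a H \<xi> x"
      then show ?thesis using tendsto_mult_left[OF l', of c] unfolding z by auto
    qed
  qed
  then show ?thesis unfolding fourier_symbol_def by metis
qed

text \<open>The common core of both calculi: \<open>K \<alpha>\<close> is the damped symbol in
  coordinates, \<open>W\<close> the singular power and \<open>U\<close> the function operated on,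
  possibly a value of \<open>theta\<close> and so known only almost everywhere. By
  \<open>ray_kernel_eq\<close>, K times W is a multiple of the kernel whose integral is already
  computed; the uniform bound on ray integrals yields the last claim.\<close>

lemma
  fixes H :: "'n::finite space \<Rightarrow> 'n space \<Rightarrow> complex" and K :: "real \<Rightarrow> real ^ 'n \<Rightarrow> complex"
  assumes H: "admissible H" and \<kappa>: "\<kappa> = 1 \<or> \<kappa> = - 1" and \<psi>: "\<psi> \<in> schwartz"
    and U: "U \<in> borel_measurable borel" "AE \<sigma> in lborel. U \<sigma> = flat (- lam) \<epsilon> \<psi> \<sigma>"
    and K: "\<And>\<alpha> \<sigma>. 1 + s \<bullet> \<sigma> \<noteq> 0 \<Longrightarrow>
      K \<alpha> \<sigma> = c * ray_integral \<kappa> \<alpha> \<epsilon> (hexp CARD('n) lam) H (s, 1) (inverse (1 + s \<bullet> \<sigma>) *\<^sub>R (\<sigma>, 1))"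
  defines "W \<equiv> \<lambda>\<sigma>. spow \<epsilon> (- hexp CARD('n) lam - 1) (1 + s \<bullet> \<sigma>)"
  shows kernel_operator_integrable: "\<And>\<alpha>. \<alpha> > 0 \<Longrightarrow> integrable lborel (\<lambda>\<sigma>. K \<alpha> \<sigma> * W \<sigma> * U \<sigma>)"
    and kernel_operator_tendsto: "((\<lambda>\<alpha>. LINT \<sigma>|lborel. K \<alpha> \<sigma> * W \<sigma> * U \<sigma>) \<longlongrightarrow>
      c * flat lam \<epsilon> (osc_op \<kappa> 0 H \<psi>) s) (at_right 0)"
    and kernel_operator_limit: "\<And>K0. \<lbrakk>\<And>\<sigma>. 1 + s \<bullet> \<sigma> \<noteq> 0 \<Longrightarrow> ((\<lambda>\<alpha>. K \<alpha> \<sigma>) \<longlongrightarrow> K0 \<sigma>) (at_right 0);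
      integrable lborel (\<lambda>\<sigma>. W \<sigma> * U \<sigma>)\<rbrakk> \<Longrightarrow>
      integrable lborel (\<lambda>\<sigma>. K0 \<sigma> * W \<sigma> * U \<sigma>) \<and>
      (LINT \<sigma>|lborel. K0 \<sigma> * W \<sigma> * U \<sigma>) = c * flat lam \<epsilon> (osc_op \<kappa> 0 H \<psi>) s"
proof -
  have [measurable]: "U \<in> borel_measurable borel" by (rule U)
  note \<psi>r = schwartz_rapid[OF \<psi>]
  have [measurable]: "\<psi> \<in> borel_measurable borel" by (rule rapid_borel[OF \<psi>r])
  have ne: "(s, 1::real) \<noteq> 0" by (simp add: prod_eq_iff)
  have "(\<lambda>z. damp \<alpha> H (s, 1) (snd z *\<^sub>R (fst z, 1))) \<in> borel_measurable (lborel \<Otimes>\<^sub>M lborel)" for \<alpha>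
    by (rule damp_borel_comp[OF H]) measurable
  then have [measurable]: "(\<lambda>(\<sigma>, t). damp \<alpha> H (s, 1) (t *\<^sub>R (\<sigma>, 1))) \<in> borel_measurable (lborel \<Otimes>\<^sub>M lborel)" for \<alpha>
    by (simp add: case_prod_beta)
  have "ray_kernel \<kappa> \<alpha> \<epsilon> lam H (s, 1) \<in> borel_measurable lborel" for \<alpha>
    unfolding ray_kernel_def[abs_def] by (rule lborel.borel_measurable_lebesgue_integral) measurable
  then have [measurable]: "ray_kernel \<kappa> \<alpha> \<epsilon> lam H (s, 1) \<in> borel_measurable borel" for \<alpha> by simp
  \<comment> \<open>Nothing is known about \<open>K\<close> on the hyperplane, but \<open>W\<close>
    vanishes there by the convention for \<open>spow\<close> at 0. The product is thus described
    everywhere, which gives its measurability.\<close>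
  have KW: "K \<alpha> \<sigma> * W \<sigma> * U \<sigma> = (if 1 + s \<bullet> \<sigma> = 0 then 0 else c * (ray_kernel \<kappa> \<alpha> \<epsilon> lam H (s, 1) \<sigma> * U \<sigma>))" for \<alpha> \<sigma>
  proof (cases "1 + s \<bullet> \<sigma> = 0")
    case False
    then show ?thesis
      using ray_kernel_eq[of "(s, 1)" \<sigma> \<kappa> \<alpha> \<epsilon> lam H] K[OF False] unfolding W_def
      by (simp add: add.commute[of _ 1] mult_ac)
  qed (simp add: W_def)
  have KWm: "(\<lambda>\<sigma>. K \<alpha> \<sigma> * W \<sigma> * U \<sigma>) \<in> borel_measurable lborel" for \<alpha>
    unfolding KW by measurable
  have eq: "AE \<sigma> in lborel. K \<alpha> \<sigma> * W \<sigma> * U \<sigma> = c * (ray_kernel \<kappa> \<alpha> \<epsilon> lam H (s, 1) \<sigma> * flat (- lam) \<epsilon> \<psi> \<sigma>)" for \<alpha>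
    using U(2) AE_hyperplane[of s] by eventually_elim (subst KW, simp)
  have m2: "(\<lambda>\<sigma>. c * (ray_kernel \<kappa> \<alpha> \<epsilon> lam H (s, 1) \<sigma> * flat (- lam) \<epsilon> \<psi> \<sigma>)) \<in> borel_measurable lborel" for \<alpha>
    by measurable
  show int: "integrable lborel (\<lambda>\<sigma>. K \<alpha> \<sigma> * W \<sigma> * U \<sigma>)" if "\<alpha> > 0" for \<alpha>
    unfolding integrable_cong_AE[OF KWm m2 eq]
    by (intro integrable_mult_right ray_kernel_integrable[OF H \<psi>r that ne])
  have val: "(LINT \<sigma>|lborel. K \<alpha> \<sigma> * W \<sigma> * U \<sigma>) = c * hom_comp lam \<epsilon> (osc_op \<kappa> \<alpha> H \<psi>) (s, 1)" if "\<alpha> > 0" for \<alpha>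
    unfolding integral_cong_AE[OF KWm m2 eq]
    by (simp add: ray_kernel_hom_comp[OF H \<psi>r that ne])
  have "((\<lambda>\<alpha>. c * hom_comp lam \<epsilon> (osc_op \<kappa> \<alpha> H \<psi>) (s, 1)) \<longlongrightarrow> c * flat lam \<epsilon> (osc_op \<kappa> 0 H \<psi>) s) (at_right 0)"
    unfolding flat_def by (intro tendsto_mult_left hom_comp_osc_op_tendsto[OF H \<psi> _ ne]) (use \<kappa> in auto)
  then show lim: "((\<lambda>\<alpha>. LINT \<sigma>|lborel. K \<alpha> \<sigma> * W \<sigma> * U \<sigma>) \<longlongrightarrow> c * flat lam \<epsilon> (osc_op \<kappa> 0 H \<psi>) s) (at_right 0)"
    by (rule Lim_transform_eventually)
       (use val in \<open>auto intro!: eventually_mono[OF eventually_at_right_less[of 0]]\<close>)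
  have "Re (hexp CARD('n) lam) \<ge> 0" unfolding Re_hexp by (rule hexp_nonneg)
  from ray_integral_bound[OF H \<kappa> this, of \<epsilon>]
  obtain B where B0: "0 \<le> B \<and> (\<forall>\<alpha>>0. \<forall>x \<xi>. x \<noteq> 0 \<longrightarrow> \<xi> \<noteq> 0 \<longrightarrow> norm (ray_integral \<kappa> \<alpha> \<epsilon> (hexp CARD('n) lam) H x \<xi>) \<le> B)"
    by (elim exE) (rule that)
  have B: "norm (ray_integral \<kappa> \<alpha> \<epsilon> (hexp CARD('n) lam) H x \<xi>) \<le> B" if "\<alpha> > 0" "x \<noteq> 0" "\<xi> \<noteq> 0" for \<alpha> x \<xi>
    by (rule conjunct2[OF B0, rule_format, OF that])
  fix K0 :: "real ^ 'n \<Rightarrow> complex"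
  assume K0: "\<And>\<sigma>. 1 + s \<bullet> \<sigma> \<noteq> 0 \<Longrightarrow> ((\<lambda>\<alpha>. K \<alpha> \<sigma>) \<longlongrightarrow> K0 \<sigma>) (at_right 0)"
    and J: "integrable lborel (\<lambda>\<sigma>. W \<sigma> * U \<sigma>)"
  show "integrable lborel (\<lambda>\<sigma>. K0 \<sigma> * W \<sigma> * U \<sigma>) \<and>
      (LINT \<sigma>|lborel. K0 \<sigma> * W \<sigma> * U \<sigma>) = c * flat lam \<epsilon> (osc_op \<kappa> 0 H \<psi>) s"
  proof (rule regularized_limit[OF int _ J _ lim])
    show "((\<lambda>\<alpha>. K \<alpha> \<sigma> * W \<sigma> * U \<sigma>) \<longlongrightarrow> K0 \<sigma> * W \<sigma> * U \<sigma>) (at_right 0)" for \<sigma>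
    proof (cases "1 + s \<bullet> \<sigma> = 0")
      case False
      then show ?thesis by (intro tendsto_mult_right K0)
    qed (simp add: W_def)
    show "norm (K \<alpha> \<sigma> * W \<sigma> * U \<sigma>) \<le> norm c * B * norm (W \<sigma> * U \<sigma>)" if "\<alpha> > 0" for \<alpha> \<sigma>
    proof (cases "1 + s \<bullet> \<sigma> = 0")
      case False
      have "norm (K \<alpha> \<sigma>) \<le> norm c * B"
        unfolding K[OF False] norm_mult using False by (intro mult_left_mono B that) (auto simp: prod_eq_iff)
      then have "norm (K \<alpha> \<sigma>) * norm (W \<sigma> * U \<sigma>) \<le> norm c * B * norm (W \<sigma> * U \<sigma>)"
        by (rule mult_right_mono) simp
      then show ?thesis by (simp add: norm_mult mult.assoc)
    qed (simp add: W_def)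
  qed
qed

text \<open>The operator picks some preimage in \<open>V\<close> and applies \<open>T\<close>; the
  hypothesis makes the result independent of the choice.\<close>

lemma component_op_exists:
  assumes "\<And>v w. v \<in> V \<Longrightarrow> w \<in> V \<Longrightarrow> flat lam \<epsilon> v = flat lam \<epsilon> w \<Longrightarrow> flat lam \<epsilon> (T v) = flat lam \<epsilon> (T w)"
  shows "\<exists>A. component_op lam \<epsilon> V T A"
proof -
  have "flat lam \<epsilon> (T v) = flat lam \<epsilon> (T (SOME w. w \<in> V \<and> flat lam \<epsilon> w = flat lam \<epsilon> v))" if "v \<in> V" for v
  proof (rule assms[OF that])
    show "(SOME w. w \<in> V \<and> flat lam \<epsilon> w = flat lam \<epsilon> v) \<in> V"
      and "flat lam \<epsilon> v = flat lam \<epsilon> (SOME w. w \<in> V \<and> flat lam \<epsilon> w = flat lam \<epsilon> v)"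
      using someI[of "\<lambda>w. w \<in> V \<and> flat lam \<epsilon> w = flat lam \<epsilon> v" v] that by auto
  qed
  then show ?thesis
    unfolding component_op_def by (intro exI[of _ "\<lambda>u. flat lam \<epsilon> (T (SOME w. w \<in> V \<and> flat lam \<epsilon> w = u))"]) blast
qed

section \<open>Identification of the operators induced on functions of n variables\<close>

lemma Op0_eq_osc_op: "Op0 H v = osc_op 1 0 H (fourier v)"
  by (rule ext) (simp add: Op0_def osc_op_def)

lemma Op1_eq_osc_op: "Op1 H v = inv_fourier (osc_op (- 1) 0 (\<lambda>x \<xi>. H \<xi> x) v)"
  unfolding Op1_def osc_op_def[abs_def] by (simp add: inner_commute)

lemma osc_op_schwartz:
  assumes "admissible H" "v \<in> schwartz_flat"
  shows "osc_op (- 1) 0 (\<lambda>x \<xi>. H \<xi> x) v \<in> schwartz"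
  using amplitude.osc_schwartz[OF amplitude_flat[OF assms, of "- 1"]]
  unfolding osc_op_def[abs_def] by (simp add: inner_commute)

lemma has_Op0_hom_comp:
  fixes H :: "'n::finite space \<Rightarrow> 'n space \<Rightarrow> complex"
  assumes H: "admissible H" and v: "v \<in> schwartz"
  shows "has_Op0 H (hom_comp lam \<epsilon> v) (hom_comp lam \<epsilon> (Op0 H v))"
  unfolding has_Op0_def
proof (intro exI conjI allI impI)
  note r = schwartz_rapid_fourier[OF v]
  \<comment> \<open>This goal fixes the witness for the Fourier transform of the component, to which
    the remaining goals refer.\<close>
  show "distr_fourier (hom_comp lam \<epsilon> v) (hom_comp (- lam) \<epsilon> (fourier v))" by (rule distr_fourier_hom_comp[OF v])
  fix x :: "'n space" assume x: "x \<noteq> 0"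
  show "integrable lborel (\<lambda>\<xi>. damp \<alpha> H x \<xi> * cis (2 * pi * (x \<bullet> \<xi>)) * hom_comp (- lam) \<epsilon> (fourier v) \<xi>)" if "\<alpha> > 0" for \<alpha>
    using regularized_integrable[OF H r that x, of 1] by simp
  show "((\<lambda>\<alpha>. LINT \<xi>|lborel. damp \<alpha> H x \<xi> * cis (2 * pi * (x \<bullet> \<xi>)) * hom_comp (- lam) \<epsilon> (fourier v) \<xi>) \<longlongrightarrow> hom_comp lam \<epsilon> (Op0 H v) x) (at_right 0)"
    unfolding Op0_eq_osc_op
  proof (rule Lim_transform_eventually[OF hom_comp_osc_op_tendsto[OF H fourier_schwartz[OF v] _ x]])
    show "\<forall>\<^sub>F \<alpha> in at_right 0. hom_comp lam \<epsilon> (osc_op 1 \<alpha> H (fourier v)) x =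
        (LINT \<xi>|lborel. damp \<alpha> H x \<xi> * cis (2 * pi * (x \<bullet> \<xi>)) * hom_comp (- lam) \<epsilon> (fourier v) \<xi>)"
      using regularized_hom_comp[OF H r _ x, of _ 1]
      by (auto intro!: eventually_mono[OF eventually_at_right_less[of 0]])
  qed simp
qed

text \<open>The representative used by \<open>coord\<close> has scalar product 1, so its class
  belongs to \<open>X_bullet\<close>.\<close>

lemma coord_tendsto:
  assumes "fourier_symbol \<Phi> f" "1 + s \<bullet> \<sigma> \<noteq> 0"
  shows "((\<lambda>\<alpha>. coord (\<Phi> \<alpha>) s \<sigma>) \<longlongrightarrow> coord f s \<sigma>) (at_right 0)"
proof -
  have "(s, 1::real) \<bullet> (inverse (1 + s \<bullet> \<sigma>) *\<^sub>R (\<sigma>, 1)) = inverse (1 + s \<bullet> \<sigma>) * (1 + s \<bullet> \<sigma>)"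
    by (simp add: distrib_left)
  then have "bullet (s, 1::real) (inverse (1 + s \<bullet> \<sigma>) *\<^sub>R (\<sigma>, 1)) \<in> X_bullet"
    using assms(2) unfolding X_bullet_def by (simp only: left_inverse[OF assms(2)]) blast
  then show ?thesis using assms(1) unfolding fourier_symbol_def coord_def by blast
qed

lemma hexp_exponents:
  "- (of_nat n + 1) / 2 - \<i> * of_real lam = - hexp n lam - 1"
  "- (of_nat n + 1) / 2 + \<i> * of_real lam = - hexp n (- lam) - 1"
  by (simp_all add: field_simps)

text \<open>The common core applies with \<psi> = \<open>fourier v\<close>, because
  \<open>theta\<close> takes the component of \<open>v\<close> almost everywhere to that of \<psi>
  for \<open>- lam\<close>.\<close>

lemma has_Op_flat:
  fixes H :: "'n::finite space \<Rightarrow> 'n space \<Rightarrow> complex"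
  assumes H: "admissible H" and v: "v \<in> schwartz"
    and f: "fourier_symbol (\<lambda>\<alpha>. f_symbol lam \<epsilon> (damp \<alpha> H)) f"
  shows "has_Op lam \<epsilon> (\<lambda>\<alpha>. f_symbol lam \<epsilon> (damp \<alpha> H)) f (flat lam \<epsilon> v) (flat lam \<epsilon> (Op0 H v))"
  unfolding has_Op_def Op_def Op_integrand_def hexp_exponents Op0_eq_osc_op
proof (intro allI conjI impI)
  fix s :: "real ^ 'n"
  define c where "c = (- 1) ^ \<epsilon> * inverse (C_norm CARD('n) (- lam) \<epsilon>)"
  \<comment> \<open>The constants of \<open>Op\<close> and of the symbol cancel:
    \<open>C_norm\<close> never vanishes, and the sign squares to 1.\<close>
  have c: "(- 1) ^ \<epsilon> * C_norm CARD('n) (- lam) \<epsilon> * (c * z) = z" for z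
  proof -
    have "(- 1) ^ \<epsilon> * C_norm CARD('n) (- lam) \<epsilon> * (c * z) =
        ((- 1) ^ \<epsilon> * (- 1) ^ \<epsilon>) * (C_norm CARD('n) (- lam) \<epsilon> * inverse (C_norm CARD('n) (- lam) \<epsilon>)) * z"
      unfolding c_def by (simp only: mult_ac)
    then show ?thesis using C_norm_nonzero[of "CARD('n)" "- lam" \<epsilon>] by (simp add: power_mult_distrib[symmetric])
  qed
  have K: "coord (f_symbol lam \<epsilon> (damp \<alpha> H)) s \<sigma> = c * ray_integral 1 \<alpha> \<epsilon> (hexp CARD('n) lam) H (s, 1) (inverse (1 + s \<bullet> \<sigma>) *\<^sub>R (\<sigma>, 1))" for \<alpha> \<sigma>
    unfolding coord_def f_symbol_bullet[OF H] c_def ..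
  note op = H disjI1[OF refl] fourier_schwartz[OF v] theta_flat_borel[OF v] theta_flat[OF v]
  show "integrable lborel (\<lambda>\<sigma>. coord (f_symbol lam \<epsilon> (damp \<alpha> H)) s \<sigma> * spow \<epsilon> (- hexp CARD('n) lam - 1) (1 + s \<bullet> \<sigma>) * theta lam \<epsilon> (flat lam \<epsilon> v) \<sigma>)" if "\<alpha> > 0" for \<alpha>
    by (rule kernel_operator_integrable[OF op K that])
  show "((\<lambda>\<alpha>. (- 1) ^ \<epsilon> * C_norm CARD('n) (- lam) \<epsilon> *
      (LINT \<sigma>|lborel. coord (f_symbol lam \<epsilon> (damp \<alpha> H)) s \<sigma> * spow \<epsilon> (- hexp CARD('n) lam - 1) (1 + s \<bullet> \<sigma>) * theta lam \<epsilon> (flat lam \<epsilon> v) \<sigma>))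
      \<longlongrightarrow> flat lam \<epsilon> (osc_op 1 0 H (fourier v)) s) (at_right 0)"
    using tendsto_mult_left[OF kernel_operator_tendsto[OF op K], of "(- 1) ^ \<epsilon> * C_norm CARD('n) (- lam) \<epsilon>"] unfolding c .
  assume "integrable lborel (\<lambda>\<sigma>. coord (\<lambda>c. 1) s \<sigma> * spow \<epsilon> (- hexp CARD('n) lam - 1) (1 + s \<bullet> \<sigma>) * theta lam \<epsilon> (flat lam \<epsilon> v) \<sigma>)"
  then have J: "integrable lborel (\<lambda>\<sigma>. spow \<epsilon> (- hexp CARD('n) lam - 1) (1 + s \<bullet> \<sigma>) * theta lam \<epsilon> (flat lam \<epsilon> v) \<sigma>)"
    by (simp add: coord_def)
  note L = kernel_operator_limit[OF op K coord_tendsto[OF f] J]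
  show "integrable lborel (\<lambda>\<sigma>. coord f s \<sigma> * spow \<epsilon> (- hexp CARD('n) lam - 1) (1 + s \<bullet> \<sigma>) * theta lam \<epsilon> (flat lam \<epsilon> v) \<sigma>)"
    using L by blast
  show "(- 1) ^ \<epsilon> * C_norm CARD('n) (- lam) \<epsilon> *
      (LINT \<sigma>|lborel. coord f s \<sigma> * spow \<epsilon> (- hexp CARD('n) lam - 1) (1 + s \<bullet> \<sigma>) * theta lam \<epsilon> (flat lam \<epsilon> v) \<sigma>) = flat lam \<epsilon> (osc_op 1 0 H (fourier v)) s"
    using L c by metis
qed

text \<open>The common core with s and \<sigma> exchanged: the transposed symbol, \<kappa> = -1,
  \<open>- lam\<close> in place of \<open>lam\<close>, and \<psi> = \<open>v\<close>. As the
  integrands contain no value of \<open>theta\<close>, the claims hold at every \<sigma>.\<close>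

lemma theta_Op_vee_flat:
  fixes H :: "'n::finite space \<Rightarrow> 'n space \<Rightarrow> complex"
  assumes H: "admissible H" and v: "v \<in> schwartz"
  defines "G \<equiv> osc_op (- 1) 0 (\<lambda>x \<xi>. H \<xi> x) v"
  shows "\<alpha> > 0 \<Longrightarrow> integrable lborel (\<lambda>s. theta_Op_vee_integrand lam \<epsilon> (h_symbol lam \<epsilon> (damp \<alpha> H)) (flat lam \<epsilon> v) \<sigma> s)"
    and "((\<lambda>\<alpha>. theta_Op_vee lam \<epsilon> (h_symbol lam \<epsilon> (damp \<alpha> H)) (flat lam \<epsilon> v) \<sigma>) \<longlongrightarrow> flat (- lam) \<epsilon> G \<sigma>) (at_right 0)"
    and "fourier_symbol (\<lambda>\<alpha>. h_symbol lam \<epsilon> (damp \<alpha> H)) h \<Longrightarrow>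
      integrable lborel (\<lambda>s. theta_Op_vee_integrand lam \<epsilon> (\<lambda>c. 1) (flat lam \<epsilon> v) \<sigma> s) \<Longrightarrow>
      integrable lborel (\<lambda>s. theta_Op_vee_integrand lam \<epsilon> h (flat lam \<epsilon> v) \<sigma> s) \<and>
      theta_Op_vee lam \<epsilon> h (flat lam \<epsilon> v) \<sigma> = flat (- lam) \<epsilon> G \<sigma>"
proof -
  note H' = admissible_swap[OF H]
  define c where "c = inverse (C_norm CARD('n) lam \<epsilon>)"
  have c: "C_norm CARD('n) lam \<epsilon> * (c * z) = z" for z
    using C_norm_nonzero[of "CARD('n)" lam \<epsilon>] by (simp add: c_def)
  have K: "coord (h_symbol lam \<epsilon> (damp \<alpha> H)) s \<sigma> = c * ray_integral (- 1) \<alpha> \<epsilon> (hexp CARD('n) (- lam)) (\<lambda>x \<xi>. H \<xi> x) (\<sigma>, 1) (inverse (1 + \<sigma> \<bullet> s) *\<^sub>R (s, 1))"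
    if "1 + \<sigma> \<bullet> s \<noteq> 0" for \<alpha> s
    unfolding coord_def h_symbol_bullet[OF H] c_def inner_commute[of s \<sigma>]
    by (subst ray_integral_dilation[OF H']) (use that in simp_all)
  have U: "flat lam \<epsilon> v \<in> borel_measurable borel" "AE s in lborel. flat lam \<epsilon> v s = flat (- (- lam)) \<epsilon> v s"
    using rapid_borel[OF schwartz_rapid[OF v]] by simp_all
  note op = H' disjI2[OF refl] v U
  note defs = theta_Op_vee_integrand_def theta_Op_vee_def hexp_exponents inner_commute[of _ \<sigma>] G_def
  show "integrable lborel (\<lambda>s. theta_Op_vee_integrand lam \<epsilon> (h_symbol lam \<epsilon> (damp \<alpha> H)) (flat lam \<epsilon> v) \<sigma> s)" if "\<alpha> > 0" for \<alpha>
    unfolding defs by (rule kernel_operator_integrable[OF op K that])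
  show "((\<lambda>\<alpha>. theta_Op_vee lam \<epsilon> (h_symbol lam \<epsilon> (damp \<alpha> H)) (flat lam \<epsilon> v) \<sigma>) \<longlongrightarrow> flat (- lam) \<epsilon> G \<sigma>) (at_right 0)"
    using tendsto_mult_left[OF kernel_operator_tendsto[OF op K], of "C_norm CARD('n) lam \<epsilon>"] unfolding defs c .
  assume h: "fourier_symbol (\<lambda>\<alpha>. h_symbol lam \<epsilon> (damp \<alpha> H)) h"
    and "integrable lborel (\<lambda>s. theta_Op_vee_integrand lam \<epsilon> (\<lambda>c. 1) (flat lam \<epsilon> v) \<sigma> s)"
  then have J: "integrable lborel (\<lambda>s. spow \<epsilon> (- hexp CARD('n) (- lam) - 1) (1 + \<sigma> \<bullet> s) * flat lam \<epsilon> v s)"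
    unfolding defs by (simp add: coord_def)
  have lim: "((\<lambda>\<alpha>. coord (h_symbol lam \<epsilon> (damp \<alpha> H)) s \<sigma>) \<longlongrightarrow> coord h s \<sigma>) (at_right 0)" if "1 + \<sigma> \<bullet> s \<noteq> 0" for s
    by (rule coord_tendsto[OF h]) (use that in \<open>simp add: inner_commute\<close>)
  note L = kernel_operator_limit[OF op K lim J]
  show "integrable lborel (\<lambda>s. theta_Op_vee_integrand lam \<epsilon> h (flat lam \<epsilon> v) \<sigma> s) \<and>
      theta_Op_vee lam \<epsilon> h (flat lam \<epsilon> v) \<sigma> = flat (- lam) \<epsilon> G \<sigma>"
    using L c unfolding defs by metis
qed

lemma has_Op_vee_flat:
  fixes H :: "'n::finite space \<Rightarrow> 'n space \<Rightarrow> complex"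
  assumes H: "admissible H" and v: "v \<in> schwartz_flat"
    and h: "fourier_symbol (\<lambda>\<alpha>. h_symbol lam \<epsilon> (damp \<alpha> H)) h"
  shows "has_Op_vee lam \<epsilon> (\<lambda>\<alpha>. h_symbol lam \<epsilon> (damp \<alpha> H)) h (flat lam \<epsilon> v) (flat lam \<epsilon> (Op1 H v))"
proof -
  define G where "G = osc_op (- 1) 0 (\<lambda>x \<xi>. H \<xi> x) v"
  have v': "v \<in> schwartz" using v by (simp add: schwartz_flat_def)
  have G: "G \<in> schwartz" unfolding G_def by (rule osc_op_schwartz[OF H v])
  have Op: "Op1 H v = inv_fourier G" unfolding Op1_eq_osc_op G_def ..
  \<comment> \<open>Flatness of \<open>v\<close> has made \<open>G\<close> a Schwartz function, so
    by Fourier inversion the transform of \<open>Op1 H v\<close> is \<open>G\<close> itself.\<close>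
  have T: "AE \<sigma> in lborel. theta lam \<epsilon> (flat lam \<epsilon> (Op1 H v)) \<sigma> = flat (- lam) \<epsilon> G \<sigma>"
    using theta_flat[OF inv_fourier_schwartz[OF G]] unfolding Op fourier_inv_fourier[OF G] .
  show ?thesis
    unfolding has_Op_vee_def
  proof
    show "square_integrable (flat lam \<epsilon> (Op1 H v))"
      unfolding Op by (rule square_integrable_flat[OF schwartz_rapid[OF inv_fourier_schwartz[OF G]]])
    show "AE \<sigma> in lborel.
     (\<forall>\<alpha>>0. integrable lborel (\<lambda>s. theta_Op_vee_integrand lam \<epsilon> (h_symbol lam \<epsilon> (damp \<alpha> H)) (flat lam \<epsilon> v) \<sigma> s)) \<and>
     ((\<lambda>\<alpha>. theta_Op_vee lam \<epsilon> (h_symbol lam \<epsilon> (damp \<alpha> H)) (flat lam \<epsilon> v) \<sigma>) \<longlongrightarrow> theta lam \<epsilon> (flat lam \<epsilon> (Op1 H v)) \<sigma>) (at_right 0) \<and>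
     (integrable lborel (\<lambda>s. theta_Op_vee_integrand lam \<epsilon> (\<lambda>c. 1) (flat lam \<epsilon> v) \<sigma> s) \<longrightarrow>
        integrable lborel (\<lambda>s. theta_Op_vee_integrand lam \<epsilon> h (flat lam \<epsilon> v) \<sigma> s) \<and>
        theta_Op_vee lam \<epsilon> h (flat lam \<epsilon> v) \<sigma> = theta lam \<epsilon> (flat lam \<epsilon> (Op1 H v)) \<sigma>)"
      using T
    proof (rule AE_mp, intro AE_I2 impI)
      fix \<sigma> assume eq: "theta lam \<epsilon> (flat lam \<epsilon> (Op1 H v)) \<sigma> = flat (- lam) \<epsilon> G \<sigma>"
      show "(\<forall>\<alpha>>0. integrable lborel (\<lambda>s. theta_Op_vee_integrand lam \<epsilon> (h_symbol lam \<epsilon> (damp \<alpha> H)) (flat lam \<epsilon> v) \<sigma> s)) \<and>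
        ((\<lambda>\<alpha>. theta_Op_vee lam \<epsilon> (h_symbol lam \<epsilon> (damp \<alpha> H)) (flat lam \<epsilon> v) \<sigma>) \<longlongrightarrow> theta lam \<epsilon> (flat lam \<epsilon> (Op1 H v)) \<sigma>) (at_right 0) \<and>
        (integrable lborel (\<lambda>s. theta_Op_vee_integrand lam \<epsilon> (\<lambda>c. 1) (flat lam \<epsilon> v) \<sigma> s) \<longrightarrow>
          integrable lborel (\<lambda>s. theta_Op_vee_integrand lam \<epsilon> h (flat lam \<epsilon> v) \<sigma> s) \<and>
          theta_Op_vee lam \<epsilon> h (flat lam \<epsilon> v) \<sigma> = theta lam \<epsilon> (flat lam \<epsilon> (Op1 H v)) \<sigma>)"
        unfolding eq G_def using theta_Op_vee_flat[OF H v'] h by (intro conjI allI impI) blast+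
    qed
  qed
qed

text \<open>The regularized operators see \<open>v\<close> only through its component, and their
  limit is unique.\<close>

lemma Op0_flat_cong:
  fixes H :: "'n::finite space \<Rightarrow> 'n space \<Rightarrow> complex"
  assumes H: "admissible H" and v: "v \<in> schwartz" and w: "w \<in> schwartz"
    and f: "fourier_symbol (\<lambda>\<alpha>. f_symbol lam \<epsilon> (damp \<alpha> H)) f"
    and eq: "flat lam \<epsilon> v = flat lam \<epsilon> w"
  shows "flat lam \<epsilon> (Op0 H v) = flat lam \<epsilon> (Op0 H w)"
proof
  fix s
  have "((\<lambda>\<alpha>. Op lam \<epsilon> (f_symbol lam \<epsilon> (damp \<alpha> H)) (flat lam \<epsilon> v) s) \<longlongrightarrow> flat lam \<epsilon> (Op0 H v) s) (at_right 0)"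
    using has_Op_flat[OF H v f] unfolding has_Op_def by blast
  moreover have "((\<lambda>\<alpha>. Op lam \<epsilon> (f_symbol lam \<epsilon> (damp \<alpha> H)) (flat lam \<epsilon> v) s) \<longlongrightarrow> flat lam \<epsilon> (Op0 H w) s) (at_right 0)"
    using has_Op_flat[OF H w f] unfolding has_Op_def eq by blast
  ultimately show "flat lam \<epsilon> (Op0 H v) s = flat lam \<epsilon> (Op0 H w) s"
    by (rule tendsto_unique[OF trivial_limit_at_right_real])
qed

text \<open>Uniqueness of the limit gives equality for the components of \<open>G v\<close> and
  \<open>G w\<close> at \<open>- lam\<close>. Applying \<open>theta\<close> for \<open>- lam\<close>
  leads, almost everywhere, to the components of their Fourier transforms; these are continuous,
  hence equal, and a reflection leads on to \<open>inv_fourier\<close>.\<close>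

lemma Op1_flat_cong:
  fixes H :: "'n::finite space \<Rightarrow> 'n space \<Rightarrow> complex"
  assumes H: "admissible H" and v: "v \<in> schwartz_flat" and w: "w \<in> schwartz_flat"
    and eq: "flat lam \<epsilon> v = flat lam \<epsilon> w"
  shows "flat lam \<epsilon> (Op1 H v) = flat lam \<epsilon> (Op1 H w)"
proof -
  define G where "G v = osc_op (- 1) 0 (\<lambda>x \<xi>. H \<xi> x) v" for v
  have vw: "v \<in> schwartz" "w \<in> schwartz" using v w by (simp_all add: schwartz_flat_def)
  have G: "G v \<in> schwartz" "G w \<in> schwartz" unfolding G_def by (rule osc_op_schwartz[OF H], fact)+
  have flatG: "flat (- lam) \<epsilon> (G v) = flat (- lam) \<epsilon> (G w)"
  proof
    fix \<sigma>
    have "((\<lambda>\<alpha>. theta_Op_vee lam \<epsilon> (h_symbol lam \<epsilon> (damp \<alpha> H)) (flat lam \<epsilon> v) \<sigma>) \<longlongrightarrow> flat (- lam) \<epsilon> (G v) \<sigma>) (at_right 0)"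
      unfolding G_def by (rule theta_Op_vee_flat(2)[OF H vw(1)])
    moreover have "((\<lambda>\<alpha>. theta_Op_vee lam \<epsilon> (h_symbol lam \<epsilon> (damp \<alpha> H)) (flat lam \<epsilon> v) \<sigma>) \<longlongrightarrow> flat (- lam) \<epsilon> (G w) \<sigma>) (at_right 0)"
      unfolding G_def eq by (rule theta_Op_vee_flat(2)[OF H vw(2)])
    ultimately show "flat (- lam) \<epsilon> (G v) \<sigma> = flat (- lam) \<epsilon> (G w) \<sigma>"
      by (rule tendsto_unique[OF trivial_limit_at_right_real])
  qed
  have "AE s in lborel. flat lam \<epsilon> (fourier (G v)) s = flat lam \<epsilon> (fourier (G w)) s"
    using theta_flat[OF G(1), of "- lam" \<epsilon>] theta_flat[OF G(2), of "- lam" \<epsilon>] unfolding flatG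
    by eventually_elim simp
  then have "flat lam \<epsilon> (fourier (G v)) = flat lam \<epsilon> (fourier (G w))"
    by (intro continuous_AE_eq flat_continuous fourier_schwartz G)
  then show ?thesis unfolding Op1_eq_osc_op G_def[symmetric] by (intro ext) (simp only: flat_inv_fourier)
qed

theorem proposition2p2:
  fixes H :: "'n::finite space \<Rightarrow> 'n space \<Rightarrow> complex" and lam :: real and \<epsilon> :: nat
  assumes "smooth (\<lambda>(x, \<xi>). H x \<xi>)"
    and "dilation_invariant H"
    and "\<forall>P\<in>symbol_ops. bounded (range (\<lambda>(x, \<xi>). P H x \<xi>))"
    and "\<epsilon> \<in> {0, 1}"
  shows
    "(\<forall>v\<in>schwartz. has_Op0 H (hom_comp lam \<epsilon> v) (hom_comp lam \<epsilon> (Op0 H v))) \<and>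
     (\<exists>A. component_op lam \<epsilon> schwartz (Op0 H) A) \<and>
     (\<exists>f. fourier_symbol (\<lambda>\<alpha>. f_symbol lam \<epsilon> (damp \<alpha> H)) f \<and>
       (\<forall>A. component_op lam \<epsilon> schwartz (Op0 H) A \<longrightarrow>
         (\<forall>u\<in>flat lam \<epsilon> ` schwartz.
            has_Op lam \<epsilon> (\<lambda>\<alpha>. f_symbol lam \<epsilon> (damp \<alpha> H)) f u (A u)))) \<and>
     (\<exists>B. component_op lam \<epsilon> schwartz_flat (Op1 H) B) \<and>
     (\<exists>h. fourier_symbol (\<lambda>\<alpha>. h_symbol lam \<epsilon> (damp \<alpha> H)) h \<and>
       (\<forall>B. component_op lam \<epsilon> schwartz_flat (Op1 H) B \<longrightarrow>
         (\<forall>u\<in>flat lam \<epsilon> ` schwartz_flat.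
            has_Op_vee lam \<epsilon> (\<lambda>\<alpha>. h_symbol lam \<epsilon> (damp \<alpha> H)) h u (B u))))"
proof -
  have H: "admissible H" unfolding admissible_def using assms(1-3) by simp
  note H' = admissible_swap[OF H]
  have a: "Re (hexp CARD('n) lam) \<ge> 0" for lam unfolding Re_hexp by (rule hexp_nonneg)
  obtain f where f: "fourier_symbol (\<lambda>\<alpha>. f_symbol lam \<epsilon> (damp \<alpha> H)) f"
    using fourier_symbol_exists[OF H disjI1[OF refl] a disjI1, OF allI, OF allI, OF allI, OF f_symbol_bullet[OF H]] by blast
  obtain h where h: "fourier_symbol (\<lambda>\<alpha>. h_symbol lam \<epsilon> (damp \<alpha> H)) h"
    \<comment> \<open>The two occurrences of \<open>disjI2\<close> select \<kappa> = -1 and the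
      reverse order of the variables, as the transposed symbol in \<open>h_symbol_bullet\<close>
      requires.\<close>
    using fourier_symbol_exists[OF H' disjI2[OF refl] a disjI2, OF allI, OF allI, OF allI, OF h_symbol_bullet[OF H]] by blast
  show ?thesis
  proof (intro conjI ballI)
    show "has_Op0 H (hom_comp lam \<epsilon> v) (hom_comp lam \<epsilon> (Op0 H v))" if "v \<in> schwartz" for v
      by (rule has_Op0_hom_comp[OF H that])
    show "\<exists>A. component_op lam \<epsilon> schwartz (Op0 H) A"
      by (rule component_op_exists) (rule Op0_flat_cong[OF H _ _ f])
    show "\<exists>B. component_op lam \<epsilon> schwartz_flat (Op1 H) B"
      by (rule component_op_exists) (rule Op1_flat_cong[OF H])
    show "\<exists>f. fourier_symbol (\<lambda>\<alpha>. f_symbol lam \<epsilon> (damp \<alpha> H)) f \<and>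
       (\<forall>A. component_op lam \<epsilon> schwartz (Op0 H) A \<longrightarrow>
         (\<forall>u\<in>flat lam \<epsilon> ` schwartz. has_Op lam \<epsilon> (\<lambda>\<alpha>. f_symbol lam \<epsilon> (damp \<alpha> H)) f u (A u)))"
      using f has_Op_flat[OF H _ f] unfolding component_op_def by (intro exI[of _ f]) auto
    show "\<exists>h. fourier_symbol (\<lambda>\<alpha>. h_symbol lam \<epsilon> (damp \<alpha> H)) h \<and>
       (\<forall>B. component_op lam \<epsilon> schwartz_flat (Op1 H) B \<longrightarrow>
         (\<forall>u\<in>flat lam \<epsilon> ` schwartz_flat. has_Op_vee lam \<epsilon> (\<lambda>\<alpha>. h_symbol lam \<epsilon> (damp \<alpha> H)) h u (B u)))"
      using h has_Op_vee_flat[OF H _ h] unfolding component_op_def by (intro exI[of _ h]) auto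
  qed
qed

end
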